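(* Problem (MV) admits a unique optimal control, in the following closed-loop form: $$u^*(t)=-b(t)\Big\{X^*(t)-\mathbb E[X^*(t)]-\frac1\nu\exp\Big[\int_t^T\big(|b(s)|^2-r(s)\big)ds\Big]\Big\},\quad t\in[0,T],$$ where $X^*(\cdot)$ satisfies $$\left\{\begin{aligned}dX^*(t)=&\Big\{\big(r(t)-|b(t)|^2\big)X^*(t)+|b(t)|^2\,\mathbb E[X^*(t)]+\frac{|b(t)|^2}{\nu}\exp\Big[\int_t^T\big(|b(s)|^2-r(s)\big)ds\Big]\Big\}dt\\&-b(t)^\top\Big\{X^*(t)-\mathbb E[X^*(t)]-\frac1\nu\exp\Big[\int_t^T\big(|b(s)|^2-r(s)\big)ds\Big]\Big\}dW(t),\quad t\in[0,T],\\ X^*(0)=&\,x.\end{aligned}\right.$$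
   Context: Mean-variance portfolio selection. Fix $T>0$ and a positive integer $m$. $W(\cdot)=(W^1(\cdot),\dots,W^m(\cdot))^\top$ is an $m$-dimensional standard Brownian motion on a complete filtered probability space $(\Omega,\mathcal F,\mathbb P,\mathbb F)$, where $\mathbb F$ is its natural filtration augmented by all $\mathbb P$-null sets. The following are bounded deterministic functions on $[0,T]$: the interest rate $r(\cdot)\ge0$; the appreciation rates $\mu(\cdot)=(\mu_1(\cdot),\dots,\mu_m(\cdot))^\top$ with $\mu_i(\cdot)>0$; the volatility matrix $\sigma(\cdot)=(\sigma_{ij}(\cdot))_{m\times m}$, for which there is $\delta>0$ with $\sigma(t)\sigma(t)^\top\ge\delta I$ for all $t\in[0,T]$. Put $b(t)=\sigma(t)^{-1}(\mu(t)-r(t)\mathbf 1)$, where $\mathbf 1$ is the vector with all entries $1$. The set of admissible controls $\mathscr U[0,T]=L^2_{\mathbb F}(0,T;\mathbb R^m)$ consists of the $\mathbb F$-progressively measurable $\mathbb R^m$-valued processes $u$ with $\mathbb E\int_0^T|u(t)|^2dt<\infty$ (here $u(t)=\sigma(t)^\top\pi(t)$, with $\pi_i(t)$ the amount of wealth invested in the $i$-th stock). For initial wealth $x>0$ the wealth process $X(\cdot)=X(\cdot;x,u(\cdot))$ solves $$dX(t)=\big[r(t)X(t)+b(t)^\top u(t)\big]dt+u(t)^\top dW(t),\quad X(0)=x.$$ For a constant $\nu>0$ the cost functional is $$J(x;u(\cdot))=\frac\nu2\mathrm{Var}(X(T))-\mathbb E[X(T)].$$ Problem (MV): find $u^*(\cdot)\in\mathscr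 U[0,T]$ (an optimal control) with $J(x;u^*(\cdot))=\inf_{u(\cdot)\in\mathscr U[0,T]}J(x;u(\cdot))$; $X^*(\cdot)=X(\cdot;x,u^*(\cdot))$ is the corresponding optimal trajectory. *)

theory Defs
  imports "HOL-Probability.Probability"
begin

section \<open>Filtered probability spaces and Brownian motion\<close>

text \<open>Only the sets of the measures \<^term>\<open>F t\<close> of a filtration matter.\<close>

definition augmented_natural_filtration ::
    "'w measure \<Rightarrow> (real \<Rightarrow> 'w \<Rightarrow> 'v::topological_space) \<Rightarrow> real \<Rightarrow> 'w measure" where
  "augmented_natural_filtration M W t =
     sigma (space M)
       ({W s -` A \<inter> space M | s A. s \<in> {0..t} \<and> A \<in> sets borel} \<union> null_sets M)"

text \<open>The Lebesgue density below is that of the centred normal law with covariance matrix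
  \<open>(t - s) I\<close>; note that \<^const>\<open>normal_density\<close> takes the standard deviation.\<close>

definition brownian_motion ::
    "'w measure \<Rightarrow> (real \<Rightarrow> 'w measure) \<Rightarrow> (real \<Rightarrow> 'w \<Rightarrow> real ^ 'm) \<Rightarrow> bool" where
  "brownian_motion M F W \<longleftrightarrow>
     (\<forall>t\<ge>0. subalgebra M (F t)) \<and>
     (\<forall>s\<ge>0. \<forall>t\<ge>s. sets (F s) \<subseteq> sets (F t)) \<and>
     (\<forall>t\<ge>0. W t \<in> borel_measurable (F t)) \<and>
     (AE \<omega> in M. W 0 \<omega> = 0) \<and>
     (AE \<omega> in M. continuous_on {0..} (\<lambda>t. W t \<omega>)) \<and>
     (\<forall>s\<ge>0. \<forall>t>s.
        distributed M lborel (\<lambda>\<omega>. W t \<omega> - W s \<omega>)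
          (\<lambda>x. ennreal (\<Prod>i\<in>UNIV. normal_density 0 (sqrt (t - s)) (x $ i))) \<and>
        prob_space.indep_set M
          {(\<lambda>\<omega>. W t \<omega> - W s \<omega>) -` A \<inter> space M | A. A \<in> sets borel} (sets (F s)))"

definition progressively_measurable ::
    "(real \<Rightarrow> 'w measure) \<Rightarrow> real \<Rightarrow> (real \<Rightarrow> 'w \<Rightarrow> 'v::topological_space) \<Rightarrow> bool" where
  "progressively_measurable F T u \<longleftrightarrow>
     (\<forall>t\<in>{0..T}. (\<lambda>(s, \<omega>). u s \<omega>) \<in> borel_measurable (restrict_space borel {0..t} \<Otimes>\<^sub>M F t))"

definition L2_processes ::
    "'w measure \<Rightarrow> (real \<Rightarrow> 'w measure) \<Rightarrow> real \<Rightarrow> (real \<Rightarrow> 'w \<Rightarrow> 'v::real_normed_vector) set" where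
  "L2_processes M F T =
     {u. progressively_measurable F T u \<and>
         (\<integral>\<^sup>+\<omega>. (\<integral>\<^sup>+t\<in>{0..T}. ennreal ((norm (u t \<omega>))\<^sup>2) \<partial>lborel) \<partial>M) < \<infinity>}"

section \<open>The Ito integral\<close>

text \<open>Elementary integrands on \<open>[0, t]\<close> are \<open>\<Sum>k<n. \<xi> k\<close> times the indicator of
  \<open>(\<tau> k, \<tau> (k + 1)]\<close>, with deterministic partition points and bounded coefficients
  known at the left end points.\<close>

definition elementary_data ::
    "'w measure \<Rightarrow> (real \<Rightarrow> 'w measure) \<Rightarrow> real \<Rightarrow> nat \<Rightarrow> (nat \<Rightarrow> real) \<Rightarrow>
     (nat \<Rightarrow> 'w \<Rightarrow> 'v::real_normed_vector) \<Rightarrow> bool" where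
  "elementary_data M F t n \<tau> \<xi> \<longleftrightarrow>
     0 \<le> \<tau> 0 \<and> (\<forall>k<n. \<tau> k \<le> \<tau> (Suc k)) \<and> \<tau> n \<le> t \<and>
     (\<forall>k<n. \<xi> k \<in> borel_measurable (F (\<tau> k)) \<and> bounded (\<xi> k ` space M))"

definition elementary_process ::
    "nat \<Rightarrow> (nat \<Rightarrow> real) \<Rightarrow> (nat \<Rightarrow> 'w \<Rightarrow> 'v::real_normed_vector) \<Rightarrow> real \<Rightarrow> 'w \<Rightarrow> 'v" where
  "elementary_process n \<tau> \<xi> s \<omega> = (\<Sum>k<n. indicat_real {\<tau> k<..\<tau> (Suc k)} s *\<^sub>R \<xi> k \<omega>)"

definition elementary_integral ::
    "(real \<Rightarrow> 'w \<Rightarrow> 'v::real_inner) \<Rightarrow> nat \<Rightarrow> (nat \<Rightarrow> real) \<Rightarrow> (nat \<Rightarrow> 'w \<Rightarrow> 'v) \<Rightarrow> 'w \<Rightarrow> real" where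
  "elementary_integral W n \<tau> \<xi> \<omega> = (\<Sum>k<n. \<xi> k \<omega> \<bullet> (W (\<tau> (Suc k)) \<omega> - W (\<tau> k) \<omega>))"

text \<open>The random variable \<open>I\<close> is a version of the Ito integral of \<open>u\<close> against \<open>W\<close>
  over \<open>[0, t]\<close>: the \<open>L\<^sup>2\<close> limit of the integrals of elementary integrands
  approximating \<open>u\<close> in mean square. It is determined up to null sets.\<close>

definition has_ito_integral ::
    "'w measure \<Rightarrow> (real \<Rightarrow> 'w measure) \<Rightarrow> (real \<Rightarrow> 'w \<Rightarrow> 'v::euclidean_space) \<Rightarrow> real \<Rightarrow>
     (real \<Rightarrow> 'w \<Rightarrow> 'v) \<Rightarrow> ('w \<Rightarrow> real) \<Rightarrow> bool" where
  "has_ito_integral M F W t u I \<longleftrightarrow>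
     I \<in> borel_measurable M \<and>
     (\<exists>n \<tau> \<xi>. (\<forall>j. elementary_data M F t (n j) (\<tau> j) (\<xi> j)) \<and>
        (\<lambda>j. \<integral>\<^sup>+\<omega>. (\<integral>\<^sup>+s\<in>{0..t}.
           ennreal ((norm (u s \<omega> - elementary_process (n j) (\<tau> j) (\<xi> j) s \<omega>))\<^sup>2) \<partial>lborel) \<partial>M)
          \<longlonglongrightarrow> 0 \<and>
        (\<lambda>j. \<integral>\<^sup>+\<omega>. ennreal ((I \<omega> - elementary_integral W (n j) (\<tau> j) (\<xi> j) \<omega>)\<^sup>2) \<partial>M)
          \<longlonglongrightarrow> 0)"

text \<open>\<open>ito_process M F W T x \<alpha> \<beta> X\<close> says that \<open>X\<close> is a continuous adapted process with
  \<open>dX = \<alpha> dt + \<beta>\<^sup>T dW\<close> on \<open>[0, T]\<close> and \<open>X 0 = x\<close>. When \<open>\<alpha>\<close> and \<open>\<beta>\<close> are expressed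
  through \<open>X\<close>, this is the (strong) solution property of the corresponding equation.\<close>

definition ito_process ::
    "'w measure \<Rightarrow> (real \<Rightarrow> 'w measure) \<Rightarrow> (real \<Rightarrow> 'w \<Rightarrow> 'v::euclidean_space) \<Rightarrow> real \<Rightarrow> real \<Rightarrow>
     (real \<Rightarrow> 'w \<Rightarrow> real) \<Rightarrow> (real \<Rightarrow> 'w \<Rightarrow> 'v) \<Rightarrow> (real \<Rightarrow> 'w \<Rightarrow> real) \<Rightarrow> bool" where
  "ito_process M F W T x \<alpha> \<beta> X \<longleftrightarrow>
     (\<forall>t\<in>{0..T}. X t \<in> borel_measurable (F t)) \<and>
     (\<forall>\<omega>\<in>space M. continuous_on {0..T} (\<lambda>t. X t \<omega>)) \<and>
     progressively_measurable F T \<alpha> \<and>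
     (AE \<omega> in M. set_integrable lborel {0..T} (\<lambda>s. \<alpha> s \<omega>)) \<and>
     \<beta> \<in> L2_processes M F T \<and>
     (\<forall>t\<in>{0..T}. \<exists>I. has_ito_integral M F W t \<beta> I \<and>
        (AE \<omega> in M. X t \<omega> = x + (LBINT s:{0..t}. \<alpha> s \<omega>) + I \<omega>))"

section \<open>The mean-variance problem\<close>

definition risk_premium ::
    "(real \<Rightarrow> real) \<Rightarrow> (real \<Rightarrow> real ^ 'm) \<Rightarrow> (real \<Rightarrow> real ^ 'm ^ 'm) \<Rightarrow> real \<Rightarrow> real ^ 'm" where
  "risk_premium r \<mu> \<sigma> t = matrix_inv (\<sigma> t) *v (\<mu> t - r t *\<^sub>R (\<chi> i. 1))"

definition wealth_equation ::
    "'w measure \<Rightarrow> (real \<Rightarrow> 'w measure) \<Rightarrow> (real \<Rightarrow> 'w \<Rightarrow> real ^ 'm) \<Rightarrow> real \<Rightarrow>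
     (real \<Rightarrow> real) \<Rightarrow> (real \<Rightarrow> real ^ 'm) \<Rightarrow> real \<Rightarrow>
     (real \<Rightarrow> 'w \<Rightarrow> real ^ 'm) \<Rightarrow> (real \<Rightarrow> 'w \<Rightarrow> real) \<Rightarrow> bool" where
  "wealth_equation M F W T r b x u X \<longleftrightarrow>
     ito_process M F W T x (\<lambda>t \<omega>. r t * X t \<omega> + b t \<bullet> u t \<omega>) u X"

text \<open>For an admissible control the wealth equation has a solution, unique up to
  indistinguishability on \<open>[0, T]\<close>; the choice below picks one, and quantities such as the
  cost do not depend on it.\<close>

definition wealth ::
    "'w measure \<Rightarrow> (real \<Rightarrow> 'w measure) \<Rightarrow> (real \<Rightarrow> 'w \<Rightarrow> real ^ 'm) \<Rightarrow> real \<Rightarrow>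
     (real \<Rightarrow> real) \<Rightarrow> (real \<Rightarrow> real ^ 'm) \<Rightarrow> real \<Rightarrow>
     (real \<Rightarrow> 'w \<Rightarrow> real ^ 'm) \<Rightarrow> real \<Rightarrow> 'w \<Rightarrow> real" where
  "wealth M F W T r b x u = (SOME X. wealth_equation M F W T r b x u X)"

definition mv_cost ::
    "'w measure \<Rightarrow> (real \<Rightarrow> 'w measure) \<Rightarrow> (real \<Rightarrow> 'w \<Rightarrow> real ^ 'm) \<Rightarrow> real \<Rightarrow>
     (real \<Rightarrow> real) \<Rightarrow> (real \<Rightarrow> real ^ 'm) \<Rightarrow> real \<Rightarrow> real \<Rightarrow>
     (real \<Rightarrow> 'w \<Rightarrow> real ^ 'm) \<Rightarrow> real" where
  "mv_cost M F W T r b \<nu> x u =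
     \<nu> / 2 * prob_space.variance M (wealth M F W T r b x u T)
     - prob_space.expectation M (wealth M F W T r b x u T)"

text \<open>The infimum is taken in the extended reals, so that it is meaningful before the cost is
  known to be bounded below.\<close>

definition mv_optimal_control ::
    "'w measure \<Rightarrow> (real \<Rightarrow> 'w measure) \<Rightarrow> (real \<Rightarrow> 'w \<Rightarrow> real ^ 'm) \<Rightarrow> real \<Rightarrow>
     (real \<Rightarrow> real) \<Rightarrow> (real \<Rightarrow> real ^ 'm) \<Rightarrow> real \<Rightarrow> real \<Rightarrow>
     (real \<Rightarrow> 'w \<Rightarrow> real ^ 'm) \<Rightarrow> bool" where
  "mv_optimal_control M F W T r b \<nu> x u \<longleftrightarrow>
     u \<in> L2_processes M F T \<and>
     ereal (mv_cost M F W T r b \<nu> x u) =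
       (INF v\<in>L2_processes M F T. ereal (mv_cost M F W T r b \<nu> x v))"

end

theory Submission
  imports Defs
begin

text \<open>Let \<open>Z\<close> be the martingale with \<open>dZ = - Z b\<^sup>T dW\<close> and \<open>Z 0 = 1\<close>. By duality, \<open>E [Z T X T]\<close> does not
  depend on the control. The candidate wealth satisfies \<open>X* T - E [X* T] = (1 - Z T) / \<nu>\<close>, so expanding
  the variance around \<open>X* T\<close> shows that the cost of any other control exceeds that of \<open>u*\<close> by exactly
  \<open>\<nu> / 2\<close> times the variance of \<open>X T - X* T\<close>. If this variance vanishes, then \<open>X T = X* T\<close> almost
  surely because \<open>E [Z T (X T - X* T)] = 0\<close> and \<open>E [Z T] = 1\<close>. Pairing \<open>X - X*\<close> with the martingale
  driven by the difference of the controls then shows that the controls agree.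

  The stochastic integral exists because progressive integrands are limits of elementary ones
  (averages over the preceding cell of a uniform partition), to which the Ito isometry applies.\<close>

section \<open>Square-integrable functions\<close>

text \<open>Everything takes place in two Hilbert spaces, over \<open>M\<close> and over the product
  of time and \<open>M\<close>, between which the stochastic integral is an isometry. The squared
  mean inside the variance rules out plain dynamic programming. The candidate comes from the first
  variation instead: for every perturbation D with E[Z T D] = 0 the quantity nu E[(X T - E[X T]) D]
  - E[D] must vanish, which forces X T - E[X T] - 1 / nu to be a multiple of Z T, and taking means
  fixes the multiple -1 / nu. The ansatz X = m + phi (1 - Z) with deterministic m and phi extends
  this to earlier times; matching drifts gives phi' = (r - |b|^2) phi, hence the exponential in the
  statement. So a product rule along paths is required only for a deterministic factor. The product
  of a martingale with the wealth is required only in expectation, where it solves a linear Volterra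
  equation with kernel r. The resolvent of that equation is positive for r >= 0, and this makes the
  pairing with the difference of two optimal controls conclusive. The coefficients are merely
  bounded and measurable, so calculus rests on integral identities and quadratic increment
  estimates.\<close>

definition sq_int :: "'a measure \<Rightarrow> ('a \<Rightarrow> 'v::euclidean_space) \<Rightarrow> bool" where
  "sq_int Q f \<longleftrightarrow> f \<in> borel_measurable Q \<and> integrable Q (\<lambda>x. (norm (f x))\<^sup>2)"

text \<open>A squared norm without the root: the triangle inequality then carries a factor 2
  (\<open>sqn_triangle\<close>), which reappears in the later tolerances. The Bochner integral of a
  non-integrable function is 0, so a bound on \<open>sqn\<close> says something only next to
  \<open>sq_int\<close>.\<close>

definition sqn :: "'a measure \<Rightarrow> ('a \<Rightarrow> 'v::euclidean_space) \<Rightarrow> real" where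
  "sqn Q f = (\<integral>x. (norm (f x))\<^sup>2 \<partial>Q)"

lemma sq_int_measurable [measurable_dest]: "sq_int Q f \<Longrightarrow> f \<in> borel_measurable Q"
  by (simp add: sq_int_def)

lemma sq_int_integrable: "sq_int Q f \<Longrightarrow> integrable Q (\<lambda>x. (norm (f x))\<^sup>2)"
  by (simp add: sq_int_def)

lemma sqn_nonneg [simp]: "0 \<le> sqn Q f"
  by (simp add: sqn_def)

lemma norm_add_sq_le: "(norm (a + b :: 'v::real_normed_vector))\<^sup>2 \<le> 2 * (norm a)\<^sup>2 + 2 * (norm b)\<^sup>2"
proof -
  have "(norm (a + b))\<^sup>2 \<le> (norm a + norm b)\<^sup>2"
    by (intro power_mono norm_triangle_ineq) auto
  also have "\<dots> \<le> 2 * (norm a)\<^sup>2 + 2 * (norm b)\<^sup>2"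
    using sum_squares_bound[of "norm a" "norm b"] by (simp add: power2_sum)
  finally show ?thesis .
qed

lemma sq_int_dominated:
  assumes "g \<in> borel_measurable Q" "integrable Q h" "\<And>x. x \<in> space Q \<Longrightarrow> (norm (g x))\<^sup>2 \<le> h x"
  shows "sq_int Q g"
proof -
  have "integrable Q (\<lambda>x. (norm (g x))\<^sup>2)"
  proof (rule Bochner_Integration.integrable_bound[OF assms(2)])
    show "(\<lambda>x. (norm (g x))\<^sup>2) \<in> borel_measurable Q" using assms(1) by measurable
    show "AE x in Q. norm ((norm (g x))\<^sup>2) \<le> norm (h x)"
      using assms(3) by (intro AE_I2) force
  qed
  then show ?thesis using assms(1) by (simp add: sq_int_def)
qed

lemma sq_int_add:
  assumes "sq_int Q f" "sq_int Q g"
  shows "sq_int Q (\<lambda>x. f x + g x)"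
  by (rule sq_int_dominated[where h = "\<lambda>x. 2 * (norm (f x))\<^sup>2 + 2 * (norm (g x))\<^sup>2"])
     (use assms in \<open>auto simp: sq_int_def norm_add_sq_le\<close>)

lemma sq_int_mult_bounded:
  assumes "sq_int Q f" "h \<in> borel_measurable Q" "\<And>x. x \<in> space Q \<Longrightarrow> \<bar>h x\<bar> \<le> K"
  shows "sq_int Q (\<lambda>x. h x *\<^sub>R f x)"
proof (rule sq_int_dominated[where h = "\<lambda>x. K\<^sup>2 * (norm (f x))\<^sup>2"])
  show "(\<lambda>x. h x *\<^sub>R f x) \<in> borel_measurable Q"
    using assms by (auto simp: sq_int_def intro!: borel_measurable_scaleR)
  show "integrable Q (\<lambda>x. K\<^sup>2 * (norm (f x))\<^sup>2)" using assms by (simp add: sq_int_def)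
  show "(norm (h x *\<^sub>R f x))\<^sup>2 \<le> K\<^sup>2 * (norm (f x))\<^sup>2" if "x \<in> space Q" for x
    using power_mono[OF assms(3)[OF that], of 2] by (auto simp: power_mult_distrib intro!: mult_right_mono)
qed

lemma sq_int_scaleR: "sq_int Q f \<Longrightarrow> sq_int Q (\<lambda>x. c *\<^sub>R f x)"
  by (rule sq_int_mult_bounded[where K="\<bar>c\<bar>"]) auto

lemma sq_int_cmult: "sq_int Q f \<Longrightarrow> sq_int Q (\<lambda>x. c * f x :: real)"
  using sq_int_scaleR[of Q f c] by simp

lemma sq_int_uminus: "sq_int Q f \<Longrightarrow> sq_int Q (\<lambda>x. - f x)"
  using sq_int_scaleR[of Q f "-1"] by simp

lemma sq_int_diff: "sq_int Q f \<Longrightarrow> sq_int Q g \<Longrightarrow> sq_int Q (\<lambda>x. f x - g x)"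
  using sq_int_add[of Q f "\<lambda>x. - g x"] sq_int_uminus[of Q g] by simp

lemma sq_int_zero [simp]: "sq_int Q (\<lambda>x. 0)"
  by (simp add: sq_int_def)

lemma sq_int_AE_cong:
  assumes "sq_int Q f" "g \<in> borel_measurable Q" "AE x in Q. f x = g x"
  shows "sq_int Q g"
  unfolding sq_int_def using assms(1)[unfolded sq_int_def] assms(2,3)
  by (auto intro: integrable_cong_AE_imp)

lemma sqn_AE_cong:
  assumes "f \<in> borel_measurable Q" "g \<in> borel_measurable Q" "AE x in Q. f x = g x"
  shows "sqn Q f = sqn Q g"
  unfolding sqn_def by (rule integral_cong_AE) (use assms in auto)

lemma (in finite_measure) sq_int_bounded:
  assumes "f \<in> borel_measurable M" "\<And>x. x \<in> space M \<Longrightarrow> norm (f x) \<le> K"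
  shows "sq_int M f"
  by (rule sq_int_dominated[where h = "\<lambda>x. K\<^sup>2"])
     (use assms in \<open>auto intro!: power_mono\<close>)

lemma (in finite_measure) sq_int_const [simp]: "sq_int M (\<lambda>x. c)"
  by (rule sq_int_bounded[where K="norm c"]) auto

lemma sq_int_inner:
  assumes "sq_int Q f" "sq_int Q g"
  shows "integrable Q (\<lambda>x. f x \<bullet> g x)"
proof (rule Bochner_Integration.integrable_bound[where f = "\<lambda>x. (norm (f x))\<^sup>2 + (norm (g x))\<^sup>2"])
  show "integrable Q (\<lambda>x. (norm (f x))\<^sup>2 + (norm (g x))\<^sup>2)" using assms by (simp add: sq_int_def)
  show "(\<lambda>x. f x \<bullet> g x) \<in> borel_measurable Q"
    using assms by (auto simp: sq_int_def)
  have "\<bar>a \<bullet> b\<bar> \<le> (norm a)\<^sup>2 + (norm b)\<^sup>2" for a b :: 'b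
  proof -
    have "\<bar>a \<bullet> b\<bar> \<le> norm a * norm b" by (rule Cauchy_Schwarz_ineq2)
    also have "\<dots> \<le> (norm a)\<^sup>2 + (norm b)\<^sup>2"
      using sum_squares_bound[of "norm a" "norm b"] mult_nonneg_nonneg[OF norm_ge_zero[of a] norm_ge_zero[of b]]
      by linarith
    finally show ?thesis .
  qed
  then show "AE x in Q. norm (f x \<bullet> g x) \<le> norm ((norm (f x))\<^sup>2 + (norm (g x))\<^sup>2)"
    by (intro AE_I2) simp
qed

lemma sq_int_mult: "sq_int Q f \<Longrightarrow> sq_int Q g \<Longrightarrow> integrable Q (\<lambda>x. f x * g x :: real)"
  using sq_int_inner[of Q f g] by simp

lemma (in finite_measure) sq_int_imp_integrable:
  fixes f :: "'a \<Rightarrow> 'v::euclidean_space"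
  assumes "sq_int M f" shows "integrable M f"
proof (rule Bochner_Integration.integrable_bound[where f = "\<lambda>x. 1 + (norm (f x))\<^sup>2"])
  show "integrable M (\<lambda>x. 1 + (norm (f x))\<^sup>2)" "f \<in> borel_measurable M"
    using assms by (auto simp: sq_int_def)
  have "a \<le> 1 + a\<^sup>2" for a :: real
    using sum_squares_bound[of a 1] zero_le_power2[of a] by (simp; linarith)
  then show "AE x in M. norm (f x) \<le> norm (1 + (norm (f x))\<^sup>2)" by auto
qed

lemma inner_eq_norm_sq: "(\<integral>x. f x \<bullet> f x \<partial>Q) = sqn Q f"
  by (simp add: sqn_def power2_norm_eq_inner)

lemma sqn_real: "sqn Q f = (\<integral>x. (f x)\<^sup>2 \<partial>Q)" for f :: "'a \<Rightarrow> real"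
  by (simp add: sqn_def)

lemma sqn_add_le:
  assumes "sq_int Q f" "sq_int Q g"
  shows "sqn Q (\<lambda>x. f x + g x) \<le> 2 * sqn Q f + 2 * sqn Q g"
proof -
  have "sqn Q (\<lambda>x. f x + g x) \<le> (\<integral>x. 2 * (norm (f x))\<^sup>2 + 2 * (norm (g x))\<^sup>2 \<partial>Q)"
    unfolding sqn_def
    by (rule integral_mono) (use assms sq_int_add[OF assms] in \<open>auto simp: sq_int_def norm_add_sq_le\<close>)
  also have "\<dots> = 2 * sqn Q f + 2 * sqn Q g"
    using assms by (simp add: sq_int_def sqn_def)
  finally show ?thesis .
qed

lemma sqn_minus: "sqn Q (\<lambda>x. f x - g x) = sqn Q (\<lambda>x. g x - f x)"
  by (simp add: sqn_def norm_minus_commute)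

lemma sqn_triangle:
  assumes "sq_int Q f" "sq_int Q g" "sq_int Q h"
  shows "sqn Q (\<lambda>x. f x - h x) \<le> 2 * sqn Q (\<lambda>x. f x - g x) + 2 * sqn Q (\<lambda>x. g x - h x)"
  using sqn_add_le[OF sq_int_diff[OF assms(1,2)] sq_int_diff[OF assms(2,3)]] by simp

lemma sqn_scaleR: "sqn Q (\<lambda>x. c *\<^sub>R f x) = c\<^sup>2 * sqn Q f"
  by (simp add: sqn_def power_mult_distrib)

lemma sqn_mono:
  assumes "sq_int Q f" "sq_int Q g" "\<And>x. x \<in> space Q \<Longrightarrow> norm (f x) \<le> norm (g x)"
  shows "sqn Q f \<le> sqn Q g"
  unfolding sqn_def by (rule integral_mono) (use assms in \<open>auto simp: sq_int_def intro!: power_mono\<close>)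

lemma sqn_mult_bounded:
  assumes "sq_int Q f" "h \<in> borel_measurable Q" "\<And>x. x \<in> space Q \<Longrightarrow> \<bar>h x\<bar> \<le> K"
  shows "sqn Q (\<lambda>x. h x *\<^sub>R f x) \<le> K\<^sup>2 * sqn Q f"
proof -
  have "sqn Q (\<lambda>x. h x *\<^sub>R f x) \<le> sqn Q (\<lambda>x. K *\<^sub>R f x)"
    using assms(3) by (intro sqn_mono sq_int_scaleR assms(1) sq_int_mult_bounded[OF assms]) 
      (force intro!: mult_right_mono)+
  then show ?thesis by (simp add: sqn_scaleR)
qed

lemma sqn_zero_iff:
  assumes "sq_int Q f" shows "sqn Q f = 0 \<longleftrightarrow> (AE x in Q. f x = 0)"
  unfolding sqn_def
  by (subst integral_nonneg_eq_0_iff_AE) (use assms in \<open>auto simp: sq_int_def\<close>)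

section \<open>Inner products and limits in L2\<close>

lemma L2_Cauchy_Schwarz:
  assumes "sq_int Q f" "sq_int Q g"
  shows "\<bar>\<integral>x. f x \<bullet> g x \<partial>Q\<bar> \<le> sqrt (sqn Q f) * sqrt (sqn Q g)"
proof -
  define A B C where "A = sqn Q f" and "B = sqn Q g" and "C = (\<integral>x. f x \<bullet> g x \<partial>Q)"
  \<comment> \<open>The squared norm of f - t g as a quadratic polynomial in t, later evaluated at
    its minimum t = C / B.\<close>
  have pos: "0 \<le> A - 2 * t * C + t\<^sup>2 * B" for t
  proof -
    have "A - 2 * t * C + t\<^sup>2 * B = (\<integral>x. f x \<bullet> f x - 2 * t * (f x \<bullet> g x) + t\<^sup>2 * (g x \<bullet> g x) \<partial>Q)"
      using sq_int_inner[OF assms] sq_int_inner[OF assms(1,1)] sq_int_inner[OF assms(2,2)]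
      by (simp add: A_def B_def C_def inner_eq_norm_sq)
    also have "\<dots> = (\<integral>x. (f x - t *\<^sub>R g x) \<bullet> (f x - t *\<^sub>R g x) \<partial>Q)"
      by (intro Bochner_Integration.integral_cong)
         (auto simp: inner_diff_left inner_diff_right inner_commute power2_eq_square algebra_simps)
    also have "\<dots> \<ge> 0" by (intro integral_nonneg_AE) auto
    finally show ?thesis .
  qed
  have "C\<^sup>2 \<le> A * B"
  proof (cases "B = 0")
    case True
    have "AE x in Q. g x = 0" using True sqn_zero_iff[OF assms(2)] by (simp add: B_def)
    then have "C = (\<integral>x. 0 \<partial>Q)" unfolding C_def
      by (intro integral_cong_AE) (use sq_int_measurable[OF assms(1)] sq_int_measurable[OF assms(2)] in auto)
    then show ?thesis using True by simp
  next
    case False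
    then have "B > 0" by (simp add: B_def less_le)
    have "0 \<le> A - 2 * (C / B) * C + (C / B)\<^sup>2 * B" by (rule pos)
    also have "\<dots> = A - C\<^sup>2 / B" using \<open>B > 0\<close> by (simp add: power2_eq_square field_simps)
    finally show ?thesis using \<open>B > 0\<close> by (simp add: field_simps)
  qed
  then have "sqrt (C\<^sup>2) \<le> sqrt (A * B)" by (rule real_sqrt_le_mono)
  then show ?thesis by (simp add: A_def B_def C_def real_sqrt_mult)
qed

text \<open>The difference splits into (f n - f0) (g n - g0), (f n - f0) g0 and f0 (g n - g0), each
  bounded by Cauchy-Schwarz. This is how isometry and orthogonality relations pass from elementary
  integrands to their limits.\<close>

lemma L2_inner_tendsto:
  assumes f: "\<And>n. sq_int Q (f n)" "sq_int Q f0" "(\<lambda>n. sqn Q (\<lambda>x. f n x - f0 x)) \<longlonglongrightarrow> 0"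
    and g: "\<And>n. sq_int Q (g n)" "sq_int Q g0" "(\<lambda>n. sqn Q (\<lambda>x. g n x - g0 x)) \<longlonglongrightarrow> 0"
  shows "(\<lambda>n. \<integral>x. f n x \<bullet> g n x \<partial>Q) \<longlonglongrightarrow> (\<integral>x. f0 x \<bullet> g0 x \<partial>Q)"
proof -
  let ?a = "\<lambda>n. sqrt (sqn Q (\<lambda>x. f n x - f0 x))" and ?b = "\<lambda>n. sqrt (sqn Q (\<lambda>x. g n x - g0 x))"
  have *: "norm ((\<integral>x. f n x \<bullet> g n x \<partial>Q) - (\<integral>x. f0 x \<bullet> g0 x \<partial>Q))
      \<le> ?a n * ?b n + ?a n * sqrt (sqn Q g0) + sqrt (sqn Q f0) * ?b n" for n
  proof -
    have d: "sq_int Q (\<lambda>x. f n x - f0 x)" "sq_int Q (\<lambda>x. g n x - g0 x)"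
      by (auto intro: sq_int_diff f g)
    have "(\<integral>x. f n x \<bullet> g n x \<partial>Q) - (\<integral>x. f0 x \<bullet> g0 x \<partial>Q)
      = (\<integral>x. f n x \<bullet> g n x - f0 x \<bullet> g0 x \<partial>Q)"
      by (rule Bochner_Integration.integral_diff[symmetric]) (auto intro: sq_int_inner f g)
    also have "\<dots> = (\<integral>x. (f n x - f0 x) \<bullet> (g n x - g0 x) + (f n x - f0 x) \<bullet> g0 x + f0 x \<bullet> (g n x - g0 x) \<partial>Q)"
      by (intro Bochner_Integration.integral_cong) (auto simp: inner_diff_left inner_diff_right)
    also have "\<dots> = (\<integral>x. (f n x - f0 x) \<bullet> (g n x - g0 x) \<partial>Q) + (\<integral>x. (f n x - f0 x) \<bullet> g0 x \<partial>Q)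
        + (\<integral>x. f0 x \<bullet> (g n x - g0 x) \<partial>Q)"
      using d f(2) g(2) by (simp add: sq_int_inner)
    finally show ?thesis
      using L2_Cauchy_Schwarz[OF d] L2_Cauchy_Schwarz[OF d(1) g(2)] L2_Cauchy_Schwarz[OF f(2) d(2)]
      by simp
  qed
  have "(\<lambda>n. ?a n * ?b n + ?a n * sqrt (sqn Q g0) + sqrt (sqn Q f0) * ?b n)
      \<longlonglongrightarrow> sqrt 0 * sqrt 0 + sqrt 0 * sqrt (sqn Q g0) + sqrt (sqn Q f0) * sqrt 0"
    by (intro tendsto_intros f g)
  then have "(\<lambda>n. ?a n * ?b n + ?a n * sqrt (sqn Q g0) + sqrt (sqn Q f0) * ?b n) \<longlonglongrightarrow> 0" by simp
  from Lim_null_comparison[OF always_eventually[OF allI[OF *]] this]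
  show ?thesis by (rule LIM_zero_cancel)
qed

lemma sq_int_nn_integral:
  assumes "sq_int Q f"
  shows "(\<integral>\<^sup>+x. ennreal ((norm (f x))\<^sup>2) \<partial>Q) = ennreal (sqn Q f)"
  unfolding sqn_def by (rule nn_integral_eq_integral) (use assms in \<open>auto simp: sq_int_def\<close>)

lemma sq_intI_nn_integral:
  assumes "f \<in> borel_measurable Q" "(\<integral>\<^sup>+x. ennreal ((norm (f x))\<^sup>2) \<partial>Q) < \<infinity>"
  shows "sq_int Q f"
  unfolding sq_int_def using assms by (auto intro!: integrableI_bounded)

lemma sqn_le_nn_integral:
  assumes "f \<in> borel_measurable Q" "(\<integral>\<^sup>+x. ennreal ((norm (f x))\<^sup>2) \<partial>Q) \<le> ennreal c" "0 \<le> c"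
  shows "sq_int Q f" "sqn Q f \<le> c"
proof -
  have "(\<integral>\<^sup>+x. ennreal ((norm (f x))\<^sup>2) \<partial>Q) < \<infinity>"
    using assms(2) by (rule order_le_less_trans) simp
  then show *: "sq_int Q f" using assms(1) sq_intI_nn_integral by blast
  show "sqn Q f \<le> c" using assms(2,3) by (simp add: sq_int_nn_integral[OF *])
qed

text \<open>Fatou's lemma is applied to nonnegative extended integrals, so square integrability of
  the limit comes out as a conclusion together with the bound.\<close>

lemma sqn_Fatou:
  assumes "\<And>n. sq_int Q (f n)" "g \<in> borel_measurable Q"
    and "AE x in Q. (\<lambda>n. f n x) \<longlonglongrightarrow> g x"
    and "eventually (\<lambda>n. sqn Q (f n) \<le> c) sequentially" "0 \<le> c"
  shows "sq_int Q g" "sqn Q g \<le> c"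
proof -
  have [measurable]: "\<And>n. f n \<in> borel_measurable Q" "g \<in> borel_measurable Q"
    using assms(1,2) by (auto simp: sq_int_def)
  have "(\<integral>\<^sup>+x. ennreal ((norm (g x))\<^sup>2) \<partial>Q) = (\<integral>\<^sup>+x. liminf (\<lambda>n. ennreal ((norm (f n x))\<^sup>2)) \<partial>Q)"
  proof (rule nn_integral_cong_AE)
    show "AE x in Q. ennreal ((norm (g x))\<^sup>2) = liminf (\<lambda>n. ennreal ((norm (f n x))\<^sup>2))"
      using assms(3)
    proof eventually_elim
      case (elim x)
      have "(\<lambda>n. ennreal ((norm (f n x))\<^sup>2)) \<longlonglongrightarrow> ennreal ((norm (g x))\<^sup>2)"
        by (intro tendsto_ennrealI tendsto_intros elim)
      then show ?case by (intro lim_imp_Liminf[symmetric]) auto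
    qed
  qed
  also have "\<dots> \<le> liminf (\<lambda>n. \<integral>\<^sup>+x. ennreal ((norm (f n x))\<^sup>2) \<partial>Q)"
    by (rule nn_integral_liminf) measurable
  also have "\<dots> = liminf (\<lambda>n. ennreal (sqn Q (f n)))"
    by (simp add: sq_int_nn_integral[OF assms(1)])
  also have "\<dots> \<le> limsup (\<lambda>n. ennreal (sqn Q (f n)))"
    by (rule Liminf_le_Limsup) simp
  also have "\<dots> \<le> ennreal c"
    by (rule Limsup_bounded) (use assms(4) in \<open>auto elim!: eventually_mono intro: ennreal_leI\<close>)
  finally have *: "(\<integral>\<^sup>+x. ennreal ((norm (g x))\<^sup>2) \<partial>Q) \<le> ennreal c" .
  show "sq_int Q g" "sqn Q g \<le> c" using sqn_le_nn_integral[OF _ * assms(5)] by simp_all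
qed

text \<open>Fatou for \<open>f n - g\<close>, whose pointwise limit is \<open>h - g\<close>, bounds
  the norm of the latter by every e > 0; no subsequence has to be extracted.\<close>

lemma L2_AE_limit_unique:
  assumes "\<And>n. sq_int Q (f n)" "sq_int Q g" "h \<in> borel_measurable Q"
    and "(\<lambda>n. sqn Q (\<lambda>x. f n x - g x)) \<longlonglongrightarrow> 0"
    and "AE x in Q. (\<lambda>n. f n x) \<longlonglongrightarrow> h x"
  shows "AE x in Q. g x = h x"
proof -
  have *: "sq_int Q (\<lambda>x. h x - g x) \<and> sqn Q (\<lambda>x. h x - g x) \<le> e" if "e > 0" for e
  proof -
    have "eventually (\<lambda>n. sqn Q (\<lambda>x. f n x - g x) \<le> e) sequentially"
      using order_tendstoD(2)[OF assms(4) that] by (auto elim: eventually_mono)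
    moreover have "AE x in Q. (\<lambda>n. f n x - g x) \<longlonglongrightarrow> h x - g x"
      using assms(5) by eventually_elim (intro tendsto_intros)
    moreover have "(\<lambda>x. h x - g x) \<in> borel_measurable Q"
      using assms(2,3) by (auto simp: sq_int_def)
    ultimately show ?thesis
      using sqn_Fatou[where f = "\<lambda>n x. f n x - g x" and g = "\<lambda>x. h x - g x" and c = e,
          OF sq_int_diff[OF assms(1,2)]] that by (meson less_imp_le)
  qed
  have "sqn Q (\<lambda>x. h x - g x) \<le> 0" by (rule field_le_epsilon) (use * in auto)
  then have "sqn Q (\<lambda>x. h x - g x) = 0" using sqn_nonneg[of Q "\<lambda>x. h x - g x"] by linarith
  moreover have "sq_int Q (\<lambda>x. h x - g x)" using *[of 1] by simp
  ultimately have "AE x in Q. h x - g x = 0" by (simp add: sqn_zero_iff)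
  then show ?thesis by auto
qed

section \<open>Elementary integrals and the Ito isometry\<close>

text \<open>The moment conditions are all that is used of the Gaussian law and of the independence of
  the increments.\<close>

locale brownian_basis = prob_space M
  for M :: "'w measure" +
  fixes F :: "real \<Rightarrow> 'w measure" and W :: "real \<Rightarrow> 'w \<Rightarrow> 'v::euclidean_space" and T :: real
  assumes T_pos: "0 < T"
    and subalg: "0 \<le> t \<Longrightarrow> subalgebra M (F t)"
    and F_mono: "0 \<le> s \<Longrightarrow> s \<le> t \<Longrightarrow> sets (F s) \<subseteq> sets (F t)"
    and F_null: "0 \<le> t \<Longrightarrow> null_sets M \<subseteq> sets (F t)"
    and W_adapted: "0 \<le> t \<Longrightarrow> W t \<in> borel_measurable (F t)"
    and W_cont: "\<omega> \<in> space M \<Longrightarrow> continuous_on {0..} (\<lambda>t. W t \<omega>)"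
    and increment_mean: "0 \<le> s \<Longrightarrow> s \<le> t \<Longrightarrow> Y \<in> borel_measurable (F s) \<Longrightarrow> integrable M Y \<Longrightarrow> i \<in> Basis \<Longrightarrow>
        integrable M (\<lambda>\<omega>. Y \<omega> * ((W t \<omega> - W s \<omega>) \<bullet> i)) \<and>
        (\<integral>\<omega>. Y \<omega> * ((W t \<omega> - W s \<omega>) \<bullet> i) \<partial>M) = 0"
    and increment_cov: "0 \<le> s \<Longrightarrow> s \<le> t \<Longrightarrow> Y \<in> borel_measurable (F s) \<Longrightarrow> integrable M Y \<Longrightarrow>
        i \<in> Basis \<Longrightarrow> j \<in> Basis \<Longrightarrow>
        integrable M (\<lambda>\<omega>. Y \<omega> * (((W t \<omega> - W s \<omega>) \<bullet> i) * ((W t \<omega> - W s \<omega>) \<bullet> j))) \<and>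
        (\<integral>\<omega>. Y \<omega> * (((W t \<omega> - W s \<omega>) \<bullet> i) * ((W t \<omega> - W s \<omega>) \<bullet> j)) \<partial>M)
          = (if i = j then t - s else 0) * (\<integral>\<omega>. Y \<omega> \<partial>M)"
begin

section \<open>The product of time and probability space\<close>

definition lam :: "real measure" where "lam = restrict_space lborel {0..T}"

abbreviation pm :: "(real \<times> 'w) measure" where "pm \<equiv> lam \<Otimes>\<^sub>M M"

lemma space_lam [simp]: "space lam = {0..T}"
  by (simp add: lam_def space_restrict_space)

lemma space_F [simp]: "0 \<le> t \<Longrightarrow> space (F t) = space M"
  using subalg by (simp add: subalgebra_def)

lemma measurable_F_mono:
  assumes "f \<in> measurable (F s) N" "0 \<le> s" "s \<le> t" shows "f \<in> measurable (F t) N"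
  using assms F_mono[OF assms(2,3)] by (auto simp: measurable_def)

lemma measurable_F_M: "f \<in> measurable (F s) N \<Longrightarrow> 0 \<le> s \<Longrightarrow> f \<in> measurable M N"
  using subalg measurable_from_subalg by blast

lemma measurable_W: "0 \<le> s \<Longrightarrow> s \<le> t \<Longrightarrow> W s \<in> borel_measurable (F t)"
  by (meson W_adapted measurable_F_mono order_trans)

lemma borel_measurable_lam: "f \<in> borel_measurable borel \<Longrightarrow> f \<in> borel_measurable lam"
  unfolding lam_def by (rule measurable_restrict_space1) simp

lemma emeasure_lam: "A \<in> sets borel \<Longrightarrow> A \<subseteq> {0..T} \<Longrightarrow> emeasure lam A = emeasure lborel A"
  unfolding lam_def by (rule emeasure_restrict_space) auto

end

sublocale brownian_basis \<subseteq> lam: finite_measure lam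
proof
  have "emeasure lam (space lam) = ennreal T"
    using T_pos by (simp add: emeasure_lam)
  then show "emeasure lam (space lam) \<noteq> \<infinity>" by simp
qed

sublocale brownian_basis \<subseteq> pair_sigma_finite lam M ..

sublocale brownian_basis \<subseteq> pm: finite_measure "lam \<Otimes>\<^sub>M M"
proof -
  show "finite_measure (lam \<Otimes>\<^sub>M M)"
  proof
    have "emeasure (lam \<Otimes>\<^sub>M M) (space lam \<times> space M) = emeasure lam (space lam) * emeasure M (space M)"
      by (intro sigma_finite_measure.emeasure_pair_measure_Times prob_space_imp_sigma_finite prob_space_axioms)
         (auto simp del: space_lam)
    then show "emeasure (lam \<Otimes>\<^sub>M M) (space (lam \<Otimes>\<^sub>M M)) \<noteq> \<infinity>"
      by (simp add: space_pair_measure emeasure_space_1 del: space_lam)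
  qed
qed

context brownian_basis
begin

lemma integrable_bounded_mult:
  fixes f g :: "'w \<Rightarrow> real"
  assumes "integrable M f" "g \<in> borel_measurable M" "\<And>\<omega>. \<omega> \<in> space M \<Longrightarrow> \<bar>g \<omega>\<bar> \<le> K"
  shows "integrable M (\<lambda>\<omega>. f \<omega> * g \<omega>)"
proof (rule Bochner_Integration.integrable_bound[where f = "\<lambda>\<omega>. K * f \<omega>"])
  show "integrable M (\<lambda>\<omega>. K * f \<omega>)" "(\<lambda>\<omega>. f \<omega> * g \<omega>) \<in> borel_measurable M"
    using assms by auto
  show "AE \<omega> in M. norm (f \<omega> * g \<omega>) \<le> norm (K * f \<omega>)"
  proof (rule AE_I2)
    fix \<omega> assume "\<omega> \<in> space M"
    from assms(3)[OF this] have "\<bar>g \<omega>\<bar> \<le> \<bar>K\<bar>" by linarith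
    then show "norm (f \<omega> * g \<omega>) \<le> norm (K * f \<omega>)"
      by (simp add: abs_mult mult.commute[of "\<bar>f \<omega>\<bar>"] mult_right_mono)
  qed
qed

section \<open>Increments paired with coefficients known at their start\<close>

lemma bounded_component:
  assumes "bounded (\<xi> ` space M)"
  obtains K where "\<And>\<omega> i. \<omega> \<in> space M \<Longrightarrow> i \<in> Basis \<Longrightarrow> \<bar>\<xi> \<omega> \<bullet> i\<bar> \<le> K"
    "\<And>\<omega>. \<omega> \<in> space M \<Longrightarrow> norm (\<xi> \<omega>) \<le> K"
proof -
  obtain K where K: "\<And>\<omega>. \<omega> \<in> space M \<Longrightarrow> norm (\<xi> \<omega>) \<le> K"
    using assms by (auto simp: bounded_iff)
  show ?thesis by (rule that[of K]) (use K Basis_le_norm order_trans in blast)+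
qed

text \<open>In coordinates each summand is an increment component times Y times a component of
  \<open>\<zeta>\<close>. The last two factors are known at time c, and their product is integrable
  because \<open>\<zeta>\<close> is bounded.\<close>

lemma increment_orthogonal:
  assumes "0 \<le> c" "c \<le> d" "\<zeta> \<in> borel_measurable (F c)" "bounded (\<zeta> ` space M)"
    and "Y \<in> borel_measurable (F c)" "integrable M Y"
  shows "integrable M (\<lambda>\<omega>. Y \<omega> * (\<zeta> \<omega> \<bullet> (W d \<omega> - W c \<omega>)))"
    and "(\<integral>\<omega>. Y \<omega> * (\<zeta> \<omega> \<bullet> (W d \<omega> - W c \<omega>)) \<partial>M) = 0"
proof -
  obtain K where K: "\<And>\<omega> i. \<omega> \<in> space M \<Longrightarrow> i \<in> Basis \<Longrightarrow> \<bar>\<zeta> \<omega> \<bullet> i\<bar> \<le> K"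
    using bounded_component[OF assms(4)] by metis
  have *: "integrable M (\<lambda>\<omega>. Y \<omega> * (\<zeta> \<omega> \<bullet> i) * ((W d \<omega> - W c \<omega>) \<bullet> i)) \<and>
      (\<integral>\<omega>. Y \<omega> * (\<zeta> \<omega> \<bullet> i) * ((W d \<omega> - W c \<omega>) \<bullet> i) \<partial>M) = 0" if "i \<in> Basis" for i
  proof (rule increment_mean[OF assms(1,2) _ _ that])
    show "(\<lambda>\<omega>. Y \<omega> * (\<zeta> \<omega> \<bullet> i)) \<in> borel_measurable (F c)" using assms(3,5) by measurable
    show "integrable M (\<lambda>\<omega>. Y \<omega> * (\<zeta> \<omega> \<bullet> i))"
      using measurable_F_M[OF assms(3,1)] by (intro integrable_bounded_mult[OF assms(6), of _ K] K that) auto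
  qed
  have eq: "Y \<omega> * (\<zeta> \<omega> \<bullet> (W d \<omega> - W c \<omega>)) = (\<Sum>i\<in>Basis. Y \<omega> * (\<zeta> \<omega> \<bullet> i) * ((W d \<omega> - W c \<omega>) \<bullet> i))" for \<omega>
    by (subst euclidean_inner) (simp add: sum_distrib_left mult.assoc)
  show "integrable M (\<lambda>\<omega>. Y \<omega> * (\<zeta> \<omega> \<bullet> (W d \<omega> - W c \<omega>)))"
    unfolding eq using * by auto
  show "(\<integral>\<omega>. Y \<omega> * (\<zeta> \<omega> \<bullet> (W d \<omega> - W c \<omega>)) \<partial>M) = 0"
    unfolding eq using * by (subst Bochner_Integration.integral_sum) auto
qed

text \<open>Expanding both inner products in the basis leaves a double sum in which the covariance
  of the increment removes the mixed terms and weights each diagonal term by d - c.\<close>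

lemma increment_isometry:
  assumes "0 \<le> c" "c \<le> d" "\<zeta> \<in> borel_measurable (F c)" "bounded (\<zeta> ` space M)"
    and "\<xi> \<in> borel_measurable (F c)" "bounded (\<xi> ` space M)"
  shows "integrable M (\<lambda>\<omega>. (\<xi> \<omega> \<bullet> (W d \<omega> - W c \<omega>)) * (\<zeta> \<omega> \<bullet> (W d \<omega> - W c \<omega>)))"
    and "(\<integral>\<omega>. (\<xi> \<omega> \<bullet> (W d \<omega> - W c \<omega>)) * (\<zeta> \<omega> \<bullet> (W d \<omega> - W c \<omega>)) \<partial>M) = (d - c) * (\<integral>\<omega>. \<xi> \<omega> \<bullet> \<zeta> \<omega> \<partial>M)"
proof -
  obtain K where K: "\<And>\<omega> i. \<omega> \<in> space M \<Longrightarrow> i \<in> Basis \<Longrightarrow> \<bar>\<zeta> \<omega> \<bullet> i\<bar> \<le> K"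
    using bounded_component[OF assms(4)] by metis
  obtain K' where K': "\<And>\<omega> i. \<omega> \<in> space M \<Longrightarrow> i \<in> Basis \<Longrightarrow> \<bar>\<xi> \<omega> \<bullet> i\<bar> \<le> K'"
    using bounded_component[OF assms(6)] by metis
  define D where "D \<omega> = W d \<omega> - W c \<omega>" for \<omega>
  have m [measurable]: "\<zeta> \<in> borel_measurable M" "\<xi> \<in> borel_measurable M"
    using measurable_F_M assms by auto
  have i1: "integrable M (\<lambda>\<omega>. (\<xi> \<omega> \<bullet> i) * (\<zeta> \<omega> \<bullet> j))" if "i \<in> Basis" "j \<in> Basis" for i j
    using K K' that by (intro integrable_bounded_mult[of _ _ K] integrable_const_bound[of _ K']) auto
  have *: "integrable M (\<lambda>\<omega>. ((\<xi> \<omega> \<bullet> i) * (\<zeta> \<omega> \<bullet> j)) * ((D \<omega> \<bullet> i) * (D \<omega> \<bullet> j))) \<and>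
      (\<integral>\<omega>. ((\<xi> \<omega> \<bullet> i) * (\<zeta> \<omega> \<bullet> j)) * ((D \<omega> \<bullet> i) * (D \<omega> \<bullet> j)) \<partial>M)
        = (if i = j then d - c else 0) * (\<integral>\<omega>. (\<xi> \<omega> \<bullet> i) * (\<zeta> \<omega> \<bullet> j) \<partial>M)"
    if "i \<in> Basis" "j \<in> Basis" for i j
    unfolding D_def
    by (rule increment_cov[OF assms(1,2) _ i1[OF that] that]) (use assms(3,5) in measurable)
  have eq: "(\<xi> \<omega> \<bullet> D \<omega>) * (\<zeta> \<omega> \<bullet> D \<omega>)
      = (\<Sum>i\<in>Basis. \<Sum>j\<in>Basis. ((\<xi> \<omega> \<bullet> i) * (\<zeta> \<omega> \<bullet> j)) * ((D \<omega> \<bullet> i) * (D \<omega> \<bullet> j)))" for \<omega>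
    by (subst (1 2) euclidean_inner) (simp add: sum_product mult.assoc mult.left_commute)
  have "integrable M (\<lambda>\<omega>. (\<xi> \<omega> \<bullet> D \<omega>) * (\<zeta> \<omega> \<bullet> D \<omega>))"
    unfolding eq using * by (intro Bochner_Integration.integrable_sum) auto
  then show "integrable M (\<lambda>\<omega>. (\<xi> \<omega> \<bullet> (W d \<omega> - W c \<omega>)) * (\<zeta> \<omega> \<bullet> (W d \<omega> - W c \<omega>)))"
    unfolding D_def .
  have "(\<integral>\<omega>. (\<xi> \<omega> \<bullet> D \<omega>) * (\<zeta> \<omega> \<bullet> D \<omega>) \<partial>M)
      = (\<Sum>i\<in>Basis. \<Sum>j\<in>Basis. (\<integral>\<omega>. ((\<xi> \<omega> \<bullet> i) * (\<zeta> \<omega> \<bullet> j)) * ((D \<omega> \<bullet> i) * (D \<omega> \<bullet> j)) \<partial>M))"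
    unfolding eq using *
    by (subst Bochner_Integration.integral_sum)
       (auto intro!: Bochner_Integration.integrable_sum sum.cong Bochner_Integration.integral_sum)
  also have "\<dots> = (\<Sum>i\<in>Basis. \<Sum>j\<in>Basis. (if i = j then (d - c) * (\<integral>\<omega>. (\<xi> \<omega> \<bullet> i) * (\<zeta> \<omega> \<bullet> j) \<partial>M) else 0))"
    using * by (intro sum.cong) auto
  also have "\<dots> = (d - c) * (\<Sum>i\<in>Basis. \<integral>\<omega>. (\<xi> \<omega> \<bullet> i) * (\<zeta> \<omega> \<bullet> i) \<partial>M)"
    by (simp add: sum_distrib_left)
  also have "(\<Sum>i\<in>Basis. \<integral>\<omega>. (\<xi> \<omega> \<bullet> i) * (\<zeta> \<omega> \<bullet> i) \<partial>M) = (\<integral>\<omega>. \<xi> \<omega> \<bullet> \<zeta> \<omega> \<partial>M)"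
    using i1 by (subst Bochner_Integration.integral_sum[symmetric]) (auto simp: euclidean_inner[of "\<xi> _" "\<zeta> _"])
  finally show "(\<integral>\<omega>. (\<xi> \<omega> \<bullet> (W d \<omega> - W c \<omega>)) * (\<zeta> \<omega> \<bullet> (W d \<omega> - W c \<omega>)) \<partial>M) = (d - c) * (\<integral>\<omega>. \<xi> \<omega> \<bullet> \<zeta> \<omega> \<partial>M)"
    unfolding D_def .
qed

section \<open>Elementary integrands as lists of blocks\<close>

fun valid_block :: "real \<times> real \<times> ('w \<Rightarrow> 'v) \<Rightarrow> bool" where
  "valid_block (a, b, \<xi>) \<longleftrightarrow>
     0 \<le> a \<and> a \<le> b \<and> b \<le> T \<and> \<xi> \<in> borel_measurable (F a) \<and> bounded (\<xi> ` space M)"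

fun block_proc :: "real \<times> real \<times> ('w \<Rightarrow> 'v) \<Rightarrow> real \<Rightarrow> 'w \<Rightarrow> 'v" where
  "block_proc (a, b, \<xi>) s \<omega> = indicat_real {a<..b} s *\<^sub>R \<xi> \<omega>"

fun block_int :: "real \<times> real \<times> ('w \<Rightarrow> 'v) \<Rightarrow> 'w \<Rightarrow> real" where
  "block_int (a, b, \<xi>) \<omega> = \<xi> \<omega> \<bullet> (W b \<omega> - W a \<omega>)"

text \<open>The blocks of a list may overlap and stand in any order, in contrast to
  \<open>elementary_data\<close>. Addition of integrands becomes concatenation, and no common
  refinement of partitions is ever formed; in return the isometry has to be shown for two arbitrary
  blocks.\<close>

definition eproc :: "(real \<times> real \<times> ('w \<Rightarrow> 'v)) list \<Rightarrow> real \<Rightarrow> 'w \<Rightarrow> 'v" where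
  "eproc L s \<omega> = (\<Sum>B\<leftarrow>L. block_proc B s \<omega>)"

definition eint :: "(real \<times> real \<times> ('w \<Rightarrow> 'v)) list \<Rightarrow> 'w \<Rightarrow> real" where
  "eint L \<omega> = (\<Sum>B\<leftarrow>L. block_int B \<omega>)"

abbreviation "valid L \<equiv> (\<forall>B\<in>set L. valid_block B)"

lemma sq_int_block_int:
  assumes "valid_block B" shows "sq_int M (block_int B)"
proof -
  obtain a b \<xi> where B: "B = (a, b, \<xi>)" by (cases B) auto
  from assms have v: "0 \<le> a" "a \<le> b" "\<xi> \<in> borel_measurable (F a)" "bounded (\<xi> ` space M)" by (auto simp: B)
  have "W a \<in> borel_measurable M" "W b \<in> borel_measurable M" "\<xi> \<in> borel_measurable M"
    using v W_adapted[of a] W_adapted[of b] by (auto intro: measurable_F_M)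
  moreover have "block_int B = (\<lambda>\<omega>. \<xi> \<omega> \<bullet> (W b \<omega> - W a \<omega>))" by (simp add: B fun_eq_iff)
  ultimately show ?thesis
    using increment_isometry(1)[OF v v(3,4)] by (simp add: sq_int_def power2_eq_square)
qed

lemma sq_int_block_proc:
  assumes "valid_block B" shows "sq_int pm (\<lambda>(s, \<omega>). block_proc B s \<omega>)"
proof -
  obtain a b \<xi> where B: "B = (a, b, \<xi>)" by (cases B) auto
  from assms have v: "0 \<le> a" "a \<le> b" "\<xi> \<in> borel_measurable (F a)" "bounded (\<xi> ` space M)" by (auto simp: B)
  obtain K where K: "\<And>\<omega>. \<omega> \<in> space M \<Longrightarrow> norm (\<xi> \<omega>) \<le> K" using bounded_component[OF v(4)] by metis
  have [measurable]: "\<xi> \<in> borel_measurable M" using v by (auto intro: measurable_F_M)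
  have [measurable]: "indicat_real {a<..b} \<in> borel_measurable lam" by (rule borel_measurable_lam) simp
  show ?thesis
  proof (rule pm.sq_int_bounded[of _ K])
    show "(\<lambda>(s, \<omega>). block_proc B s \<omega>) \<in> borel_measurable pm"
      by (simp add: B split_beta')
    show "norm (case x of (s, \<omega>) \<Rightarrow> block_proc B s \<omega>) \<le> K" if "x \<in> space pm" for x
      using K[of "snd x"] order_trans[OF norm_ge_zero K[of "snd x"]] that
      by (auto simp: B space_pair_measure split: split_indicator)
  qed
qed

lemma sq_int_eint: "valid L \<Longrightarrow> sq_int M (eint L)"
  unfolding eint_def by (induction L) (auto intro: sq_int_add sq_int_block_int)

lemma sq_int_eproc: "valid L \<Longrightarrow> sq_int pm (\<lambda>(s, \<omega>). eproc L s \<omega>)"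
proof (induction L)
  case (Cons B L)
  then show ?case using sq_int_add[OF sq_int_block_proc[of B] Cons.IH]
    by (auto simp: eproc_def split_beta')
qed (auto simp: eproc_def split_beta')

lemma integral_pm_product:
  fixes f :: "real \<Rightarrow> real" and g :: "'w \<Rightarrow> real"
  assumes "integrable lam f" "integrable M g"
  shows "(\<integral>(s, \<omega>). f s * g \<omega> \<partial>pm) = (\<integral>s. f s \<partial>lam) * (\<integral>\<omega>. g \<omega> \<partial>M)"
proof -
  have [measurable]: "f \<in> borel_measurable lam" "g \<in> borel_measurable M" using assms by auto
  have "integrable pm (\<lambda>(s, \<omega>). f s * g \<omega>)"
  proof (rule Fubini_integrable)
    show "integrable lam (\<lambda>s. \<integral>\<omega>. norm (case (s, \<omega>) of (s, \<omega>) \<Rightarrow> f s * g \<omega>) \<partial>M)"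
      using assms by (simp add: abs_mult)
  qed (use assms in auto)
  from integral_fst'[OF this] show ?thesis using assms by simp
qed

text \<open>The factor max 0 (min b d - c) is the length of the overlap. Both increments are cut at
  c and at the end m of the overlap. A product of pieces over non-overlapping intervals has mean
  zero, because the earlier piece is known when the later one starts, so only the pieces over (c, m]
  contribute.\<close>

lemma block_isometry_aux:
  assumes v: "valid_block (a, b, \<xi>)" "valid_block (c, d, \<zeta>)" and ac: "a \<le> c"
  shows "(\<integral>\<omega>. block_int (a, b, \<xi>) \<omega> * block_int (c, d, \<zeta>) \<omega> \<partial>M) = max 0 (min b d - c) * (\<integral>\<omega>. \<xi> \<omega> \<bullet> \<zeta> \<omega> \<partial>M)"
proof -
  from v have a: "0 \<le> a" "a \<le> b" "\<xi> \<in> borel_measurable (F a)" "bounded (\<xi> ` space M)"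
    and c: "0 \<le> c" "c \<le> d" "\<zeta> \<in> borel_measurable (F c)" "bounded (\<zeta> ` space M)" by auto
  have xi: "\<xi> \<in> borel_measurable (F t)" if "a \<le> t" for t using measurable_F_mono[OF a(3,1) that] .
  have zeta: "\<zeta> \<in> borel_measurable (F t)" if "c \<le> t" for t using measurable_F_mono[OF c(3,1) that] .
  have int: "integrable M (\<lambda>\<omega>. \<eta> \<omega> \<bullet> (W q \<omega> - W p \<omega>))"
    if "0 \<le> p" "p \<le> q" "\<eta> \<in> borel_measurable (F p)" "bounded (\<eta> ` space M)" for p q \<eta>
  proof -
    have "integrable M (\<lambda>\<omega>. 1 * (\<eta> \<omega> \<bullet> (W q \<omega> - W p \<omega>)))"
      by (rule increment_orthogonal(1)[OF that]) simp_all
    then show ?thesis by simp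
  qed
  have meas: "(\<lambda>\<omega>. \<eta> \<omega> \<bullet> (W q \<omega> - W p \<omega>)) \<in> borel_measurable (F t)"
    if "0 \<le> p" "p \<le> t" "0 \<le> q" "q \<le> t" "\<eta> \<in> borel_measurable (F t)" for p q t \<eta>
    using measurable_W[OF that(1,2)] measurable_W[OF that(3,4)] that(5) by measurable
  have orth: "integrable M (\<lambda>\<omega>. (\<eta> \<omega> \<bullet> (W q \<omega> - W p \<omega>)) * (\<theta> \<omega> \<bullet> (W q' \<omega> - W p' \<omega>)))"
      "(\<integral>\<omega>. (\<eta> \<omega> \<bullet> (W q \<omega> - W p \<omega>)) * (\<theta> \<omega> \<bullet> (W q' \<omega> - W p' \<omega>)) \<partial>M) = 0"
    if "0 \<le> p" "p \<le> q" "q \<le> p'" "p' \<le> q'" "\<eta> \<in> borel_measurable (F p)" "bounded (\<eta> ` space M)"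
      "\<theta> \<in> borel_measurable (F p')" "bounded (\<theta> ` space M)" for p q p' q' \<eta> \<theta>
  proof -
    have "\<eta> \<in> borel_measurable (F p')" using that by (auto intro: measurable_F_mono)
    then have *: "0 \<le> p'" "(\<lambda>\<omega>. \<eta> \<omega> \<bullet> (W q \<omega> - W p \<omega>)) \<in> borel_measurable (F p')"
      using that meas by auto
    show "integrable M (\<lambda>\<omega>. (\<eta> \<omega> \<bullet> (W q \<omega> - W p \<omega>)) * (\<theta> \<omega> \<bullet> (W q' \<omega> - W p' \<omega>)))"
      "(\<integral>\<omega>. (\<eta> \<omega> \<bullet> (W q \<omega> - W p \<omega>)) * (\<theta> \<omega> \<bullet> (W q' \<omega> - W p' \<omega>)) \<partial>M) = 0"
      using increment_orthogonal[OF *(1) that(4,7,8) *(2) int[OF that(1,2,5,6)]] by auto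
  qed
  show ?thesis
  proof (cases "b \<le> c")
    case True
    then have "max 0 (min b d - c) = 0" by auto
    then show ?thesis using orth(2)[OF a(1,2) True c(2) a(3,4) c(3,4)] by simp
  next
    case False
    define m where "m = min b d"
    have m: "c \<le> m" "m \<le> b" "m \<le> d" "b = m \<or> d = m" using False c by (auto simp: m_def)
    define X where "X \<eta> p q \<omega> = \<eta> \<omega> \<bullet> (W q \<omega> - W p \<omega>)" for \<eta> :: "'w \<Rightarrow> 'v" and p q \<omega>
    have X0: "X \<eta> p p = (\<lambda>_. 0)" for \<eta> p by (simp add: X_def fun_eq_iff)
    have Xadd: "X \<eta> p q \<omega> = X \<eta> p r \<omega> + X \<eta> r q \<omega>" for \<eta> p q r \<omega>
      by (simp add: X_def inner_diff_right)
    have 1: "integrable M (\<lambda>\<omega>. X \<xi> a c \<omega> * X \<zeta> c d \<omega>)" "(\<integral>\<omega>. X \<xi> a c \<omega> * X \<zeta> c d \<omega> \<partial>M) = 0"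
      using orth[OF a(1) ac order_refl c(2) a(3,4) c(3,4)] by (auto simp: X_def)
    have 2: "integrable M (\<lambda>\<omega>. X \<xi> c m \<omega> * X \<zeta> c m \<omega>)"
      "(\<integral>\<omega>. X \<xi> c m \<omega> * X \<zeta> c m \<omega> \<partial>M) = (m - c) * (\<integral>\<omega>. \<xi> \<omega> \<bullet> \<zeta> \<omega> \<partial>M)"
      using increment_isometry[OF c(1) m(1) c(3,4) xi[OF ac] a(4)] by (auto simp: X_def)
    have 3: "integrable M (\<lambda>\<omega>. X \<xi> c m \<omega> * X \<zeta> m d \<omega>)" "(\<integral>\<omega>. X \<xi> c m \<omega> * X \<zeta> m d \<omega> \<partial>M) = 0"
      using orth[OF c(1) m(1) order_refl m(3) xi[OF ac] a(4) zeta[OF m(1)] c(4)] by (auto simp: X_def)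
    have 4: "integrable M (\<lambda>\<omega>. X \<zeta> c m \<omega> * X \<xi> m b \<omega>)" "(\<integral>\<omega>. X \<zeta> c m \<omega> * X \<xi> m b \<omega> \<partial>M) = 0"
      using orth[OF c(1) m(1) order_refl m(2) c(3,4) xi a(4)] ac m by (auto simp: X_def)
    \<comment> \<open>Beyond the overlap at most one of the two blocks continues, so one of these
      pieces is degenerate.\<close>
    have 5: "X \<xi> m b \<omega> * X \<zeta> m d \<omega> = 0" for \<omega> using m(4) X0 by auto
    have "(\<integral>\<omega>. X \<xi> a b \<omega> * X \<zeta> c d \<omega> \<partial>M)
      = (\<integral>\<omega>. X \<xi> a c \<omega> * X \<zeta> c d \<omega> + X \<xi> c m \<omega> * X \<zeta> c m \<omega> + X \<xi> c m \<omega> * X \<zeta> m d \<omega> + X \<zeta> c m \<omega> * X \<xi> m b \<omega> \<partial>M)"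
    proof (rule Bochner_Integration.integral_cong[OF refl])
      fix \<omega>
      have "X \<xi> a b \<omega> = X \<xi> a c \<omega> + X \<xi> c m \<omega> + X \<xi> m b \<omega>"
        using Xadd[of \<xi> a b \<omega> c] Xadd[of \<xi> c b \<omega> m] by simp
      moreover have "X \<zeta> c d \<omega> = X \<zeta> c m \<omega> + X \<zeta> m d \<omega>" by (rule Xadd)
      ultimately show "X \<xi> a b \<omega> * X \<zeta> c d \<omega> = X \<xi> a c \<omega> * X \<zeta> c d \<omega> + X \<xi> c m \<omega> * X \<zeta> c m \<omega>
          + X \<xi> c m \<omega> * X \<zeta> m d \<omega> + X \<zeta> c m \<omega> * X \<xi> m b \<omega>"
        using 5[of \<omega>] by (simp add: algebra_simps)
    qed
    also have "\<dots> = (m - c) * (\<integral>\<omega>. \<xi> \<omega> \<bullet> \<zeta> \<omega> \<partial>M)"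
      using 1 2 3 4 by simp
    also have "m - c = max 0 (min b d - c)" using m by (simp add: m_def)
    finally show ?thesis by (simp add: X_def)
  qed
qed

lemma block_isometry:
  assumes v: "valid_block B" "valid_block B'"
  shows "(\<integral>\<omega>. block_int B \<omega> * block_int B' \<omega> \<partial>M) = (\<integral>(s, \<omega>). block_proc B s \<omega> \<bullet> block_proc B' s \<omega> \<partial>pm)"
proof -
  obtain a b \<xi> c d \<zeta> where B: "B = (a, b, \<xi>)" "B' = (c, d, \<zeta>)" by (cases B, cases B') auto
  from v have a: "0 \<le> a" "a \<le> b" "\<xi> \<in> borel_measurable (F a)" "bounded (\<xi> ` space M)" "b \<le> T"
    and c: "0 \<le> c" "c \<le> d" "\<zeta> \<in> borel_measurable (F c)" "bounded (\<zeta> ` space M)" "d \<le> T" by (auto simp: B)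
  have I: "integrable M (\<lambda>\<omega>. \<xi> \<omega> \<bullet> \<zeta> \<omega>)"
  proof -
    obtain K K' where "\<And>\<omega>. \<omega> \<in> space M \<Longrightarrow> norm (\<xi> \<omega>) \<le> K" "\<And>\<omega>. \<omega> \<in> space M \<Longrightarrow> norm (\<zeta> \<omega>) \<le> K'"
      using bounded_component[OF a(4)] bounded_component[OF c(4)] by metis
    then show ?thesis
      by (intro sq_int_inner sq_int_bounded measurable_F_M[OF a(3,1)] measurable_F_M[OF c(3,1)])
  qed
  let ?J = "{max a c<..min b d}"
  have "(\<integral>(s, \<omega>). block_proc B s \<omega> \<bullet> block_proc B' s \<omega> \<partial>pm) = (\<integral>(s, \<omega>). indicat_real ?J s * (\<xi> \<omega> \<bullet> \<zeta> \<omega>) \<partial>pm)"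
    by (intro Bochner_Integration.integral_cong) (auto simp: B split: split_indicator)
  also have "\<dots> = (\<integral>s. indicat_real ?J s \<partial>lam) * (\<integral>\<omega>. \<xi> \<omega> \<bullet> \<zeta> \<omega> \<partial>M)"
    by (intro integral_pm_product I lam.integrable_const_bound[of _ 1] borel_measurable_lam) auto
  also have "(\<integral>s. indicat_real ?J s \<partial>lam) = max 0 (min b d - max a c)"
  proof -
    have "?J \<subseteq> {0..T}" using a c by auto
    then have "(\<integral>s. indicat_real ?J s \<partial>lam) = measure lborel ?J"
      by (simp add: lam_def Int_absorb2 measure_restrict_space)
    also have "\<dots> = max 0 (min b d - max a c)"
      by (cases "max a c \<le> min b d") (auto simp: max_def min_def)
    finally show ?thesis .
  qed
  finally have R: "(\<integral>(s, \<omega>). block_proc B s \<omega> \<bullet> block_proc B' s \<omega> \<partial>pm)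
      = max 0 (min b d - max a c) * (\<integral>\<omega>. \<xi> \<omega> \<bullet> \<zeta> \<omega> \<partial>M)" .
  show ?thesis
  proof (cases "a \<le> c")
    case True
    then show ?thesis using block_isometry_aux[OF v[unfolded B] True] R by (simp add: B max_absorb2)
  next
    case False
    then have "c \<le> a" by simp
    show ?thesis using block_isometry_aux[OF v(2,1)[unfolded B] \<open>c \<le> a\<close>] R False
      by (simp add: B max_absorb1 inner_commute min.commute mult.commute)
  qed
qed

text \<open>Bilinearity reduces the claim to single blocks: the second list is taken apart against a
  fixed block, then the first list against the second.\<close>

lemma elementary_isometry:
  assumes "valid L" "valid L'"
  shows "(\<integral>\<omega>. eint L \<omega> * eint L' \<omega> \<partial>M) = (\<integral>(s, \<omega>). eproc L s \<omega> \<bullet> eproc L' s \<omega> \<partial>pm)"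
proof -
  have 1: "(\<integral>\<omega>. block_int B \<omega> * eint L' \<omega> \<partial>M) = (\<integral>(s, \<omega>). block_proc B s \<omega> \<bullet> eproc L' s \<omega> \<partial>pm)"
    if "valid_block B" for B
    using assms(2)
  proof (induction L')
    case (Cons C L')
    have "(\<integral>\<omega>. block_int B \<omega> * eint (C # L') \<omega> \<partial>M) = (\<integral>\<omega>. block_int B \<omega> * block_int C \<omega> + block_int B \<omega> * eint L' \<omega> \<partial>M)"
      by (simp add: eint_def distrib_left)
    also have "\<dots> = (\<integral>\<omega>. block_int B \<omega> * block_int C \<omega> \<partial>M) + (\<integral>\<omega>. block_int B \<omega> * eint L' \<omega> \<partial>M)"
      by (intro Bochner_Integration.integral_add sq_int_mult sq_int_block_int sq_int_eint) (use that Cons.prems in auto)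
    also have "\<dots> = (\<integral>(s, \<omega>). block_proc B s \<omega> \<bullet> block_proc C s \<omega> \<partial>pm) + (\<integral>(s, \<omega>). block_proc B s \<omega> \<bullet> eproc L' s \<omega> \<partial>pm)"
      using Cons block_isometry[OF that] by auto
    also have "\<dots> = (\<integral>(s, \<omega>). block_proc B s \<omega> \<bullet> eproc (C # L') s \<omega> \<partial>pm)"
      using sq_int_inner[OF sq_int_block_proc[OF that] sq_int_block_proc[of C]]
        sq_int_inner[OF sq_int_block_proc[OF that] sq_int_eproc[of L']] Cons.prems
      by (simp add: split_beta' eproc_def inner_add_right)
    finally show ?case .
  qed (simp add: eint_def eproc_def split_beta')
  show ?thesis
    using assms(1)
  proof (induction L)
    case (Cons C L)
    have "(\<integral>\<omega>. eint (C # L) \<omega> * eint L' \<omega> \<partial>M) = (\<integral>\<omega>. block_int C \<omega> * eint L' \<omega> + eint L \<omega> * eint L' \<omega> \<partial>M)"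
      by (simp add: eint_def distrib_right)
    also have "\<dots> = (\<integral>\<omega>. block_int C \<omega> * eint L' \<omega> \<partial>M) + (\<integral>\<omega>. eint L \<omega> * eint L' \<omega> \<partial>M)"
      by (intro Bochner_Integration.integral_add sq_int_mult sq_int_block_int sq_int_eint) (use assms Cons.prems in auto)
    also have "\<dots> = (\<integral>(s, \<omega>). block_proc C s \<omega> \<bullet> eproc L' s \<omega> \<partial>pm) + (\<integral>(s, \<omega>). eproc L s \<omega> \<bullet> eproc L' s \<omega> \<partial>pm)"
      using Cons 1 by auto
    also have "\<dots> = (\<integral>(s, \<omega>). eproc (C # L) s \<omega> \<bullet> eproc L' s \<omega> \<partial>pm)"
      using sq_int_inner[OF sq_int_block_proc[of C] sq_int_eproc[OF assms(2)]]
        sq_int_inner[OF sq_int_eproc[of L] sq_int_eproc[OF assms(2)]] Cons.prems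
      by (simp add: split_beta' eproc_def inner_add_left)
    finally show ?case .
  qed (simp add: eint_def eproc_def split_beta')
qed

end

section \<open>The Ito integral as an isometry\<close>

context brownian_basis
begin

lemma pm_add: "sq_int pm (case_prod u) \<Longrightarrow> sq_int pm (case_prod v) \<Longrightarrow> sq_int pm (\<lambda>(s, \<omega>). u s \<omega> + v s \<omega>)"
  using sq_int_add[of pm "case_prod u" "case_prod v"] by (simp add: split_beta')

lemma pm_diff: "sq_int pm (case_prod u) \<Longrightarrow> sq_int pm (case_prod v) \<Longrightarrow> sq_int pm (\<lambda>(s, \<omega>). u s \<omega> - v s \<omega>)"
  using sq_int_diff[of pm "case_prod u" "case_prod v"] by (simp add: split_beta')

lemma pm_scaleR: "sq_int pm (case_prod u) \<Longrightarrow> sq_int pm (\<lambda>(s, \<omega>). c *\<^sub>R u s \<omega>)"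
  using sq_int_scaleR[of pm "case_prod u" c] by (simp add: split_beta')

lemma pm_time_mult:
  assumes "sq_int pm (case_prod u)" "f \<in> borel_measurable lam" "\<And>s. s \<in> {0..T} \<Longrightarrow> \<bar>f s\<bar> \<le> K"
  shows "sq_int pm (\<lambda>(s, \<omega>). f s *\<^sub>R u s \<omega>)"
    and "sqn pm (\<lambda>(s, \<omega>). f s *\<^sub>R u s \<omega>) \<le> K\<^sup>2 * sqn pm (case_prod u)"
proof -
  have f: "(\<lambda>x. f (fst x)) \<in> borel_measurable pm" using assms(2) by measurable
  have K: "\<bar>f (fst x)\<bar> \<le> K" if "x \<in> space pm" for x
    using that assms(3) by (auto simp: space_pair_measure)
  show "sq_int pm (\<lambda>(s, \<omega>). f s *\<^sub>R u s \<omega>)"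
    using sq_int_mult_bounded[OF assms(1) f K] by (simp add: split_beta')
  show "sqn pm (\<lambda>(s, \<omega>). f s *\<^sub>R u s \<omega>) \<le> K\<^sup>2 * sqn pm (case_prod u)"
    using sqn_mult_bounded[OF assms(1) f K] by (simp add: split_beta')
qed

lemma pm_indicator:
  assumes "sq_int pm (case_prod u)" "A \<in> sets borel"
  shows "sq_int pm (\<lambda>(s, \<omega>). indicat_real A s *\<^sub>R u s \<omega>)"
    and "sqn pm (\<lambda>(s, \<omega>). indicat_real A s *\<^sub>R u s \<omega>) \<le> sqn pm (case_prod u)"
proof -
  have A: "indicat_real A \<in> borel_measurable lam" using assms(2) by (intro borel_measurable_lam) simp
  have 1: "\<bar>indicat_real A s\<bar> \<le> 1" for s by (simp add: indicator_def)
  show "sq_int pm (\<lambda>(s, \<omega>). indicat_real A s *\<^sub>R u s \<omega>)" by (rule pm_time_mult(1)[OF assms(1) A 1])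
  show "sqn pm (\<lambda>(s, \<omega>). indicat_real A s *\<^sub>R u s \<omega>) \<le> sqn pm (case_prod u)"
    using pm_time_mult(2)[OF assms(1) A 1] by simp
qed

lemma pm_minus: "sqn pm (\<lambda>(s, \<omega>). u s \<omega> - v s \<omega>) = sqn pm (\<lambda>x. case_prod v x - case_prod u x)"
  using sqn_minus[of pm "case_prod u" "case_prod v"] by (simp add: split_beta')

text \<open>The closure, in the product of the two L2 spaces, of the graph of the elementary
  integral. Integrals over a shorter interval are expressed by an indicator in the integrand, so
  that one horizon T serves for all times.\<close>

definition SI :: "(real \<Rightarrow> 'w \<Rightarrow> 'v) \<Rightarrow> ('w \<Rightarrow> real) \<Rightarrow> bool" where
  "SI u I \<longleftrightarrow> sq_int pm (case_prod u) \<and> sq_int M I \<and>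
     (\<exists>L. (\<forall>j. valid (L j)) \<and>
        (\<lambda>j. sqn pm (\<lambda>(s, \<omega>). u s \<omega> - eproc (L j) s \<omega>)) \<longlonglongrightarrow> 0 \<and>
        (\<lambda>j. sqn M (\<lambda>\<omega>. I \<omega> - eint (L j) \<omega>)) \<longlonglongrightarrow> 0)"

lemma SI_sq_int: "SI u I \<Longrightarrow> sq_int pm (case_prod u)" "SI u I \<Longrightarrow> sq_int M I"
  by (auto simp: SI_def)

lemma SI_elementary: "valid L \<Longrightarrow> SI (eproc L) (eint L)"
  unfolding SI_def using sq_int_eproc[of L] sq_int_eint[of L]
  by (auto intro!: exI[of _ "\<lambda>_. L"] simp: sqn_def)

lemma SI_add:
  assumes "SI u I" "SI v J"
  shows "SI (\<lambda>s \<omega>. u s \<omega> + v s \<omega>) (\<lambda>\<omega>. I \<omega> + J \<omega>)"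
proof -
  from assms obtain L L' where L: "\<And>j. valid (L j)"
      "(\<lambda>j. sqn pm (\<lambda>(s, \<omega>). u s \<omega> - eproc (L j) s \<omega>)) \<longlonglongrightarrow> 0"
      "(\<lambda>j. sqn M (\<lambda>\<omega>. I \<omega> - eint (L j) \<omega>)) \<longlonglongrightarrow> 0"
    and L': "\<And>j. valid (L' j)" "(\<lambda>j. sqn pm (\<lambda>(s, \<omega>). v s \<omega> - eproc (L' j) s \<omega>)) \<longlonglongrightarrow> 0"
      "(\<lambda>j. sqn M (\<lambda>\<omega>. J \<omega> - eint (L' j) \<omega>)) \<longlonglongrightarrow> 0"
    by (auto simp: SI_def)
  note s = SI_sq_int[OF assms(1)] SI_sq_int[OF assms(2)]
  have 1: "(\<lambda>j. sqn pm (\<lambda>(s, \<omega>). (u s \<omega> + v s \<omega>) - eproc (L j @ L' j) s \<omega>)) \<longlonglongrightarrow> 0"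
  proof (rule tendsto_sandwich[OF always_eventually always_eventually tendsto_const])
    show "\<forall>j. sqn pm (\<lambda>(s, \<omega>). (u s \<omega> + v s \<omega>) - eproc (L j @ L' j) s \<omega>)
      \<le> 2 * sqn pm (\<lambda>(s, \<omega>). u s \<omega> - eproc (L j) s \<omega>) + 2 * sqn pm (\<lambda>(s, \<omega>). v s \<omega> - eproc (L' j) s \<omega>)"
    proof
      fix j
      show "sqn pm (\<lambda>(s, \<omega>). (u s \<omega> + v s \<omega>) - eproc (L j @ L' j) s \<omega>)
        \<le> 2 * sqn pm (\<lambda>(s, \<omega>). u s \<omega> - eproc (L j) s \<omega>) + 2 * sqn pm (\<lambda>(s, \<omega>). v s \<omega> - eproc (L' j) s \<omega>)"
        using sqn_add_le[OF pm_diff[OF s(1) sq_int_eproc[OF L(1)[of j]]] pm_diff[OF s(3) sq_int_eproc[OF L'(1)[of j]]]]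
        by (simp add: split_beta' eproc_def algebra_simps)
    qed
    show "(\<lambda>j. 2 * sqn pm (\<lambda>(s, \<omega>). u s \<omega> - eproc (L j) s \<omega>) + 2 * sqn pm (\<lambda>(s, \<omega>). v s \<omega> - eproc (L' j) s \<omega>)) \<longlonglongrightarrow> 0"
      using tendsto_add[OF tendsto_mult_left[OF L(2), of 2] tendsto_mult_left[OF L'(2), of 2]] by simp
  qed simp
  have 2: "(\<lambda>j. sqn M (\<lambda>\<omega>. (I \<omega> + J \<omega>) - eint (L j @ L' j) \<omega>)) \<longlonglongrightarrow> 0"
  proof (rule tendsto_sandwich[OF always_eventually always_eventually tendsto_const])
    show "\<forall>j. sqn M (\<lambda>\<omega>. (I \<omega> + J \<omega>) - eint (L j @ L' j) \<omega>)
      \<le> 2 * sqn M (\<lambda>\<omega>. I \<omega> - eint (L j) \<omega>) + 2 * sqn M (\<lambda>\<omega>. J \<omega> - eint (L' j) \<omega>)"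
    proof
      fix j
      show "sqn M (\<lambda>\<omega>. (I \<omega> + J \<omega>) - eint (L j @ L' j) \<omega>)
      \<le> 2 * sqn M (\<lambda>\<omega>. I \<omega> - eint (L j) \<omega>) + 2 * sqn M (\<lambda>\<omega>. J \<omega> - eint (L' j) \<omega>)"
        using sqn_add_le[OF sq_int_diff[OF s(2) sq_int_eint[OF L(1)[of j]]] sq_int_diff[OF s(4) sq_int_eint[OF L'(1)[of j]]]]
        by (simp add: eint_def algebra_simps)
    qed
    show "(\<lambda>j. 2 * sqn M (\<lambda>\<omega>. I \<omega> - eint (L j) \<omega>) + 2 * sqn M (\<lambda>\<omega>. J \<omega> - eint (L' j) \<omega>)) \<longlonglongrightarrow> 0"
      using tendsto_add[OF tendsto_mult_left[OF L(3), of 2] tendsto_mult_left[OF L'(3), of 2]] by simp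
  qed simp
  have "valid (L j @ L' j)" for j using L(1)[of j] L'(1)[of j] by (metis Un_iff set_append)
  then show ?thesis
    unfolding SI_def
    by (intro conjI exI[of _ "\<lambda>j. L j @ L' j"] allI pm_add s sq_int_add 1 2)
qed

lemma SI_scaleR:
  assumes "SI u I" shows "SI (\<lambda>s \<omega>. c *\<^sub>R u s \<omega>) (\<lambda>\<omega>. c * I \<omega>)"
proof -
  from assms obtain L where L: "\<And>j. valid (L j)"
      "(\<lambda>j. sqn pm (\<lambda>(s, \<omega>). u s \<omega> - eproc (L j) s \<omega>)) \<longlonglongrightarrow> 0"
      "(\<lambda>j. sqn M (\<lambda>\<omega>. I \<omega> - eint (L j) \<omega>)) \<longlonglongrightarrow> 0"
    by (auto simp: SI_def)
  note s = SI_sq_int[OF assms(1)]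
  define S :: "(real \<times> real \<times> ('w \<Rightarrow> 'v)) list \<Rightarrow> (real \<times> real \<times> ('w \<Rightarrow> 'v)) list"
    where "S = map (\<lambda>(a, b, \<xi>). (a, b, \<lambda>\<omega>. c *\<^sub>R \<xi> \<omega>))"
  have v: "valid (S L)" if "valid L" for L
  proof
    fix B assume "B \<in> set (S L)"
    then obtain a b \<xi> where B: "(a, b, \<xi>) \<in> set L" "B = (a, b, \<lambda>\<omega>. c *\<^sub>R \<xi> \<omega>)"
      by (auto simp: S_def)
    then have "valid_block (a, b, \<xi>)" using that by blast
    moreover have "bounded ((\<lambda>\<omega>. c *\<^sub>R \<xi> \<omega>) ` space M)" if "bounded (\<xi> ` space M)"
      using bounded_scaling[OF that, of c] by (simp add: image_image)
    ultimately show "valid_block B" by (auto simp: B(2))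
  qed
  have p: "eproc (S L) s \<omega> = c *\<^sub>R eproc L s \<omega>" for L s \<omega>
    unfolding eproc_def S_def by (induction L) (auto simp: algebra_simps)
  have i: "eint (S L) \<omega> = c * eint L \<omega>" for L \<omega>
    unfolding eint_def S_def by (induction L) (auto simp: algebra_simps)
  have 1: "sqn pm (\<lambda>(s, \<omega>). c *\<^sub>R u s \<omega> - eproc (S (L j)) s \<omega>) = c\<^sup>2 * sqn pm (\<lambda>(s, \<omega>). u s \<omega> - eproc (L j) s \<omega>)" for j
    using sqn_scaleR[of pm c "\<lambda>(s, \<omega>). u s \<omega> - eproc (L j) s \<omega>"]
    by (simp add: split_beta' p scaleR_diff_right)
  have 2: "sqn M (\<lambda>\<omega>. c * I \<omega> - eint (S (L j)) \<omega>) = c\<^sup>2 * sqn M (\<lambda>\<omega>. I \<omega> - eint (L j) \<omega>)" for j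
    using sqn_scaleR[of M c "\<lambda>\<omega>. I \<omega> - eint (L j) \<omega>"]
    by (simp add: i right_diff_distrib)
  show ?thesis
    unfolding SI_def using pm_scaleR[OF s(1)] sq_int_cmult[OF s(2)]
      v[OF L(1)] tendsto_mult_left[OF L(2), of "c\<^sup>2"] tendsto_mult_left[OF L(3), of "c\<^sup>2"]
    by (intro conjI exI[of _ "\<lambda>j. S (L j)"]) (simp_all add: 1 2)
qed

lemma SI_diff: "SI u I \<Longrightarrow> SI v J \<Longrightarrow> SI (\<lambda>s \<omega>. u s \<omega> - v s \<omega>) (\<lambda>\<omega>. I \<omega> - J \<omega>)"
  using SI_add[of u I "\<lambda>s \<omega>. (-1) *\<^sub>R v s \<omega>" "\<lambda>\<omega>. (-1) * J \<omega>"] SI_scaleR[of v J "-1"] by simp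

lemma SI_zero: "SI (\<lambda>s \<omega>. 0) (\<lambda>\<omega>. 0)"
  using SI_elementary[of "[]"] by (simp add: eproc_def[abs_def] eint_def[abs_def])

lemma SI_sum:
  assumes "\<And>k. k \<in> K \<Longrightarrow> SI (u k) (I k)"
  shows "SI (\<lambda>s \<omega>. \<Sum>k\<in>K. u k s \<omega>) (\<lambda>\<omega>. \<Sum>k\<in>K. I k \<omega>)"
  using assms by (induction K rule: infinite_finite_induct) (auto intro: SI_zero SI_add)

text \<open>The polarized form, for two integrands: the duality argument takes the mean of a product
  of two different stochastic integrals and reads it off from here.\<close>

lemma SI_isometry:
  assumes "SI u I" "SI v J"
  shows "(\<integral>\<omega>. I \<omega> * J \<omega> \<partial>M) = (\<integral>(s, \<omega>). u s \<omega> \<bullet> v s \<omega> \<partial>pm)"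
proof -
  from assms obtain L L' where L: "\<And>j. valid (L j)"
      "(\<lambda>j. sqn pm (\<lambda>(s, \<omega>). u s \<omega> - eproc (L j) s \<omega>)) \<longlonglongrightarrow> 0"
      "(\<lambda>j. sqn M (\<lambda>\<omega>. I \<omega> - eint (L j) \<omega>)) \<longlonglongrightarrow> 0"
    and L': "\<And>j. valid (L' j)" "(\<lambda>j. sqn pm (\<lambda>(s, \<omega>). v s \<omega> - eproc (L' j) s \<omega>)) \<longlonglongrightarrow> 0"
      "(\<lambda>j. sqn M (\<lambda>\<omega>. J \<omega> - eint (L' j) \<omega>)) \<longlonglongrightarrow> 0"
    by (auto simp: SI_def)
  note s = SI_sq_int[OF assms(1)] SI_sq_int[OF assms(2)]
  have "(\<lambda>j. \<integral>\<omega>. eint (L j) \<omega> \<bullet> eint (L' j) \<omega> \<partial>M) \<longlonglongrightarrow> (\<integral>\<omega>. I \<omega> \<bullet> J \<omega> \<partial>M)"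
    by (rule L2_inner_tendsto[OF sq_int_eint[OF L(1)] s(2) L(3)[unfolded sqn_minus[of M I]]
          sq_int_eint[OF L'(1)] s(4) L'(3)[unfolded sqn_minus[of M J]]])
  moreover have "(\<lambda>j. \<integral>x. case_prod (eproc (L j)) x \<bullet> case_prod (eproc (L' j)) x \<partial>pm)
      \<longlonglongrightarrow> (\<integral>x. case_prod u x \<bullet> case_prod v x \<partial>pm)"
    by (rule L2_inner_tendsto[OF sq_int_eproc[OF L(1)] s(1) L(2)[unfolded pm_minus]
          sq_int_eproc[OF L'(1)] s(3) L'(2)[unfolded pm_minus]])
  moreover have "(\<integral>\<omega>. eint (L j) \<omega> \<bullet> eint (L' j) \<omega> \<partial>M)
      = (\<integral>x. case_prod (eproc (L j)) x \<bullet> case_prod (eproc (L' j)) x \<partial>pm)" for j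
    using elementary_isometry[OF L(1)[of j] L'(1)[of j]] by (simp add: split_beta')
  ultimately have "(\<integral>\<omega>. I \<omega> \<bullet> J \<omega> \<partial>M) = (\<integral>x. case_prod u x \<bullet> case_prod v x \<partial>pm)"
    using LIMSEQ_unique by simp
  then show ?thesis by (simp add: split_beta')
qed

lemma SI_sqn: "SI u I \<Longrightarrow> sqn M I = sqn pm (case_prod u)"
  using SI_isometry[of u I u I] inner_eq_norm_sq[of pm "case_prod u"] inner_eq_norm_sq[of M I]
  by (simp add: split_beta')

text \<open>Linearity and the isometry turn convergence of integrands into convergence of integrals
  and back.\<close>

lemma SI_distance:
  assumes "SI u I" "SI v J"
  shows "sqn M (\<lambda>\<omega>. I \<omega> - J \<omega>) = sqn pm (\<lambda>(s, \<omega>). u s \<omega> - v s \<omega>)"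
  using SI_sqn[OF SI_diff[OF assms]] .

lemma SI_unique:
  assumes "SI u I" "SI u J" shows "AE \<omega> in M. I \<omega> = J \<omega>"
proof -
  have "sqn M (\<lambda>\<omega>. I \<omega> - J \<omega>) = 0"
    using SI_distance[OF assms] by (simp add: sqn_def split_beta')
  then have "AE \<omega> in M. I \<omega> - J \<omega> = 0"
    by (subst (asm) sqn_zero_iff[OF sq_int_diff[OF SI_sq_int(2)[OF assms(1)] SI_sq_int(2)[OF assms(2)]]])
  then show ?thesis by eventually_elim simp
qed

text \<open>The relation is closed: for each n choose a list within 1 / (n + 1) of the n-th pair in
  both norms, and use these lists as a diagonal sequence.\<close>

lemma SI_limit:
  assumes "\<And>n. SI (u n) (I n)" "sq_int pm (case_prod v)" "sq_int M J"
    and "(\<lambda>n. sqn pm (\<lambda>(s, \<omega>). u n s \<omega> - v s \<omega>)) \<longlonglongrightarrow> 0"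
    and "(\<lambda>n. sqn M (\<lambda>\<omega>. I n \<omega> - J \<omega>)) \<longlonglongrightarrow> 0"
  shows "SI v J"
proof -
  have "\<exists>L. valid L \<and> sqn pm (\<lambda>(s, \<omega>). u n s \<omega> - eproc L s \<omega>) < inverse (Suc n)
      \<and> sqn M (\<lambda>\<omega>. I n \<omega> - eint L \<omega>) < inverse (Suc n)" for n
  proof -
    from assms(1)[of n] obtain L where L: "\<And>j. valid (L j)"
      "(\<lambda>j. sqn pm (\<lambda>(s, \<omega>). u n s \<omega> - eproc (L j) s \<omega>)) \<longlonglongrightarrow> 0"
      "(\<lambda>j. sqn M (\<lambda>\<omega>. I n \<omega> - eint (L j) \<omega>)) \<longlonglongrightarrow> 0"
      by (auto simp: SI_def)
    have "eventually (\<lambda>j. sqn pm (\<lambda>(s, \<omega>). u n s \<omega> - eproc (L j) s \<omega>) < inverse (Suc n)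
      \<and> sqn M (\<lambda>\<omega>. I n \<omega> - eint (L j) \<omega>) < inverse (Suc n)) sequentially"
      by (intro eventually_conj order_tendstoD[OF L(2)] order_tendstoD[OF L(3)]) auto
    then show ?thesis using L(1) by (auto simp: eventually_sequentially)
  qed
  from choice[OF allI[OF this]] obtain L where L': "\<forall>n. valid (L n) \<and>
    sqn pm (\<lambda>(s, \<omega>). u n s \<omega> - eproc (L n) s \<omega>) < inverse (Suc n) \<and>
    sqn M (\<lambda>\<omega>. I n \<omega> - eint (L n) \<omega>) < inverse (Suc n)" ..
  then have L: "\<And>n. valid (L n)"
    "\<And>n. sqn pm (\<lambda>(s, \<omega>). u n s \<omega> - eproc (L n) s \<omega>) < inverse (Suc n)"
    "\<And>n. sqn M (\<lambda>\<omega>. I n \<omega> - eint (L n) \<omega>) < inverse (Suc n)" by blast+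
  have lim: "(\<lambda>n. 2 * a n + 2 * inverse (real (Suc n))) \<longlonglongrightarrow> 0" if "a \<longlonglongrightarrow> 0" for a :: "nat \<Rightarrow> real"
    using tendsto_add[OF tendsto_mult_left[OF that, of 2] tendsto_mult_left[OF LIMSEQ_inverse_real_of_nat, of 2]]
    by simp
  have 1: "(\<lambda>j. sqn pm (\<lambda>(s, \<omega>). v s \<omega> - eproc (L j) s \<omega>)) \<longlonglongrightarrow> 0"
  proof (rule tendsto_sandwich[OF always_eventually always_eventually tendsto_const lim[OF assms(4)]])
    show "\<forall>j. sqn pm (\<lambda>(s, \<omega>). v s \<omega> - eproc (L j) s \<omega>)
      \<le> 2 * sqn pm (\<lambda>(s, \<omega>). u j s \<omega> - v s \<omega>) + 2 * inverse (real (Suc j))"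
    proof
      fix j
      show "sqn pm (\<lambda>(s, \<omega>). v s \<omega> - eproc (L j) s \<omega>)
        \<le> 2 * sqn pm (\<lambda>(s, \<omega>). u j s \<omega> - v s \<omega>) + 2 * inverse (real (Suc j))"
        using sqn_triangle[OF assms(2) SI_sq_int(1)[OF assms(1)[of j]] sq_int_eproc[OF L(1)[of j]]] L(2)[of j]
          sqn_minus[of pm "case_prod v" "case_prod (u j)"]
        by (simp add: split_beta')
    qed
  qed simp
  have 2: "(\<lambda>j. sqn M (\<lambda>\<omega>. J \<omega> - eint (L j) \<omega>)) \<longlonglongrightarrow> 0"
  proof (rule tendsto_sandwich[OF always_eventually always_eventually tendsto_const lim[OF assms(5)]])
    show "\<forall>j. sqn M (\<lambda>\<omega>. J \<omega> - eint (L j) \<omega>) \<le> 2 * sqn M (\<lambda>\<omega>. I j \<omega> - J \<omega>) + 2 * inverse (real (Suc j))"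
    proof
      fix j
      show "sqn M (\<lambda>\<omega>. J \<omega> - eint (L j) \<omega>) \<le> 2 * sqn M (\<lambda>\<omega>. I j \<omega> - J \<omega>) + 2 * inverse (real (Suc j))"
        using sqn_triangle[OF assms(3) SI_sq_int(2)[OF assms(1)[of j]] sq_int_eint[OF L(1)[of j]]] L(3)[of j]
          sqn_minus[of M J "I j"] by simp
    qed
  qed simp
  show ?thesis unfolding SI_def using assms(2,3) L(1) 1 2 by blast
qed

text \<open>A constant sequence converges in L2 to every version of itself, so
  \<open>SI_limit\<close> applies.\<close>

lemma SI_AE_cong:
  assumes "SI u I" "case_prod v \<in> borel_measurable pm" "AE x in pm. case_prod u x = case_prod v x"
    and "J \<in> borel_measurable M" "AE \<omega> in M. I \<omega> = J \<omega>"
  shows "SI v J"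
proof (rule SI_limit[of "\<lambda>_. u" "\<lambda>_. I"])
  note s = SI_sq_int[OF assms(1)]
  show v: "sq_int pm (case_prod v)" by (rule sq_int_AE_cong[OF s(1) assms(2,3)])
  show J: "sq_int M J" by (rule sq_int_AE_cong[OF s(2) assms(4,5)])
  have "sqn pm (\<lambda>x. case_prod u x - case_prod v x) = 0"
    unfolding sqn_zero_iff[OF sq_int_diff[OF s(1) v]] using assms(3) by eventually_elim simp
  then show "(\<lambda>n. sqn pm (\<lambda>(s, \<omega>). u s \<omega> - v s \<omega>)) \<longlonglongrightarrow> 0" by (simp add: split_beta')
  have "sqn M (\<lambda>x. I x - J x) = 0"
    unfolding sqn_zero_iff[OF sq_int_diff[OF s(2) J]] using assms(5) by eventually_elim simp
  then show "(\<lambda>n. sqn M (\<lambda>\<omega>. I \<omega> - J \<omega>)) \<longlonglongrightarrow> 0" by simp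
qed (fact assms(1))

section \<open>Restriction to a time window and orthogonality to the past\<close>

definition trunc :: "real \<Rightarrow> real \<Rightarrow> (real \<times> real \<times> ('w \<Rightarrow> 'v)) list \<Rightarrow> (real \<times> real \<times> ('w \<Rightarrow> 'v)) list" where
  "trunc s t = map (\<lambda>(a, b, \<xi>). (max a s, max (max a s) (min b t), \<xi>))"

lemma eproc_trunc: "eproc (trunc s t L) p \<omega> = indicat_real {s<..t} p *\<^sub>R eproc L p \<omega>"
  unfolding eproc_def trunc_def
  by (induction L) (auto simp: scaleR_add_right split: split_indicator)

text \<open>The nested \<open>max\<close> in \<open>trunc\<close> collapses a block that misses the
  window into a degenerate one instead of reversing its end points. Moving the left end to the right
  keeps the coefficient measurable because the filtration increases.\<close>

lemma valid_trunc:
  assumes "valid L" "0 \<le> s" "s \<le> t" "t \<le> T" shows "valid (trunc s t L)"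
proof
  fix B assume "B \<in> set (trunc s t L)"
  then obtain a b \<xi> where B: "(a, b, \<xi>) \<in> set L" "B = (max a s, max (max a s) (min b t), \<xi>)"
    by (auto simp: trunc_def)
  then have v: "valid_block (a, b, \<xi>)" using assms by blast
  then have "\<xi> \<in> borel_measurable (F (max a s))" by (auto intro: measurable_F_mono)
  then show "valid_block B" using v assms by (auto simp: B(2))
qed

text \<open>Every truncated block starts at s or later, so \<open>\<xi>\<close> is known at its left
  end and \<open>increment_orthogonal\<close> applies block by block.\<close>

lemma eint_trunc_orthogonal:
  assumes "valid L" "0 \<le> s" "s \<le> t" "t \<le> T" "\<xi> \<in> borel_measurable (F s)" "sq_int M \<xi>"
  shows "(\<integral>\<omega>. \<xi> \<omega> * eint (trunc s t L) \<omega> \<partial>M) = 0"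
  using assms(1)
proof (induction L)
  case (Cons B L)
  obtain a b \<zeta> where B: "B = (a, b, \<zeta>)" by (cases B) auto
  let ?B = "(max a s, max (max a s) (min b t), \<zeta>)"
  have v: "valid_block ?B" using valid_trunc[of "[B]"] Cons.prems assms by (simp add: trunc_def B)
  have "\<xi> \<in> borel_measurable (F (max a s))" using assms by (auto intro: measurable_F_mono)
  then have 0: "(\<integral>\<omega>. \<xi> \<omega> * block_int ?B \<omega> \<partial>M) = 0"
    using v sq_int_imp_integrable[OF assms(6)]
      increment_orthogonal(2)[of "max a s" "max (max a s) (min b t)" \<zeta> \<xi>] by simp
  have "(\<integral>\<omega>. \<xi> \<omega> * eint (trunc s t (B # L)) \<omega> \<partial>M) = (\<integral>\<omega>. \<xi> \<omega> * block_int ?B \<omega> + \<xi> \<omega> * eint (trunc s t L) \<omega> \<partial>M)"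
    by (simp add: trunc_def B eint_def distrib_left)
  also have "\<dots> = (\<integral>\<omega>. \<xi> \<omega> * block_int ?B \<omega> \<partial>M) + (\<integral>\<omega>. \<xi> \<omega> * eint (trunc s t L) \<omega> \<partial>M)"
    by (intro Bochner_Integration.integral_add sq_int_mult assms(6) sq_int_block_int sq_int_eint v valid_trunc)
       (use Cons.prems assms in auto)
  finally show ?case using 0 Cons by simp
qed (simp add: trunc_def eint_def)

text \<open>The approximating integrands may charge times outside (s, t]. Truncating them does not
  increase the distance, since the integrand is itself supported on the window, and the truncated
  integrals are orthogonal to \<open>\<xi>\<close>. This is the martingale property of the
  stochastic integral in the form in which it is used.\<close>

lemma SI_orthogonal:
  assumes "SI (\<lambda>p \<omega>. indicat_real {s<..t} p *\<^sub>R u p \<omega>) I" "0 \<le> s" "s \<le> t" "t \<le> T"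
    and "\<xi> \<in> borel_measurable (F s)" "sq_int M \<xi>"
  shows "(\<integral>\<omega>. \<xi> \<omega> * I \<omega> \<partial>M) = 0"
proof -
  let ?u = "\<lambda>p \<omega>. indicat_real {s<..t} p *\<^sub>R u p \<omega>"
  from assms(1) obtain L where L: "\<And>j. valid (L j)"
      "(\<lambda>j. sqn pm (\<lambda>(s, \<omega>). ?u s \<omega> - eproc (L j) s \<omega>)) \<longlonglongrightarrow> 0"
    by (auto simp: SI_def)
  have v: "valid (trunc s t (L j))" for j by (rule valid_trunc[OF L(1) assms(2-4)])
  have le: "sqn M (\<lambda>\<omega>. I \<omega> - eint (trunc s t (L j)) \<omega>) \<le> sqn pm (\<lambda>(s, \<omega>). ?u s \<omega> - eproc (L j) s \<omega>)" for j
  proof -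
    have "sqn M (\<lambda>\<omega>. I \<omega> - eint (trunc s t (L j)) \<omega>) = sqn pm (\<lambda>(p, \<omega>). ?u p \<omega> - eproc (trunc s t (L j)) p \<omega>)"
      by (rule SI_distance[OF assms(1) SI_elementary[OF v]])
    also have "\<dots> = sqn pm (\<lambda>(p, \<omega>). indicat_real {s<..t} p *\<^sub>R (?u p \<omega> - eproc (L j) p \<omega>))"
      by (rule arg_cong[of _ _ "sqn pm"]) (auto simp: eproc_trunc fun_eq_iff split: split_indicator)
    also have "\<dots> \<le> sqn pm (\<lambda>(s, \<omega>). ?u s \<omega> - eproc (L j) s \<omega>)"
      by (rule pm_indicator(2)[OF pm_diff[OF SI_sq_int(1)[OF assms(1)] sq_int_eproc[OF L(1)]]]) simp
    finally show ?thesis .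
  qed
  have "(\<lambda>j. sqn M (\<lambda>\<omega>. I \<omega> - eint (trunc s t (L j)) \<omega>)) \<longlonglongrightarrow> 0"
    by (rule tendsto_sandwich[OF always_eventually always_eventually tendsto_const L(2)]) (use le in auto)
  then have "(\<lambda>j. \<integral>\<omega>. \<xi> \<omega> \<bullet> eint (trunc s t (L j)) \<omega> \<partial>M) \<longlonglongrightarrow> (\<integral>\<omega>. \<xi> \<omega> \<bullet> I \<omega> \<partial>M)"
    unfolding sqn_minus[of M I]
    by (intro L2_inner_tendsto assms(6) sq_int_eint v SI_sq_int(2)[OF assms(1)])
       (simp_all add: sqn_def)
  moreover have "(\<integral>\<omega>. \<xi> \<omega> \<bullet> eint (trunc s t (L j)) \<omega> \<partial>M) = 0" for j
    using eint_trunc_orthogonal[OF L(1) assms(2-6)] by simp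
  ultimately have "(\<lambda>j. 0) \<longlonglongrightarrow> (\<integral>\<omega>. \<xi> \<omega> * I \<omega> \<partial>M)" by simp
  then show ?thesis using LIMSEQ_unique tendsto_const by metis
qed

end

section \<open>Progressive measurability\<close>

lemma set_integral_restrict: "(LBINT s:{0..t}. f s) = (\<integral>s. f s \<partial>restrict_space lborel {0..t::real})"
  for f :: "real \<Rightarrow> 'b::{banach, second_countable_topology}"
  unfolding set_lebesgue_integral_def by (subst integral_restrict_space) auto

lemma finite_measure_Icc: "finite_measure (restrict_space lborel {0..t::real})"
  by (intro finite_measureI) (auto simp: space_restrict_space emeasure_restrict_space emeasure_lborel_Icc_eq)

context brownian_basis
begin

lemma measurable_id_F: "0 \<le> t \<Longrightarrow> (\<lambda>\<omega>. \<omega>) \<in> measurable M (F t)"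
  using subalg[of t] by (auto simp: measurable_def subalgebra_def Int_absorb2 dest: sets.sets_into_space)

lemma progressive_pm:
  fixes u :: "real \<Rightarrow> 'w \<Rightarrow> 'b::topological_space"
  assumes "progressively_measurable F T u"
  shows "case_prod u \<in> borel_measurable pm"
proof -
  have 1: "(\<lambda>(s, \<omega>). u s \<omega>) \<in> borel_measurable (restrict_space borel {0..T} \<Otimes>\<^sub>M F T)"
    using assms T_pos by (auto simp: progressively_measurable_def)
  have 2: "(\<lambda>x. (fst x, snd x)) \<in> measurable pm (restrict_space borel {0..T} \<Otimes>\<^sub>M F T)"
  proof (rule measurable_Pair)
    have "sets lam = sets (restrict_space borel {0..T})"
      by (simp add: lam_def sets_restrict_space)
    then show "fst \<in> measurable pm (restrict_space borel {0..T})"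
      by (metis measurable_cong_sets measurable_fst)
    show "snd \<in> measurable pm (F T)"
      using measurable_compose[OF measurable_snd measurable_id_F[of T]] T_pos by simp
  qed
  from measurable_compose[OF 2 1] show ?thesis by (simp add: split_beta')
qed

lemma progressive_section:
  assumes "progressively_measurable F T u" "t \<in> {0..T}"
  shows "u t \<in> borel_measurable (F t)"
proof -
  have 1: "(\<lambda>(s, \<omega>). u s \<omega>) \<in> borel_measurable (restrict_space borel {0..t} \<Otimes>\<^sub>M F t)"
    using assms by (auto simp: progressively_measurable_def)
  have 2: "Pair t \<in> measurable (F t) (restrict_space borel {0..t} \<Otimes>\<^sub>M F t)"
    by (rule measurable_Pair1') (use assms in \<open>auto simp: space_restrict_space\<close>)
  from measurable_compose[OF 2 1] show ?thesis by simp
qed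

text \<open>Joint measurability on [0, t] with respect to F t makes the parametrized integral known
  at t. The extra indicator serves the averages over single cells.\<close>

lemma progressive_integral:
  fixes u :: "real \<Rightarrow> 'w \<Rightarrow> 'b::{banach, second_countable_topology}"
  assumes "progressively_measurable F T u" "t \<in> {0..T}" "A \<in> sets borel"
  shows "(\<lambda>\<omega>. LBINT s:{0..t}. indicat_real A s *\<^sub>R u s \<omega>) \<in> borel_measurable (F t)"
proof -
  interpret I: finite_measure "restrict_space lborel {0..t}" by (rule finite_measure_Icc)
  have u: "(\<lambda>(s, \<omega>). u s \<omega>) \<in> borel_measurable (restrict_space borel {0..t} \<Otimes>\<^sub>M F t)"
    using assms by (auto simp: progressively_measurable_def)
  have sw: "(\<lambda>x. (snd x, fst x)) \<in> measurable (F t \<Otimes>\<^sub>M restrict_space lborel {0..t}) (restrict_space borel {0..t} \<Otimes>\<^sub>M F t)"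
  proof (rule measurable_Pair)
    have "sets (restrict_space lborel {0..t}) = sets (restrict_space borel {0..t})"
      by (simp add: sets_restrict_space)
    then show "snd \<in> measurable (F t \<Otimes>\<^sub>M restrict_space lborel {0..t}) (restrict_space borel {0..t})"
      by (metis measurable_cong_sets measurable_snd)
  qed simp
  have [measurable]: "indicat_real A \<in> borel_measurable (restrict_space lborel {0..t})"
    by (rule measurable_restrict_space1) (use assms in simp)
  have [measurable]: "(\<lambda>x. u (snd x) (fst x)) \<in> borel_measurable (F t \<Otimes>\<^sub>M restrict_space lborel {0..t})"
    using measurable_compose[OF sw u] by (simp add: split_beta')
  show ?thesis
    unfolding set_integral_restrict
    by (rule I.borel_measurable_lebesgue_integral) (simp add: split_beta')
qed

text \<open>Sample the path at the dyadic point just below the current time: the sampled times are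
  countably many and at most t, and path continuity recovers the process in the limit.\<close>

lemma continuous_adapted_progressive:
  fixes u :: "real \<Rightarrow> 'w \<Rightarrow> 'b::metric_space"
  assumes "\<And>t. t \<in> {0..T} \<Longrightarrow> u t \<in> borel_measurable (F t)"
    and "\<And>\<omega>. \<omega> \<in> space M \<Longrightarrow> continuous_on {0..T} (\<lambda>t. u t \<omega>)"
  shows "progressively_measurable F T u"
  unfolding progressively_measurable_def
proof
  fix t assume t: "t \<in> {0..T}"
  let ?N = "restrict_space borel {0..t} \<Otimes>\<^sub>M F t"
  \<comment> \<open>For s in [0, t] the clamp changes nothing. It keeps the sampled time in [0, t]
    for every integer index, since the countable case distinction runs over all integers.\<close>
  define g where "g n s = max 0 (min t ((real_of_int \<lfloor>s * 2 ^ n\<rfloor>) / 2 ^ n))" for n :: nat and s :: real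
  have g: "g n s \<in> {0..t}" for n s using t by (auto simp: g_def)
  show "(\<lambda>(s, \<omega>). u s \<omega>) \<in> borel_measurable ?N"
  proof (rule borel_measurable_LIMSEQ_metric)
    fix n
    have "(\<lambda>x. (\<lambda>k x. u (max 0 (min t (real_of_int k / 2 ^ n))) (snd x)) (\<lfloor>fst x * 2 ^ n\<rfloor>) x) \<in> borel_measurable ?N"
    proof (rule measurable_compose_countable[where g = "\<lambda>x. \<lfloor>fst x * 2 ^ n\<rfloor>"
          and f = "\<lambda>k x. u (max 0 (min t (real_of_int k / 2 ^ n))) (snd x)"])
      fix k :: int
      have "u (max 0 (min t (real_of_int k / 2 ^ n))) \<in> borel_measurable (F t)"
        by (rule measurable_F_mono[OF assms(1)]) (use t in auto)
      then show "(\<lambda>x. u (max 0 (min t (real_of_int k / 2 ^ n))) (snd x)) \<in> borel_measurable ?N"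
        by (rule measurable_compose[OF measurable_snd])
    next
      have "(\<lambda>s::real. \<lfloor>s * 2 ^ n\<rfloor>) \<in> measurable borel (count_space UNIV)" by measurable
      then have "(\<lambda>s::real. \<lfloor>s * 2 ^ n\<rfloor>) \<in> measurable (restrict_space borel {0..t}) (count_space UNIV)"
        by (rule measurable_restrict_space1)
      then show "(\<lambda>x. \<lfloor>fst x * 2 ^ n\<rfloor>) \<in> measurable ?N (count_space UNIV)"
        by (rule measurable_compose[OF measurable_fst])
    qed
    then show "(\<lambda>(s, \<omega>). u (g n s) \<omega>) \<in> borel_measurable ?N"
      by (simp add: g_def split_beta')
  next
    fix x assume x: "x \<in> space ?N"
    then obtain s \<omega> where s: "x = (s, \<omega>)" "s \<in> {0..t}" "\<omega> \<in> space M"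
      using t by (auto simp: space_pair_measure space_restrict_space)
    have lim: "(\<lambda>n. g n s) \<longlonglongrightarrow> s"
    proof (rule metric_LIMSEQ_I)
      fix e :: real assume "e > 0"
      obtain n0 where n0: "(1/2) ^ n0 < e" using real_arch_pow_inv[OF \<open>e > 0\<close>, of "1/2"] by auto
      have "dist (g n s) s < e" if "n \<ge> n0" for n
      proof -
        have f: "real_of_int \<lfloor>s * 2 ^ n\<rfloor> / 2 ^ n \<le> s"
          by (simp add: divide_le_eq)
        have f2: "s - 1 / 2 ^ n \<le> real_of_int \<lfloor>s * 2 ^ n\<rfloor> / 2 ^ n"
        proof -
          have "(s * 2 ^ n - 1) / 2 ^ n \<le> real_of_int \<lfloor>s * 2 ^ n\<rfloor> / 2 ^ n"
            using floor_correct[of "s * 2 ^ n"] by (intro divide_right_mono) auto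
          then show ?thesis by (simp add: diff_divide_distrib)
        qed
        have "0 \<le> real_of_int \<lfloor>s * 2 ^ n\<rfloor> / 2 ^ n" using s by simp
        then have "g n s = real_of_int \<lfloor>s * 2 ^ n\<rfloor> / 2 ^ n" using f s by (simp add: g_def)
        then have "dist (g n s) s \<le> 1 / 2 ^ n" using f f2 by (simp add: dist_real_def)
        also have "\<dots> \<le> (1/2) ^ n0" using that by (simp add: power_one_over frac_le)
        finally show ?thesis using n0 by simp
      qed
      then show "\<exists>n0. \<forall>n\<ge>n0. dist (g n s) s < e" by blast
    qed
    have "(\<lambda>n. u (g n s) \<omega>) \<longlonglongrightarrow> u s \<omega>"
    proof (rule continuous_on_tendsto_compose[OF assms(2)[OF s(3)] lim])
      show "s \<in> {0..T}" using s(2) t by auto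
      show "\<forall>\<^sub>F n in sequentially. g n s \<in> {0..T}" 
        using g[of _ s] t by (intro always_eventually allI) (meson atLeastAtMost_iff order_trans)
    qed
    then show "(\<lambda>n. case x of (s, \<omega>) \<Rightarrow> u (g n s) \<omega>) \<longlonglongrightarrow> (case x of (s, \<omega>) \<Rightarrow> u s \<omega>)"
      by (simp add: s(1))
  qed
qed

section \<open>Continuous square-integrable martingales\<close>

text \<open>The martingale property is tested against square-integrable variables known at s, in
  place of a conditional expectation. This form is stable under L2 limits and matches
  \<open>SI_orthogonal\<close>. Continuity is asked of every path, so that path arguments later need
  no exceptional set.\<close>

definition cmart :: "(real \<Rightarrow> 'w \<Rightarrow> real) \<Rightarrow> bool" where
  "cmart N \<longleftrightarrow>
     (\<forall>t\<in>{0..T}. N t \<in> borel_measurable (F t) \<and> sq_int M (N t)) \<and>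
     (\<forall>\<omega>\<in>space M. continuous_on {0..T} (\<lambda>t. N t \<omega>)) \<and>
     (\<forall>s t \<xi>. 0 \<le> s \<longrightarrow> s \<le> t \<longrightarrow> t \<le> T \<longrightarrow> \<xi> \<in> borel_measurable (F s) \<longrightarrow> sq_int M \<xi> \<longrightarrow>
        (\<integral>\<omega>. \<xi> \<omega> * N t \<omega> \<partial>M) = (\<integral>\<omega>. \<xi> \<omega> * N s \<omega> \<partial>M))"

lemma cmart_adapted: "cmart N \<Longrightarrow> t \<in> {0..T} \<Longrightarrow> N t \<in> borel_measurable (F t)"
  by (simp add: cmart_def)

lemma cmart_sq_int: "cmart N \<Longrightarrow> t \<in> {0..T} \<Longrightarrow> sq_int M (N t)"
  by (simp add: cmart_def)

lemma cmart_continuous: "cmart N \<Longrightarrow> \<omega> \<in> space M \<Longrightarrow> continuous_on {0..T} (\<lambda>t. N t \<omega>)"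
  by (simp add: cmart_def)

lemma cmart_martingale:
  "cmart N \<Longrightarrow> 0 \<le> s \<Longrightarrow> s \<le> t \<Longrightarrow> t \<le> T \<Longrightarrow> \<xi> \<in> borel_measurable (F s) \<Longrightarrow> sq_int M \<xi> \<Longrightarrow>
     (\<integral>\<omega>. \<xi> \<omega> * N t \<omega> \<partial>M) = (\<integral>\<omega>. \<xi> \<omega> * N s \<omega> \<partial>M)"
  unfolding cmart_def by blast

lemma cmart_diff:
  assumes "cmart N" "cmart N'" shows "cmart (\<lambda>t \<omega>. N t \<omega> - N' t \<omega>)"
  unfolding cmart_def
proof (intro conjI ballI allI impI)
  fix t assume t: "t \<in> {0..T}"
  show "(\<lambda>\<omega>. N t \<omega> - N' t \<omega>) \<in> borel_measurable (F t)"
    using cmart_adapted[OF assms(1) t] cmart_adapted[OF assms(2) t] by measurable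
  show "sq_int M (\<lambda>\<omega>. N t \<omega> - N' t \<omega>)"
    by (intro sq_int_diff cmart_sq_int assms t)
next
  fix \<omega> assume "\<omega> \<in> space M"
  then show "continuous_on {0..T} (\<lambda>t. N t \<omega> - N' t \<omega>)"
    by (intro continuous_intros cmart_continuous assms)
next
  fix s t and \<xi> :: "'w \<Rightarrow> real"
  assume a: "0 \<le> s" "s \<le> t" "t \<le> T" "\<xi> \<in> borel_measurable (F s)" "sq_int M \<xi>"
  have st: "s \<in> {0..T}" "t \<in> {0..T}" using a by auto
  have I: "integrable M (\<lambda>\<omega>. \<xi> \<omega> * X r \<omega>)" if "cmart X" "r \<in> {0..T}" for X :: "real \<Rightarrow> 'w \<Rightarrow> real" and r
    by (intro sq_int_mult a cmart_sq_int that)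
  show "(\<integral>\<omega>. \<xi> \<omega> * (N t \<omega> - N' t \<omega>) \<partial>M) = (\<integral>\<omega>. \<xi> \<omega> * (N s \<omega> - N' s \<omega>) \<partial>M)"
    using cmart_martingale[OF assms(1) a] cmart_martingale[OF assms(2) a] assms st
    by (simp add: right_diff_distrib I)
qed

lemma cmart_const: "cmart (\<lambda>t \<omega>. c)"
  unfolding cmart_def by (intro conjI ballI allI impI sq_int_const measurable_const continuous_on_const refl) simp

lemma cmart_progressive: "cmart N \<Longrightarrow> progressively_measurable F T N"
  by (intro continuous_adapted_progressive cmart_adapted cmart_continuous)

text \<open>The submartingale property of the square: expand the mean of the squared increment over
  A, and evaluate the mixed term by testing with the indicator of A times N s.\<close>

lemma cmart_localized_second_moment:
  assumes N: "cmart N" and st: "0 \<le> s" "s \<le> t" "t \<le> T" and A: "A \<in> sets (F s)"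
  shows "(\<integral>\<omega>. indicat_real A \<omega> * (N s \<omega>)\<^sup>2 \<partial>M) \<le> (\<integral>\<omega>. indicat_real A \<omega> * (N t \<omega>)\<^sup>2 \<partial>M)"
proof -
  have s: "s \<in> {0..T}" "t \<in> {0..T}" using st by auto
  have A': "A \<in> sets M" using A subalg[OF st(1)] by (auto simp: subalgebra_def)
  have b: "sq_int M (\<lambda>\<omega>. indicat_real A \<omega> * X \<omega>)" if "sq_int M X" for X
    using sq_int_mult_bounded[OF that, of "indicat_real A" 1] A' by (simp add: indicator_def)
  note n = cmart_sq_int[OF N s(1)] cmart_sq_int[OF N s(2)]
  have m: "(\<integral>\<omega>. (indicat_real A \<omega> * N s \<omega>) * N t \<omega> \<partial>M) = (\<integral>\<omega>. (indicat_real A \<omega> * N s \<omega>) * N s \<omega> \<partial>M)"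
  proof (rule cmart_martingale[OF N st])
    show "(\<lambda>\<omega>. indicat_real A \<omega> * N s \<omega>) \<in> borel_measurable (F s)"
      using A cmart_adapted[OF N s(1)] by measurable
  qed (rule b[OF n(1)])
  note i = sq_int_mult[OF b[OF n(1)] n(1)] sq_int_mult[OF b[OF n(1)] n(2)] sq_int_mult[OF b[OF n(2)] n(2)]
  have "0 \<le> (\<integral>\<omega>. indicat_real A \<omega> * (N t \<omega> - N s \<omega>)\<^sup>2 \<partial>M)"
    by (intro integral_nonneg_AE) auto
  also have "\<dots> = (\<integral>\<omega>. indicat_real A \<omega> * N t \<omega> * N t \<omega> - 2 * (indicat_real A \<omega> * N s \<omega> * N t \<omega>)
      + indicat_real A \<omega> * N s \<omega> * N s \<omega> \<partial>M)"
    by (intro Bochner_Integration.integral_cong) (auto simp: power2_eq_square algebra_simps)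
  also have "\<dots> = (\<integral>\<omega>. indicat_real A \<omega> * N t \<omega> * N t \<omega> \<partial>M) - (\<integral>\<omega>. indicat_real A \<omega> * N s \<omega> * N s \<omega> \<partial>M)"
    using i m by simp
  finally show ?thesis by (simp add: power2_eq_square mult.assoc)
qed

lemma cmart_sqn_mono:
  assumes "cmart N" "0 \<le> s" "s \<le> t" "t \<le> T"
  shows "sqn M (N s) \<le> sqn M (N t)"
proof -
  have "space M \<in> sets (F s)" using sets.top[of "F s"] assms(2) by simp
  from cmart_localized_second_moment[OF assms this] show ?thesis
    by (simp add: sqn_real cong: Bochner_Integration.integral_cong)
qed

text \<open>Doob's inequality by first passage. On the event that k is the first index above level
  l, the squared level is at most the second moment at that index, which the localized inequality
  bounds by the one at T; these events are disjoint.\<close>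

lemma discrete_maximal_inequality:
  assumes N: "cmart N" and l: "l > 0" and \<tau>: "\<And>k. \<tau> k \<in> {0..T}" "mono \<tau>"
  shows "{\<omega>\<in>space M. \<exists>k\<le>n. \<bar>N (\<tau> k) \<omega>\<bar> > l} \<in> sets M"
    and "measure M {\<omega>\<in>space M. \<exists>k\<le>n::nat. \<bar>N (\<tau> k) \<omega>\<bar> > l} \<le> sqn M (N T) / l\<^sup>2"
proof -
  define A where "A k = {\<omega>\<in>space M. \<bar>N (\<tau> k) \<omega>\<bar> > l \<and> (\<forall>j\<in>{..<k}. \<bar>N (\<tau> j) \<omega>\<bar> \<le> l)}" for k
  have \<tau>0: "0 \<le> \<tau> k" "\<tau> k \<le> T" for k using \<tau>(1)[of k] by auto
  have Nj: "N (\<tau> j) \<in> borel_measurable (F (\<tau> k))" if "j \<le> k" for j k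
    by (rule measurable_F_mono[OF cmart_adapted[OF N \<tau>(1)]]) (use \<tau>0 monoD[OF \<tau>(2) that] in auto)
  have A: "A k \<in> sets (F (\<tau> k))" for k
  proof -
    have [measurable]: "N (\<tau> j) \<in> borel_measurable (F (\<tau> k))" if "j \<in> {..<k}" for j
      using Nj[of j k] that by auto
    have [measurable]: "N (\<tau> k) \<in> borel_measurable (F (\<tau> k))" by (rule Nj) simp
    have "{\<omega>\<in>space (F (\<tau> k)). \<bar>N (\<tau> k) \<omega>\<bar> > l \<and> (\<forall>j\<in>{..<k}. \<bar>N (\<tau> j) \<omega>\<bar> \<le> l)} \<in> sets (F (\<tau> k))"
      by measurable
    then show ?thesis unfolding A_def space_F[OF \<tau>0(1)] .
  qed
  have A': "A k \<in> sets M" for k using A[of k] subalg[OF \<tau>0(1)[of k]] by (auto simp: subalgebra_def)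
  have disj: "disjoint_family A"
    unfolding disjoint_family_on_def A_def by (auto simp: disjoint_iff) (metis lessThan_iff linorder_neqE_nat not_le)
  have U: "{\<omega>\<in>space M. \<exists>k\<le>n. \<bar>N (\<tau> k) \<omega>\<bar> > l} = (\<Union>k\<le>n. A k)"
  proof (intro equalityI subsetI)
    fix \<omega> assume "\<omega> \<in> {\<omega>\<in>space M. \<exists>k\<le>n. \<bar>N (\<tau> k) \<omega>\<bar> > l}"
    then obtain k where k: "\<omega> \<in> space M" "k \<le> n" "\<bar>N (\<tau> k) \<omega>\<bar> > l" by auto
    define k0 where "k0 = (LEAST k. \<bar>N (\<tau> k) \<omega>\<bar> > l)"
    have "\<bar>N (\<tau> k0) \<omega>\<bar> > l" unfolding k0_def by (rule LeastI[of _ k]) (use k in auto)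
    moreover have "k0 \<le> k" unfolding k0_def by (rule Least_le) (use k in auto)
    moreover have "\<bar>N (\<tau> j) \<omega>\<bar> \<le> l" if "j < k0" for j
      using not_less_Least[OF that[unfolded k0_def]] by auto
    ultimately show "\<omega> \<in> (\<Union>k\<le>n. A k)" using k by (auto simp: A_def intro!: bexI[of _ k0])
  qed (auto simp: A_def)
  show "{\<omega>\<in>space M. \<exists>k\<le>n. \<bar>N (\<tau> k) \<omega>\<bar> > l} \<in> sets M" unfolding U using A' by auto
  have T: "T \<in> {0..T}" using T_pos by simp
  have int: "integrable M (\<lambda>\<omega>. (N t \<omega>)\<^sup>2)" if "t \<in> {0..T}" for t
    using sq_int_integrable[OF cmart_sq_int[OF N that]] by simp
  have int': "integrable M (\<lambda>\<omega>. indicat_real B \<omega> * (N t \<omega>)\<^sup>2)" if "t \<in> {0..T}" "B \<in> sets M" for t B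
    using integrable_mult_indicator[OF that(2) int[OF that(1)]] by simp
  have k: "l\<^sup>2 * measure M (A k) \<le> (\<integral>\<omega>. indicat_real (A k) \<omega> * (N T \<omega>)\<^sup>2 \<partial>M)" for k
  proof -
    have "l\<^sup>2 * measure M (A k) = (\<integral>\<omega>. l\<^sup>2 * indicat_real (A k) \<omega> \<partial>M)" using A' by simp
    also have "\<dots> \<le> (\<integral>\<omega>. indicat_real (A k) \<omega> * (N (\<tau> k) \<omega>)\<^sup>2 \<partial>M)"
    proof (rule integral_mono)
      show "integrable M (\<lambda>\<omega>. l\<^sup>2 * indicat_real (A k) \<omega>)" using A' by (simp add: emeasure_eq_measure)
      show "integrable M (\<lambda>\<omega>. indicat_real (A k) \<omega> * (N (\<tau> k) \<omega>)\<^sup>2)" by (rule int'[OF \<tau>(1) A'])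
      show "l\<^sup>2 * indicat_real (A k) \<omega> \<le> indicat_real (A k) \<omega> * (N (\<tau> k) \<omega>)\<^sup>2" for \<omega>
      proof (cases "\<omega> \<in> A k")
        case True
        then have "l \<le> \<bar>N (\<tau> k) \<omega>\<bar>" by (simp add: A_def)
        then have "l\<^sup>2 \<le> \<bar>N (\<tau> k) \<omega>\<bar>\<^sup>2" using l by (intro power_mono) auto
        then show ?thesis using True by simp
      qed simp
    qed
    also have "\<dots> \<le> (\<integral>\<omega>. indicat_real (A k) \<omega> * (N T \<omega>)\<^sup>2 \<partial>M)"
      by (rule cmart_localized_second_moment[OF N \<tau>0 order_refl A])
    finally show ?thesis .
  qed
  have "l\<^sup>2 * measure M (\<Union>k\<le>n. A k) = (\<Sum>k\<le>n. l\<^sup>2 * measure M (A k))"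
    using A' disj by (subst finite_measure_finite_Union)
      (auto simp: disjoint_family_on_def sum_distrib_left)
  also have "\<dots> \<le> (\<Sum>k\<le>n. \<integral>\<omega>. indicat_real (A k) \<omega> * (N T \<omega>)\<^sup>2 \<partial>M)" by (intro sum_mono k)
  also have "\<dots> = (\<integral>\<omega>. (\<Sum>k\<le>n. indicat_real (A k) \<omega> * (N T \<omega>)\<^sup>2) \<partial>M)"
    by (rule Bochner_Integration.integral_sum[symmetric]) (rule int'[OF T A'])
  also have "\<dots> \<le> (\<integral>\<omega>. (N T \<omega>)\<^sup>2 \<partial>M)"
  proof (rule integral_mono)
    show "integrable M (\<lambda>\<omega>. \<Sum>k\<le>n. indicat_real (A k) \<omega> * (N T \<omega>)\<^sup>2)"
      by (intro Bochner_Integration.integrable_sum int' T A')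
    show "(\<Sum>k\<le>n. indicat_real (A k) \<omega> * (N T \<omega>)\<^sup>2) \<le> (N T \<omega>)\<^sup>2" for \<omega>
    proof -
      have "(\<Sum>k\<le>n. indicat_real (A k) \<omega>) = indicat_real (\<Union>k\<le>n. A k) \<omega>"
        by (rule indicator_UN_disjoint[symmetric]) (use disj in \<open>auto simp: disjoint_family_on_def\<close>)
      also have "\<dots> \<le> 1" by (simp add: indicator_def)
      finally have "(\<Sum>k\<le>n. indicat_real (A k) \<omega>) * (N T \<omega>)\<^sup>2 \<le> 1 * (N T \<omega>)\<^sup>2"
        by (rule mult_right_mono) simp
      then show ?thesis by (simp add: sum_distrib_right)
    qed
  qed (rule int[OF T])
  also have "\<dots> = sqn M (N T)" by (simp add: sqn_real)
  finally show "measure M {\<omega>\<in>space M. \<exists>k\<le>n. \<bar>N (\<tau> k) \<omega>\<bar> > l} \<le> sqn M (N T) / l\<^sup>2"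
    unfolding U using l by (simp add: field_simps)
qed

lemma maximal_inequality:
  assumes N: "cmart N" and l: "l > 0"
  shows "{\<omega>\<in>space M. \<exists>t\<in>{0..T}. \<bar>N t \<omega>\<bar> > l} \<in> sets M"
    and "measure M {\<omega>\<in>space M. \<exists>t\<in>{0..T}. \<bar>N t \<omega>\<bar> > l} \<le> sqn M (N T) / l\<^sup>2"
proof -
  \<comment> \<open>Indices beyond 2 ^ n would leave [0, T]; the minimum makes this a monotone
    sequence in [0, T] over all natural numbers, as the discrete inequality requires.\<close>
  define \<tau> where "\<tau> n k = min T (real k * T / 2 ^ n)" for n k :: nat
  have \<tau>: "\<tau> n k \<in> {0..T}" "mono (\<tau> n)" for n k
  proof -
    show "\<tau> n k \<in> {0..T}" using T_pos by (auto simp: \<tau>_def)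
    show "mono (\<tau> n)"
      unfolding \<tau>_def using T_pos
      by (intro monoI min.mono order_refl divide_right_mono mult_right_mono) auto
  qed
  define A where "A n = {\<omega>\<in>space M. \<exists>k\<le>2 ^ n. \<bar>N (\<tau> n k) \<omega>\<bar> > l}" for n
  have A: "A n \<in> sets M" "measure M (A n) \<le> sqn M (N T) / l\<^sup>2" for n
    unfolding A_def by (rule discrete_maximal_inequality[OF N l \<tau>])+
  have inc: "incseq A"
  proof (rule incseq_SucI, rule subsetI)
    fix n \<omega> assume "\<omega> \<in> A n"
    then obtain k where k: "\<omega> \<in> space M" "k \<le> 2 ^ n" "\<bar>N (\<tau> n k) \<omega>\<bar> > l" by (auto simp: A_def)
    \<comment> \<open>Each dyadic grid is contained in the next, so the events increase.\<close>
    have "\<tau> (Suc n) (2 * k) = \<tau> n k" by (simp add: \<tau>_def)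
    then show "\<omega> \<in> A (Suc n)" using k by (auto simp: A_def intro!: exI[of _ "2 * k"])
  qed
  have U: "{\<omega>\<in>space M. \<exists>t\<in>{0..T}. \<bar>N t \<omega>\<bar> > l} = (\<Union>n. A n)"
  proof (intro equalityI subsetI)
    fix \<omega> assume "\<omega> \<in> {\<omega>\<in>space M. \<exists>t\<in>{0..T}. \<bar>N t \<omega>\<bar> > l}"
    then obtain t where t: "\<omega> \<in> space M" "t \<in> {0..T}" "\<bar>N t \<omega>\<bar> > l" by auto
    \<comment> \<open>The index of the grid point at or just below t. The inequality at t is strict,
      so by continuity it holds at nearby grid points as well.\<close>
    define k where "k n = nat \<lfloor>t * 2 ^ n / T\<rfloor>" for n
    have k: "real (k n) \<le> t * 2 ^ n / T" "t * 2 ^ n / T < real (k n) + 1" for n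
      using t T_pos by (auto simp: k_def)
    have k1: "k n \<le> 2 ^ n" for n
    proof -
      have "t * 2 ^ n / T \<le> 2 ^ n" using t T_pos by (simp add: field_simps)
      then have "real (k n) \<le> 2 ^ n" using k(1)[of n] by linarith
      then show ?thesis by (metis of_nat_le_iff of_nat_numeral of_nat_power)
    qed
    have \<tau>k: "\<tau> n (k n) = real (k n) * T / 2 ^ n" for n
    proof -
      have "real (k n) * T \<le> 2 ^ n * T" using k1[of n] T_pos
        by (intro mult_right_mono) (auto simp: of_nat_le_iff[of "k n" "2 ^ n", simplified] )
      then show ?thesis by (simp add: \<tau>_def field_simps)
    qed
    have "\<bar>\<tau> n (k n) - t\<bar> \<le> T * (1/2) ^ n" for n
    proof -
      have "\<tau> n (k n) \<le> t" using k(1)[of n] T_pos by (simp add: \<tau>k field_simps)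
      moreover have "t \<le> \<tau> n (k n) + T / 2 ^ n" using k(2)[of n] T_pos by (simp add: \<tau>k field_simps)
      ultimately show ?thesis by (simp add: power_one_over)
    qed
    moreover have "(\<lambda>n. T * (1/2::real) ^ n) \<longlonglongrightarrow> 0"
      using tendsto_mult_left[OF LIMSEQ_realpow_zero[of "1/2::real"], of T] by simp
    ultimately have "(\<lambda>n. \<tau> n (k n) - t) \<longlonglongrightarrow> 0"
      by (intro Lim_null_comparison[of "\<lambda>n. \<tau> n (k n) - t" "\<lambda>n. T * (1/2) ^ n"]) auto
    then have lim: "(\<lambda>n. \<tau> n (k n)) \<longlonglongrightarrow> t" by (rule LIM_zero_cancel)
    have "(\<lambda>n. \<bar>N (\<tau> n (k n)) \<omega>\<bar>) \<longlonglongrightarrow> \<bar>N t \<omega>\<bar>"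
      by (intro tendsto_rabs continuous_on_tendsto_compose[OF cmart_continuous[OF N t(1)] lim t(2)]
          always_eventually allI \<tau>)
    from order_tendstoD(1)[OF this t(3)] obtain n where "\<bar>N (\<tau> n (k n)) \<omega>\<bar> > l"
      by (auto simp: eventually_sequentially)
    then have "\<omega> \<in> A n" unfolding A_def using t(1) k1[of n] by blast
    then show "\<omega> \<in> (\<Union>n. A n)" by blast
  next
    fix \<omega> assume "\<omega> \<in> (\<Union>n. A n)"
    then show "\<omega> \<in> {\<omega>\<in>space M. \<exists>t\<in>{0..T}. \<bar>N t \<omega>\<bar> > l}" using \<tau>(1) by (force simp: A_def)
  qed
  show "{\<omega>\<in>space M. \<exists>t\<in>{0..T}. \<bar>N t \<omega>\<bar> > l} \<in> sets M" unfolding U using A by auto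
  have "(\<lambda>n. measure M (A n)) \<longlonglongrightarrow> measure M (\<Union>n. A n)"
    by (rule finite_Lim_measure_incseq) (use A inc in auto)
  then show "measure M {\<omega>\<in>space M. \<exists>t\<in>{0..T}. \<bar>N t \<omega>\<bar> > l} \<le> sqn M (N T) / l\<^sup>2"
    unfolding U by (rule LIMSEQ_le_const2) (use A in auto)
qed

text \<open>A Cauchy condition at time T suffices because the second moments of differences increase
  in time. Along a fast subsequence the maximal inequality and Borel-Cantelli give uniform
  convergence of almost all paths, hence a continuous limit; Fatou then bounds the distance of the
  whole sequence to it.\<close>

lemma cmart_limit:
  assumes N: "\<And>n. cmart (N n)"
    and Cauchy: "\<And>e. e > 0 \<Longrightarrow> \<exists>n0::nat. \<forall>i\<ge>n0. \<forall>j\<ge>n0. sqn M (\<lambda>\<omega>. N i T \<omega> - N j T \<omega>) < e"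
  obtains N0 where "cmart N0"
    "\<And>e. e > 0 \<Longrightarrow> \<exists>n0. \<forall>n\<ge>n0. \<forall>t\<in>{0..T}. sqn M (\<lambda>\<omega>. N n t \<omega> - N0 t \<omega>) \<le> e"
proof -
  have T: "T \<in> {0..T}" using T_pos by simp
  \<comment> \<open>With rate (1/8)^k the probability that an increment exceeds (1/2)^k is at most
    (1/8)^k / (1/4)^k = (1/2)^k, which is summable; the levels (1/2)^k are summable too.\<close>
  have "\<forall>k::nat. \<exists>n0::nat. \<forall>i\<ge>n0. \<forall>j\<ge>n0. sqn M (\<lambda>\<omega>. N i T \<omega> - N j T \<omega>) < (1/8) ^ k"
    by (intro allI Cauchy) simp
  from choice[OF this] obtain m' where
    m': "\<And>k i j. m' k \<le> i \<Longrightarrow> m' k \<le> j \<Longrightarrow> sqn M (\<lambda>\<omega>. N i T \<omega> - N j T \<omega>) < (1/8) ^ k" by blast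
  \<comment> \<open>Partial sums turn the chosen indices into a monotone sequence that still
    dominates them.\<close>
  define m where "m k = (\<Sum>i\<le>k. m' i)" for k
  have m'm: "m' k \<le> m k" for k unfolding m_def by (rule member_le_sum) auto
  have m_mono: "m k \<le> m l" if "k \<le> l" for k l
    unfolding m_def by (rule sum_mono2) (use that in auto)
  define D where "D k t \<omega> = N (m (Suc k)) t \<omega> - N (m k) t \<omega>" for k t \<omega>
  have D: "cmart (D k)" for k unfolding D_def[abs_def] by (intro cmart_diff N)
  define E where "E k = {\<omega>\<in>space M. \<exists>t\<in>{0..T}. \<bar>D k t \<omega>\<bar> > (1/2) ^ k}" for k
  have E: "E k \<in> sets M" for k unfolding E_def by (rule maximal_inequality(1)[OF D]) simp
  have mE: "measure M (E k) \<le> (1/2) ^ k" for k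
  proof -
    have "measure M (E k) \<le> sqn M (D k T) / ((1/2) ^ k)\<^sup>2"
      unfolding E_def by (rule maximal_inequality(2)[OF D]) simp
    also have "\<dots> \<le> (1/8) ^ k / ((1/2) ^ k)\<^sup>2"
    proof (rule divide_right_mono)
      show "sqn M (D k T) \<le> (1/8) ^ k"
        using m'[of k "m (Suc k)" "m k"] m'm[of k] m_mono[of k "Suc k"] by (simp add: D_def[abs_def])
    qed simp
    also have "\<dots> = (1/2) ^ k"
    proof -
      have "(1/8) ^ k / ((1/2) ^ k)\<^sup>2 = ((1/8) / ((1/2) * (1/2)) :: real) ^ k"
        by (simp only: power2_eq_square power_mult_distrib power_divide)
      then show ?thesis by simp
    qed
    finally show ?thesis .
  qed
  have "AE \<omega> in M. eventually (\<lambda>k. \<omega> \<in> space M - E k) sequentially"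
  proof (rule borel_cantelli_AE1[OF E])
    show "emeasure M (E k) < \<infinity>" for k by (simp add: emeasure_eq_measure)
    show "summable (\<lambda>k. measure M (E k))"
      by (rule summable_comparison_test'[of "\<lambda>k. (1/2::real) ^ k" 0]) (use mE in auto)
  qed
  then obtain Z where Z: "{\<omega>\<in>space M. \<not> eventually (\<lambda>k. \<omega> \<in> space M - E k) sequentially} \<subseteq> Z" "Z \<in> null_sets M"
    unfolding eventually_ae_filter by auto
  have good: "eventually (\<lambda>k. \<forall>t\<in>{0..T}. \<bar>D k t \<omega>\<bar> \<le> (1/2) ^ k) sequentially" if "\<omega> \<in> space M" "\<omega> \<notin> Z" for \<omega>
  proof -
    have "eventually (\<lambda>k. \<omega> \<in> space M - E k) sequentially" using that Z(1) by auto
    then show ?thesis by eventually_elim (use that in \<open>auto simp: E_def not_less\<close>)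
  qed
  \<comment> \<open>On the exceptional null set the limit is 0, so that every path is continuous.
    Adaptedness survives because null sets belong to every F t.\<close>
  define N0 where "N0 t \<omega> = (if \<omega> \<in> Z then 0 else N (m 0) t \<omega> + (\<Sum>k. D k t \<omega>))" for t \<omega>
  have unif: "uniform_limit {0..T} (\<lambda>n t. \<Sum>k<n. D k t \<omega>) (\<lambda>t. \<Sum>k. D k t \<omega>) sequentially"
    if "\<omega> \<in> space M" "\<omega> \<notin> Z" for \<omega>
    by (rule Weierstrass_m_test_ev[where M = "\<lambda>k. (1/2) ^ k"]) (use good[OF that] in auto)
  have tele: "(\<Sum>k<n. D k t \<omega>) = N (m n) t \<omega> - N (m 0) t \<omega>" for n t \<omega>
    unfolding D_def by (rule sum_lessThan_telescope)
  have lim: "(\<lambda>n. N (m n) t \<omega>) \<longlonglongrightarrow> N0 t \<omega>" if "\<omega> \<in> space M" "\<omega> \<notin> Z" "t \<in> {0..T}" for \<omega> t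
  proof -
    have "(\<lambda>n. \<Sum>k<n. D k t \<omega>) \<longlonglongrightarrow> (\<Sum>k. D k t \<omega>)"
      using tendsto_uniform_limitI[OF unif[OF that(1,2)] that(3)] .
    from tendsto_add[OF tendsto_const[of "N (m 0) t \<omega>"] this] show ?thesis
      using that(2) by (simp add: tele N0_def)
  qed
  have meas: "N0 t \<in> borel_measurable (F t)" if t: "t \<in> {0..T}" for t
  proof -
    have [measurable]: "N (m 0) t \<in> borel_measurable (F t)" "\<And>k. D k t \<in> borel_measurable (F t)"
      by (auto intro: cmart_adapted N D t)
    have [measurable]: "Z \<in> sets (F t)" using F_null[of t] Z(2) t by auto
    show ?thesis unfolding N0_def[abs_def] by measurable
  qed
  \<comment> \<open>Only the subsequence converges along paths. Fatou is applied to
    \<open>N n t - N (m k) t\<close> as k grows with n fixed, so the bound holds for every n from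
    \<open>m k0\<close> on.\<close>
  have L2: "sq_int M (N0 t) \<and> sqn M (\<lambda>\<omega>. N n t \<omega> - N0 t \<omega>) \<le> (1/8) ^ k0"
    if t: "t \<in> {0..T}" and n: "n \<ge> m k0" for t n k0
  proof -
    have sq: "sq_int M (\<lambda>\<omega>. N n t \<omega> - N (m k) t \<omega>)" for k
      by (intro sq_int_diff cmart_sq_int N t)
    have M0: "N0 t \<in> borel_measurable M" "N n t \<in> borel_measurable M"
      using measurable_F_M[OF meas[OF t]] t sq_int_measurable[OF cmart_sq_int[OF N t]] by auto
    have "AE \<omega> in M. \<omega> \<notin> Z" by (rule AE_not_in[OF Z(2)])
    then have ae: "AE \<omega> in M. (\<lambda>k. N n t \<omega> - N (m k) t \<omega>) \<longlonglongrightarrow> N n t \<omega> - N0 t \<omega>"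
      using AE_space by eventually_elim (intro tendsto_intros lim t)
    have "sqn M (\<lambda>\<omega>. N n t \<omega> - N (m k) t \<omega>) \<le> (1/8) ^ k0" if "k \<ge> k0" for k
    proof -
      have "sqn M (\<lambda>\<omega>. N n t \<omega> - N (m k) t \<omega>) \<le> sqn M (\<lambda>\<omega>. N n T \<omega> - N (m k) T \<omega>)"
        by (rule cmart_sqn_mono[OF cmart_diff[OF N N]]) (use t in auto)
      also have "\<dots> < (1/8) ^ k0"
        by (rule m') (use n m'm[of k0] m_mono[OF that] in auto)
      finally show ?thesis by simp
    qed
    then have ev: "eventually (\<lambda>k. sqn M (\<lambda>\<omega>. N n t \<omega> - N (m k) t \<omega>) \<le> (1/8) ^ k0) sequentially"
      by (auto simp: eventually_sequentially)
    have c: "(0::real) \<le> (1/8) ^ k0" by simp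
    have mm: "(\<lambda>\<omega>. N n t \<omega> - N0 t \<omega>) \<in> borel_measurable M" using M0 by measurable
    note f = sqn_Fatou[OF sq mm ae ev c]
    have "sq_int M (\<lambda>\<omega>. N n t \<omega> - (N n t \<omega> - N0 t \<omega>))"
      by (intro sq_int_diff f cmart_sq_int N t)
    then show ?thesis using f(2) by simp
  qed
  have conv: "\<exists>n0. \<forall>n\<ge>n0. \<forall>t\<in>{0..T}. sqn M (\<lambda>\<omega>. N n t \<omega> - N0 t \<omega>) \<le> e" if e: "e > 0" for e
  proof -
    obtain k0 where "(1/8::real) ^ k0 < e" using real_arch_pow_inv[OF e, of "1/8"] by auto
    then have "\<forall>n\<ge>m k0. \<forall>t\<in>{0..T}. sqn M (\<lambda>\<omega>. N n t \<omega> - N0 t \<omega>) \<le> e"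
      using L2 by (meson less_imp_le order_trans)
    then show ?thesis by blast
  qed
  have "cmart N0"
    unfolding cmart_def
  proof (intro conjI ballI allI impI)
    fix t assume t: "t \<in> {0..T}"
    show "N0 t \<in> borel_measurable (F t)" by (rule meas[OF t])
    show "sq_int M (N0 t)" using L2[OF t order_refl, of 0] by blast
  next
    fix \<omega> assume w: "\<omega> \<in> space M"
    show "continuous_on {0..T} (\<lambda>t. N0 t \<omega>)"
    proof (cases "\<omega> \<in> Z")
      case False
      have "continuous_on {0..T} (\<lambda>t. \<Sum>k. D k t \<omega>)"
        by (rule uniform_limit_theorem[OF always_eventually unif[OF w False]])
           (auto intro!: continuous_intros cmart_continuous D w)
      then have "continuous_on {0..T} (\<lambda>t. N (m 0) t \<omega> + (\<Sum>k. D k t \<omega>))"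
        by (intro continuous_on_add cmart_continuous[OF N w])
      then show ?thesis using False by (simp add: N0_def)
    qed (simp add: N0_def)
  next
    fix s t and \<xi> :: "'w \<Rightarrow> real"
    assume a: "0 \<le> s" "s \<le> t" "t \<le> T" "\<xi> \<in> borel_measurable (F s)" "sq_int M \<xi>"
    have l: "(\<lambda>n. \<integral>\<omega>. \<xi> \<omega> \<bullet> N n r \<omega> \<partial>M) \<longlonglongrightarrow> (\<integral>\<omega>. \<xi> \<omega> \<bullet> N0 r \<omega> \<partial>M)" if r: "r \<in> {0..T}" for r
    proof (rule L2_inner_tendsto)
      show "(\<lambda>n. sqn M (\<lambda>\<omega>. \<xi> \<omega> - \<xi> \<omega>)) \<longlonglongrightarrow> 0" by (simp add: sqn_def)
      show "sq_int M (N n r)" for n by (intro cmart_sq_int N r)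
      show "sq_int M (N0 r)" using L2[OF r order_refl, of 0] by blast
      show "(\<lambda>n. sqn M (\<lambda>\<omega>. N n r \<omega> - N0 r \<omega>)) \<longlonglongrightarrow> 0"
      proof (rule LIMSEQ_I)
        fix e :: real assume "e > 0"
        then obtain n0 where "\<forall>n\<ge>n0. \<forall>t\<in>{0..T}. sqn M (\<lambda>\<omega>. N n t \<omega> - N0 t \<omega>) \<le> e / 2"
          using conv[of "e / 2"] by auto
        then show "\<exists>n0. \<forall>n\<ge>n0. norm (sqn M (\<lambda>\<omega>. N n r \<omega> - N0 r \<omega>) - 0) < e"
          using r \<open>e > 0\<close> by (intro exI[of _ n0]) force
      qed
    qed (fact a)+
    have "(\<integral>\<omega>. \<xi> \<omega> \<bullet> N n t \<omega> \<partial>M) = (\<integral>\<omega>. \<xi> \<omega> \<bullet> N n s \<omega> \<partial>M)" for n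
      using cmart_martingale[OF N a] by simp
    then have "(\<integral>\<omega>. \<xi> \<omega> \<bullet> N0 t \<omega> \<partial>M) = (\<integral>\<omega>. \<xi> \<omega> \<bullet> N0 s \<omega> \<partial>M)"
      using LIMSEQ_unique[OF l[of t]] l[of s] a by auto
    then show "(\<integral>\<omega>. \<xi> \<omega> * N0 t \<omega> \<partial>M) = (\<integral>\<omega>. \<xi> \<omega> * N0 s \<omega> \<partial>M)" by simp
  qed
  from that[OF this conv] show ?thesis .
qed

end

section \<open>Approximation by elementary processes\<close>

text \<open>Each cell carries the average over the preceding cell, so that an adapted process is
  turned into an adapted one.\<close>

definition cell :: "real \<Rightarrow> nat \<Rightarrow> real set" where
  "cell h k = {h * real k<..h * real (Suc k)}"

text \<open>The first cell has no predecessor and gets the value 0; the error made there disappears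
  as the cells shrink.\<close>

definition lagged_average :: "real \<Rightarrow> real \<Rightarrow> (real \<Rightarrow> 'v::euclidean_space) \<Rightarrow> nat \<Rightarrow> 'v" where
  "lagged_average t h f k = (if k = 0 then 0
     else (1 / h) *\<^sub>R (\<integral>s. indicat_real (cell h (k - 1)) s *\<^sub>R f s \<partial>restrict_space lborel {0..t}))"

definition step_average :: "real \<Rightarrow> nat \<Rightarrow> (real \<Rightarrow> 'v::euclidean_space) \<Rightarrow> real \<Rightarrow> 'v" where
  "step_average t n f s = (\<Sum>k<n. indicat_real (cell (t / real n) k) s *\<^sub>R lagged_average t (t / real n) f k)"

lemma cell_disjoint:
  assumes "0 < h" "j < k" shows "cell h j \<inter> cell h k = {}"
proof -
  have "h * real (Suc j) \<le> h * real k" using assms by (intro mult_left_mono) auto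
  then show ?thesis by (auto simp: cell_def)
qed

lemma cell_subset:
  fixes n :: nat
  assumes "0 < t" "k < n" shows "cell (t / real n) k \<subseteq> {0<..t}"
proof
  fix x assume "x \<in> cell (t / real n) k"
  then have x: "t / real n * real k < x" "x \<le> t / real n * real (Suc k)" by (auto simp: cell_def)
  have "t / real n * real (Suc k) \<le> t / real n * real n" using assms by (intro mult_left_mono) auto
  moreover have "t / real n * real n = t" using assms by simp
  moreover have "0 \<le> t / real n * real k" using assms by simp
  ultimately have "0 < x" "x \<le> t" using x by linarith+
  then show "x \<in> {0<..t}" by simp
qed

lemma adjacent_cells:
  assumes "r \<in> cell h (k - 1)" "s \<in> cell h k" "k \<noteq> 0"
  shows "dist r s < 2 * h"
proof -
  have "real (k - 1) = real k - 1" using assms(3) by (simp add: of_nat_diff)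
  then have "h * real k - h < r" "r \<le> h * real k" "h * real k < s" "s \<le> h * real k + h"
    using assms(1,2) by (auto simp: cell_def algebra_simps)
  then show ?thesis by (simp add: dist_real_def)
qed

section \<open>Step averages on a fixed interval\<close>

locale interval = 
  fixes t :: real assumes t_pos: "0 < t"
begin

definition I :: "real measure" where "I = restrict_space lborel {0..t}"

sublocale I: finite_measure I unfolding I_def by (rule finite_measure_Icc)

lemma space_I [simp]: "space I = {0..t}" by (simp add: I_def space_restrict_space)

lemma measurable_I: "f \<in> borel_measurable borel \<Longrightarrow> f \<in> borel_measurable I"
  unfolding I_def by (rule measurable_restrict_space1) simp

lemma sets_I_cell [measurable]: "k < n \<Longrightarrow> cell (t / real n) k \<in> sets I"
  using cell_subset[OF t_pos, of k n]
  by (auto simp: I_def sets_restrict_space cell_def intro!: image_eqI[where x = "cell (t / real n) k"])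

lemma measure_I_cell: "k < n \<Longrightarrow> measure I (cell (t / real n) k) = t / real n"
  using cell_subset[OF t_pos, of k n] t_pos
  by (subst I_def, subst measure_restrict_space) (auto simp: cell_def field_simps)

lemma cell_Int_space: "k < n \<Longrightarrow> cell (t / real n) k \<inter> {0..t} = cell (t / real n) k"
  using cell_subset[OF t_pos, of k n] by auto

lemma integral_cell: "k < n \<Longrightarrow> (\<integral>s. indicat_real (cell (t / real n) k) s * c \<partial>I) = t / real n * c"
  by (simp add: cell_Int_space measure_I_cell)

lemma ind_cell [measurable]: "indicat_real (cell h k) \<in> borel_measurable I"
  by (rule measurable_I) (simp add: cell_def)

lemma integrable_ind: "integrable I f \<Longrightarrow> integrable I (\<lambda>s. indicat_real (cell h k) s *\<^sub>R f s)"
  for f :: "real \<Rightarrow> 'v::euclidean_space"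
  by (rule Bochner_Integration.integrable_bound[of I f]) (auto split: split_indicator)

lemma step_average_diff:
  fixes f g :: "real \<Rightarrow> 'v::euclidean_space"
  assumes "integrable I f" "integrable I g"
  shows "step_average t n (\<lambda>s. f s - g s) s = step_average t n f s - step_average t n g s"
proof -
  have "lagged_average t h (\<lambda>s. f s - g s) k = lagged_average t h f k - lagged_average t h g k" for h k
    using integrable_ind[OF assms(1)] integrable_ind[OF assms(2)]
    by (simp add: lagged_average_def scaleR_diff_right flip: I_def)
  then show ?thesis by (simp add: step_average_def scaleR_diff_right sum_subtractf)
qed

lemma sum_cells_le: "(\<Sum>k<n. indicat_real (cell (t / real n) k) s) \<le> 1"
proof (cases "n = 0")
  case False
  then have "0 < t / real n" using t_pos by simp
  then have "disjoint_family_on (cell (t / real n)) {..<n}"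
    using cell_disjoint by (auto simp: disjoint_family_on_def) (metis disjoint_iff linorder_neqE_nat)
  then have "(\<Sum>k<n. indicat_real (cell (t / real n) k) s) = indicat_real (\<Union>k<n. cell (t / real n) k) s"
    by (intro indicator_UN_disjoint[symmetric]) auto
  then show ?thesis by (simp add: indicator_def)
qed simp

lemma norm_lagged_average_le:
  fixes f :: "real \<Rightarrow> 'v::euclidean_space"
  assumes "0 < h"
  shows "h * norm (lagged_average t h f k) \<le> (if k = 0 then 0 else (\<integral>s. indicat_real (cell h (k - 1)) s * norm (f s) \<partial>I))"
proof (cases "k = 0")
  case False
  have "h * norm (lagged_average t h f k) = norm (\<integral>s. indicat_real (cell h (k - 1)) s *\<^sub>R f s \<partial>I)"
    using False assms by (simp add: lagged_average_def flip: I_def)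
  also have "\<dots> \<le> (\<integral>s. norm (indicat_real (cell h (k - 1)) s *\<^sub>R f s) \<partial>I)" by (rule integral_norm_bound)
  finally show ?thesis using False by simp
qed (simp add: lagged_average_def)

text \<open>The mean over a cell is carried to the next cell of the same length and the last one is
  lost, so the L1 norm cannot grow. This reduces convergence for measurable functions to convergence
  for continuous ones.\<close>

lemma step_average_contraction:
  fixes f :: "real \<Rightarrow> 'v::euclidean_space"
  assumes f: "integrable I f" and n: "0 < n"
  shows "integrable I (step_average t n f)"
    and "(\<integral>s. norm (step_average t n f s) \<partial>I) \<le> (\<integral>s. norm (f s) \<partial>I)"
proof -
  let ?h = "t / real n" and ?c = "lagged_average t (t / real n) f"
  have h: "0 < ?h" using n t_pos by simp
  show i: "integrable I (step_average t n f)"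
    unfolding step_average_def[abs_def]
    by (intro Bochner_Integration.integrable_sum integrable_ind) simp
  obtain n' where n': "n = Suc n'" using n by (cases n) auto
  have "(\<integral>s. norm (step_average t n f s) \<partial>I) \<le> (\<integral>s. (\<Sum>k<n. indicat_real (cell ?h k) s * norm (?c k)) \<partial>I)"
  proof (rule integral_mono)
    show "integrable I (\<lambda>s. \<Sum>k<n. indicat_real (cell ?h k) s * norm (?c k))"
      using integrable_ind[of "\<lambda>_. norm (?c _)"] by (intro Bochner_Integration.integrable_sum) simp
    show "norm (step_average t n f s) \<le> (\<Sum>k<n. indicat_real (cell ?h k) s * norm (?c k))" for s
      unfolding step_average_def by (rule norm_sum[THEN order_trans]) (intro sum_mono, simp)
  qed (use i in auto)
  also have "\<dots> = (\<Sum>k<n. ?h * norm (?c k))"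
    using integrable_ind[of "\<lambda>_. norm (?c _)"]
    by (subst Bochner_Integration.integral_sum) (auto intro!: sum.cong simp: cell_Int_space measure_I_cell)
  also have "\<dots> \<le> (\<Sum>k<n. if k = 0 then 0 else (\<integral>s. indicat_real (cell ?h (k - 1)) s * norm (f s) \<partial>I))"
    by (intro sum_mono norm_lagged_average_le h)
  also have "\<dots> = (\<Sum>k<n'. \<integral>s. indicat_real (cell ?h k) s * norm (f s) \<partial>I)"
    unfolding n' by (subst sum.lessThan_Suc_shift) simp
  also have "\<dots> \<le> (\<Sum>k<n. \<integral>s. indicat_real (cell ?h k) s * norm (f s) \<partial>I)"
    unfolding n' by (simp add: integral_nonneg_AE)
  also have "\<dots> = (\<integral>s. (\<Sum>k<n. indicat_real (cell ?h k) s * norm (f s)) \<partial>I)"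
    using integrable_ind[of "\<lambda>s. norm (f s)"] f
    by (intro Bochner_Integration.integral_sum[symmetric]) simp
  also have "\<dots> \<le> (\<integral>s. norm (f s) \<partial>I)"
  proof (rule integral_mono)
    show "integrable I (\<lambda>s. \<Sum>k<n. indicat_real (cell ?h k) s * norm (f s))"
      using integrable_ind[of "\<lambda>s. norm (f s)"] f by (intro Bochner_Integration.integrable_sum) simp
    show "(\<Sum>k<n. indicat_real (cell ?h k) s * norm (f s)) \<le> norm (f s)" for s
      using mult_right_mono[OF sum_cells_le[of n s], of "norm (f s)"] by (simp add: sum_distrib_right)
  qed (use f in auto)
  finally show "(\<integral>s. norm (step_average t n f s) \<partial>I) \<le> (\<integral>s. norm (f s) \<partial>I)" .
qed

lemma norm_lagged_average_bound:
  fixes f :: "real \<Rightarrow> 'v::euclidean_space"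
  assumes "0 < n" "k < n" "integrable I f" "\<And>s. s \<in> {0..t} \<Longrightarrow> norm (f s) \<le> C" "0 \<le> C"
  shows "norm (lagged_average t (t / real n) f k) \<le> C"
proof -
  let ?h = "t / real n"
  have h: "0 < ?h" using assms t_pos by simp
  have "?h * norm (lagged_average t ?h f k) \<le> ?h * C"
  proof (cases "k = 0")
    case False
    then have k: "k - 1 < n" using assms by simp
    have "?h * norm (lagged_average t ?h f k) \<le> (\<integral>s. indicat_real (cell ?h (k - 1)) s * norm (f s) \<partial>I)"
      using norm_lagged_average_le[OF h, of f k] False by simp
    also have "\<dots> \<le> (\<integral>s. indicat_real (cell ?h (k - 1)) s * C \<partial>I)"
      using integrable_ind[of "\<lambda>s. norm (f s)" ?h "k - 1"] integrable_ind[of "\<lambda>s. C" ?h "k - 1"] assms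
      by (intro integral_mono) (auto intro!: mult_left_mono)
    also have "\<dots> = ?h * C" by (rule integral_cell[OF k])
    finally show ?thesis .
  next
    case True
    have "0 \<le> ?h * C" using h assms(5) by (intro mult_nonneg_nonneg) auto
    then show ?thesis using True by (simp add: lagged_average_def)
  qed
  then show ?thesis using h by (simp only: mult_le_cancel_left_pos)
qed

lemma step_average_on_cell:
  assumes "0 < n" "k < n" "s \<in> cell (t / real n) k"
  shows "step_average t n f s = lagged_average t (t / real n) f k"
proof -
  have h: "0 < t / real n" using assms t_pos by simp
  have "indicat_real (cell (t / real n) j) s = (if j = k then 1 else 0)" for j
    using cell_disjoint[OF h, of j k] cell_disjoint[OF h, of k j] assms(3)
    by (cases j k rule: linorder_cases) (auto simp: indicator_def)
  then show ?thesis using assms(2) by (simp add: step_average_def if_distrib[of "\<lambda>x. x *\<^sub>R _"] sum.delta cong: if_cong)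
qed

lemma cell_exists:
  assumes "0 < n" "s \<in> {0<..t}" obtains k where "k < n" "s \<in> cell (t / real n) k"
proof -
  \<comment> \<open>Cells are open on the left and closed on the right, hence the ceiling minus
    one.\<close>
  define k where "k = nat (\<lceil>s * n / t\<rceil> - 1)"
  have p: "0 < s * n / t" using assms t_pos by simp
  then have "1 \<le> \<lceil>s * n / t\<rceil>" by linarith
  then have k: "real k = real_of_int \<lceil>s * n / t\<rceil> - 1" by (simp add: k_def)
  have 1: "real k < s * n / t" "s * n / t \<le> real k + 1" using k by linarith+
  have "s * n / t \<le> n" using assms t_pos by (simp add: field_simps)
  then have "k < n" using 1 by linarith
  moreover have "s \<in> cell (t / real n) k"
    using 1 assms t_pos by (simp add: cell_def field_simps)
  ultimately show ?thesis by (rule that)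
qed

lemma norm_step_average_bound:
  fixes f :: "real \<Rightarrow> 'v::euclidean_space"
  assumes "0 < n" "integrable I f" "\<And>s. s \<in> {0..t} \<Longrightarrow> norm (f s) \<le> C" "0 \<le> C"
  shows "norm (step_average t n f s) \<le> C"
proof (cases "\<exists>k<n. s \<in> cell (t / real n) k")
  case True
  then obtain k where k: "k < n" "s \<in> cell (t / real n) k" by blast
  show ?thesis
    unfolding step_average_on_cell[OF assms(1) k] by (rule norm_lagged_average_bound[OF assms(1) k(1) assms(2-4)])
next
  case False
  then show ?thesis using assms(4) by (simp add: step_average_def)
qed

lemma step_average_continuous:
  fixes g :: "real \<Rightarrow> 'v::euclidean_space"
  assumes g: "continuous_on UNIV g" and s: "s \<in> {0<..t}" and int: "integrable I g"
  shows "(\<lambda>n. step_average t (Suc n) g s) \<longlonglongrightarrow> g s"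
proof (rule LIMSEQ_I)
  fix e :: real assume e: "e > 0"
  obtain d where d: "d > 0" "\<And>r. dist r s < d \<Longrightarrow> dist (g r) (g s) < e / 2"
    using g e by (metis UNIV_I continuous_on_iff half_gt_zero)
  \<comment> \<open>Two demands on the mesh h = t / (n + 1): 2 h < d keeps the preceding cell within
    d of s, and h < s keeps s out of the first cell with its default value.\<close>
  obtain n0 where n0: "real n0 > 2 * t / d + t / s" using reals_Archimedean2 by blast
  have "norm (step_average t (Suc n) g s - g s) < e" if "n \<ge> n0" for n
  proof -
    let ?h = "t / real (Suc n)"
    have pos: "0 < ?h" using t_pos by simp
    have N: "real (Suc n) > 2 * t / d + t / s" using n0 that by linarith
    have q: "0 < 2 * t / d" "0 < t / s" using t_pos d s by auto
    have "2 * t / d < real (Suc n)" "t / s < real (Suc n)" using N q by linarith+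
    then have h: "2 * ?h < d" "?h < s" using d s t_pos by (auto simp: field_simps)
    obtain k where k: "k < Suc n" "s \<in> cell ?h k" using cell_exists[OF _ s] by (metis zero_less_Suc)
    have k0: "k \<noteq> 0"
    proof
      assume "k = 0"
      then have "s \<le> ?h" using k(2) by (simp add: cell_def)
      then show False using h(2) by simp
    qed
    then have k1: "k - 1 < Suc n" using k by simp
    have near: "dist (g r) (g s) \<le> e / 2" if "r \<in> cell ?h (k - 1)" for r
    proof (rule less_imp_le, rule d(2))
      show "dist r s < d" using adjacent_cells[OF that k(2) k0] h(1) by simp
    qed
    have mc: "(\<integral>r. indicat_real (cell ?h (k - 1)) r *\<^sub>R g s \<partial>I) = ?h *\<^sub>R g s"
      by (subst integral_scaleR_left) (use measure_I_cell[OF k1] sets_I_cell[OF k1] cell_Int_space[OF k1] in \<open>auto simp: I.emeasure_eq_measure\<close>)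
    have "?h *\<^sub>R (lagged_average t ?h g k - g s) = (\<integral>r. indicat_real (cell ?h (k - 1)) r *\<^sub>R g r \<partial>I) - ?h *\<^sub>R g s"
      using k0 pos t_pos by (simp add: lagged_average_def scaleR_diff_right flip: I_def)
    also have "\<dots> = (\<integral>r. indicat_real (cell ?h (k - 1)) r *\<^sub>R g r - indicat_real (cell ?h (k - 1)) r *\<^sub>R g s \<partial>I)"
      unfolding mc[symmetric] using integrable_ind[OF int] integrable_ind[of "\<lambda>_. g s"]
      by (intro Bochner_Integration.integral_diff[symmetric]) auto
    finally have "?h * norm (lagged_average t ?h g k - g s)
        = norm (\<integral>r. indicat_real (cell ?h (k - 1)) r *\<^sub>R g r - indicat_real (cell ?h (k - 1)) r *\<^sub>R g s \<partial>I)"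
      using pos by (metis abs_of_pos norm_scaleR)
    also have "\<dots> \<le> (\<integral>r. norm (indicat_real (cell ?h (k - 1)) r *\<^sub>R g r - indicat_real (cell ?h (k - 1)) r *\<^sub>R g s) \<partial>I)"
      by (rule integral_norm_bound)
    also have "\<dots> \<le> (\<integral>r. indicat_real (cell ?h (k - 1)) r *\<^sub>R (e / 2) \<partial>I)"
    proof (rule integral_mono)
      show "integrable I (\<lambda>r. norm (indicat_real (cell ?h (k - 1)) r *\<^sub>R g r - indicat_real (cell ?h (k - 1)) r *\<^sub>R g s))"
        using integrable_ind[OF int] integrable_ind[of "\<lambda>_. g s"]
        by (intro integrable_norm Bochner_Integration.integrable_diff) auto
      show "integrable I (\<lambda>r. indicat_real (cell ?h (k - 1)) r *\<^sub>R (e / 2))"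
        by (rule integrable_ind) simp
      show "norm (indicat_real (cell ?h (k - 1)) r *\<^sub>R g r - indicat_real (cell ?h (k - 1)) r *\<^sub>R g s)
          \<le> indicat_real (cell ?h (k - 1)) r *\<^sub>R (e / 2)" for r
        using near[of r] by (simp add: dist_norm split: split_indicator)
    qed
    also have "\<dots> = ?h * (e / 2)" using integral_cell[OF k1, of "e / 2"] by (simp only: real_scaleR_def)
    finally have "norm (lagged_average t ?h g k - g s) \<le> e / 2" using pos by (simp only: mult_le_cancel_left_pos)
    then show ?thesis using e by (simp add: step_average_on_cell[OF _ k])
  qed
  then show "\<exists>n0. \<forall>n\<ge>n0. norm (step_average t (Suc n) g s - g s) < e" by blast
qed

text \<open>Measurability provides continuous functions that converge almost everywhere. Composing
  them with the nearest-point projection onto the ball of radius C preserves continuity and adds the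
  uniform bound that dominated convergence requires.\<close>

lemma continuous_L1_approximation:
  fixes f :: "real \<Rightarrow> 'v::euclidean_space"
  assumes f: "f \<in> borel_measurable I" "\<And>s. s \<in> {0..t} \<Longrightarrow> norm (f s) \<le> C" and C: "0 \<le> C" and e: "e > 0"
  obtains g where "continuous_on UNIV g" "\<And>s. norm (g s) \<le> C" "(\<integral>s. norm (f s - g s) \<partial>I) < e"
proof -
  have fI: "f \<in> borel_measurable (lebesgue_on {0..t})"
  proof -
    have "(\<lambda>x. indicat_real {0..t} x *\<^sub>R f x) \<in> borel_measurable lborel"
      using f(1) unfolding I_def by (subst (asm) borel_measurable_restrict_space_iff) auto
    then have "(\<lambda>x. indicat_real {0..t} x *\<^sub>R f x) \<in> borel_measurable lebesgue"
      by (rule measurable_completion)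
    then show ?thesis by (subst borel_measurable_restrict_space_iff) auto
  qed
  have "f measurable_on {0..t}"
    using fI by (simp add: measurable_on_iff_borel_measurable)
  then obtain N g where N: "negligible N" and g: "\<And>n. continuous_on UNIV (g n)"
    and lim: "\<And>x. x \<notin> N \<Longrightarrow> (\<lambda>n. g n x) \<longlonglongrightarrow> (if x \<in> {0..t} then f x else 0)"
    by (auto simp: measurable_on_def)
  define p where "p = closest_point (cball (0::'v) C)"
  have p: "continuous_on UNIV p" "norm (p x) \<le> C" "norm x \<le> C \<Longrightarrow> p x = x" for x
  proof -
    show "continuous_on UNIV p" unfolding p_def
      by (rule continuous_on_closest_point) (use C in auto)
    show "norm (p x) \<le> C"
      using closest_point_in_set[of "cball (0::'v) C" x] C unfolding p_def by auto
    show "norm x \<le> C \<Longrightarrow> p x = x" unfolding p_def by (rule closest_point_self) auto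
  qed
  define G where "G n x = p (g n x)" for n x
  have G: "continuous_on UNIV (G n)" for n unfolding G_def[abs_def]
    using continuous_on_compose2[OF p(1) g[of n]] by simp
  have Gm: "G n \<in> borel_measurable I" for n
    by (intro measurable_I borel_measurable_continuous_onI G)
  have "AE x in lebesgue. x \<notin> N"
    using N by (intro AE_not_in) (simp add: negligible_iff_null_sets)
  then have "AE x in lborel. x \<notin> N" by (simp add: AE_completion_iff)
  then have "AE x in I. x \<notin> N" unfolding I_def by (subst AE_restrict_space_iff) auto
  then have ae: "AE x in I. (\<lambda>n. norm (f x - G n x)) \<longlonglongrightarrow> 0"
    using AE_space
  proof eventually_elim
    case (elim x)
    have "(\<lambda>n. G n x) \<longlonglongrightarrow> p (f x)"
      unfolding G_def using lim[OF elim(1)] elim(2)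
      by (intro continuous_on_tendsto_compose[OF p(1)]) auto
    then have "(\<lambda>n. f x - G n x) \<longlonglongrightarrow> f x - f x"
      using p(3)[OF f(2)[of x]] elim(2) by (intro tendsto_intros) auto
    then show ?case using tendsto_norm by fastforce
  qed
  have "(\<lambda>n. \<integral>x. norm (f x - G n x) \<partial>I) \<longlonglongrightarrow> (\<integral>x. 0 \<partial>I)"
  proof (rule integral_dominated_convergence[where w = "\<lambda>_. 2 * C"])
    show "AE x in I. norm (norm (f x - G n x)) \<le> 2 * C" for n
    proof (rule AE_I2)
      fix x assume "x \<in> space I"
      then show "norm (norm (f x - G n x)) \<le> 2 * C"
        using norm_triangle_ineq4[of "f x" "G n x"] f(2)[of x] p(2)[of "g n x"] by (simp add: G_def)
    qed
    show "(\<lambda>x. norm (f x - G n x)) \<in> borel_measurable I" for n using f(1) Gm[of n] by measurable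
  qed (use ae in auto)
  then have "eventually (\<lambda>n. (\<integral>x. norm (f x - G n x) \<partial>I) < e) sequentially"
    using e by (intro order_tendstoD) auto
  then obtain n where "(\<integral>x. norm (f x - G n x) \<partial>I) < e" by (auto simp: eventually_sequentially)
  then show ?thesis by (intro that[of "G n"] G) (auto simp: G_def p)
qed

text \<open>Three errors of size e / 3: f - g is small by the choice of g, the step averages of the
  continuous g converge by dominated convergence, and the step average of f - g is controlled by the
  contraction.\<close>

lemma step_average_L1:
  fixes f :: "real \<Rightarrow> 'v::euclidean_space"
  assumes f: "f \<in> borel_measurable I" "\<And>s. s \<in> {0..t} \<Longrightarrow> norm (f s) \<le> C" and C: "0 \<le> C"
  shows "(\<lambda>n. \<integral>s. norm (f s - step_average t (Suc n) f s) \<partial>I) \<longlonglongrightarrow> 0"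
proof (rule LIMSEQ_I)
  fix e :: real assume e: "e > 0"
  obtain g where g: "continuous_on UNIV g" "\<And>s. norm (g s) \<le> C" "(\<integral>s. norm (f s - g s) \<partial>I) < e / 3"
    using continuous_L1_approximation[OF f C, of "e / 3"] e by auto
  have gm: "g \<in> borel_measurable I" by (intro measurable_I borel_measurable_continuous_onI g)
  have int: "integrable I f" "integrable I g"
    by (rule I.integrable_const_bound[of _ C]; use f g gm in auto)+
  note d = Bochner_Integration.integrable_diff[OF int]
  have P: "integrable I (step_average t (Suc n) h)" if "integrable I h" for n and h :: "real \<Rightarrow> 'v"
    by (rule step_average_contraction[OF that]) simp
  have "(\<lambda>n. \<integral>s. norm (g s - step_average t (Suc n) g s) \<partial>I) \<longlonglongrightarrow> (\<integral>s. 0 \<partial>I)"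
  proof (rule integral_dominated_convergence[where w = "\<lambda>_. 2 * C"])
    show "AE x in I. norm (norm (g x - step_average t (Suc n) g x)) \<le> 2 * C" for n
    proof (rule AE_I2)
      fix x assume "x \<in> space I"
      have "norm (step_average t (Suc n) g x) \<le> C"
        by (rule norm_step_average_bound) (use int g C in auto)
      then show "norm (norm (g x - step_average t (Suc n) g x)) \<le> 2 * C"
        using norm_triangle_ineq4[of "g x" "step_average t (Suc n) g x"] g(2)[of x] by simp
    qed
    show "(\<lambda>x. norm (g x - step_average t (Suc n) g x)) \<in> borel_measurable I" for n
      using gm borel_measurable_integrable[OF P[OF int(2), of n]] by measurable
    have "AE x in lborel. x \<noteq> (0::real)" by (rule AE_lborel_singleton)
    then have "AE x in I. x \<noteq> 0" unfolding I_def by (subst AE_restrict_space_iff) auto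
    then show "AE x in I. (\<lambda>n. norm (g x - step_average t (Suc n) g x)) \<longlonglongrightarrow> 0"
      using AE_space
    proof eventually_elim
      case (elim x)
      have "(\<lambda>n. g x - step_average t (Suc n) g x) \<longlonglongrightarrow> g x - g x"
        using elim by (intro tendsto_intros step_average_continuous g int) auto
      then show ?case using tendsto_norm by fastforce
    qed
  qed auto
  then have "eventually (\<lambda>n. (\<integral>s. norm (g s - step_average t (Suc n) g s) \<partial>I) < e / 3) sequentially"
    using e by (intro order_tendstoD) auto
  then obtain n0 where n0: "\<And>n. n \<ge> n0 \<Longrightarrow> (\<integral>s. norm (g s - step_average t (Suc n) g s) \<partial>I) < e / 3"
    by (auto simp: eventually_sequentially)
  have "norm ((\<integral>s. norm (f s - step_average t (Suc n) f s) \<partial>I) - 0) < e" if "n \<ge> n0" for n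
  proof -
    let ?P = "step_average t (Suc n)"
    have "(\<integral>s. norm (f s - ?P f s) \<partial>I)
        \<le> (\<integral>s. norm (f s - g s) + norm (g s - ?P g s) + norm (?P (\<lambda>s. f s - g s) s) \<partial>I)"
    proof (rule integral_mono)
      show "integrable I (\<lambda>s. norm (f s - ?P f s))"
        by (intro integrable_norm Bochner_Integration.integrable_diff P int)
      show "integrable I (\<lambda>s. norm (f s - g s) + norm (g s - ?P g s) + norm (?P (\<lambda>s. f s - g s) s))"
        by (intro integrable_norm Bochner_Integration.integrable_add Bochner_Integration.integrable_diff P int)
      show "norm (f s - ?P f s) \<le> norm (f s - g s) + norm (g s - ?P g s) + norm (?P (\<lambda>s. f s - g s) s)" for s
      proof -
        have "norm (f s - ?P f s) = norm ((f s - g s) + (g s - ?P g s) - ?P (\<lambda>s. f s - g s) s)"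
          by (simp add: step_average_diff[OF int])
        then show ?thesis
          using norm_triangle_ineq4[of "(f s - g s) + (g s - ?P g s)" "?P (\<lambda>s. f s - g s) s"]
            norm_triangle_ineq[of "f s - g s" "g s - ?P g s"] by linarith
      qed
    qed
    also have "\<dots> = (\<integral>s. norm (f s - g s) \<partial>I) + (\<integral>s. norm (g s - ?P g s) \<partial>I) + (\<integral>s. norm (?P (\<lambda>s. f s - g s) s) \<partial>I)"
    proof -
      have "integrable I (\<lambda>s. norm (f s - g s))" "integrable I (\<lambda>s. norm (g s - ?P g s))"
        "integrable I (\<lambda>s. norm (?P (\<lambda>s. f s - g s) s))"
        by (intro integrable_norm Bochner_Integration.integrable_diff P int)+
      then show ?thesis by (simp only: Bochner_Integration.integral_add Bochner_Integration.integrable_add)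
    qed
    also have "\<dots> < e"
      using g(3) n0[OF that] step_average_contraction(2)[OF d, of "Suc n"] by linarith
    finally show ?thesis by (simp add: integral_nonneg_AE)
  qed
  then show "\<exists>n0. \<forall>n\<ge>n0. norm ((\<integral>s. norm (f s - step_average t (Suc n) f s) \<partial>I) - 0) < e" by blast
qed

end

section \<open>Existence of the Ito integral\<close>

context brownian_basis
begin

section \<open>Elementary data, lists of blocks and the product measure\<close>

lemma elementary_data_times:
  assumes "elementary_data M F t n \<tau> \<xi>" "k \<le> n"
  shows "0 \<le> \<tau> k" "\<tau> k \<le> t"
proof -
  have d: "0 \<le> \<tau> 0" "\<And>k. k < n \<Longrightarrow> \<tau> k \<le> \<tau> (Suc k)" "\<tau> n \<le> t"
    using assms(1) by (auto simp: elementary_data_def)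
  show "0 \<le> \<tau> k"
    using assms(2) by (induction k) (use d in \<open>auto intro: order_trans\<close>)
  have "\<tau> (n - j) \<le> \<tau> n" if "j \<le> n" for j
    using that
  proof (induction j)
    case (Suc j)
    then have "\<tau> (n - Suc j) \<le> \<tau> (Suc (n - Suc j))" by (intro d) auto
    also have "Suc (n - Suc j) = n - j" using Suc by simp
    finally show ?case using Suc by simp
  qed simp
  from this[of "n - k"] show "\<tau> k \<le> t" using assms(2) d(3) by simp
qed

lemma elementary_process_support:
  assumes "elementary_data M F t n \<tau> \<xi>" "s \<notin> {0..t}"
  shows "elementary_process n \<tau> \<xi> s \<omega> = 0"
  unfolding elementary_process_def
proof (rule sum.neutral, rule ballI)
  fix k assume "k \<in> {..<n}"
  then have "0 \<le> \<tau> k" "\<tau> (Suc k) \<le> t"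
    using elementary_data_times(1)[OF assms(1), of k] elementary_data_times(2)[OF assms(1), of "Suc k"] by auto
  then show "indicat_real {\<tau> k<..\<tau> (Suc k)} s *\<^sub>R \<xi> k \<omega> = 0" using assms(2) by auto
qed

lemma elementary_data_valid:
  assumes "elementary_data M F t n \<tau> \<xi>" "t \<le> T"
  defines "L \<equiv> map (\<lambda>k. (\<tau> k, \<tau> (Suc k), \<xi> k)) [0..<n]"
  shows "valid L" "eproc L = elementary_process n \<tau> \<xi>" "eint L = elementary_integral W n \<tau> \<xi>"
proof -
  show "valid L"
  proof
    fix B assume "B \<in> set L"
    then obtain k where k: "k < n" "B = (\<tau> k, \<tau> (Suc k), \<xi> k)" by (auto simp: L_def)
    then show "valid_block B"
      using assms(1,2) elementary_data_times(1)[OF assms(1), of k] elementary_data_times(2)[OF assms(1), of "Suc k"]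
      by (auto simp: elementary_data_def)
  qed
  show "eproc L = elementary_process n \<tau> \<xi>"
    by (simp add: fun_eq_iff eproc_def L_def elementary_process_def interv_sum_list_conv_sum_set_nat
        atLeast0LessThan comp_def)
  show "eint L = elementary_integral W n \<tau> \<xi>"
    by (simp add: fun_eq_iff eint_def L_def elementary_integral_def interv_sum_list_conv_sum_set_nat
        atLeast0LessThan comp_def)
qed

lemma nn_integral_pm:
  assumes [measurable]: "(\<lambda>(s, \<omega>). g s \<omega>) \<in> borel_measurable pm"
  shows "(\<integral>\<^sup>+\<omega>. (\<integral>\<^sup>+s\<in>{0..T}. g s \<omega> \<partial>lborel) \<partial>M) = (\<integral>\<^sup>+(s, \<omega>). g s \<omega> \<partial>pm)"
proof -
  have "(\<integral>\<^sup>+\<omega>. (\<integral>\<^sup>+s\<in>{0..T}. g s \<omega> \<partial>lborel) \<partial>M) = (\<integral>\<^sup>+\<omega>. (\<integral>\<^sup>+s. g s \<omega> \<partial>lam) \<partial>M)"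
    unfolding lam_def by (subst nn_integral_restrict_space) auto
  also have "\<dots> = (\<integral>\<^sup>+(s, \<omega>). g s \<omega> \<partial>pm)"
    by (subst nn_integral_snd[symmetric]) (auto simp: split_beta')
  finally show ?thesis .
qed

text \<open>Tonelli turns the iterated extended integral of the definition into square integrability
  on the product space, where the Hilbert space lemmas apply.\<close>

lemma L2_processes_iff:
  fixes u :: "real \<Rightarrow> 'w \<Rightarrow> 'b::euclidean_space"
  shows "u \<in> L2_processes M F T \<longleftrightarrow> progressively_measurable F T u \<and> sq_int pm (case_prod u)"
proof -
  have "(\<integral>\<^sup>+\<omega>. (\<integral>\<^sup>+t\<in>{0..T}. ennreal ((norm (u t \<omega>))\<^sup>2) \<partial>lborel) \<partial>M) < \<infinity> \<longleftrightarrow> sq_int pm (case_prod u)"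
    if "progressively_measurable F T u"
  proof -
    have [measurable]: "case_prod u \<in> borel_measurable pm" by (rule progressive_pm[OF that])
    have "(\<integral>\<^sup>+\<omega>. (\<integral>\<^sup>+t\<in>{0..T}. ennreal ((norm (u t \<omega>))\<^sup>2) \<partial>lborel) \<partial>M)
        = (\<integral>\<^sup>+x. ennreal ((norm (case_prod u x))\<^sup>2) \<partial>pm)"
      by (subst nn_integral_pm) (auto simp: split_beta')
    moreover have "(\<integral>\<^sup>+x. ennreal ((norm (case_prod u x))\<^sup>2) \<partial>pm) < \<infinity> \<longleftrightarrow> sq_int pm (case_prod u)"
    proof
      assume "sq_int pm (case_prod u)"
      from sq_int_nn_integral[OF this]
      show "(\<integral>\<^sup>+x. ennreal ((norm (case_prod u x))\<^sup>2) \<partial>pm) < \<infinity>" by (simp only: ennreal_less_top infinity_ennreal_def)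
    qed (rule sq_intI_nn_integral; measurable)
    ultimately show ?thesis by (simp only:)
  qed
  then show ?thesis by (auto simp: L2_processes_def)
qed

lemma progressive_clip:
  fixes u :: "real \<Rightarrow> 'w \<Rightarrow> 'b::euclidean_space"
  assumes "progressively_measurable F T u"
  shows "progressively_measurable F T (\<lambda>s \<omega>. if norm (u s \<omega>) \<le> c then u s \<omega> else 0)"
  unfolding progressively_measurable_def
proof
  fix t assume "t \<in> {0..T}"
  then have [measurable]: "case_prod u \<in> borel_measurable (restrict_space borel {0..t} \<Otimes>\<^sub>M F t)"
    using assms by (auto simp: progressively_measurable_def)
  have "(\<lambda>x. if norm (case_prod u x) \<le> c then case_prod u x else 0) \<in> borel_measurable (restrict_space borel {0..t} \<Otimes>\<^sub>M F t)"
    by measurable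
  then show "(\<lambda>(s, \<omega>). if norm (u s \<omega>) \<le> c then u s \<omega> else 0) \<in> borel_measurable (restrict_space borel {0..t} \<Otimes>\<^sub>M F t)"
    by (simp add: split_beta')
qed

text \<open>Step averages converge in L1 along each path. All differences are bounded by 2 C, so
  their squares are at most 2 C times their size; this gives L2 convergence in time for each path,
  and dominated convergence over \<open>M\<close> gives it on the product.\<close>

lemma bounded_approximation:
  fixes u :: "real \<Rightarrow> 'w \<Rightarrow> 'v"
  assumes u: "progressively_measurable F T u" and C: "0 \<le> C" "\<And>s \<omega>. norm (u s \<omega>) \<le> C"
    and t: "0 < t" "t \<le> T" and e: "e > 0"
  shows "\<exists>n \<tau> \<xi>. elementary_data M F t n \<tau> \<xi> \<and>
     sqn pm (\<lambda>(s, \<omega>). indicat_real {0..t} s *\<^sub>R u s \<omega> - elementary_process n \<tau> \<xi> s \<omega>) < e"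
proof -
  interpret V: interval t by unfold_locales (rule t)
  define \<tau> where "\<tau> n k = t / real n * real k" for n k
  define \<xi> where "\<xi> n k \<omega> = lagged_average t (t / real n) (\<lambda>s. u s \<omega>) k" for n k \<omega>
  have sec: "(\<lambda>s. u s \<omega>) \<in> borel_measurable V.I" if "\<omega> \<in> space M" for \<omega>
  proof -
    have 1: "(\<lambda>(s, \<omega>). u s \<omega>) \<in> borel_measurable (restrict_space borel {0..t} \<Otimes>\<^sub>M F t)"
      using u t by (auto simp: progressively_measurable_def)
    have 2: "(\<lambda>s. (s, \<omega>)) \<in> measurable (restrict_space borel {0..t}) (restrict_space borel {0..t} \<Otimes>\<^sub>M F t)"
      by (rule measurable_Pair2') (use that t in simp)
    have "(\<lambda>s. u s \<omega>) \<in> borel_measurable (restrict_space borel {0..t})"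
      using measurable_compose[OF 2 1] by simp
    moreover have "sets V.I = sets (restrict_space borel {0..t})" by (simp add: V.I_def sets_restrict_space)
    ultimately show ?thesis by (metis measurable_cong_sets)
  qed
  have int: "integrable V.I (\<lambda>s. u s \<omega>)" if "\<omega> \<in> space M" for \<omega>
    by (rule V.I.integrable_const_bound[of _ C]) (use C sec[OF that] in auto)
  have ed: "elementary_data M F t n (\<tau> n) (\<xi> n)" if n: "0 < n" for n
    unfolding elementary_data_def
  proof (intro conjI allI impI)
    show "0 \<le> \<tau> n 0" "\<tau> n n \<le> t" using n by (auto simp: \<tau>_def)
    fix k assume k: "k < n"
    have h: "0 < t / real n" using n t by simp
    show "\<tau> n k \<le> \<tau> n (Suc k)" unfolding \<tau>_def using h by (intro mult_left_mono) auto
    show "bounded (\<xi> n k ` space M)"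
      unfolding bounded_iff \<xi>_def using V.norm_lagged_average_bound[OF n k int C(2) C(1)] by auto
    show "\<xi> n k \<in> borel_measurable (F (\<tau> n k))"
    proof (cases "k = 0")
      case True
      then show ?thesis by (simp add: \<xi>_def[abs_def] lagged_average_def)
    next
      case False
      have "\<tau> n k \<le> \<tau> n n" unfolding \<tau>_def using h k by (intro mult_left_mono) auto
      then have \<tau>t: "\<tau> n k \<le> t" using n by (simp add: \<tau>_def)
      have \<tau>0: "0 \<le> \<tau> n k" unfolding \<tau>_def using h by (intro mult_nonneg_nonneg) auto
      \<comment> \<open>The coefficient on cell k integrates over cell k - 1, which ends exactly
        where cell k begins. Hence it is an integral over times up to that point and known there by
        progressive measurability.\<close>
      have sub: "cell (t / real n) (k - 1) \<subseteq> {0..\<tau> n k}"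
      proof
        fix x assume "x \<in> cell (t / real n) (k - 1)"
        then have x: "t / real n * real (k - 1) < x" "x \<le> t / real n * real (Suc (k - 1))" by (auto simp: cell_def)
        have "0 \<le> t / real n * real (k - 1)" using h by (intro mult_nonneg_nonneg) auto
        then show "x \<in> {0..\<tau> n k}" using x False by (auto simp: \<tau>_def)
      qed
      have eq: "(\<integral>s. indicat_real (cell (t / real n) (k - 1)) s *\<^sub>R u s \<omega> \<partial>restrict_space lborel {0..t})
          = (LBINT s:{0..\<tau> n k}. indicat_real (cell (t / real n) (k - 1)) s *\<^sub>R u s \<omega>)" for \<omega>
        unfolding set_integral_restrict[symmetric] set_lebesgue_integral_def
        by (rule Bochner_Integration.integral_cong) (use sub \<tau>t in \<open>auto split: split_indicator\<close>)
      have "(\<lambda>\<omega>. (1 / (t / real n)) *\<^sub>R (LBINT s:{0..\<tau> n k}. indicat_real (cell (t / real n) (k - 1)) s *\<^sub>R u s \<omega>))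
          \<in> borel_measurable (F (\<tau> n k))"
        by (intro borel_measurable_scaleR borel_measurable_const progressive_integral[OF u]) (use \<tau>t \<tau>0 t in \<open>auto simp: cell_def\<close>)
      then show ?thesis using False by (simp add: \<xi>_def[abs_def] lagged_average_def eq[unfolded One_nat_def])
    qed
  qed
  have ep: "elementary_process n (\<tau> n) (\<xi> n) s \<omega> = step_average t n (\<lambda>s. u s \<omega>) s" for n s \<omega>
    by (simp add: elementary_process_def step_average_def \<xi>_def \<tau>_def cell_def)
  define \<Delta> where "\<Delta> n s \<omega> = indicat_real {0..t} s *\<^sub>R u s \<omega> - step_average t (Suc n) (\<lambda>s. u s \<omega>) s" for n s \<omega>
  have sb: "norm (step_average t (Suc n) (\<lambda>s. u s \<omega>) s) \<le> C" if "\<omega> \<in> space M" for n s \<omega>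
    by (rule V.norm_step_average_bound[OF _ int[OF that] C(2) C(1)]) simp
  have \<Delta>b: "norm (\<Delta> n s \<omega>) \<le> 2 * C" if "\<omega> \<in> space M" for n s \<omega>
    unfolding \<Delta>_def using norm_triangle_ineq4[of "indicat_real {0..t} s *\<^sub>R u s \<omega>" "step_average t (Suc n) (\<lambda>s. u s \<omega>) s"]
      sb[OF that, of n s] C(2)[of s \<omega>] C(1) by (auto split: split_indicator)
  have \<Delta>m: "(\<lambda>(s, \<omega>). \<Delta> n s \<omega>) \<in> borel_measurable pm" for n
  proof -
    let ?L = "map (\<lambda>k. (\<tau> (Suc n) k, \<tau> (Suc n) (Suc k), \<xi> (Suc n) k)) [0..<Suc n]"
    have "valid ?L" "eproc ?L = elementary_process (Suc n) (\<tau> (Suc n)) (\<xi> (Suc n))"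
      using elementary_data_valid[OF ed[of "Suc n"] t(2)] by auto
    then have [measurable]: "(\<lambda>(s, \<omega>). step_average t (Suc n) (\<lambda>s. u s \<omega>) s) \<in> borel_measurable pm"
      using sq_int_measurable[OF sq_int_eproc[of ?L]] by (simp add: ep)
    have [measurable]: "case_prod u \<in> borel_measurable pm" by (rule progressive_pm[OF u])
    have [measurable]: "indicat_real {0..t} \<in> borel_measurable lam" by (rule borel_measurable_lam) simp
    have "(\<lambda>x. indicat_real {0..t} (fst x) *\<^sub>R case_prod u x - (\<lambda>(s, \<omega>). step_average t (Suc n) (\<lambda>s. u s \<omega>) s) x) \<in> borel_measurable pm"
      by measurable
    then show ?thesis by (simp add: \<Delta>_def split_beta')
  qed
  have \<Delta>i: "integrable pm (\<lambda>(s, \<omega>). (norm (\<Delta> n s \<omega>))\<^sup>2)" for n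
  proof (rule pm.integrable_const_bound[of _ "(2 * C)\<^sup>2"])
    show "AE x in pm. norm (case x of (s, \<omega>) \<Rightarrow> (norm (\<Delta> n s \<omega>))\<^sup>2) \<le> (2 * C)\<^sup>2"
    proof (rule AE_I2)
      fix x assume "x \<in> space pm"
      then have "snd x \<in> space M" by (auto simp: space_pair_measure)
      from power_mono[OF \<Delta>b[OF this, of n "fst x"] norm_ge_zero, of 2]
      show "norm (case x of (s, \<omega>) \<Rightarrow> (norm (\<Delta> n s \<omega>))\<^sup>2) \<le> (2 * C)\<^sup>2" by (simp add: split_beta')
    qed
    show "(\<lambda>(s, \<omega>). (norm (\<Delta> n s \<omega>))\<^sup>2) \<in> borel_measurable pm"
      using \<Delta>m[of n] by (simp add: split_beta')
  qed
  define \<psi> where "\<psi> n \<omega> = (\<integral>s. (norm (\<Delta> n s \<omega>))\<^sup>2 \<partial>lam)" for n \<omega>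
  have sqn_eq: "sqn pm (\<lambda>(s, \<omega>). \<Delta> n s \<omega>) = (\<integral>\<omega>. \<psi> n \<omega> \<partial>M)" for n
    using integral_snd[OF \<Delta>i[of n]] by (simp add: sqn_def \<psi>_def split_beta')
  have lamsec: "(\<lambda>s. (norm (\<Delta> n s \<omega>))\<^sup>2) \<in> borel_measurable lam" if "\<omega> \<in> space M" for n \<omega>
  proof -
    have "(\<lambda>s. (s, \<omega>)) \<in> measurable lam pm" by (rule measurable_Pair2'[OF that])
    from measurable_compose[OF this \<Delta>m[of n]] show ?thesis by simp
  qed
  have \<psi>b: "\<bar>\<psi> n \<omega>\<bar> \<le> (2 * C)\<^sup>2 * T" if "\<omega> \<in> space M" for n \<omega>
  proof -
    have "\<psi> n \<omega> \<le> (\<integral>s. (2 * C)\<^sup>2 \<partial>lam)"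
      unfolding \<psi>_def
    proof (rule integral_mono)
      show "integrable lam (\<lambda>s. (norm (\<Delta> n s \<omega>))\<^sup>2)"
        by (rule lam.integrable_const_bound[of _ "(2 * C)\<^sup>2"]) (use power_mono[OF \<Delta>b[OF that] norm_ge_zero, of _ _ 2] lamsec[OF that] in auto)
    qed (use power_mono[OF \<Delta>b[OF that] norm_ge_zero, of _ _ 2] in auto)
    also have "\<dots> = (2 * C)\<^sup>2 * T"
      using emeasure_lam[of "{0..T}"] T_pos by (simp add: measure_def)
    finally show ?thesis by (simp add: \<psi>_def integral_nonneg_AE)
  qed
  have \<psi>0: "(\<lambda>n. \<psi> n \<omega>) \<longlonglongrightarrow> 0" if w: "\<omega> \<in> space M" for \<omega>
  proof (rule tendsto_sandwich[OF always_eventually always_eventually tendsto_const])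
    let ?g = "\<lambda>n. \<integral>s. norm (u s \<omega> - step_average t (Suc n) (\<lambda>s. u s \<omega>) s) \<partial>V.I"
    show "\<forall>n. \<psi> n \<omega> \<le> 2 * C * ?g n"
    proof
      fix n
      have "\<psi> n \<omega> = (\<integral>s. (norm (u s \<omega> - step_average t (Suc n) (\<lambda>s. u s \<omega>) s))\<^sup>2 \<partial>V.I)"
        unfolding \<psi>_def lam_def V.I_def set_integral_restrict[symmetric] set_lebesgue_integral_def
      proof (rule Bochner_Integration.integral_cong[OF refl])
        fix s :: real
        have "step_average t (Suc n) (\<lambda>s. u s \<omega>) s = 0" if "s \<notin> {0..t}"
        proof -
          have "s \<notin> cell (t / real (Suc n)) k" if "k < Suc n" for k
            using cell_subset[OF t(1) that] \<open>s \<notin> {0..t}\<close> by auto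
          then show ?thesis unfolding step_average_def by (intro sum.neutral) auto
        qed
        then show "indicat_real {0..T} s *\<^sub>R (norm (\<Delta> n s \<omega>))\<^sup>2
            = indicat_real {0..t} s *\<^sub>R (norm (u s \<omega> - step_average t (Suc n) (\<lambda>s. u s \<omega>) s))\<^sup>2"
          using t by (auto simp: \<Delta>_def split: split_indicator)
      qed
      also have "\<dots> \<le> (\<integral>s. 2 * C * norm (u s \<omega> - step_average t (Suc n) (\<lambda>s. u s \<omega>) s) \<partial>V.I)"
      proof (rule integral_mono)
        have i: "integrable V.I (\<lambda>s. u s \<omega> - step_average t (Suc n) (\<lambda>s. u s \<omega>) s)"
          by (intro Bochner_Integration.integrable_diff int[OF w] V.step_average_contraction(1)) simp
        then show "integrable V.I (\<lambda>s. 2 * C * norm (u s \<omega> - step_average t (Suc n) (\<lambda>s. u s \<omega>) s))" by simp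
        have b: "norm (u s \<omega> - step_average t (Suc n) (\<lambda>s. u s \<omega>) s) \<le> 2 * C" for s
          using norm_triangle_ineq4[of "u s \<omega>" "step_average t (Suc n) (\<lambda>s. u s \<omega>) s"] sb[OF w, of n s] C(2)[of s \<omega>]
          by linarith
        then show "(norm (u s \<omega> - step_average t (Suc n) (\<lambda>s. u s \<omega>) s))\<^sup>2
            \<le> 2 * C * norm (u s \<omega> - step_average t (Suc n) (\<lambda>s. u s \<omega>) s)" for s
          by (simp add: power2_eq_square mult_right_mono)
        show "integrable V.I (\<lambda>s. (norm (u s \<omega> - step_average t (Suc n) (\<lambda>s. u s \<omega>) s))\<^sup>2)"
          by (rule V.I.integrable_const_bound[of _ "(2 * C)\<^sup>2"])
             (use power_mono[OF b norm_ge_zero, of _ 2] borel_measurable_integrable[OF i] in auto)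
      qed
      finally show "\<psi> n \<omega> \<le> 2 * C * ?g n" by simp
    qed
    show "(\<lambda>n. 2 * C * ?g n) \<longlonglongrightarrow> 0"
      using tendsto_mult_left[OF V.step_average_L1[OF sec[OF w] C(2) C(1)], of "2 * C"] by simp
  qed (simp add: \<psi>_def integral_nonneg_AE)
  have "(\<lambda>n. \<integral>\<omega>. \<psi> n \<omega> \<partial>M) \<longlonglongrightarrow> (\<integral>\<omega>. 0 \<partial>M)"
  proof (rule integral_dominated_convergence[where w = "\<lambda>_. (2 * C)\<^sup>2 * T"])
    show "\<psi> n \<in> borel_measurable M" for n
      unfolding \<psi>_def[abs_def] using integrable_snd[OF \<Delta>i[of n]] by (rule borel_measurable_integrable)
    show "AE \<omega> in M. norm (\<psi> n \<omega>) \<le> (2 * C)\<^sup>2 * T" for n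
      by (rule AE_I2) (simp only: real_norm_def \<psi>b)
  qed (use \<psi>0 in auto)
  then have "eventually (\<lambda>n. (\<integral>\<omega>. \<psi> n \<omega> \<partial>M) < e) sequentially" using e by (intro order_tendstoD) auto
  then obtain n where "(\<integral>\<omega>. \<psi> n \<omega> \<partial>M) < e" by (auto simp: eventually_sequentially)
  then have "sqn pm (\<lambda>(s, \<omega>). \<Delta> n s \<omega>) < e" by (simp only: sqn_eq)
  then show ?thesis
    using ed[of "Suc n"] by (intro exI[of _ "Suc n"] exI[of _ "\<tau> (Suc n)"] exI[of _ "\<xi> (Suc n)"]) (simp add: ep \<Delta>_def)
qed

text \<open>At each point the clipped value is eventually the full one, and the squared norm of u
  dominates.\<close>

lemma clip_approximation:
  assumes u: "sq_int pm (case_prod u)"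
  shows "(\<lambda>n. sqn pm (\<lambda>(s, \<omega>). u s \<omega> - (if norm (u s \<omega>) \<le> real n then u s \<omega> else 0))) \<longlonglongrightarrow> 0"
proof -
  have [measurable]: "case_prod u \<in> borel_measurable pm" by (rule sq_int_measurable[OF u])
  let ?d = "\<lambda>n x. case_prod u x - (if norm (case_prod u x) \<le> real n then case_prod u x else 0)"
  have "(\<lambda>n. \<integral>x. (norm (?d n x))\<^sup>2 \<partial>pm) \<longlonglongrightarrow> (\<integral>x. 0 \<partial>pm)"
  proof (rule integral_dominated_convergence[where w = "\<lambda>x. (norm (case_prod u x))\<^sup>2"])
    show "AE x in pm. (\<lambda>n. (norm (?d n x))\<^sup>2) \<longlonglongrightarrow> 0"
    proof (rule AE_I2)
      fix x
      obtain n0 where "norm (case_prod u x) \<le> real n0" using real_arch_simple by blast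
      then have "\<forall>n\<ge>n0. (norm (?d n x))\<^sup>2 = 0" by auto
      then show "(\<lambda>n. (norm (?d n x))\<^sup>2) \<longlonglongrightarrow> 0"
        by (intro tendsto_eventually eventually_sequentiallyI[of n0]) simp
    qed
  qed (use sq_int_integrable[OF u] in auto)
  then show ?thesis by (simp add: sqn_def split_beta' cong: if_cong)
qed

text \<open>Elementary processes live on left-open intervals and vanish at time 0; this lets them be
  compared with integrands on closed intervals.\<close>

lemma AE_pm_nonzero: "AE x in pm. fst x \<noteq> 0"
proof (rule AE_pair_measure)
  have "(\<lambda>s. s) \<in> borel_measurable lam" by (rule borel_measurable_lam) simp
  then have [measurable]: "fst \<in> borel_measurable pm" by (rule measurable_compose[OF measurable_fst])
  show "{x \<in> space pm. fst x \<noteq> 0} \<in> sets pm" by measurable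
  have "AE s in lborel. s \<noteq> (0::real)" by (rule AE_lborel_singleton)
  then have "AE s in lam. s \<noteq> 0" unfolding lam_def by (subst AE_restrict_space_iff) auto
  then show "AE s in lam. AE \<omega> in M. fst (s, \<omega>) \<noteq> 0" by eventually_elim simp
qed

lemma elementary_dense:
  fixes u :: "real \<Rightarrow> 'w \<Rightarrow> 'v"
  assumes u: "u \<in> L2_processes M F T" and t: "t \<in> {0..T}"
  shows "\<exists>n \<tau> \<xi>. (\<forall>j. elementary_data M F t (n j) (\<tau> j) (\<xi> j)) \<and>
     (\<lambda>j. sqn pm (\<lambda>(s, \<omega>). indicat_real {0..t} s *\<^sub>R u s \<omega> - elementary_process (n j) (\<tau> j) (\<xi> j) s \<omega>)) \<longlonglongrightarrow> 0"
proof -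
  have u': "progressively_measurable F T u" "sq_int pm (case_prod u)" using u by (auto simp: L2_processes_iff)
  have "\<exists>n \<tau> \<xi>. elementary_data M F t n \<tau> \<xi> \<and>
     sqn pm (\<lambda>(s, \<omega>). indicat_real {0..t} s *\<^sub>R u s \<omega> - elementary_process n \<tau> \<xi> s \<omega>) < e" if e: "e > 0" for e
  proof (cases "t = 0")
    case True
    \<comment> \<open>For t = 0 the integrand lives on the null slice at time 0, and the empty
      elementary process approximates it exactly.\<close>
    have "sqn pm (\<lambda>(s, \<omega>). indicat_real {0..t} s *\<^sub>R u s \<omega> - elementary_process 0 (\<lambda>_. 0) (\<lambda>_ _. 0) s \<omega>)
        = sqn pm (\<lambda>x. 0 :: 'v)"
    proof (rule sqn_AE_cong)
      show "(\<lambda>(s, \<omega>). indicat_real {0..t} s *\<^sub>R u s \<omega> - elementary_process 0 (\<lambda>_. 0) (\<lambda>_ _. 0) s \<omega>) \<in> borel_measurable pm"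
        using sq_int_measurable[OF pm_indicator(1)[OF u'(2), of "{0..t}"]] by (simp add: elementary_process_def)
      show "AE x in pm. (case x of (s, \<omega>) \<Rightarrow> indicat_real {0..t} s *\<^sub>R u s \<omega> - elementary_process 0 (\<lambda>_. 0) (\<lambda>_ _. 0) s \<omega>) = 0"
        using AE_pm_nonzero
        by eventually_elim (auto simp: elementary_process_def True split: split_indicator)
    qed simp
    then have "sqn pm (\<lambda>(s, \<omega>). indicat_real {0..t} s *\<^sub>R u s \<omega> - elementary_process 0 (\<lambda>_. 0) (\<lambda>_ _. 0) s \<omega>) = 0"
      by (simp add: sqn_def)
    then show ?thesis using e True
      by (intro exI[of _ 0] exI[of _ "\<lambda>_. 0"] exI[of _ "\<lambda>_ _. 0"]) (auto simp: elementary_data_def)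
  next
    case False
    then have t': "0 < t" "t \<le> T" using t by auto
    \<comment> \<open>Clipping and step approximation each cost e / 4, and
      \<open>sqn_triangle\<close> doubles both.\<close>
    have "eventually (\<lambda>n. sqn pm (\<lambda>(s, \<omega>). u s \<omega> - (if norm (u s \<omega>) \<le> real n then u s \<omega> else 0)) < e / 4) sequentially"
      using clip_approximation[OF u'(2)] e by (intro order_tendstoD) auto
    then obtain N where N: "sqn pm (\<lambda>(s, \<omega>). u s \<omega> - (if norm (u s \<omega>) \<le> real N then u s \<omega> else 0)) < e / 4"
      by (auto simp: eventually_sequentially)
    define v where "v s \<omega> = (if norm (u s \<omega>) \<le> real N then u s \<omega> else 0)" for s \<omega>
    have v: "progressively_measurable F T v" unfolding v_def[abs_def] by (rule progressive_clip[OF u'(1)])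
    have vb: "norm (v s \<omega>) \<le> real N" for s \<omega> by (simp add: v_def)
    then have vs: "sq_int pm (case_prod v)"
      by (intro pm.sq_int_bounded[of _ "real N"] progressive_pm[OF v]) auto
    obtain n \<tau> \<xi> where el: "elementary_data M F t n \<tau> \<xi>"
      "sqn pm (\<lambda>(s, \<omega>). indicat_real {0..t} s *\<^sub>R v s \<omega> - elementary_process n \<tau> \<xi> s \<omega>) < e / 4"
      using bounded_approximation[OF v, of "real N" t "e / 4"] t' e vb by auto
    have ep: "sq_int pm (\<lambda>(s, \<omega>). elementary_process n \<tau> \<xi> s \<omega>)"
      using sq_int_eproc[OF elementary_data_valid(1)[OF el(1) t'(2)]] elementary_data_valid(2)[OF el(1) t'(2)] by simp
    have iu: "sq_int pm (\<lambda>(s, \<omega>). indicat_real {0..t} s *\<^sub>R u s \<omega>)"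
      and iv: "sq_int pm (\<lambda>(s, \<omega>). indicat_real {0..t} s *\<^sub>R v s \<omega>)"
      using pm_indicator(1)[OF u'(2), of "{0..t}"] pm_indicator(1)[OF vs, of "{0..t}"] by auto
    have "sqn pm (\<lambda>(s, \<omega>). indicat_real {0..t} s *\<^sub>R (u s \<omega> - v s \<omega>)) \<le> sqn pm (\<lambda>(s, \<omega>). u s \<omega> - v s \<omega>)"
      by (rule pm_indicator(2)[OF pm_diff[OF u'(2) vs]]) simp
    then have a: "sqn pm (\<lambda>(s, \<omega>). indicat_real {0..t} s *\<^sub>R u s \<omega> - indicat_real {0..t} s *\<^sub>R v s \<omega>) < e / 4"
      using N by (simp add: v_def scaleR_diff_right)
    have "sqn pm (\<lambda>(s, \<omega>). indicat_real {0..t} s *\<^sub>R u s \<omega> - elementary_process n \<tau> \<xi> s \<omega>) < e"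
      using sqn_triangle[OF iu iv ep] a el(2) by (simp add: split_beta')
    then show ?thesis using el(1) by blast
  qed
  then have "\<forall>j. \<exists>n \<tau> \<xi>. elementary_data M F t n \<tau> \<xi> \<and>
     sqn pm (\<lambda>(s, \<omega>). indicat_real {0..t} s *\<^sub>R u s \<omega> - elementary_process n \<tau> \<xi> s \<omega>) < inverse (real (Suc j))"
    by simp
  then obtain n \<tau> \<xi> where e: "\<And>j. elementary_data M F t (n j) (\<tau> j) (\<xi> j)"
    "\<And>j. sqn pm (\<lambda>(s, \<omega>). indicat_real {0..t} s *\<^sub>R u s \<omega> - elementary_process (n j) (\<tau> j) (\<xi> j) s \<omega>) < inverse (real (Suc j))"
    by (subst (asm) choice_iff, elim exE, subst (asm) choice_iff, elim exE, subst (asm) choice_iff, elim exE) blast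
  have "(\<lambda>j. sqn pm (\<lambda>(s, \<omega>). indicat_real {0..t} s *\<^sub>R u s \<omega> - elementary_process (n j) (\<tau> j) (\<xi> j) s \<omega>)) \<longlonglongrightarrow> 0"
    by (rule tendsto_sandwich[OF always_eventually always_eventually tendsto_const LIMSEQ_inverse_real_of_nat])
       (use e(2) in \<open>auto intro: less_imp_le\<close>)
  then show ?thesis using e(1) by blast
qed

section \<open>The integral as a continuous martingale in its upper limit\<close>

lemma SI_indicator_diff:
  assumes "SI (\<lambda>p \<omega>. indicat_real {0<..t} p *\<^sub>R u p \<omega>) I" "SI (\<lambda>p \<omega>. indicat_real {0<..s} p *\<^sub>R u p \<omega>) J"
    and "0 \<le> s" "s \<le> t"
  shows "SI (\<lambda>p \<omega>. indicat_real {s<..t} p *\<^sub>R u p \<omega>) (\<lambda>\<omega>. I \<omega> - J \<omega>)"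
proof -
  have "(\<lambda>p \<omega>. indicat_real {0<..t} p *\<^sub>R u p \<omega> - indicat_real {0<..s} p *\<^sub>R u p \<omega>)
      = (\<lambda>p \<omega>. indicat_real {s<..t} p *\<^sub>R u p \<omega>)"
    using assms(3,4) by (auto simp: fun_eq_iff split: split_indicator)
  then show ?thesis using SI_diff[OF assms(1,2)] by simp
qed

text \<open>The increment from s to t is the integral over the window (s, t], so
  \<open>SI_orthogonal\<close> makes it orthogonal to everything known at s.\<close>

lemma cmart_from_SI:
  assumes "\<And>t. t \<in> {0..T} \<Longrightarrow> N t \<in> borel_measurable (F t)"
    and "\<And>\<omega>. \<omega> \<in> space M \<Longrightarrow> continuous_on {0..T} (\<lambda>t. N t \<omega>)"
    and SI: "\<And>t. t \<in> {0..T} \<Longrightarrow> SI (\<lambda>p \<omega>. indicat_real {0<..t} p *\<^sub>R u p \<omega>) (N t)"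
  shows "cmart N"
  unfolding cmart_def
proof (intro conjI ballI allI impI)
  fix t assume "t \<in> {0..T}"
  then show "N t \<in> borel_measurable (F t)" "sq_int M (N t)" using assms(1) SI_sq_int(2)[OF SI] by auto
next
  fix s t and \<xi> :: "'w \<Rightarrow> real"
  assume a: "0 \<le> s" "s \<le> t" "t \<le> T" "\<xi> \<in> borel_measurable (F s)" "sq_int M \<xi>"
  have st: "s \<in> {0..T}" "t \<in> {0..T}" using a by auto
  have "(\<integral>\<omega>. \<xi> \<omega> * (N t \<omega> - N s \<omega>) \<partial>M) = 0"
    by (rule SI_orthogonal[OF SI_indicator_diff[OF SI[OF st(2)] SI[OF st(1)] a(1,2)] a])
  moreover have "(\<integral>\<omega>. \<xi> \<omega> * (N t \<omega> - N s \<omega>) \<partial>M) = (\<integral>\<omega>. \<xi> \<omega> * N t \<omega> \<partial>M) - (\<integral>\<omega>. \<xi> \<omega> * N s \<omega> \<partial>M)"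
    unfolding right_diff_distrib
    by (intro Bochner_Integration.integral_diff sq_int_mult a SI_sq_int(2)[OF SI] st)
  ultimately show "(\<integral>\<omega>. \<xi> \<omega> * N t \<omega> \<partial>M) = (\<integral>\<omega>. \<xi> \<omega> * N s \<omega> \<partial>M)" by simp
qed (fact assms(2))

lemma SI_trunc:
  assumes "valid L" "t \<in> {0..T}"
  shows "SI (\<lambda>p \<omega>. indicat_real {0<..t} p *\<^sub>R eproc L p \<omega>) (eint (trunc 0 t L))"
  using SI_elementary[OF valid_trunc[OF assms(1), of 0 t]] assms(2) by (simp add: eproc_trunc[abs_def])

lemma cmart_elementary:
  assumes "valid L" shows "cmart (\<lambda>t. eint (trunc 0 t L))"
proof (rule cmart_from_SI[OF _ _ SI_trunc[OF assms]])
  fix t assume t: "t \<in> {0..T}"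
  show "eint (trunc 0 t L) \<in> borel_measurable (F t)"
    using assms
  proof (induction L)
    case (Cons B L)
    obtain a b \<xi> where B: "B = (a, b, \<xi>)" by (cases B) auto
    then have v: "0 \<le> a" "a \<le> b" "\<xi> \<in> borel_measurable (F a)" using Cons.prems by auto
    have "block_int (a, max a (min b t), \<xi>) \<in> borel_measurable (F t)"
    proof (cases "a \<le> t")
      case True
      have [measurable]: "\<xi> \<in> borel_measurable (F t)" "W a \<in> borel_measurable (F t)"
        "W (max a (min b t)) \<in> borel_measurable (F t)"
        using v True t by (auto intro: measurable_F_mono measurable_W)
      have "(\<lambda>\<omega>. \<xi> \<omega> \<bullet> (W (max a (min b t)) \<omega> - W a \<omega>)) \<in> borel_measurable (F t)" by measurable
      then show ?thesis by (simp add: fun_eq_iff cong: measurable_cong)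
    next
      case False
      \<comment> \<open>The coefficient of a block that starts after t may not yet be known at t,
        but the truncated block is degenerate and its integral vanishes identically.\<close>
      then have "block_int (a, max a (min b t), \<xi>) = (\<lambda>\<omega>. 0)" by (auto simp: fun_eq_iff)
      then show ?thesis by simp
    qed
    moreover have "eint (trunc 0 t (B # L)) = (\<lambda>\<omega>. block_int (a, max a (min b t), \<xi>) \<omega> + eint (trunc 0 t L) \<omega>)"
      using v by (simp add: fun_eq_iff eint_def trunc_def B max_absorb1)
    ultimately show ?case using Cons by (simp del: block_int.simps)
  qed (simp add: eint_def[abs_def] trunc_def)
next
  fix \<omega> assume w: "\<omega> \<in> space M"
  show "continuous_on {0..T} (\<lambda>t. eint (trunc 0 t L) \<omega>)"
    using assms
  proof (induction L)
    case (Cons B L)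
    obtain a b \<xi> where B: "B = (a, b, \<xi>)" by (cases B) auto
    then have v: "0 \<le> a" "a \<le> b" using Cons.prems by auto
    have "continuous_on {0..T} (\<lambda>t. W (max a (min b t)) \<omega>)"
      by (rule continuous_on_compose2[OF W_cont[OF w]]) (use v in \<open>auto intro!: continuous_intros\<close>)
    moreover have "eint (trunc 0 t (B # L)) \<omega> = \<xi> \<omega> \<bullet> (W (max a (min b t)) \<omega> - W a \<omega>) + eint (trunc 0 t L) \<omega>" for t
      using v by (simp add: eint_def trunc_def B max_absorb1)
    ultimately show ?case using Cons by (auto intro!: continuous_intros)
  qed (simp add: eint_def trunc_def)
qed

text \<open>One process represents the integral at all times at once. Elementary integrals are
  continuous because W is, the isometry makes their values at T a Cauchy sequence, and
  \<open>cmart_limit\<close> supplies a continuous limit.\<close>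

lemma ito_integral_exists:
  fixes u :: "real \<Rightarrow> 'w \<Rightarrow> 'v"
  assumes u: "u \<in> L2_processes M F T"
  obtains N where "cmart N" "\<And>t. t \<in> {0..T} \<Longrightarrow> SI (\<lambda>p \<omega>. indicat_real {0<..t} p *\<^sub>R u p \<omega>) (N t)"
proof -
  have T: "T \<in> {0..T}" using T_pos by simp
  have us: "sq_int pm (case_prod u)" using u by (simp add: L2_processes_iff)
  obtain n \<tau> \<xi> where e: "\<And>j. elementary_data M F T (n j) (\<tau> j) (\<xi> j)"
     "(\<lambda>j. sqn pm (\<lambda>(s, \<omega>). indicat_real {0..T} s *\<^sub>R u s \<omega> - elementary_process (n j) (\<tau> j) (\<xi> j) s \<omega>)) \<longlonglongrightarrow> 0"
    using elementary_dense[OF u T] by blast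
  define L where "L j = map (\<lambda>k. (\<tau> j k, \<tau> j (Suc k), \<xi> j k)) [0..<n j]" for j
  have L: "valid (L j)" "eproc (L j) = elementary_process (n j) (\<tau> j) (\<xi> j)" for j
    using elementary_data_valid[OF e(1)[of j] order_refl] by (auto simp only: L_def)
  have conv: "(\<lambda>j. sqn pm (\<lambda>(s, \<omega>). eproc (L j) s \<omega> - u s \<omega>)) \<longlonglongrightarrow> 0"
  proof -
    have "sqn pm (\<lambda>(s, \<omega>). eproc (L j) s \<omega> - u s \<omega>)
        = sqn pm (\<lambda>(s, \<omega>). indicat_real {0..T} s *\<^sub>R u s \<omega> - elementary_process (n j) (\<tau> j) (\<xi> j) s \<omega>)" for j
      unfolding sqn_def
      by (rule Bochner_Integration.integral_cong[OF refl])
         (auto simp: space_pair_measure L norm_minus_commute)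
    then show ?thesis using e(2) by simp
  qed
  define N where "N j t = eint (trunc 0 t (L j))" for j t
  have N: "cmart (N j)" for j unfolding N_def[abs_def] by (rule cmart_elementary[OF L(1)])
  have NSI: "SI (\<lambda>p \<omega>. indicat_real {0<..t} p *\<^sub>R eproc (L j) p \<omega>) (N j t)" if "t \<in> {0..T}" for j t
    unfolding N_def by (rule SI_trunc[OF L(1) that])
  have s1: "sq_int pm (\<lambda>(s, \<omega>). eproc (L j) s \<omega>)" for j by (rule sq_int_eproc[OF L(1)])
  have dist: "sqn pm (\<lambda>(s, \<omega>). eproc (L i) s \<omega> - eproc (L j) s \<omega>)
      \<le> 2 * sqn pm (\<lambda>(s, \<omega>). eproc (L i) s \<omega> - u s \<omega>) + 2 * sqn pm (\<lambda>(s, \<omega>). eproc (L j) s \<omega> - u s \<omega>)" for i j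
    using sqn_triangle[OF s1[of i] us s1[of j]] sqn_minus[of pm "case_prod u" "case_prod (eproc (L j))"]
    by (simp add: split_beta')
  have Cauchy: "\<exists>n0. \<forall>i\<ge>n0. \<forall>j\<ge>n0. sqn M (\<lambda>\<omega>. N i T \<omega> - N j T \<omega>) < e" if e0: "e > 0" for e
  proof -
    have "eventually (\<lambda>j. sqn pm (\<lambda>(s, \<omega>). eproc (L j) s \<omega> - u s \<omega>) < e / 4) sequentially"
      using e0 by (intro order_tendstoD(2)[OF conv]) simp
    then obtain n0 where n0: "\<And>j. j \<ge> n0 \<Longrightarrow> sqn pm (\<lambda>(s, \<omega>). eproc (L j) s \<omega> - u s \<omega>) < e / 4"
      by (auto simp: eventually_sequentially)
    have "sqn M (\<lambda>\<omega>. N i T \<omega> - N j T \<omega>) < e" if "i \<ge> n0" "j \<ge> n0" for i j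
    proof -
      have "sqn M (\<lambda>\<omega>. N i T \<omega> - N j T \<omega>)
          = sqn pm (\<lambda>(s, \<omega>). indicat_real {0<..T} s *\<^sub>R (eproc (L i) s \<omega> - eproc (L j) s \<omega>))"
        using SI_distance[OF NSI[OF T, of i] NSI[OF T, of j]] by (simp add: scaleR_diff_right)
      also have "\<dots> \<le> sqn pm (\<lambda>(s, \<omega>). eproc (L i) s \<omega> - eproc (L j) s \<omega>)"
        by (rule pm_indicator(2)[OF pm_diff[OF s1 s1]]) simp
      also have "\<dots> < e" using dist[of i j] n0[OF that(1)] n0[OF that(2)] by linarith
      finally show ?thesis .
    qed
    then show ?thesis by blast
  qed
  obtain N0 where N0: "cmart N0"
    "\<And>e. e > 0 \<Longrightarrow> \<exists>n0. \<forall>n\<ge>n0. \<forall>t\<in>{0..T}. sqn M (\<lambda>\<omega>. N n t \<omega> - N0 t \<omega>) \<le> e"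
    using cmart_limit[OF N Cauchy] by blast
  show thesis
  proof (rule that[OF N0(1)])
    fix t assume t: "t \<in> {0..T}"
    show "SI (\<lambda>p \<omega>. indicat_real {0<..t} p *\<^sub>R u p \<omega>) (N0 t)"
    proof (rule SI_limit[OF NSI[OF t]])
      show "sq_int pm (\<lambda>(p, \<omega>). indicat_real {0<..t} p *\<^sub>R u p \<omega>)" by (rule pm_indicator(1)[OF us]) simp
      show "sq_int M (N0 t)" by (rule cmart_sq_int[OF N0(1) t])
      show "(\<lambda>j. sqn pm (\<lambda>(p, \<omega>). indicat_real {0<..t} p *\<^sub>R eproc (L j) p \<omega> - indicat_real {0<..t} p *\<^sub>R u p \<omega>)) \<longlonglongrightarrow> 0"
      proof (rule tendsto_sandwich[OF always_eventually always_eventually tendsto_const conv], safe)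
        fix j
        show "sqn pm (\<lambda>(p, \<omega>). indicat_real {0<..t} p *\<^sub>R eproc (L j) p \<omega> - indicat_real {0<..t} p *\<^sub>R u p \<omega>)
          \<le> sqn pm (\<lambda>(s, \<omega>). eproc (L j) s \<omega> - u s \<omega>)"
          using pm_indicator(2)[OF pm_diff[OF s1[of j] us], of "{0<..t}"] by (simp add: scaleR_diff_right)
      qed simp
      show "(\<lambda>j. sqn M (\<lambda>\<omega>. N j t \<omega> - N0 t \<omega>)) \<longlonglongrightarrow> 0"
      proof (rule LIMSEQ_I)
        fix e :: real assume "e > 0"
        then obtain n0 where "\<forall>n\<ge>n0. \<forall>t\<in>{0..T}. sqn M (\<lambda>\<omega>. N n t \<omega> - N0 t \<omega>) \<le> e / 2"
          using N0(2)[of "e / 2"] by auto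
        then show "\<exists>n0. \<forall>n\<ge>n0. norm (sqn M (\<lambda>\<omega>. N n t \<omega> - N0 t \<omega>) - 0) < e"
          using t \<open>e > 0\<close> by (intro exI[of _ n0]) force
      qed
    qed
  qed
qed

section \<open>Agreement with the Ito integral of the definitions\<close>

lemma SI_indicator_Icc:
  assumes "sq_int pm (case_prod u)"
  shows "SI (\<lambda>p \<omega>. indicat_real {0<..t} p *\<^sub>R u p \<omega>) I \<longleftrightarrow> SI (\<lambda>p \<omega>. indicat_real {0..t} p *\<^sub>R u p \<omega>) I"
proof -
  have m: "(\<lambda>(p, \<omega>). indicat_real {0<..t} p *\<^sub>R u p \<omega>) \<in> borel_measurable pm"
    "(\<lambda>(p, \<omega>). indicat_real {0..t} p *\<^sub>R u p \<omega>) \<in> borel_measurable pm"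
    by (rule sq_int_measurable, rule pm_indicator(1)[OF assms], simp)+
  have ae: "AE x in pm. (\<lambda>(p, \<omega>). indicat_real {0<..t} p *\<^sub>R u p \<omega>) x = (\<lambda>(p, \<omega>). indicat_real {0..t} p *\<^sub>R u p \<omega>) x"
    using AE_pm_nonzero AE_space by eventually_elim (auto simp: space_pair_measure split: split_indicator)
  then have ae': "AE x in pm. (\<lambda>(p, \<omega>). indicat_real {0..t} p *\<^sub>R u p \<omega>) x = (\<lambda>(p, \<omega>). indicat_real {0<..t} p *\<^sub>R u p \<omega>) x"
    by eventually_elim simp
  show ?thesis
    using SI_AE_cong[OF _ m(2) ae, of I I] SI_AE_cong[OF _ m(1) ae', of I I] SI_sq_int(2) sq_int_measurable
    by (metis (mono_tags, lifting) AE_I2)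
qed

text \<open>\<open>SI\<close> approximates on [0, T] by arbitrary lists,
  \<open>has_ito_integral\<close> on [0, t] by ordered partitions. One direction reads elementary
  data as lists. For the other, \<open>elementary_dense\<close> supplies data close to the
  integrand, and the isometry carries this closeness over to the integrals.\<close>

lemma has_ito_integral_iff:
  fixes u :: "real \<Rightarrow> 'w \<Rightarrow> 'v"
  assumes u: "u \<in> L2_processes M F T" and t: "t \<in> {0..T}"
  shows "has_ito_integral M F W t u I \<longleftrightarrow> SI (\<lambda>p \<omega>. indicat_real {0<..t} p *\<^sub>R u p \<omega>) I"
proof -
  have us: "sq_int pm (case_prod u)" using u by (simp add: L2_processes_iff)
  have iu: "sq_int pm (\<lambda>(p, \<omega>). indicat_real {0..t} p *\<^sub>R u p \<omega>)" by (rule pm_indicator(1)[OF us]) simp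
  have t': "t \<le> T" using t by simp
  have ep: "sq_int pm (\<lambda>(s, \<omega>). indicat_real {0..t} s *\<^sub>R u s \<omega> - elementary_process n \<tau> \<xi> s \<omega>)"
    if "elementary_data M F t n \<tau> \<xi>" for n \<tau> \<xi>
    using pm_diff[OF iu sq_int_eproc[OF elementary_data_valid(1)[OF that t']]] elementary_data_valid(2)[OF that t'] by simp
  have nn: "(\<integral>\<^sup>+\<omega>. (\<integral>\<^sup>+s\<in>{0..t}. ennreal ((norm (u s \<omega> - elementary_process n \<tau> \<xi> s \<omega>))\<^sup>2) \<partial>lborel) \<partial>M)
      = ennreal (sqn pm (\<lambda>(s, \<omega>). indicat_real {0..t} s *\<^sub>R u s \<omega> - elementary_process n \<tau> \<xi> s \<omega>))"
    if ed: "elementary_data M F t n \<tau> \<xi>" for n \<tau> \<xi>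
  proof -
    let ?d = "\<lambda>s \<omega>. indicat_real {0..t} s *\<^sub>R u s \<omega> - elementary_process n \<tau> \<xi> s \<omega>"
    have "(\<integral>\<^sup>+\<omega>. (\<integral>\<^sup>+s\<in>{0..t}. ennreal ((norm (u s \<omega> - elementary_process n \<tau> \<xi> s \<omega>))\<^sup>2) \<partial>lborel) \<partial>M)
      = (\<integral>\<^sup>+\<omega>. (\<integral>\<^sup>+s\<in>{0..T}. ennreal ((norm (?d s \<omega>))\<^sup>2) \<partial>lborel) \<partial>M)"
      using elementary_process_support[OF ed] t
      by (intro nn_integral_cong) (auto split: split_indicator)
    also have "\<dots> = (\<integral>\<^sup>+(s, \<omega>). ennreal ((norm (?d s \<omega>))\<^sup>2) \<partial>pm)"
      using sq_int_measurable[OF ep[OF ed]] by (intro nn_integral_pm) (simp add: split_beta')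
    also have "\<dots> = ennreal (sqn pm (\<lambda>(s, \<omega>). ?d s \<omega>))"
      using sq_int_nn_integral[OF ep[OF ed]] by (simp add: split_beta')
    finally show ?thesis .
  qed
  show ?thesis
    unfolding SI_indicator_Icc[OF us]
  proof
    assume "has_ito_integral M F W t u I"
    then obtain n \<tau> \<xi> where I: "I \<in> borel_measurable M"
      and ed: "\<And>j. elementary_data M F t (n j) (\<tau> j) (\<xi> j)"
      and l1: "(\<lambda>j. \<integral>\<^sup>+\<omega>. (\<integral>\<^sup>+s\<in>{0..t}.
           ennreal ((norm (u s \<omega> - elementary_process (n j) (\<tau> j) (\<xi> j) s \<omega>))\<^sup>2) \<partial>lborel) \<partial>M) \<longlonglongrightarrow> 0"
      and l2: "(\<lambda>j. \<integral>\<^sup>+\<omega>. ennreal ((I \<omega> - elementary_integral W (n j) (\<tau> j) (\<xi> j) \<omega>)\<^sup>2) \<partial>M) \<longlonglongrightarrow> 0"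
      unfolding has_ito_integral_def by blast
    define L where "L j = map (\<lambda>k. (\<tau> j k, \<tau> j (Suc k), \<xi> j k)) [0..<n j]" for j
    have L: "valid (L j)" "eproc (L j) = elementary_process (n j) (\<tau> j) (\<xi> j)"
      "eint (L j) = elementary_integral W (n j) (\<tau> j) (\<xi> j)" for j
      using elementary_data_valid[OF ed[of j] t'] by (auto simp only: L_def)
    have "(\<lambda>j. ennreal (sqn pm (\<lambda>(s, \<omega>). indicat_real {0..t} s *\<^sub>R u s \<omega> - eproc (L j) s \<omega>))) \<longlonglongrightarrow> ennreal 0"
      using l1 by (simp add: nn[OF ed] L(2))
    then have c1: "(\<lambda>j. sqn pm (\<lambda>(s, \<omega>). indicat_real {0..t} s *\<^sub>R u s \<omega> - eproc (L j) s \<omega>)) \<longlonglongrightarrow> 0"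
      by (subst (asm) tendsto_ennreal_iff) auto
    have Im: "(\<lambda>\<omega>. I \<omega> - eint (L j) \<omega>) \<in> borel_measurable M" for j
      using I sq_int_measurable[OF sq_int_eint[OF L(1)[of j]]] by measurable
    \<comment> \<open>Square integrability of I is extracted from a single elementary integral at
      finite distance.\<close>
    have "eventually (\<lambda>j. (\<integral>\<^sup>+\<omega>. ennreal ((I \<omega> - eint (L j) \<omega>)\<^sup>2) \<partial>M) < 1) sequentially"
      using l2 unfolding L(3) by (intro order_tendstoD(2)) auto
    then obtain j0 where "(\<integral>\<^sup>+\<omega>. ennreal ((I \<omega> - eint (L j0) \<omega>)\<^sup>2) \<partial>M) < 1"
      by (auto simp: eventually_sequentially)
    then have "(\<integral>\<^sup>+\<omega>. ennreal ((norm (I \<omega> - eint (L j0) \<omega>))\<^sup>2) \<partial>M) < \<infinity>"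
      by (simp add: order.strict_trans[OF _ ennreal_one_less_top])
    then have "sq_int M (\<lambda>\<omega>. I \<omega> - eint (L j0) \<omega>)" by (rule sq_intI_nn_integral[OF Im])
    from sq_int_add[OF this sq_int_eint[OF L(1)[of j0]]] have Is: "sq_int M I" by simp
    have "(\<lambda>j. ennreal (sqn M (\<lambda>\<omega>. I \<omega> - eint (L j) \<omega>))) \<longlonglongrightarrow> ennreal 0"
      using l2 unfolding L(3)[symmetric]
      using sq_int_nn_integral[OF sq_int_diff[OF Is sq_int_eint[OF L(1)]]] by simp
    then have c2: "(\<lambda>j. sqn M (\<lambda>\<omega>. I \<omega> - eint (L j) \<omega>)) \<longlonglongrightarrow> 0"
      by (subst (asm) tendsto_ennreal_iff) auto
    show "SI (\<lambda>p \<omega>. indicat_real {0..t} p *\<^sub>R u p \<omega>) I"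
      unfolding SI_def using iu Is L(1) c1 c2 by blast
  next
    assume SI: "SI (\<lambda>p \<omega>. indicat_real {0..t} p *\<^sub>R u p \<omega>) I"
    obtain n \<tau> \<xi> where ed: "\<And>j. elementary_data M F t (n j) (\<tau> j) (\<xi> j)"
     and c1: "(\<lambda>j. sqn pm (\<lambda>(s, \<omega>). indicat_real {0..t} s *\<^sub>R u s \<omega> - elementary_process (n j) (\<tau> j) (\<xi> j) s \<omega>)) \<longlonglongrightarrow> 0"
      using elementary_dense[OF u t] by blast
    define L where "L j = map (\<lambda>k. (\<tau> j k, \<tau> j (Suc k), \<xi> j k)) [0..<n j]" for j
    have L: "valid (L j)" "eproc (L j) = elementary_process (n j) (\<tau> j) (\<xi> j)"
      "eint (L j) = elementary_integral W (n j) (\<tau> j) (\<xi> j)" for j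
      using elementary_data_valid[OF ed[of j] t'] by (auto simp only: L_def)
    have l1: "(\<lambda>j. \<integral>\<^sup>+\<omega>. (\<integral>\<^sup>+s\<in>{0..t}.
           ennreal ((norm (u s \<omega> - elementary_process (n j) (\<tau> j) (\<xi> j) s \<omega>))\<^sup>2) \<partial>lborel) \<partial>M) \<longlonglongrightarrow> 0"
      unfolding nn[OF ed] using tendsto_ennrealI[OF c1] by simp
    have "(\<integral>\<^sup>+\<omega>. ennreal ((I \<omega> - eint (L j) \<omega>)\<^sup>2) \<partial>M)
        = ennreal (sqn pm (\<lambda>(s, \<omega>). indicat_real {0..t} s *\<^sub>R u s \<omega> - eproc (L j) s \<omega>))" for j
      using sq_int_nn_integral[OF sq_int_diff[OF SI_sq_int(2)[OF SI] sq_int_eint[OF L(1)]], of j]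
        SI_distance[OF SI SI_elementary[OF L(1)], of j] by simp
    then have l2: "(\<lambda>j. \<integral>\<^sup>+\<omega>. ennreal ((I \<omega> - elementary_integral W (n j) (\<tau> j) (\<xi> j) \<omega>)\<^sup>2) \<partial>M) \<longlonglongrightarrow> 0"
      using tendsto_ennrealI[OF c1] by (simp add: L)
    show "has_ito_integral M F W t u I"
      unfolding has_ito_integral_def
      using ed l1 l2 sq_int_measurable[OF SI_sq_int(2)[OF SI]] by blast
  qed
qed

end

section \<open>Linear Volterra equations\<close>

definition bdd_meas :: "real \<Rightarrow> (real \<Rightarrow> real) \<Rightarrow> bool" where
  "bdd_meas T f \<longleftrightarrow> f \<in> borel_measurable (restrict_space borel {0..T}) \<and> bounded (f ` {0..T})"

text \<open>P is a Lipschitz function with density f. As r and b are only bounded and measurable,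
  this integral relation takes the place of pointwise differentiability.\<close>

definition primitive :: "real \<Rightarrow> (real \<Rightarrow> real) \<Rightarrow> (real \<Rightarrow> real) \<Rightarrow> bool" where
  "primitive T P f \<longleftrightarrow> bdd_meas T f \<and> (\<forall>t\<in>{0..T}. P t = P 0 + (LBINT s:{0..t}. f s))"

lemma bdd_meas_bound:
  assumes "bdd_meas T f" obtains K where "0 < K" "\<And>s. s \<in> {0..T} \<Longrightarrow> \<bar>f s\<bar> \<le> K"
proof -
  obtain K where "\<forall>s\<in>{0..T}. \<bar>f s\<bar> \<le> K"
    using assms by (auto simp: bdd_meas_def bounded_iff)
  then show thesis by (intro that[of "max K 1"]) (auto simp: le_max_iff_disj)
qed

lemma bdd_measI:
  assumes "f \<in> borel_measurable (restrict_space borel {0..T})" "\<And>s. s \<in> {0..T} \<Longrightarrow> \<bar>f s\<bar> \<le> K"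
  shows "bdd_meas T f"
  unfolding bdd_meas_def bounded_iff using assms by (auto intro!: exI[of _ K])

lemma bdd_meas_mult:
  assumes "bdd_meas T f" "bdd_meas T g" shows "bdd_meas T (\<lambda>s. f s * g s)"
proof -
  obtain K where K: "0 < K" "\<And>s. s \<in> {0..T} \<Longrightarrow> \<bar>f s\<bar> \<le> K" by (rule bdd_meas_bound[OF assms(1)]) auto
  obtain L where L: "0 < L" "\<And>s. s \<in> {0..T} \<Longrightarrow> \<bar>g s\<bar> \<le> L" by (rule bdd_meas_bound[OF assms(2)]) auto
  show ?thesis
  proof (rule bdd_measI[where K = "K * L"])
    show "(\<lambda>s. f s * g s) \<in> borel_measurable (restrict_space borel {0..T})"
      using assms by (auto simp: bdd_meas_def)
    show "\<bar>f s * g s\<bar> \<le> K * L" if "s \<in> {0..T}" for s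
      unfolding abs_mult using K L that by (intro mult_mono) auto
  qed
qed

lemma bdd_meas_add:
  assumes "bdd_meas T f" "bdd_meas T g" shows "bdd_meas T (\<lambda>s. f s + g s)"
proof -
  obtain K where K: "0 < K" "\<And>s. s \<in> {0..T} \<Longrightarrow> \<bar>f s\<bar> \<le> K" by (rule bdd_meas_bound[OF assms(1)]) auto
  obtain L where L: "0 < L" "\<And>s. s \<in> {0..T} \<Longrightarrow> \<bar>g s\<bar> \<le> L" by (rule bdd_meas_bound[OF assms(2)]) auto
  show ?thesis
  proof (rule bdd_measI[where K = "K + L"])
    show "(\<lambda>s. f s + g s) \<in> borel_measurable (restrict_space borel {0..T})"
      using assms by (auto simp: bdd_meas_def)
    show "\<bar>f s + g s\<bar> \<le> K + L" if "s \<in> {0..T}" for s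
      using K(2)[OF that] L(2)[OF that] by linarith
  qed
qed

lemma bdd_meas_const: "bdd_meas T (\<lambda>s. c)"
  by (rule bdd_measI[where K = "\<bar>c\<bar>"]) auto

lemma bdd_meas_uminus: "bdd_meas T f \<Longrightarrow> bdd_meas T (\<lambda>s. - f s)"
  using bdd_meas_mult[OF bdd_meas_const[of T "-1"]] by simp

lemma bdd_meas_diff: "bdd_meas T f \<Longrightarrow> bdd_meas T g \<Longrightarrow> bdd_meas T (\<lambda>s. f s - g s)"
  using bdd_meas_add[OF _ bdd_meas_uminus] by force

lemma bdd_meas_continuous:
  assumes "continuous_on {0..T} f" shows "bdd_meas T f"
  unfolding bdd_meas_def
  using assms by (auto intro: borel_measurable_continuous_on_restrict compact_imp_bounded compact_continuous_image)

lemma bdd_meas_set_integrable: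
  assumes "bdd_meas T f" "0 \<le> a" "b \<le> T"
  shows "set_integrable lborel {a..b} f"
proof -
  obtain K where K: "0 < K" "\<And>s. s \<in> {0..T} \<Longrightarrow> \<bar>f s\<bar> \<le> K" by (rule bdd_meas_bound[OF assms(1)]) auto
  have "set_integrable lborel {0..T} f"
    unfolding set_integrable_def
  proof (rule Bochner_Integration.integrable_bound[where f = "\<lambda>s. K * indicat_real {0..T} s"])
    show "integrable lborel (\<lambda>s. K * indicat_real {0..T} s)"
      by (intro integrable_mult_right integrable_real_indicator) (auto simp: emeasure_lborel_Icc_eq)
    show "(\<lambda>s. indicat_real {0..T} s *\<^sub>R f s) \<in> borel_measurable lborel"
      using assms(1) unfolding bdd_meas_def by (auto simp: borel_measurable_restrict_space_iff)
    show "AE s in lborel. norm (indicat_real {0..T} s *\<^sub>R f s) \<le> norm (K * indicat_real {0..T} s)"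
      using K by (intro AE_I2) (auto split: split_indicator)
  qed
  then show ?thesis by (rule set_integrable_subset) (use assms in auto)
qed

lemma set_integral_abs_le: "\<bar>LINT s:A|M. f s\<bar> \<le> (LINT s:A|M. \<bar>f s :: real\<bar>)"
  unfolding set_lebesgue_integral_def
  using integral_norm_bound[of M "\<lambda>s. indicat_real A s *\<^sub>R f s"] by (simp add: abs_mult)

lemma bdd_meas_integral_bound:
  assumes "bdd_meas T f" "0 \<le> a" "a \<le> b" "b \<le> T" "\<And>s. s \<in> {a..b} \<Longrightarrow> \<bar>f s\<bar> \<le> K"
  shows "\<bar>LBINT s:{a..b}. f s\<bar> \<le> K * (b - a)"
proof -
  have i: "set_integrable lborel {a..b} f" by (rule bdd_meas_set_integrable) (use assms in auto)
  have "\<bar>LBINT s:{a..b}. f s\<bar> \<le> (LBINT s:{a..b}. \<bar>f s\<bar>)"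
    by (rule set_integral_abs_le)
  also have "\<dots> \<le> (LBINT s:{a..b}. K)"
    by (rule set_integral_mono) (use i assms bdd_meas_set_integrable[OF bdd_meas_const assms(2,4)] in \<open>auto simp: set_integrable_abs\<close>)
  also have "\<dots> = K * (b - a)"
    using assms by (subst set_integral_const) auto
  finally show ?thesis .
qed

lemma set_integral_singleton [simp]: "(LBINT r:{a::real}. f r) = 0"
  for f :: "real \<Rightarrow> 'a::{banach, second_countable_topology}"
proof -
  have "AE r in lborel. indicat_real {a} r *\<^sub>R f r = 0"
    using AE_lborel_singleton[of a] by eventually_elim simp
  then show ?thesis unfolding set_lebesgue_integral_def by (rule integral_eq_zero_AE)
qed

lemma set_integral_split:
  fixes f :: "real \<Rightarrow> 'a::{banach, second_countable_topology}"
  assumes "set_integrable lborel {0..t} f" "0 \<le> s" "s \<le> t"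
  shows "(LBINT r:{0..t}. f r) - (LBINT r:{0..s}. f r) = (LBINT r:{s..t}. f r)"
proof -
  have i: "set_integrable lborel {0..s} f" "set_integrable lborel {s..t} f"
    by (rule set_integrable_subset[OF assms(1)]; use assms in auto)+
  have "AE r in lborel. \<not> (r \<in> {0..s} \<and> r \<in> {s..t})"
    using AE_lborel_singleton[of s] by eventually_elim auto
  from set_integral_Un_AE[OF this _ _ i] have "(LBINT r:{0..s} \<union> {s..t}. f r) = (LBINT r:{0..s}. f r) + (LBINT r:{s..t}. f r)"
    by simp
  moreover have "{0..s} \<union> {s..t} = {0..t}" using assms by auto
  ultimately have "(LBINT r:{0..s}. f r) + (LBINT r:{s..t}. f r) = (LBINT r:{0..t}. f r)" by simp
  then show ?thesis by (simp add: algebra_simps)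
qed

section \<open>Product and chain rule for primitives\<close>

lemma primitive_eq: "primitive T P f \<Longrightarrow> t \<in> {0..T} \<Longrightarrow> P t = P 0 + (LBINT s:{0..t}. f s)"
  unfolding primitive_def by blast

lemma primitive_density: "primitive T P f \<Longrightarrow> bdd_meas T f"
  unfolding primitive_def by blast

lemma primitive_diff:
  assumes "primitive T P f" "0 \<le> s" "s \<le> t" "t \<le> T"
  shows "P t - P s = (LBINT r:{s..t}. f r)"
proof -
  have "P t = P 0 + (LBINT s:{0..t}. f s)" "P s = P 0 + (LBINT s:{0..s}. f s)"
    by (rule primitive_eq[OF assms(1)]; use assms in simp)+
  moreover have "set_integrable lborel {0..t} f"
    by (rule bdd_meas_set_integrable[OF primitive_density[OF assms(1)]]) (use assms in auto)
  ultimately show ?thesis using set_integral_split[of t f s] assms by simp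
qed

lemma primitive_Lipschitz:
  assumes "primitive T P f"
  obtains K where "0 < K" "\<And>s t. 0 \<le> s \<Longrightarrow> s \<le> t \<Longrightarrow> t \<le> T \<Longrightarrow> \<bar>P t - P s\<bar> \<le> K * (t - s)"
    "\<And>s. s \<in> {0..T} \<Longrightarrow> \<bar>f s\<bar> \<le> K"
proof -
  note f = primitive_density[OF assms]
  obtain K where K: "0 < K" "\<And>s. s \<in> {0..T} \<Longrightarrow> \<bar>f s\<bar> \<le> K" by (rule bdd_meas_bound[OF f]) auto
  show thesis
  proof (rule that[OF K(1) _ K(2)])
    fix s t assume st: "0 \<le> s" "s \<le> t" "t \<le> T"
    show "\<bar>P t - P s\<bar> \<le> K * (t - s)"
      unfolding primitive_diff[OF assms st]
      by (rule bdd_meas_integral_bound[OF f st]) (use K st in auto)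
  qed
qed

lemma primitive_continuous:
  assumes "primitive T P f" shows "continuous_on {0..T} P"
proof -
  obtain K where K: "0 < K" "\<And>s t. 0 \<le> s \<Longrightarrow> s \<le> t \<Longrightarrow> t \<le> T \<Longrightarrow> \<bar>P t - P s\<bar> \<le> K * (t - s)"
    by (rule primitive_Lipschitz[OF assms]) auto
  have "K-lipschitz_on {0..T} P"
  proof (rule lipschitz_onI)
    fix s t assume "s \<in> {0..T}" "t \<in> {0..T}"
    then show "dist (P s) (P t) \<le> K * dist s t"
      using K(2)[of s t] K(2)[of t s] by (cases "s \<le> t") (auto simp: dist_real_def abs_minus_commute)
  qed (use K in simp)
  then show ?thesis by (rule lipschitz_on_continuous_on)
qed

lemmas primitive_bdd = bdd_meas_continuous[OF primitive_continuous]

text \<open>An error quadratic in the step length adds up to at most A t^2 / (n + 1) over n + 1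
  equal steps, hence to nothing in the limit. It is the device by which product and chain rule are
  proved for measurable densities.\<close>

lemma primitiveI_increments:
  assumes f: "bdd_meas T f"
    and H: "\<And>s t. 0 \<le> s \<Longrightarrow> s \<le> t \<Longrightarrow> t \<le> T \<Longrightarrow> \<bar>P t - P s - (LBINT r:{s..t}. f r)\<bar> \<le> A * (t - s)\<^sup>2"
  shows "primitive T P f"
  unfolding primitive_def
proof (intro conjI ballI f)
  fix t assume t: "t \<in> {0..T}"
  define h where "h s = P s - (LBINT r:{0..s}. f r)" for s
  have inc: "\<bar>h v - h u\<bar> \<le> A * (v - u)\<^sup>2" if "0 \<le> u" "u \<le> v" "v \<le> T" for u v
  proof -
    have "(LBINT r:{0..v}. f r) - (LBINT r:{0..u}. f r) = (LBINT r:{u..v}. f r)"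
      by (rule set_integral_split[OF bdd_meas_set_integrable[OF f]]) (use that in auto)
    then show ?thesis using H[OF that] by (simp add: h_def algebra_simps)
  qed
  have "\<bar>h t - h 0\<bar> \<le> A * t\<^sup>2 * inverse (real (Suc n))" for n
  proof -
    let ?n = "real (Suc n)"
    define \<tau> where "\<tau> k = t / ?n * real k" for k
    have d: "\<tau> (Suc k) - \<tau> k = t / ?n" for k
      unfolding \<tau>_def right_diff_distrib[symmetric] by simp
    have \<tau>: "0 \<le> \<tau> k" "k \<le> Suc n \<Longrightarrow> \<tau> k \<le> T" for k
    proof -
      show "0 \<le> \<tau> k" using t by (simp add: \<tau>_def)
      assume "k \<le> Suc n"
      then have "t / ?n * real k \<le> t / ?n * ?n" using t by (intro mult_left_mono) auto
      then have "\<tau> k \<le> t" by (simp add: \<tau>_def)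
      then show "\<tau> k \<le> T" using t by simp
    qed
    have "h t - h 0 = (\<Sum>k<Suc n. h (\<tau> (Suc k)) - h (\<tau> k))"
    proof -
      have "\<tau> (Suc n) = t" "\<tau> 0 = 0" by (simp_all add: \<tau>_def del: of_nat_Suc)
      then show ?thesis using sum_lessThan_telescope[of "\<lambda>k. h (\<tau> k)" "Suc n"] by (simp only:)
    qed
    also have "\<bar>\<dots>\<bar> \<le> (\<Sum>k<Suc n. \<bar>h (\<tau> (Suc k)) - h (\<tau> k)\<bar>)" by (rule sum_abs)
    also have "\<dots> \<le> (\<Sum>k<Suc n. A * (t / ?n)\<^sup>2)"
    proof (rule sum_mono)
      fix k assume "k \<in> {..<Suc n}"
      then have k: "Suc k \<le> Suc n" by simp
      have "0 \<le> t / ?n" using t by simp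
      then have "\<tau> k \<le> \<tau> (Suc k)" using d[of k] by linarith
      from inc[OF \<tau>(1) this \<tau>(2)[OF k]] show "\<bar>h (\<tau> (Suc k)) - h (\<tau> k)\<bar> \<le> A * (t / ?n)\<^sup>2" by (simp add: d)
    qed
    also have "\<dots> = A * t\<^sup>2 * inverse ?n"
    proof -
      have "m * (A * (t / m)\<^sup>2) = A * t\<^sup>2 * inverse m" if "m \<noteq> 0" for m :: real
        using that by (simp add: power2_eq_square field_simps)
      from this[of ?n] show ?thesis by (simp del: of_nat_Suc)
    qed
    finally show ?thesis .
  qed
  moreover have "(\<lambda>n. A * t\<^sup>2 * inverse (real (Suc n))) \<longlonglongrightarrow> A * t\<^sup>2 * 0"
    by (intro tendsto_mult_left LIMSEQ_inverse_real_of_nat)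
  ultimately have "\<bar>h t - h 0\<bar> \<le> 0" by (intro LIMSEQ_le_const) auto
  then show "P t = P 0 + (LBINT s:{0..t}. f s)" by (simp add: h_def)
qed

text \<open>With Q frozen at the right end and P at the left end the increment of the product is
  exact; undoing each freezing costs at most K L (t - s)^2, by the Lipschitz bounds.\<close>

lemma primitive_mult:
  assumes P: "primitive T P p" and Q: "primitive T Q q"
  shows "primitive T (\<lambda>t. P t * Q t) (\<lambda>t. p t * Q t + P t * q t)"
proof -
  obtain K where K: "0 < K" "\<And>s t. 0 \<le> s \<Longrightarrow> s \<le> t \<Longrightarrow> t \<le> T \<Longrightarrow> \<bar>P t - P s\<bar> \<le> K * (t - s)" "\<And>s. s \<in> {0..T} \<Longrightarrow> \<bar>p s\<bar> \<le> K"
    by (rule primitive_Lipschitz[OF P]) auto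
  obtain L where L: "0 < L" "\<And>s t. 0 \<le> s \<Longrightarrow> s \<le> t \<Longrightarrow> t \<le> T \<Longrightarrow> \<bar>Q t - Q s\<bar> \<le> L * (t - s)" "\<And>s. s \<in> {0..T} \<Longrightarrow> \<bar>q s\<bar> \<le> L"
    by (rule primitive_Lipschitz[OF Q]) auto
  note p = primitive_density[OF P] primitive_density[OF Q]
  note m = p primitive_bdd[OF P] primitive_bdd[OF Q]
  show ?thesis
  proof (rule primitiveI_increments[where A = "2 * (K * L)"])
    show "bdd_meas T (\<lambda>t. p t * Q t + P t * q t)" by (intro bdd_meas_add bdd_meas_mult m)
    fix s t assume st: "0 \<le> s" "s \<le> t" "t \<le> T"
    have i: "set_integrable lborel {s..t} f" if "bdd_meas T f" for f
      by (rule bdd_meas_set_integrable[OF that]) (use st in auto)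
    have "P t * Q t - P s * Q s - (LBINT r:{s..t}. p r * Q r + P r * q r)
        = (P t - P s) * Q t + P s * (Q t - Q s) - (LBINT r:{s..t}. p r * Q r + P r * q r)"
      by (simp add: algebra_simps)
    also have "\<dots> = (LBINT r:{s..t}. p r * Q t) + (LBINT r:{s..t}. P s * q r) - (LBINT r:{s..t}. p r * Q r + P r * q r)"
      by (simp add: primitive_diff[OF P st] primitive_diff[OF Q st])
    also have "\<dots> = (LBINT r:{s..t}. p r * Q t + P s * q r) - (LBINT r:{s..t}. p r * Q r + P r * q r)"
      by (subst set_integral_add) (auto intro!: i bdd_meas_mult m bdd_meas_const)
    also have "\<dots> = (LBINT r:{s..t}. (p r * Q t + P s * q r) - (p r * Q r + P r * q r))"
      by (rule set_integral_diff(2)[symmetric]) (auto intro!: i bdd_meas_add bdd_meas_mult m bdd_meas_const)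
    also have "\<bar>\<dots>\<bar> \<le> 2 * (K * L) * (t - s) * (t - s)"
    proof (rule bdd_meas_integral_bound[OF _ st])
      show "bdd_meas T (\<lambda>r. (p r * Q t + P s * q r) - (p r * Q r + P r * q r))"
        by (intro bdd_meas_diff bdd_meas_add bdd_meas_mult m bdd_meas_const)
      fix r assume r: "r \<in> {s..t}"
      have eq: "(p r * Q t + P s * q r) - (p r * Q r + P r * q r) = p r * (Q t - Q r) - (P r - P s) * q r"
        by (simp add: algebra_simps)
      have "\<bar>p r * (Q t - Q r)\<bar> \<le> K * (L * (t - s))"
        unfolding abs_mult
      proof (rule mult_mono)
        have "\<bar>Q t - Q r\<bar> \<le> L * (t - r)" using L(2)[of r t] r st by simp
        also have "\<dots> \<le> L * (t - s)" using L(1) r by (intro mult_left_mono) auto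
        finally show "\<bar>Q t - Q r\<bar> \<le> L * (t - s)" .
      qed (use K(1,3) r st in auto)
      moreover have "\<bar>(P r - P s) * q r\<bar> \<le> (K * (t - s)) * L"
        unfolding abs_mult
      proof (rule mult_mono)
        have "\<bar>P r - P s\<bar> \<le> K * (r - s)" using K(2)[of s r] r st by simp
        also have "\<dots> \<le> K * (t - s)" using K(1) r by (intro mult_left_mono) auto
        finally show "\<bar>P r - P s\<bar> \<le> K * (t - s)" .
      qed (use K(1) L(3) r st in auto)
      ultimately show "\<bar>(p r * Q t + P s * q r) - (p r * Q r + P r * q r)\<bar> \<le> 2 * (K * L) * (t - s)"
        unfolding eq by (simp add: algebra_simps)
    qed
    finally show "\<bar>P t * Q t - P s * Q s - (LBINT r:{s..t}. p r * Q r + P r * q r)\<bar> \<le> 2 * (K * L) * (t - s)\<^sup>2"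
      by (simp add: power2_eq_square mult.assoc)
  qed
qed

lemma exp_difference_bound:
  assumes "\<bar>x\<bar> \<le> B" "\<bar>y\<bar> \<le> B"
  shows "\<bar>exp y - exp x\<bar> \<le> exp B * \<bar>y - x :: real\<bar>"
proof -
  have "norm (exp y - exp x) \<le> exp B * norm (y - x)"
    by (rule field_differentiable_bound[of "{-B..B}" exp exp]) (use assms in \<open>auto intro!: derivative_eq_intros\<close>)
  then show ?thesis by simp
qed

text \<open>The mean value theorem is applied twice: once for the increment of exp, once for the
  difference of its derivatives at the intermediate point and at x.\<close>

lemma exp_second_difference_bound:
  assumes "\<bar>x\<bar> \<le> B" "\<bar>y\<bar> \<le> B"
  shows "\<bar>exp y - exp x - (y - x) * exp x\<bar> \<le> exp B * (y - x :: real)\<^sup>2"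
proof (cases "y = x")
  case False
  obtain z where z: "\<bar>z - x\<bar> \<le> \<bar>y - x\<bar>" "\<bar>z\<bar> \<le> B" "exp y - exp x = (y - x) * exp z"
  proof (cases "x < y")
    case True
    obtain z where "x < z" "z < y" "exp y - exp x = (y - x) * exp z"
      using MVT2[OF True, of exp exp] by (auto intro!: derivative_eq_intros)
    then show ?thesis using assms by (intro that[of z]) auto
  next
    case False
    then have "y < x" using \<open>y \<noteq> x\<close> by simp
    obtain z where "y < z" "z < x" "exp x - exp y = (x - y) * exp z"
      using MVT2[OF \<open>y < x\<close>, of exp exp] by (auto intro!: derivative_eq_intros)
    then show ?thesis using assms by (intro that[of z]) (auto simp: algebra_simps)
  qed
  have "\<bar>exp y - exp x - (y - x) * exp x\<bar> = \<bar>y - x\<bar> * \<bar>exp z - exp x\<bar>"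
    unfolding z(3) by (simp add: abs_mult flip: right_diff_distrib)
  also have "\<dots> \<le> \<bar>y - x\<bar> * (exp B * \<bar>y - x\<bar>)"
  proof (rule mult_left_mono)
    have "\<bar>exp z - exp x\<bar> \<le> exp B * \<bar>z - x\<bar>" by (rule exp_difference_bound[OF assms(1) z(2)])
    also have "\<dots> \<le> exp B * \<bar>y - x\<bar>" by (intro mult_left_mono z(1)) auto
    finally show "\<bar>exp z - exp x\<bar> \<le> exp B * \<bar>y - x\<bar>" .
  qed simp
  also have "\<dots> = exp B * (y - x)\<^sup>2" by (simp add: power2_eq_square abs_mult_self_eq)
  finally show ?thesis .
qed simp

text \<open>One half of the constant comes from the second-order remainder of exp, the other from
  replacing exp (P s) by exp (P r) under the integral.\<close>

lemma primitive_exp: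
  assumes P: "primitive T P p"
  shows "primitive T (\<lambda>t. exp (P t)) (\<lambda>t. p t * exp (P t))"
proof -
  obtain K where K: "0 < K" "\<And>s t. 0 \<le> s \<Longrightarrow> s \<le> t \<Longrightarrow> t \<le> T \<Longrightarrow> \<bar>P t - P s\<bar> \<le> K * (t - s)" "\<And>s. s \<in> {0..T} \<Longrightarrow> \<bar>p s\<bar> \<le> K"
    by (rule primitive_Lipschitz[OF P]) auto
  obtain B where B: "0 < B" "\<And>s. s \<in> {0..T} \<Longrightarrow> \<bar>P s\<bar> \<le> B" by (rule bdd_meas_bound[OF primitive_bdd[OF P]]) auto
  note p = primitive_density[OF P]
  have e: "bdd_meas T (\<lambda>t. exp (P t))"
    by (intro bdd_meas_continuous continuous_on_exp primitive_continuous[OF P])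
  show ?thesis
  proof (rule primitiveI_increments[where A = "2 * (exp B * K\<^sup>2)"])
    show "bdd_meas T (\<lambda>t. p t * exp (P t))" by (intro bdd_meas_mult p e)
    fix s t assume st: "0 \<le> s" "s \<le> t" "t \<le> T"
    have i: "set_integrable lborel {s..t} f" if "bdd_meas T f" for f
      by (rule bdd_meas_set_integrable[OF that]) (use st in auto)
    have 1: "\<bar>exp (P t) - exp (P s) - (P t - P s) * exp (P s)\<bar> \<le> exp B * K\<^sup>2 * (t - s)\<^sup>2"
    proof -
      have "\<bar>exp (P t) - exp (P s) - (P t - P s) * exp (P s)\<bar> \<le> exp B * (P t - P s)\<^sup>2"
        by (rule exp_second_difference_bound) (use B st in auto)
      also have "\<dots> \<le> exp B * (K * (t - s))\<^sup>2"
        using power_mono[OF K(2)[OF st], of 2] by (intro mult_left_mono) auto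
      finally show ?thesis by (simp add: power_mult_distrib)
    qed
    have "\<bar>LBINT r:{s..t}. p r * exp (P s) - p r * exp (P r)\<bar> \<le> K * (exp B * (K * (t - s))) * (t - s)"
    proof (rule bdd_meas_integral_bound[OF _ st])
      show "bdd_meas T (\<lambda>r. p r * exp (P s) - p r * exp (P r))"
        by (intro bdd_meas_diff bdd_meas_mult p e bdd_meas_const)
      fix r assume r: "r \<in> {s..t}"
      have "\<bar>p r * exp (P s) - p r * exp (P r)\<bar> = \<bar>p r\<bar> * \<bar>exp (P r) - exp (P s)\<bar>"
        by (simp only: abs_mult abs_minus_commute[of "exp (P s)"] flip: right_diff_distrib)
      also have "\<dots> \<le> K * (exp B * (K * (t - s)))"
      proof (rule mult_mono)
        have "\<bar>exp (P r) - exp (P s)\<bar> \<le> exp B * \<bar>P r - P s\<bar>"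
          by (rule exp_difference_bound) (use B st r in auto)
        also have "\<dots> \<le> exp B * (K * (t - s))"
        proof (rule mult_left_mono)
          have "\<bar>P r - P s\<bar> \<le> K * (r - s)" using K(2)[of s r] r st by simp
          also have "\<dots> \<le> K * (t - s)" using K(1) r by (intro mult_left_mono) auto
          finally show "\<bar>P r - P s\<bar> \<le> K * (t - s)" .
        qed simp
        finally show "\<bar>exp (P r) - exp (P s)\<bar> \<le> exp B * (K * (t - s))" .
      qed (use K(1,3) r st in auto)
      finally show "\<bar>p r * exp (P s) - p r * exp (P r)\<bar> \<le> K * (exp B * (K * (t - s)))" .
    qed
    then have 2: "\<bar>LBINT r:{s..t}. p r * exp (P s) - p r * exp (P r)\<bar> \<le> exp B * K\<^sup>2 * (t - s)\<^sup>2"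
      by (simp add: power2_eq_square algebra_simps)
    have "exp (P t) - exp (P s) - (LBINT r:{s..t}. p r * exp (P r))
        = (exp (P t) - exp (P s) - (P t - P s) * exp (P s))
          + ((LBINT r:{s..t}. p r * exp (P s)) - (LBINT r:{s..t}. p r * exp (P r)))"
      by (simp add: primitive_diff[OF P st])
    also have "(LBINT r:{s..t}. p r * exp (P s)) - (LBINT r:{s..t}. p r * exp (P r))
        = (LBINT r:{s..t}. p r * exp (P s) - p r * exp (P r))"
      by (rule set_integral_diff(2)[symmetric]) (auto intro!: i bdd_meas_mult p e bdd_meas_const)
    finally show "\<bar>exp (P t) - exp (P s) - (LBINT r:{s..t}. p r * exp (P r))\<bar> \<le> 2 * (exp B * K\<^sup>2) * (t - s)\<^sup>2"
      using 1 2 by linarith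
  qed
qed

section \<open>The resolvent of a linear Volterra equation\<close>

lemma primitive_integral: "bdd_meas T f \<Longrightarrow> primitive T (\<lambda>t. LBINT s:{0..t}. f s) f"
  by (simp add: primitive_def)

text \<open>Variation of constants for y' = c (y + G) with y 0 = 0. Thus G plus
  \<open>volterra c G\<close> is the solution f of f = G + integral of c f, and G may be any bounded
  measurable function.\<close>

definition volterra :: "(real \<Rightarrow> real) \<Rightarrow> (real \<Rightarrow> real) \<Rightarrow> real \<Rightarrow> real" where
  "volterra c G t = exp (LBINT s:{0..t}. c s) *
     (LBINT s:{0..t}. exp (- (LBINT r:{0..s}. c r)) * c s * G s)"

lemma primitive_volterra:
  assumes c: "bdd_meas T c" and G: "bdd_meas T G"
  shows "primitive T (volterra c G) (\<lambda>t. c t * (volterra c G t + G t))"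
proof -
  let ?C = "\<lambda>t. LBINT s:{0..t}. c s"
  let ?g = "\<lambda>s. exp (- ?C s) * c s * G s"
  have C: "primitive T ?C c" by (rule primitive_integral[OF c])
  have "bdd_meas T (\<lambda>s. exp (- ?C s))"
    by (intro bdd_meas_continuous continuous_on_exp continuous_on_minus primitive_continuous[OF C])
  then have g: "bdd_meas T ?g" by (intro bdd_meas_mult c G)
  have "primitive T (\<lambda>t. exp (?C t) * (LBINT s:{0..t}. ?g s))
      (\<lambda>t. c t * exp (?C t) * (LBINT s:{0..t}. ?g s) + exp (?C t) * ?g t)"
    by (rule primitive_mult[OF primitive_exp[OF C] primitive_integral[OF g]])
  moreover have "c t * exp (?C t) * (LBINT s:{0..t}. ?g s) + exp (?C t) * ?g t = c t * (volterra c G t + G t)" for t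
  proof -
    have "exp (?C t) * ?g t = (exp (?C t) * exp (- ?C t)) * (c t * G t)" by (simp only: mult.assoc)
    also have "\<dots> = c t * G t" by (simp add: exp_minus)
    finally show ?thesis by (simp add: volterra_def distrib_left)
  qed
  ultimately show ?thesis unfolding volterra_def[abs_def] by simp
qed

lemma volterra_equation:
  assumes "bdd_meas T c" "bdd_meas T G" "t \<in> {0..T}"
  shows "volterra c G t = (LBINT s:{0..t}. c s * (volterra c G s + G s))"
  using primitive_eq[OF primitive_volterra[OF assms(1,2)] assms(3)] by (simp add: volterra_def)

text \<open>Multiplied by the integrating factor exp (- integral of c), f has density zero; so the
  product is constant, and it starts at 0.\<close>

lemma volterra_unique_zero:
  assumes c: "bdd_meas T c" and f: "bdd_meas T f"
    and eq: "\<And>t. t \<in> {0..T} \<Longrightarrow> f t = (LBINT s:{0..t}. c s * f s)" and t: "t \<in> {0..T}"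
  shows "f t = 0"
proof -
  let ?C = "\<lambda>t. LBINT s:{0..t}. - c s"
  have T: "0 \<in> {0..T}" using t by auto
  have F: "primitive T f (\<lambda>s. c s * f s)"
    unfolding primitive_def
  proof (intro conjI ballI bdd_meas_mult c f)
    show "f t = f 0 + (LBINT s:{0..t}. c s * f s)" if "t \<in> {0..T}" for t
      using eq[OF that] eq[OF T] by simp
  qed
  have C: "primitive T ?C (\<lambda>s. - c s)" by (intro primitive_integral bdd_meas_uminus c)
  have "primitive T (\<lambda>t. exp (?C t) * f t) (\<lambda>t. - c t * exp (?C t) * f t + exp (?C t) * (c t * f t))"
    by (rule primitive_mult[OF primitive_exp[OF C] F])
  then have "primitive T (\<lambda>t. exp (?C t) * f t) (\<lambda>t. 0)" by (simp add: algebra_simps)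
  from primitive_eq[OF this t] have "exp (?C t) * f t = exp (?C 0) * f 0" by simp
  then show ?thesis using eq[OF T] by simp
qed

text \<open>The difference of f and the resolvent solution satisfies the homogeneous
  equation.\<close>

lemma volterra_unique:
  assumes c: "bdd_meas T c" and f: "bdd_meas T f" and G: "bdd_meas T G"
    and eq: "\<And>t. t \<in> {0..T} \<Longrightarrow> f t = G t + (LBINT s:{0..t}. c s * f s)" and t: "t \<in> {0..T}"
  shows "f t = G t + volterra c G t"
proof -
  note V = primitive_bdd[OF primitive_volterra[OF c G]]
  have "f t - (G t + volterra c G t) = 0"
  proof (rule volterra_unique_zero[OF c _ _ t])
    show "bdd_meas T (\<lambda>t. f t - (G t + volterra c G t))" by (intro bdd_meas_diff bdd_meas_add f G V)
    fix t assume t: "t \<in> {0..T}"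
    have i: "set_integrable lborel {0..t} h" if "bdd_meas T h" for h
      by (rule bdd_meas_set_integrable[OF that]) (use t in auto)
    have "f t - (G t + volterra c G t) = (LBINT s:{0..t}. c s * f s) - (LBINT s:{0..t}. c s * (volterra c G s + G s))"
      using eq[OF t] volterra_equation[OF c G t] by simp
    also have "\<dots> = (LBINT s:{0..t}. c s * f s - c s * (volterra c G s + G s))"
      by (rule set_integral_diff(2)[symmetric]) (auto intro!: i bdd_meas_mult bdd_meas_add c f G V)
    finally show "f t - (G t + volterra c G t) = (LBINT s:{0..t}. c s * (f s - (G s + volterra c G s)))"
      by (simp add: algebra_simps)
  qed
  then show ?thesis by simp
qed

text \<open>Applied with c = r: this is where the sign of the interest rate enters the uniqueness of
  the control.\<close>

lemma volterra_nonneg: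
  assumes "\<And>s. s \<in> {0..t} \<Longrightarrow> 0 \<le> c s" "\<And>s. s \<in> {0..t} \<Longrightarrow> 0 \<le> G s"
  shows "0 \<le> volterra c G t"
  unfolding volterra_def set_lebesgue_integral_def
  by (intro mult_nonneg_nonneg integral_nonneg_AE AE_I2) (use assms in \<open>auto split: split_indicator\<close>)

text \<open>The constant is the same for all G. Used path by path, it carries moment bounds from the
  forcing term to the solution.\<close>

lemma volterra_bound:
  assumes c: "bdd_meas T c"
  obtains K where "0 < K" "\<And>G t. bdd_meas T G \<Longrightarrow> t \<in> {0..T} \<Longrightarrow> \<bar>volterra c G t\<bar> \<le> K * (LBINT s:{0..t}. \<bar>G s\<bar>)"
proof -
  let ?C = "\<lambda>t. LBINT s:{0..t}. c s"
  have C: "primitive T ?C c" by (rule primitive_integral[OF c])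
  obtain B where B: "0 < B" "\<And>s. s \<in> {0..T} \<Longrightarrow> \<bar>?C s\<bar> \<le> B" by (rule bdd_meas_bound[OF primitive_bdd[OF C]]) auto
  obtain L where L: "0 < L" "\<And>s. s \<in> {0..T} \<Longrightarrow> \<bar>c s\<bar> \<le> L" by (rule bdd_meas_bound[OF c]) auto
  have em: "bdd_meas T (\<lambda>s. exp (- ?C s))"
    by (intro bdd_meas_continuous continuous_on_exp continuous_on_minus primitive_continuous[OF C])
  show thesis
  proof (rule that[of "exp B * (exp B * L)"])
    fix G t assume G: "bdd_meas T G" and t: "t \<in> {0..T}"
    have i: "set_integrable lborel {0..t} h" if "bdd_meas T h" for h
      by (rule bdd_meas_set_integrable[OF that]) (use t in auto)
    let ?g = "\<lambda>s. exp (- ?C s) * c s * G s"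
    have g: "bdd_meas T ?g" by (intro bdd_meas_mult em c G)
    have "\<bar>LBINT s:{0..t}. ?g s\<bar> \<le> (LBINT s:{0..t}. \<bar>?g s\<bar>)"
      by (rule set_integral_abs_le)
    also have "\<dots> \<le> (LBINT s:{0..t}. exp B * L * \<bar>G s\<bar>)"
    proof (rule set_integral_mono)
      show "set_integrable lborel {0..t} (\<lambda>s. \<bar>?g s\<bar>)" using i[OF g] by (rule set_integrable_abs)
      show "set_integrable lborel {0..t} (\<lambda>s. exp B * L * \<bar>G s\<bar>)"
        by (intro set_integrable_mult_right impI set_integrable_abs i G)
      fix s assume "s \<in> {0..t}"
      then have s: "s \<in> {0..T}" using t by auto
      have "exp (- ?C s) \<le> exp B" using B(2)[OF s] by simp
      then show "\<bar>?g s\<bar> \<le> exp B * L * \<bar>G s\<bar>"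
        unfolding abs_mult using L(2)[OF s] by (intro mult_mono) auto
    qed
    finally have 1: "\<bar>LBINT s:{0..t}. ?g s\<bar> \<le> exp B * L * (LBINT s:{0..t}. \<bar>G s\<bar>)" by simp
    have "\<bar>volterra c G t\<bar> = exp (?C t) * \<bar>LBINT s:{0..t}. ?g s\<bar>" by (simp add: volterra_def abs_mult)
    also have "\<dots> \<le> exp B * (exp B * L * (LBINT s:{0..t}. \<bar>G s\<bar>))"
      using B(2)[OF t] 1 by (intro mult_mono) auto
    finally show "\<bar>volterra c G t\<bar> \<le> exp B * (exp B * L) * (LBINT s:{0..t}. \<bar>G s\<bar>)" by (simp add: mult.assoc)
  qed (use L in simp)
qed

section \<open>The wealth equation\<close>

context brownian_basis
begin

section \<open>Progressive coefficients and their moments\<close>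

lemma measurable_lam_iff: "f \<in> borel_measurable lam \<longleftrightarrow> f \<in> borel_measurable (restrict_space borel {0..T})"
proof -
  have "sets lam = sets (restrict_space borel {0..T})" by (simp add: lam_def sets_restrict_space)
  then show ?thesis by (metis measurable_cong_sets)
qed

lemma progressive_deterministic:
  fixes f :: "real \<Rightarrow> 'b::topological_space"
  assumes "f \<in> borel_measurable (restrict_space borel {0..T})"
  shows "progressively_measurable F T (\<lambda>s \<omega>. f s)"
  unfolding progressively_measurable_def
proof
  fix t assume "t \<in> {0..T}"
  then have "restrict_space (restrict_space borel {0..T}) {0..t} = restrict_space borel {0..t}"
    by (subst restrict_restrict_space) (auto intro!: arg_cong[where f = "restrict_space borel"])
  then have "f \<in> borel_measurable (restrict_space borel {0..t})"
    using measurable_restrict_space1[OF assms, of "{0..t}"] by simp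
  then show "(\<lambda>(s, \<omega>). f s) \<in> borel_measurable (restrict_space borel {0..t} \<Otimes>\<^sub>M F t)"
    by (simp add: split_beta' measurable_compose[OF measurable_fst])
qed

lemma progressive_add:
  fixes u v :: "real \<Rightarrow> 'w \<Rightarrow> 'b::euclidean_space"
  assumes "progressively_measurable F T u" "progressively_measurable F T v"
  shows "progressively_measurable F T (\<lambda>s \<omega>. u s \<omega> + v s \<omega>)"
  using assms unfolding progressively_measurable_def split_beta' by (auto intro: borel_measurable_add)

lemma progressive_diff:
  fixes u v :: "real \<Rightarrow> 'w \<Rightarrow> 'b::euclidean_space"
  assumes "progressively_measurable F T u" "progressively_measurable F T v"
  shows "progressively_measurable F T (\<lambda>s \<omega>. u s \<omega> - v s \<omega>)"
  using assms unfolding progressively_measurable_def split_beta' by (auto intro: borel_measurable_diff)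

lemma progressive_scaleR:
  fixes v :: "real \<Rightarrow> 'w \<Rightarrow> 'b::euclidean_space"
  assumes "progressively_measurable F T u" "progressively_measurable F T v"
  shows "progressively_measurable F T (\<lambda>s \<omega>. u s \<omega> *\<^sub>R v s \<omega>)"
  using assms unfolding progressively_measurable_def split_beta' by (auto intro: borel_measurable_scaleR)

lemma progressive_mult:
  fixes u v :: "real \<Rightarrow> 'w \<Rightarrow> real"
  assumes "progressively_measurable F T u" "progressively_measurable F T v"
  shows "progressively_measurable F T (\<lambda>s \<omega>. u s \<omega> * v s \<omega>)"
  using assms unfolding progressively_measurable_def split_beta' by (auto intro: borel_measurable_times)

lemma progressive_inner:
  fixes u v :: "real \<Rightarrow> 'w \<Rightarrow> 'b::euclidean_space"
  assumes "progressively_measurable F T u" "progressively_measurable F T v"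
  shows "progressively_measurable F T (\<lambda>s \<omega>. u s \<omega> \<bullet> v s \<omega>)"
  using assms unfolding progressively_measurable_def split_beta' by (auto intro: borel_measurable_inner)

lemma L2_processes_diff:
  fixes u v :: "real \<Rightarrow> 'w \<Rightarrow> 'b::euclidean_space"
  assumes "u \<in> L2_processes M F T" "v \<in> L2_processes M F T"
  shows "(\<lambda>s \<omega>. u s \<omega> - v s \<omega>) \<in> L2_processes M F T"
proof -
  have u: "progressively_measurable F T u" "sq_int pm (case_prod u)"
    and v: "progressively_measurable F T v" "sq_int pm (case_prod v)"
    using assms by (simp_all add: L2_processes_iff)
  have "sq_int pm (\<lambda>(s, \<omega>). u s \<omega> - v s \<omega>)"
    using sq_int_diff[OF u(2) v(2)] by (simp add: split_beta')
  then show ?thesis using progressive_diff[OF u(1) v(1)] by (simp add: L2_processes_iff)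
qed

lemma sq_int_pm_vector_mult:
  fixes c :: "real \<Rightarrow> 'b::euclidean_space" and h :: "real \<Rightarrow> 'w \<Rightarrow> real"
  assumes h: "sq_int pm (case_prod h)" and c: "c \<in> borel_measurable (restrict_space borel {0..T})"
    "\<And>s. s \<in> {0..T} \<Longrightarrow> norm (c s) \<le> K"
  shows "sq_int pm (\<lambda>(s, \<omega>). h s \<omega> *\<^sub>R c s)"
    and "sqn pm (\<lambda>(s, \<omega>). h s \<omega> *\<^sub>R c s) \<le> K\<^sup>2 * sqn pm (case_prod h)"
proof -
  have [measurable]: "c \<in> borel_measurable lam" using c(1) by (simp add: measurable_lam_iff)
  have [measurable]: "case_prod h \<in> borel_measurable pm" by (rule sq_int_measurable[OF h])
  have b: "(norm (case x of (s, \<omega>) \<Rightarrow> h s \<omega> *\<^sub>R c s))\<^sup>2 \<le> K\<^sup>2 * (norm (case_prod h x))\<^sup>2" if "x \<in> space pm" for x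
  proof -
    have "fst x \<in> {0..T}" using that by (auto simp: space_pair_measure)
    from power_mono[OF c(2)[OF this] norm_ge_zero, of 2] show ?thesis
      by (simp add: split_beta' power_mult_distrib mult.commute mult_right_mono)
  qed
  have m: "(\<lambda>(s, \<omega>). h s \<omega> *\<^sub>R c s) \<in> borel_measurable pm"
  proof -
    have "(\<lambda>x. case_prod h x *\<^sub>R c (fst x)) \<in> borel_measurable pm" by measurable
    then show ?thesis by (simp add: split_beta')
  qed
  have i: "integrable pm (\<lambda>x. K\<^sup>2 * (norm (case_prod h x))\<^sup>2)" using sq_int_integrable[OF h] by simp
  show s: "sq_int pm (\<lambda>(s, \<omega>). h s \<omega> *\<^sub>R c s)" by (rule sq_int_dominated[OF m i b])
  have "sqn pm (\<lambda>(s, \<omega>). h s \<omega> *\<^sub>R c s) \<le> (\<integral>x. K\<^sup>2 * (norm (case_prod h x))\<^sup>2 \<partial>pm)"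
    unfolding sqn_def by (rule integral_mono[OF sq_int_integrable[OF s] i b])
  then show "sqn pm (\<lambda>(s, \<omega>). h s \<omega> *\<^sub>R c s) \<le> K\<^sup>2 * sqn pm (case_prod h)" by (simp add: sqn_def)
qed

lemma sq_int_pm_vector_inner:
  fixes c :: "real \<Rightarrow> 'b::euclidean_space" and v :: "real \<Rightarrow> 'w \<Rightarrow> 'b"
  assumes v: "sq_int pm (case_prod v)" and c: "c \<in> borel_measurable (restrict_space borel {0..T})"
    "\<And>s. s \<in> {0..T} \<Longrightarrow> norm (c s) \<le> K"
  shows "sq_int pm (\<lambda>(s, \<omega>). c s \<bullet> v s \<omega>)"
proof (rule sq_int_dominated)
  have [measurable]: "c \<in> borel_measurable lam" using c(1) by (simp add: measurable_lam_iff)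
  have [measurable]: "case_prod v \<in> borel_measurable pm" by (rule sq_int_measurable[OF v])
  have "(\<lambda>x. c (fst x) \<bullet> case_prod v x) \<in> borel_measurable pm" by measurable
  then show "(\<lambda>(s, \<omega>). c s \<bullet> v s \<omega>) \<in> borel_measurable pm" by (simp add: split_beta')
  show "integrable pm (\<lambda>x. K\<^sup>2 * (norm (case_prod v x))\<^sup>2)" using sq_int_integrable[OF v] by simp
  fix x assume "x \<in> space pm"
  then have x: "fst x \<in> {0..T}" by (auto simp: space_pair_measure)
  have "norm (c (fst x) \<bullet> case_prod v x) \<le> K * norm (case_prod v x)"
    using Cauchy_Schwarz_ineq2[of "c (fst x)" "case_prod v x"] mult_right_mono[OF c(2)[OF x], of "norm (case_prod v x)"]
    by simp
  from power_mono[OF this norm_ge_zero, of 2] show "(norm (case x of (s, \<omega>) \<Rightarrow> c s \<bullet> v s \<omega>))\<^sup>2 \<le> K\<^sup>2 * (norm (case_prod v x))\<^sup>2"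
    by (simp add: split_beta' power_mult_distrib)
qed

lemma measure_lam: "measure lam {0..T} = T"
  using emeasure_lam[of "{0..T}"] T_pos by (simp add: measure_def)

text \<open>The function is measurable on [0, T] only; the inserted indicator of [0, T] makes it
  Borel on the whole line. The half-open and closed intervals differ by the null point 0.\<close>

lemma lam_set_integral:
  fixes f :: "real \<Rightarrow> 'b::{banach, second_countable_topology}"
  assumes t: "t \<in> {0..T}" and f: "f \<in> borel_measurable lam"
  shows "(\<integral>s. indicat_real {0<..t} s *\<^sub>R f s \<partial>lam) = (LBINT s:{0..t}. f s)"
proof -
  have [measurable]: "(\<lambda>s. indicat_real {0..T} s *\<^sub>R f s) \<in> borel_measurable borel"
    using f unfolding measurable_lam_iff by (subst (asm) borel_measurable_restrict_space_iff) auto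
  have eq: "indicat_real A s *\<^sub>R f s = indicat_real A s *\<^sub>R indicat_real {0..T} s *\<^sub>R f s" if "A \<subseteq> {0..T}" for A s
    using that by (auto split: split_indicator)
  have sub: "{0<..t} \<subseteq> {0..T}" "{0..t} \<subseteq> {0..T}" using t by auto
  have "(\<integral>s. indicat_real {0<..t} s *\<^sub>R f s \<partial>lam) = (\<integral>s. indicat_real {0..T} s *\<^sub>R indicat_real {0<..t} s *\<^sub>R f s \<partial>lborel)"
    unfolding lam_def by (rule integral_restrict_space) simp
  also have "\<dots> = (\<integral>s. indicat_real {0..t} s *\<^sub>R indicat_real {0..T} s *\<^sub>R f s \<partial>lborel)"
  proof (rule integral_cong_AE)
    have "(\<lambda>s. indicat_real {0<..t} s *\<^sub>R indicat_real {0..T} s *\<^sub>R f s) \<in> borel_measurable lborel" by measurable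
    then show "(\<lambda>s. indicat_real {0..T} s *\<^sub>R indicat_real {0<..t} s *\<^sub>R f s) \<in> borel_measurable lborel"
      by (simp add: mult.commute)
    show "(\<lambda>s. indicat_real {0..t} s *\<^sub>R indicat_real {0..T} s *\<^sub>R f s) \<in> borel_measurable lborel" by measurable
    show "AE s in lborel. indicat_real {0..T} s *\<^sub>R indicat_real {0<..t} s *\<^sub>R f s = indicat_real {0..t} s *\<^sub>R indicat_real {0..T} s *\<^sub>R f s"
      using AE_lborel_singleton[of "0::real"] by eventually_elim (auto split: split_indicator)
  qed
  finally show ?thesis by (simp only: set_lebesgue_integral_def eq[OF sub(2)])
qed

lemma pm_time_integral:
  assumes h: "integrable pm (case_prod h)" and t: "t \<in> {0..T}"
  shows "(\<integral>(s, \<omega>). indicat_real {0<..t} s * h s \<omega> \<partial>pm) = (LBINT s:{0..t}. (\<integral>\<omega>. h s \<omega> \<partial>M :: real))"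
proof -
  have [measurable]: "indicat_real {0<..t} \<in> borel_measurable lam" by (rule borel_measurable_lam) simp
  have "integrable pm (\<lambda>(s, \<omega>). indicat_real {0<..t} s * h s \<omega>)"
  proof (rule Bochner_Integration.integrable_bound[OF h])
    have "(\<lambda>x. indicat_real {0<..t} (fst x) * case_prod h x) \<in> borel_measurable pm"
      using h by measurable
    then show "(\<lambda>(s, \<omega>). indicat_real {0<..t} s * h s \<omega>) \<in> borel_measurable pm" by (simp add: split_beta')
  qed (auto split: split_indicator)
  from integral_fst'[OF this] show ?thesis
    using lam_set_integral[OF t, of "\<lambda>s. \<integral>\<omega>. h s \<omega> \<partial>M"] borel_measurable_integrable[OF integrable_fst'[OF h]] by simp
qed

lemma AE_integrable_time:
  assumes "integrable pm (case_prod h)"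
  shows "AE \<omega> in M. integrable lam (\<lambda>s. h s \<omega> :: 'b::{banach, second_countable_topology})"
proof -
  interpret Q: pair_sigma_finite M lam ..
  have "integrable (M \<Otimes>\<^sub>M lam) (\<lambda>(\<omega>, s). h s \<omega>)"
    using integrable_product_swap[OF assms] by simp
  from Q.AE_integrable_fst'[OF this] show ?thesis by simp
qed

lemma lam_set_integrable:
  fixes f :: "real \<Rightarrow> 'b::{banach, second_countable_topology}"
  shows "integrable lam f \<longleftrightarrow> set_integrable lborel {0..T} f"
  unfolding lam_def set_integrable_def by (subst integrable_restrict_space) auto

lemma sq_int_pm_uniform:
  fixes u :: "real \<Rightarrow> 'w \<Rightarrow> 'b::euclidean_space"
  assumes m: "case_prod u \<in> borel_measurable pm" and u: "\<And>s. s \<in> {0..T} \<Longrightarrow> sq_int M (u s) \<and> sqn M (u s) \<le> C" and C: "0 \<le> C"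
  shows "sq_int pm (case_prod u)" "sqn pm (case_prod u) \<le> C * T"
proof -
  have [measurable]: "case_prod u \<in> borel_measurable pm" by fact
  have "(\<integral>\<^sup>+x. ennreal ((norm (case_prod u x))\<^sup>2) \<partial>pm) = (\<integral>\<^sup>+s. \<integral>\<^sup>+\<omega>. ennreal ((norm (u s \<omega>))\<^sup>2) \<partial>M \<partial>lam)"
    using sigma_finite_measure.nn_integral_fst[OF prob_space_imp_sigma_finite[OF prob_space_axioms],
        of "\<lambda>x. ennreal ((norm (case_prod u x))\<^sup>2)" lam] by simp
  also have "\<dots> = (\<integral>\<^sup>+s. ennreal (sqn M (u s)) \<partial>lam)"
    using u sq_int_nn_integral by (intro nn_integral_cong) auto
  also have "\<dots> \<le> (\<integral>\<^sup>+s. ennreal C \<partial>lam)"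
    using u by (intro nn_integral_mono ennreal_leI) auto
  also have "\<dots> = ennreal (C * T)"
    using emeasure_lam[of "{0..T}"] T_pos C by (simp add: ennreal_mult)
  finally have le: "(\<integral>\<^sup>+x. ennreal ((norm (case_prod u x))\<^sup>2) \<partial>pm) \<le> ennreal (C * T)" .
  have "0 \<le> C * T" using C T_pos by simp
  from sqn_le_nn_integral[OF m le this] show "sq_int pm (case_prod u)" "sqn pm (case_prod u) \<le> C * T" by auto
qed

text \<open>Cauchy-Schwarz in time against the indicator of (0, t], whose squared norm is at most T,
  followed by Tonelli.\<close>

lemma sq_int_time_integral:
  fixes h :: "real \<Rightarrow> 'w \<Rightarrow> real"
  assumes h: "sq_int pm (case_prod h)" and t: "t \<in> {0..T}"
    and m: "(\<lambda>\<omega>. LBINT s:{0..t}. h s \<omega>) \<in> borel_measurable M"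
  shows "sq_int M (\<lambda>\<omega>. LBINT s:{0..t}. h s \<omega>)" "sqn M (\<lambda>\<omega>. LBINT s:{0..t}. h s \<omega>) \<le> T * sqn pm (case_prod h)"
proof -
  have [measurable]: "case_prod h \<in> borel_measurable pm" using h by (rule sq_int_measurable)
  have i2: "integrable pm (\<lambda>(s, \<omega>). (norm (h s \<omega>))\<^sup>2)" using sq_int_integrable[OF h] by (simp add: split_beta')
  have "AE \<omega> in M. ennreal ((norm (LBINT s:{0..t}. h s \<omega>))\<^sup>2) \<le> ennreal T * (\<integral>\<^sup>+s. ennreal ((norm (h s \<omega>))\<^sup>2) \<partial>lam)"
    using AE_integrable_time[OF i2] AE_space
  proof eventually_elim
    case (elim \<omega>)
    have "(\<lambda>s. (s, \<omega>)) \<in> measurable lam pm" by (rule measurable_Pair2'[OF elim(2)])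
    from measurable_compose[OF this, of "case_prod h" borel] have "(\<lambda>s. h s \<omega>) \<in> borel_measurable lam" by simp
    then have hs: "sq_int lam (\<lambda>s. h s \<omega>)" using elim(1) by (simp add: sq_int_def)
    have ind: "sq_int lam (indicat_real {0<..t})"
      by (rule lam.sq_int_bounded[where K = 1]) (auto intro: borel_measurable_lam)
    have "\<bar>LBINT s:{0..t}. h s \<omega>\<bar> = \<bar>\<integral>s. indicat_real {0<..t} s \<bullet> h s \<omega> \<partial>lam\<bar>"
      using lam_set_integral[OF t sq_int_measurable[OF hs]] by simp
    also have "\<dots> \<le> sqrt (sqn lam (indicat_real {0<..t})) * sqrt (sqn lam (\<lambda>s. h s \<omega>))"
      by (rule L2_Cauchy_Schwarz[OF ind hs])
    also have "\<dots> \<le> sqrt T * sqrt (sqn lam (\<lambda>s. h s \<omega>))"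
    proof (intro mult_right_mono real_sqrt_le_mono)
      have "sqn lam (indicat_real {0<..t}) \<le> sqn lam (\<lambda>s. 1::real)"
        by (rule sqn_mono[OF ind]) (auto simp: indicator_def)
      also have "\<dots> = T" using measure_lam by (simp add: sqn_def)
      finally show "sqn lam (indicat_real {0<..t}) \<le> T" .
    qed auto
    finally have "\<bar>LBINT s:{0..t}. h s \<omega>\<bar>\<^sup>2 \<le> (sqrt T * sqrt (sqn lam (\<lambda>s. h s \<omega>)))\<^sup>2"
      by (intro power_mono) auto
    also have "\<dots> = T * sqn lam (\<lambda>s. h s \<omega>)" using T_pos by (simp add: power_mult_distrib)
    finally have "ennreal ((norm (LBINT s:{0..t}. h s \<omega>))\<^sup>2) \<le> ennreal (T * sqn lam (\<lambda>s. h s \<omega>))"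
      by (intro ennreal_leI) simp
    then show ?case using sq_int_nn_integral[OF hs] T_pos by (simp add: ennreal_mult)
  qed
  then have "(\<integral>\<^sup>+\<omega>. ennreal ((norm (LBINT s:{0..t}. h s \<omega>))\<^sup>2) \<partial>M) \<le> (\<integral>\<^sup>+\<omega>. ennreal T * (\<integral>\<^sup>+s. ennreal ((norm (h s \<omega>))\<^sup>2) \<partial>lam) \<partial>M)"
    by (rule nn_integral_mono_AE)
  also have "\<dots> = ennreal T * (\<integral>\<^sup>+\<omega>. \<integral>\<^sup>+s. ennreal ((norm (h s \<omega>))\<^sup>2) \<partial>lam \<partial>M)"
  proof (rule nn_integral_cmult)
    interpret Q: pair_sigma_finite M lam ..
    have "(\<lambda>x. (snd x, fst x)) \<in> measurable (M \<Otimes>\<^sub>M lam) pm" by measurable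
    from measurable_compose[OF this, of "\<lambda>x. ennreal ((norm (case_prod h x))\<^sup>2)" borel]
    have "(\<lambda>(\<omega>, s). ennreal ((norm (h s \<omega>))\<^sup>2)) \<in> borel_measurable (M \<Otimes>\<^sub>M lam)" by (simp add: split_beta')
    from lam.borel_measurable_nn_integral[OF this]
    show "(\<lambda>\<omega>. \<integral>\<^sup>+s. ennreal ((norm (h s \<omega>))\<^sup>2) \<partial>lam) \<in> borel_measurable M" by simp
  qed
  also have "(\<integral>\<^sup>+\<omega>. \<integral>\<^sup>+s. ennreal ((norm (h s \<omega>))\<^sup>2) \<partial>lam \<partial>M) = (\<integral>\<^sup>+x. ennreal ((norm (case_prod h x))\<^sup>2) \<partial>pm)"
    by (subst nn_integral_snd[symmetric]) (auto simp: split_beta')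
  also have "\<dots> = ennreal (sqn pm (case_prod h))" by (rule sq_int_nn_integral[OF h])
  finally have le: "(\<integral>\<^sup>+\<omega>. ennreal ((norm (LBINT s:{0..t}. h s \<omega>))\<^sup>2) \<partial>M) \<le> ennreal (T * sqn pm (case_prod h))"
    using T_pos by (simp add: ennreal_mult)
  have "0 \<le> T * sqn pm (case_prod h)" using T_pos by simp
  from sqn_le_nn_integral[OF m le this]
  show "sq_int M (\<lambda>\<omega>. LBINT s:{0..t}. h s \<omega>)" "sqn M (\<lambda>\<omega>. LBINT s:{0..t}. h s \<omega>) \<le> T * sqn pm (case_prod h)" by auto
qed

lemma progressive_integral':
  fixes u :: "real \<Rightarrow> 'w \<Rightarrow> 'b::{banach, second_countable_topology}"
  shows "progressively_measurable F T u \<Longrightarrow> t \<in> {0..T} \<Longrightarrow> (\<lambda>\<omega>. LBINT s:{0..t}. u s \<omega>) \<in> borel_measurable (F t)"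
  using progressive_integral[of u t UNIV] by simp

lemma sq_int_bdd_sum3:
  assumes "sq_int M f" "sq_int M g" "sq_int M h"
  shows "sqn M (\<lambda>\<omega>. f \<omega> + g \<omega> + h \<omega>) \<le> 4 * sqn M f + 4 * sqn M g + 2 * sqn M h"
  using sqn_add_le[OF sq_int_add[OF assms(1,2)] assms(3)] sqn_add_le[OF assms(1,2)] by linarith

end

section \<open>Continuity in time\<close>

lemma continuous_on_indefinite_set_integral:
  fixes f :: "real \<Rightarrow> real"
  assumes "set_integrable lborel {0..T} f"
  shows "continuous_on {0..T} (\<lambda>t. LBINT s:{0..t}. f s)"
proof -
  have i: "set_integrable lborel {0..t} f" if "t \<in> {0..T}" for t
    by (rule set_integrable_subset[OF assms]) (use that in auto)
  have "continuous_on {0..T} (\<lambda>t. integral {0..t} f)"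
    by (rule indefinite_integral_continuous_1) (rule set_borel_integral_eq_integral(1)[OF assms])
  then show ?thesis
    by (rule continuous_on_cong[THEN iffD1, rotated 2]) (use set_borel_integral_eq_integral(2)[OF i] in auto)
qed

text \<open>An almost sure identity at each fixed time holds at all rational times off one null set;
  continuity then extends it to the whole interval.\<close>

lemma continuous_zero_on_Rats:
  fixes h :: "real \<Rightarrow> real"
  assumes T: "0 < T" and h: "continuous_on {0..T} h" and q: "\<And>q. q \<in> \<rat> \<Longrightarrow> q \<in> {0..T} \<Longrightarrow> h q = 0" and t: "t \<in> {0..T}"
  shows "h t = 0"
proof (rule ccontr)
  assume "h t \<noteq> 0"
  then obtain d where d: "d > 0" "\<And>s. s \<in> {0..T} \<Longrightarrow> dist s t < d \<Longrightarrow> dist (h s) (h t) < \<bar>h t\<bar>"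
    using h t unfolding continuous_on_iff by (metis zero_less_abs_iff)
  obtain s where s: "s \<in> \<rat>" "s \<in> {0..T}" "dist s t < d"
  proof (cases "t < T")
    case True
    then obtain s where "s \<in> \<rat>" "t < s" "s < min T (t + d)"
      using Rats_dense_in_real[of t "min T (t + d)"] d by auto
    then show ?thesis using t by (intro that[of s]) (auto simp: dist_real_def)
  next
    case False
    then have "t = T" using t by simp
    then obtain s where "s \<in> \<rat>" "max 0 (t - d) < s" "s < t"
      using Rats_dense_in_real[of "max 0 (t - d)" t] d T by auto
    then show ?thesis using t by (intro that[of s]) (auto simp: dist_real_def)
  qed
  have "dist (h s) (h t) < \<bar>h t\<bar>" by (rule d(2)[OF s(2,3)])
  then show False using q[OF s(1,2)] by (simp add: dist_real_def)
qed

locale market = brownian_basis M F W T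
  for M :: "'w measure" and F :: "real \<Rightarrow> 'w measure" and W :: "real \<Rightarrow> 'w \<Rightarrow> 'v::euclidean_space" and T :: real +
  fixes r :: "real \<Rightarrow> real" and b :: "real \<Rightarrow> 'v" and Kb :: real
  assumes r_bdd: "bdd_meas T r" and r_nonneg: "\<And>t. t \<in> {0..T} \<Longrightarrow> 0 \<le> r t"
    and b_meas: "b \<in> borel_measurable (restrict_space borel {0..T})"
    and b_bound: "\<And>t. t \<in> {0..T} \<Longrightarrow> norm (b t) \<le> Kb"
begin

text \<open>The wealth equation with \<open>SI\<close> in the role of
  \<open>has_ito_integral\<close>. In \<open>wealth_equation_iff\<close> the progressive
  measurability of the drift is recovered from continuity and adaptedness of X.\<close>

definition solves :: "real \<Rightarrow> (real \<Rightarrow> 'w \<Rightarrow> 'v) \<Rightarrow> (real \<Rightarrow> 'w \<Rightarrow> real) \<Rightarrow> bool" where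
  "solves x v X \<longleftrightarrow>
     (\<forall>t\<in>{0..T}. X t \<in> borel_measurable (F t)) \<and>
     (\<forall>\<omega>\<in>space M. continuous_on {0..T} (\<lambda>t. X t \<omega>)) \<and>
     (AE \<omega> in M. set_integrable lborel {0..T} (\<lambda>s. r s * X s \<omega> + b s \<bullet> v s \<omega>)) \<and>
     v \<in> L2_processes M F T \<and>
     (\<forall>t\<in>{0..T}. \<exists>I. SI (\<lambda>p \<omega>. indicat_real {0<..t} p *\<^sub>R v p \<omega>) I \<and>
        (AE \<omega> in M. X t \<omega> = x + (LBINT s:{0..t}. r s * X s \<omega> + b s \<bullet> v s \<omega>) + I \<omega>))"

section \<open>Existence and uniqueness of the wealth process\<close>

lemma drift_progressive:
  assumes "progressively_measurable F T X" "progressively_measurable F T v"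
  shows "progressively_measurable F T (\<lambda>t \<omega>. r t * X t \<omega> + b t \<bullet> v t \<omega>)"
proof -
  have "r \<in> borel_measurable (restrict_space borel {0..T})" using r_bdd by (simp add: bdd_meas_def)
  then show ?thesis
    by (intro progressive_add progressive_mult progressive_inner progressive_deterministic assms b_meas)
qed

lemma wealth_equation_iff:
  "ito_process M F W T x (\<lambda>t \<omega>. r t * X t \<omega> + b t \<bullet> v t \<omega>) v X \<longleftrightarrow> solves x v X"
proof
  assume a: "ito_process M F W T x (\<lambda>t \<omega>. r t * X t \<omega> + b t \<bullet> v t \<omega>) v X"
  then have "v \<in> L2_processes M F T" by (simp add: ito_process_def)
  with a show "solves x v X"
    unfolding solves_def ito_process_def by (auto simp: has_ito_integral_iff)
next
  assume a: "solves x v X"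
  then have v: "v \<in> L2_processes M F T" by (simp add: solves_def)
  have "progressively_measurable F T X"
    by (rule continuous_adapted_progressive) (use a in \<open>auto simp: solves_def\<close>)
  then have "progressively_measurable F T (\<lambda>t \<omega>. r t * X t \<omega> + b t \<bullet> v t \<omega>)"
    by (rule drift_progressive) (use v in \<open>auto simp: L2_processes_iff\<close>)
  with a v show "ito_process M F W T x (\<lambda>t \<omega>. r t * X t \<omega> + b t \<bullet> v t \<omega>) v X"
    unfolding solves_def ito_process_def by (auto simp: has_ito_integral_iff)
qed

text \<open>The noise is additive: with x, the time integral of b . v and the stochastic integral
  collected in G, the equation X = G + integral of r X is a deterministic linear one for each path,
  and the resolvent solves it explicitly.\<close>

lemma solves_exists:
  assumes v: "v \<in> L2_processes M F T"
  obtains X C where "solves x v X" "0 \<le> C" "\<And>t. t \<in> {0..T} \<Longrightarrow> sq_int M (X t) \<and> sqn M (X t) \<le> C"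
proof -
  have v': "progressively_measurable F T v" "sq_int pm (case_prod v)" using v by (auto simp: L2_processes_iff)
  obtain N where N: "cmart N" and NSI: "\<And>t. t \<in> {0..T} \<Longrightarrow> SI (\<lambda>p \<omega>. indicat_real {0<..t} p *\<^sub>R v p \<omega>) (N t)"
    by (rule ito_integral_exists[OF v]) auto
  define g where "g s \<omega> = b s \<bullet> v s \<omega>" for s \<omega>
  have gp: "progressively_measurable F T g"
    unfolding g_def[abs_def] by (intro progressive_inner progressive_deterministic b_meas v')
  have gs: "sq_int pm (case_prod g)"
    using sq_int_pm_vector_inner[OF v'(2) b_meas b_bound] by (simp add: g_def[abs_def])
  have "AE \<omega> in M. set_integrable lborel {0..T} (\<lambda>s. g s \<omega>)"
    using AE_integrable_time[OF pm.sq_int_imp_integrable[OF gs]] by (simp only: lam_set_integrable)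
  then obtain Z where Z: "{\<omega>\<in>space M. \<not> set_integrable lborel {0..T} (\<lambda>s. g s \<omega>)} \<subseteq> Z" "Z \<in> null_sets M"
    unfolding eventually_ae_filter by auto
  \<comment> \<open>On the null set containing the paths where b . v is not integrable in time the
    forcing is the constant x, which keeps all paths continuous.\<close>
  define G where "G t \<omega> = (if \<omega> \<in> Z then x else x + (LBINT s:{0..t}. g s \<omega>) + N t \<omega>)" for t \<omega>
  have gi: "set_integrable lborel {0..T} (\<lambda>s. g s \<omega>)" if "\<omega> \<in> space M" "\<omega> \<notin> Z" for \<omega> using that Z(1) by blast
  have Gc: "continuous_on {0..T} (\<lambda>t. G t \<omega>)" if w: "\<omega> \<in> space M" for \<omega>
  proof (cases "\<omega> \<in> Z")
    case False
    have "continuous_on {0..T} (\<lambda>t. x + (LBINT s:{0..t}. g s \<omega>) + N t \<omega>)"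
      by (intro continuous_on_add continuous_on_const continuous_on_indefinite_set_integral gi w False cmart_continuous[OF N])
    then show ?thesis using False by (simp add: G_def)
  qed (simp add: G_def)
  have Gm: "G t \<in> borel_measurable (F t)" if t: "t \<in> {0..T}" for t
  proof -
    have [measurable]: "Z \<in> sets (F t)" using F_null[of t] Z(2) t by auto
    have [measurable]: "(\<lambda>\<omega>. LBINT s:{0..t}. g s \<omega>) \<in> borel_measurable (F t)" "N t \<in> borel_measurable (F t)"
      by (rule progressive_integral'[OF gp t], rule cmart_adapted[OF N t])
    show ?thesis unfolding G_def[abs_def] by measurable
  qed
  have Gp: "progressively_measurable F T G" by (rule continuous_adapted_progressive[OF Gm Gc])
  have Gb: "bdd_meas T (\<lambda>t. G t \<omega>)" if "\<omega> \<in> space M" for \<omega> by (rule bdd_meas_continuous[OF Gc[OF that]])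
  have AEZ: "AE \<omega> in M. \<omega> \<notin> Z" by (rule AE_not_in[OF Z(2)])
  \<comment> \<open>The weights 4, 4 and 2 are those of \<open>sq_int_bdd_sum3\<close>; the middle
    term is the bound of \<open>sq_int_time_integral\<close>, and the second moment of the
    martingale is largest at T.\<close>
  define CG where "CG = 4 * x\<^sup>2 + 4 * (T * sqn pm (case_prod g)) + 2 * sqn M (N T)"
  have CG: "0 \<le> CG" using T_pos by (simp add: CG_def)
  have Gs: "sq_int M (G t) \<and> sqn M (G t) \<le> CG" if t: "t \<in> {0..T}" for t
  proof -
    have mi: "(\<lambda>\<omega>. LBINT s:{0..t}. g s \<omega>) \<in> borel_measurable M"
      by (rule measurable_F_M[OF progressive_integral'[OF gp t]]) (use t in simp)
    have GM: "G t \<in> borel_measurable M" by (rule measurable_F_M[OF Gm[OF t]]) (use t in simp)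
    note gt = sq_int_time_integral[OF gs t mi]
    have s: "sq_int M (\<lambda>\<omega>. x + (LBINT s:{0..t}. g s \<omega>) + N t \<omega>)"
      by (intro sq_int_add sq_int_const gt cmart_sq_int[OF N t])
    have ae: "AE \<omega> in M. x + (LBINT s:{0..t}. g s \<omega>) + N t \<omega> = G t \<omega>"
      using AEZ by eventually_elim (simp add: G_def)
    have "sqn M (G t) = sqn M (\<lambda>\<omega>. x + (LBINT s:{0..t}. g s \<omega>) + N t \<omega>)"
      by (rule sqn_AE_cong[OF sq_int_measurable[OF s] GM ae, symmetric])
    also have "\<dots> \<le> 4 * sqn M (\<lambda>_. x) + 4 * sqn M (\<lambda>\<omega>. LBINT s:{0..t}. g s \<omega>) + 2 * sqn M (N t)"
      by (intro sq_int_bdd_sum3 sq_int_const gt cmart_sq_int[OF N t])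
    also have "sqn M (\<lambda>_. x) = x\<^sup>2" by (simp add: sqn_def prob_space)
    also have "sqn M (N t) \<le> sqn M (N T)" by (rule cmart_sqn_mono[OF N]) (use t in auto)
    finally have "sqn M (G t) \<le> CG" using gt(2) by (simp add: CG_def)
    then show ?thesis using sq_int_AE_cong[OF s GM ae] by blast
  qed
  define X where "X t \<omega> = G t \<omega> + volterra r (\<lambda>s. G s \<omega>) t" for t \<omega>
  have Xc: "continuous_on {0..T} (\<lambda>t. X t \<omega>)" if w: "\<omega> \<in> space M" for \<omega>
    unfolding X_def by (intro continuous_on_add Gc w primitive_continuous[OF primitive_volterra[OF r_bdd Gb]])
  have Vm: "(\<lambda>\<omega>. volterra r (\<lambda>s. G s \<omega>) t) \<in> borel_measurable (F t)" if t: "t \<in> {0..T}" for t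
  proof -
    have "continuous_on {0..T} (\<lambda>s. exp (- (LBINT u:{0..s}. r u)))"
      by (intro continuous_on_exp continuous_on_minus primitive_continuous[OF primitive_integral[OF r_bdd]])
    from bdd_meas_mult[OF bdd_meas_continuous[OF this] r_bdd]
    have "(\<lambda>s. exp (- (LBINT u:{0..s}. r u)) * r s) \<in> borel_measurable (restrict_space borel {0..T})"
      by (simp add: bdd_meas_def)
    from progressive_integral'[OF progressive_mult[OF progressive_deterministic[OF this] Gp] t]
    show ?thesis unfolding volterra_def by simp
  qed
  have Xm: "X t \<in> borel_measurable (F t)" if t: "t \<in> {0..T}" for t
    unfolding X_def[abs_def] by (intro borel_measurable_add Gm Vm t)
  have eq: "X t \<omega> = x + (LBINT s:{0..t}. r s * X s \<omega> + b s \<bullet> v s \<omega>) + N t \<omega>"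
    if w: "\<omega> \<in> space M" "\<omega> \<notin> Z" and t: "t \<in> {0..T}" for t \<omega>
  proof -
    have i1: "set_integrable lborel {0..t} (\<lambda>s. r s * X s \<omega>)"
      by (rule bdd_meas_set_integrable[OF bdd_meas_mult[OF r_bdd bdd_meas_continuous[OF Xc[OF w(1)]]]]) (use t in auto)
    have i2: "set_integrable lborel {0..t} (\<lambda>s. g s \<omega>)"
      by (rule set_integrable_subset[OF gi[OF w]]) (use t in auto)
    have "volterra r (\<lambda>s. G s \<omega>) t = (LBINT s:{0..t}. r s * X s \<omega>)"
      using volterra_equation[OF r_bdd Gb[OF w(1)] t] by (simp add: X_def add.commute)
    then have "X t \<omega> = x + (LBINT s:{0..t}. g s \<omega>) + N t \<omega> + (LBINT s:{0..t}. r s * X s \<omega>)"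
      using w(2) by (simp add: X_def G_def)
    also have "\<dots> = x + (LBINT s:{0..t}. r s * X s \<omega> + g s \<omega>) + N t \<omega>"
      using set_integral_add(2)[OF i1 i2] by simp
    finally show ?thesis by (simp add: g_def)
  qed
  have sol: "solves x v X"
    unfolding solves_def
  proof (intro conjI ballI v Xm Xc)
    show "AE \<omega> in M. set_integrable lborel {0..T} (\<lambda>s. r s * X s \<omega> + b s \<bullet> v s \<omega>)"
      using AEZ AE_space
    proof eventually_elim
      case (elim \<omega>)
      have "set_integrable lborel {0..T} (\<lambda>s. r s * X s \<omega>)"
        by (rule bdd_meas_set_integrable[OF bdd_meas_mult[OF r_bdd bdd_meas_continuous[OF Xc[OF elim(2)]]]]) auto
      from set_integral_add(1)[OF this gi[OF elim(2,1)]] show ?case by (simp add: g_def)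
    qed
    fix t assume t: "t \<in> {0..T}"
    have "AE \<omega> in M. X t \<omega> = x + (LBINT s:{0..t}. r s * X s \<omega> + b s \<bullet> v s \<omega>) + N t \<omega>"
      using AEZ AE_space by eventually_elim (rule eq[OF _ _ t])
    then show "\<exists>I. SI (\<lambda>p \<omega>. indicat_real {0<..t} p *\<^sub>R v p \<omega>) I \<and>
        (AE \<omega> in M. X t \<omega> = x + (LBINT s:{0..t}. r s * X s \<omega> + b s \<bullet> v s \<omega>) + I \<omega>)"
      using NSI[OF t] by blast
  qed auto
  obtain K where K: "0 < K" "\<And>G t. bdd_meas T G \<Longrightarrow> t \<in> {0..T} \<Longrightarrow> \<bar>volterra r G t\<bar> \<le> K * (LBINT s:{0..t}. \<bar>G s\<bar>)"
    by (rule volterra_bound[OF r_bdd]) auto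
  \<comment> \<open>K bounds the resolvent by the time integral of |G|. The second moment of that
    integral is at most T times the squared norm of G on the product, which in turn is at most CG
    T.\<close>
  define C where "C = 2 * CG + 2 * (K\<^sup>2 * (T * (CG * T)))"
  have C: "0 \<le> C" using CG T_pos by (simp add: C_def)
  have "sq_int M (X t) \<and> sqn M (X t) \<le> C" if t: "t \<in> {0..T}" for t
  proof -
    note Gpm = sq_int_pm_uniform[OF progressive_pm[OF Gp] Gs CG]
    have absG: "progressively_measurable F T (\<lambda>s \<omega>. \<bar>G s \<omega>\<bar>)"
      using Gp unfolding progressively_measurable_def split_beta' by (auto intro: borel_measurable_abs)
    have aG: "sq_int pm (\<lambda>(s, \<omega>). \<bar>G s \<omega>\<bar>)" "sqn pm (\<lambda>(s, \<omega>). \<bar>G s \<omega>\<bar>) = sqn pm (case_prod G)"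
      using Gpm(1) progressive_pm[OF absG] by (simp_all add: sq_int_def sqn_def split_beta')
    have mi: "(\<lambda>\<omega>. LBINT s:{0..t}. \<bar>G s \<omega>\<bar>) \<in> borel_measurable M"
      by (rule measurable_F_M[OF progressive_integral'[OF absG t]]) (use t in simp)
    note A = sq_int_time_integral[OF aG(1) t mi]
    have Vs: "sq_int M (\<lambda>\<omega>. volterra r (\<lambda>s. G s \<omega>) t)"
      and Vn: "sqn M (\<lambda>\<omega>. volterra r (\<lambda>s. G s \<omega>) t) \<le> K\<^sup>2 * sqn M (\<lambda>\<omega>. LBINT s:{0..t}. \<bar>G s \<omega>\<bar>)"
    proof -
      have n: "norm (volterra r (\<lambda>s. G s \<omega>) t) \<le> norm (K *\<^sub>R (LBINT s:{0..t}. \<bar>G s \<omega>\<bar>))" if "\<omega> \<in> space M" for \<omega>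
        using K(2)[OF Gb[OF that] t] by (simp add: abs_mult) (metis abs_ge_self abs_mult order_trans)
      have ks: "sq_int M (\<lambda>\<omega>. K *\<^sub>R (LBINT s:{0..t}. \<bar>G s \<omega>\<bar>))" by (rule sq_int_scaleR[OF A(1)])
      show s: "sq_int M (\<lambda>\<omega>. volterra r (\<lambda>s. G s \<omega>) t)"
      proof (rule sq_int_dominated[OF _ sq_int_integrable[OF ks]])
        show "(\<lambda>\<omega>. volterra r (\<lambda>s. G s \<omega>) t) \<in> borel_measurable M"
          by (rule measurable_F_M[OF Vm[OF t]]) (use t in simp)
      qed (rule power_mono[OF n norm_ge_zero])
      show "sqn M (\<lambda>\<omega>. volterra r (\<lambda>s. G s \<omega>) t) \<le> K\<^sup>2 * sqn M (\<lambda>\<omega>. LBINT s:{0..t}. \<bar>G s \<omega>\<bar>)"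
        using sqn_mono[OF s ks n] by (simp only: sqn_scaleR)
    qed
    have "sqn M (X t) \<le> 2 * sqn M (G t) + 2 * sqn M (\<lambda>\<omega>. volterra r (\<lambda>s. G s \<omega>) t)"
      unfolding X_def[abs_def] using Gs[OF t] Vs by (intro sqn_add_le) auto
    also have "\<dots> \<le> C"
    proof -
      have "K\<^sup>2 * sqn M (\<lambda>\<omega>. LBINT s:{0..t}. \<bar>G s \<omega>\<bar>) \<le> K\<^sup>2 * (T * (CG * T))"
        using A(2) Gpm(2) T_pos by (intro mult_left_mono) (auto simp: aG(2) intro: order_trans mult_left_mono)
      then show ?thesis using Vn Gs[OF t] by (simp add: C_def)
    qed
    finally show ?thesis using Gs[OF t] Vs by (auto simp: X_def[abs_def] intro: sq_int_add)
  qed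
  with sol C show thesis by (rule that)
qed

text \<open>The stochastic integrals agree almost surely and cancel, so the difference solves the
  homogeneous Volterra equation at each fixed time. Rational times and continuous paths give a
  single null set, off which the deterministic uniqueness applies.\<close>

lemma solves_unique:
  assumes X: "solves x v X" and Y: "solves x v Y" and t: "t \<in> {0..T}"
  shows "AE \<omega> in M. X t \<omega> = Y t \<omega>"
proof -
  define D where "D t \<omega> = X t \<omega> - Y t \<omega>" for t \<omega>
  let ?aX = "\<lambda>\<omega> s. r s * X s \<omega> + b s \<bullet> v s \<omega>" and ?aY = "\<lambda>\<omega> s. r s * Y s \<omega> + b s \<bullet> v s \<omega>"
  have iX: "AE \<omega> in M. set_integrable lborel {0..T} (?aX \<omega>)" and iY: "AE \<omega> in M. set_integrable lborel {0..T} (?aY \<omega>)"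
    using X Y by (auto simp: solves_def)
  have Dc: "continuous_on {0..T} (\<lambda>t. D t \<omega>)" if "\<omega> \<in> space M" for \<omega>
    unfolding D_def using X Y that by (intro continuous_on_diff) (auto simp: solves_def)
  have D1: "AE \<omega> in M. D t \<omega> = (LBINT s:{0..t}. r s * D s \<omega>)" if t: "t \<in> {0..T}" for t
  proof -
    obtain I where I: "SI (\<lambda>p \<omega>. indicat_real {0<..t} p *\<^sub>R v p \<omega>) I"
      "AE \<omega> in M. X t \<omega> = x + (LBINT s:{0..t}. ?aX \<omega> s) + I \<omega>" using X t unfolding solves_def by blast
    obtain J where J: "SI (\<lambda>p \<omega>. indicat_real {0<..t} p *\<^sub>R v p \<omega>) J"
      "AE \<omega> in M. Y t \<omega> = x + (LBINT s:{0..t}. ?aY \<omega> s) + J \<omega>" using Y t unfolding solves_def by blast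
    show ?thesis
      using I(2) J(2) SI_unique[OF I(1) J(1)] iX iY
    proof eventually_elim
      case (elim \<omega>)
      have "set_integrable lborel {0..t} (?aX \<omega>)" "set_integrable lborel {0..t} (?aY \<omega>)"
        by (rule set_integrable_subset[OF elim(4)], use t in auto) (rule set_integrable_subset[OF elim(5)], use t in auto)
      from set_integral_diff(2)[OF this]
      have "D t \<omega> = (LBINT s:{0..t}. ?aX \<omega> s - ?aY \<omega> s)" using elim by (simp add: D_def)
      then show ?case by (simp add: D_def right_diff_distrib)
    qed
  qed
  have "AE \<omega> in M. \<forall>q\<in>\<rat> \<inter> {0..T}. D q \<omega> = (LBINT s:{0..q}. r s * D s \<omega>)"
    by (intro AE_ball_countable' D1) (auto intro: countable_subset[OF _ countable_rat])
  then show ?thesis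
    using AE_space
  proof eventually_elim
    case (elim \<omega>)
    note Db = bdd_meas_continuous[OF Dc[OF elim(2)]]
    have "D t \<omega> - (LBINT s:{0..t}. r s * D s \<omega>) = 0" if t: "t \<in> {0..T}" for t
      by (rule continuous_zero_on_Rats[OF T_pos _ _ t])
         (use elim in \<open>auto intro!: continuous_on_diff Dc primitive_continuous[OF primitive_integral] bdd_meas_mult r_bdd Db\<close>)
    then have "D t \<omega> = 0" by (intro volterra_unique_zero[OF r_bdd Db _ t]) simp
    then show ?case by (simp add: D_def)
  qed
qed

end

section \<open>Linear stochastic equations without drift\<close>

context market
begin

lemma cmart_sq_int_pm:
  assumes "cmart P" shows "sq_int pm (case_prod P)" "sqn pm (case_prod P) \<le> sqn M (P T) * T"
proof -
  have "sq_int M (P s) \<and> sqn M (P s) \<le> sqn M (P T)" if "s \<in> {0..T}" for s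
    using cmart_sq_int[OF assms that] cmart_sqn_mono[OF assms, of s T] that by simp
  from sq_int_pm_uniform[OF progressive_pm[OF cmart_progressive[OF assms]] this]
  show "sq_int pm (case_prod P)" "sqn pm (case_prod P) \<le> sqn M (P T) * T" by auto
qed

lemma integrand_L2:
  assumes \<psi>: "\<psi> \<in> L2_processes M F T" and P: "cmart P"
  shows "(\<lambda>s \<omega>. \<psi> s \<omega> - P s \<omega> *\<^sub>R b s) \<in> L2_processes M F T"
proof (rule L2_processes_diff[OF \<psi>])
  show "(\<lambda>s \<omega>. P s \<omega> *\<^sub>R b s) \<in> L2_processes M F T"
    unfolding L2_processes_iff
    using progressive_scaleR[OF cmart_progressive[OF P] progressive_deterministic[OF b_meas]]
      sq_int_pm_vector_mult(1)[OF cmart_sq_int_pm(1)[OF P] b_meas b_bound] by simp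
qed

lemma sqn_time_restricted:
  assumes h: "sq_int pm (case_prod h)" and t: "t \<in> {0..T}"
  shows "sqn pm (\<lambda>(s, \<omega>). indicat_real {0<..t} s * h s \<omega>) = (LBINT s:{0..t}. sqn M (h s :: 'w \<Rightarrow> real))"
proof -
  have i: "integrable pm (\<lambda>(s, \<omega>). (h s \<omega>)\<^sup>2)" using sq_int_integrable[OF h] by (simp add: split_beta')
  have "sqn pm (\<lambda>(s, \<omega>). indicat_real {0<..t} s * h s \<omega>) = (\<integral>(s, \<omega>). indicat_real {0<..t} s * (h s \<omega>)\<^sup>2 \<partial>pm)"
    unfolding sqn_def by (intro Bochner_Integration.integral_cong) (auto split: split_indicator)
  then show ?thesis using pm_time_integral[OF i t] by (simp add: sqn_real)
qed

lemma set_integrable_sqn: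
  assumes h: "sq_int pm (case_prod h)" and t: "t \<in> {0..T}"
  shows "set_integrable lborel {0..t} (\<lambda>s. sqn M (h s :: 'w \<Rightarrow> real))"
proof -
  have i: "integrable pm (\<lambda>(s, \<omega>). (h s \<omega>)\<^sup>2)" using sq_int_integrable[OF h] by (simp add: split_beta')
  have "integrable lam (\<lambda>s. sqn M (h s))" using integrable_fst'[OF i] by (simp add: sqn_real)
  then show ?thesis unfolding lam_set_integrable by (rule set_integrable_subset) (use t in auto)
qed

text \<open>The Lipschitz estimate of the Picard map: \<open>\<psi>\<close> cancels, the integrands
  differ by (Q' - Q) b, and the isometry together with the bound on b does the rest.\<close>

lemma iteration_step:
  assumes Q: "cmart Q" "cmart Q'"
    and R: "SI (\<lambda>p \<omega>. indicat_real {0<..t} p *\<^sub>R (\<psi> p \<omega> - Q p \<omega> *\<^sub>R b p)) (\<lambda>\<omega>. R \<omega> - p0)"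
      "SI (\<lambda>p \<omega>. indicat_real {0<..t} p *\<^sub>R (\<psi> p \<omega> - Q' p \<omega> *\<^sub>R b p)) (\<lambda>\<omega>. R' \<omega> - p0)"
    and t: "t \<in> {0..T}"
  shows "sqn M (\<lambda>\<omega>. R \<omega> - R' \<omega>) \<le> Kb\<^sup>2 * (LBINT s:{0..t}. sqn M (\<lambda>\<omega>. Q s \<omega> - Q' s \<omega>))"
proof -
  let ?h = "\<lambda>s \<omega>. indicat_real {0<..t} s * (Q' s \<omega> - Q s \<omega>)"
  have d: "sq_int pm (\<lambda>(s, \<omega>). Q' s \<omega> - Q s \<omega>)"
    using cmart_sq_int_pm(1)[OF cmart_diff[OF Q(2,1)]] by simp
  have h: "sq_int pm (\<lambda>(s, \<omega>). ?h s \<omega>)" using pm_indicator(1)[OF d, of "{0<..t}"] by simp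
  have "sqn M (\<lambda>\<omega>. R \<omega> - R' \<omega>) = sqn M (\<lambda>\<omega>. (R \<omega> - p0) - (R' \<omega> - p0))" by simp
  also have "\<dots> = sqn pm (\<lambda>(p, \<omega>). indicat_real {0<..t} p *\<^sub>R (\<psi> p \<omega> - Q p \<omega> *\<^sub>R b p)
      - indicat_real {0<..t} p *\<^sub>R (\<psi> p \<omega> - Q' p \<omega> *\<^sub>R b p))"
    by (rule SI_distance[OF R])
  also have "\<dots> = sqn pm (\<lambda>(s, \<omega>). ?h s \<omega> *\<^sub>R b s)"
    by (rule arg_cong[of _ _ "sqn pm"]) (auto simp: fun_eq_iff scaleR_diff_left split: split_indicator)
  also have "\<dots> \<le> Kb\<^sup>2 * sqn pm (\<lambda>(s, \<omega>). ?h s \<omega>)"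
    by (rule sq_int_pm_vector_mult(2)[OF h b_meas b_bound])
  also have "sqn pm (\<lambda>(s, \<omega>). ?h s \<omega>) = (LBINT s:{0..t}. sqn M (\<lambda>\<omega>. Q' s \<omega> - Q s \<omega>))"
    by (rule sqn_time_restricted[OF d t])
  finally show ?thesis by (simp add: sqn_minus[of M "Q' _"])
qed

lemma set_integral_power: "0 \<le> t \<Longrightarrow> (LBINT s:{0..t}. s ^ k) = t ^ Suc k / real (Suc k)"
  using integral_power[of 0 t k] by (simp add: set_lebesgue_integral_def mult.commute)

text \<open>Picard iteration among continuous martingales, starting from the constant p0. In squared
  norm the k-th increment at time t is at most D (L t)^k / k!.\<close>

lemma linear_sde_exists:
  assumes \<psi>: "\<psi> \<in> L2_processes M F T"
  obtains P where "cmart P"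
    "\<And>t. t \<in> {0..T} \<Longrightarrow> SI (\<lambda>p \<omega>. indicat_real {0<..t} p *\<^sub>R (\<psi> p \<omega> - P p \<omega> *\<^sub>R b p)) (\<lambda>\<omega>. P t \<omega> - p0)"
proof -
  have T: "T \<in> {0..T}" "0 \<le> T" using T_pos by auto
  \<comment> \<open>The implication makes the statement hold for every Q, so that choice yields a
    total map which can be iterated.\<close>
  have "\<exists>R. cmart Q \<longrightarrow> cmart R \<and>
      (\<forall>t\<in>{0..T}. SI (\<lambda>p \<omega>. indicat_real {0<..t} p *\<^sub>R (\<psi> p \<omega> - Q p \<omega> *\<^sub>R b p)) (\<lambda>\<omega>. R t \<omega> - p0))" for Q
  proof (cases "cmart Q")
    case True
    obtain N where N: "cmart N" "\<And>t. t \<in> {0..T} \<Longrightarrow> SI (\<lambda>p \<omega>. indicat_real {0<..t} p *\<^sub>R (\<psi> p \<omega> - Q p \<omega> *\<^sub>R b p)) (N t)"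
      by (rule ito_integral_exists[OF integrand_L2[OF \<psi> True]]) auto
    have "cmart (\<lambda>t \<omega>. N t \<omega> - (- p0))" by (intro cmart_diff N(1) cmart_const)
    moreover have "(\<lambda>\<omega>. (N t \<omega> - (- p0)) - p0) = N t" for t by simp
    ultimately show ?thesis using N(2) by (intro exI[of _ "\<lambda>t \<omega>. N t \<omega> - (- p0)"]) simp
  qed simp
  from choice[OF allI[OF this]] obtain f where f: "\<forall>Q. cmart Q \<longrightarrow> cmart (f Q) \<and>
      (\<forall>t\<in>{0..T}. SI (\<lambda>p \<omega>. indicat_real {0<..t} p *\<^sub>R (\<psi> p \<omega> - Q p \<omega> *\<^sub>R b p)) (\<lambda>\<omega>. f Q t \<omega> - p0))" ..
  define P where "P n = (f ^^ n) (\<lambda>_ _. p0)" for n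
  have PS: "P (Suc n) = f (P n)" for n by (simp add: P_def)
  have P: "cmart (P n)" for n
  proof (induction n)
    case 0
    show ?case by (simp add: P_def cmart_const)
  next
    case (Suc n)
    then show ?case using f PS by simp
  qed
  have PSI: "SI (\<lambda>p \<omega>. indicat_real {0<..t} p *\<^sub>R (\<psi> p \<omega> - P n p \<omega> *\<^sub>R b p)) (\<lambda>\<omega>. P (Suc n) t \<omega> - p0)"
    if "t \<in> {0..T}" for n t using f P[of n] that PS by simp
  define \<delta> where "\<delta> k t = sqn M (\<lambda>\<omega>. P (Suc k) t \<omega> - P k t \<omega>)" for k t
  define D where "D = \<delta> 0 T"
  define L where "L = Kb\<^sup>2"
  have pos: "0 \<le> D" "0 \<le> L" by (simp_all add: D_def \<delta>_def L_def)
  have \<delta>: "\<delta> k t \<le> D * (L * t) ^ k / fact k" if "t \<in> {0..T}" for k t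
    using that
  proof (induction k arbitrary: t)
    case 0
    then show ?case
      using cmart_sqn_mono[OF cmart_diff[OF P[of "Suc 0"] P[of 0]], of t T] by (simp add: D_def \<delta>_def)
  next
    case (Suc k)
    have "\<delta> (Suc k) t \<le> Kb\<^sup>2 * (LBINT s:{0..t}. sqn M (\<lambda>\<omega>. P (Suc k) s \<omega> - P k s \<omega>))"
      unfolding \<delta>_def by (rule iteration_step[OF P P PSI PSI]) (use Suc in auto)
    also have "\<dots> \<le> Kb\<^sup>2 * (LBINT s:{0..t}. D * L ^ k / fact k * s ^ k)"
    proof (intro mult_left_mono set_integral_mono)
      show "set_integrable lborel {0..t} (\<lambda>s. sqn M (\<lambda>\<omega>. P (Suc k) s \<omega> - P k s \<omega>))"
        by (rule set_integrable_sqn[OF cmart_sq_int_pm(1)[OF cmart_diff[OF P P]] Suc.prems])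
      show "set_integrable lborel {0..t} (\<lambda>s. D * L ^ k / fact k * s ^ k)"
        by (rule bdd_meas_set_integrable[OF bdd_meas_continuous[of t]]) (auto intro!: continuous_intros)
      fix s assume "s \<in> {0..t}"
      then have "s \<in> {0..T}" using Suc.prems by auto
      from Suc.IH[OF this] show "sqn M (\<lambda>\<omega>. P (Suc k) s \<omega> - P k s \<omega>) \<le> D * L ^ k / fact k * s ^ k"
        by (simp add: \<delta>_def power_mult_distrib)
    qed simp
    also have "\<dots> = L * (D * L ^ k / fact k * (t ^ Suc k / real (Suc k)))"
      using Suc.prems set_integral_power[of t k] by (simp add: L_def)
    also have "\<dots> = D * (L * t) ^ Suc k / fact (Suc k)"
      by (simp add: power_mult_distrib field_simps)
    finally show ?case .
  qed
  \<comment> \<open>Each application of \<open>sqn_triangle\<close> in the telescope doubles what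
    remains, whence the weights 2 ^ k. The factorial absorbs them: (2 L T)^k / k! is still
    summable.\<close>
  have chain: "2 ^ j * sqn M (\<lambda>\<omega>. P (j + n) T \<omega> - P j T \<omega>) \<le> 2 * (\<Sum>k\<in>{j..<j + n}. 2 ^ k * \<delta> k T)" for n j
  proof (induction n arbitrary: j)
    case 0
    then show ?case by (simp add: sqn_def)
  next
    case (Suc n)
    have "sqn M (\<lambda>\<omega>. P (j + Suc n) T \<omega> - P j T \<omega>)
        \<le> 2 * sqn M (\<lambda>\<omega>. P (Suc j + n) T \<omega> - P (Suc j) T \<omega>) + 2 * \<delta> j T"
      using sqn_triangle[OF cmart_sq_int[OF P[of "Suc j + n"] T(1)] cmart_sq_int[OF P[of "Suc j"] T(1)] cmart_sq_int[OF P[of j] T(1)]]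
      by (simp add: \<delta>_def)
    then have "2 ^ j * sqn M (\<lambda>\<omega>. P (j + Suc n) T \<omega> - P j T \<omega>)
        \<le> 2 ^ j * (2 * sqn M (\<lambda>\<omega>. P (Suc j + n) T \<omega> - P (Suc j) T \<omega>) + 2 * \<delta> j T)"
      by (rule mult_left_mono) simp
    also have "\<dots> = 2 ^ Suc j * sqn M (\<lambda>\<omega>. P (Suc j + n) T \<omega> - P (Suc j) T \<omega>) + 2 * (2 ^ j * \<delta> j T)"
      by (simp add: algebra_simps)
    also have "\<dots> \<le> 2 * (\<Sum>k\<in>{Suc j..<Suc j + n}. 2 ^ k * \<delta> k T) + 2 * (2 ^ j * \<delta> j T)"
      using Suc.IH[of "Suc j"] by simp
    also have "\<dots> = 2 * (\<Sum>k\<in>{j..<j + Suc n}. 2 ^ k * \<delta> k T)"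
      by (subst (2) sum.atLeast_Suc_lessThan) (auto simp: algebra_simps)
    finally show ?case .
  qed
  define a where "a k = (2 * L * T) ^ k / fact k" for k
  have "summable a"
    using summable_exp[of "2 * L * T"] by (simp add: a_def[abs_def] field_simps)
  have bound: "sqn M (\<lambda>\<omega>. P (j + n) T \<omega> - P j T \<omega>) \<le> 2 * D * (\<Sum>k\<in>{j..<j + n}. a k)" for j n
  proof -
    have "1 * sqn M (\<lambda>\<omega>. P (j + n) T \<omega> - P j T \<omega>) \<le> 2 ^ j * sqn M (\<lambda>\<omega>. P (j + n) T \<omega> - P j T \<omega>)"
      by (rule mult_right_mono) auto
    also have "\<dots> \<le> 2 * (\<Sum>k\<in>{j..<j + n}. 2 ^ k * \<delta> k T)" by (rule chain)
    also have "\<dots> \<le> 2 * (\<Sum>k\<in>{j..<j + n}. D * a k)"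
    proof (intro mult_left_mono sum_mono)
      fix k
      have "2 ^ k * \<delta> k T \<le> 2 ^ k * (D * (L * T) ^ k / fact k)" by (intro mult_left_mono \<delta> T) simp
      also have "\<dots> = D * a k" by (simp add: a_def power_mult_distrib)
      finally show "2 ^ k * \<delta> k T \<le> D * a k" .
    qed simp
    finally show ?thesis by (simp add: sum_distrib_left mult.assoc)
  qed
  have Cauchy: "\<exists>n0. \<forall>i\<ge>n0. \<forall>j\<ge>n0. sqn M (\<lambda>\<omega>. P i T \<omega> - P j T \<omega>) < e" if e: "e > 0" for e
  proof -
    \<comment> \<open>The added 1 covers the case D = 0.\<close>
    have e': "0 < e / (2 * D + 1)" using e pos by simp
    obtain n0 where n0: "\<And>m n. m \<ge> n0 \<Longrightarrow> norm (sum a {m..<n}) < e / (2 * D + 1)"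
      using \<open>summable a\<close> e' unfolding summable_Cauchy by blast
    have le: "sqn M (\<lambda>\<omega>. P i T \<omega> - P j T \<omega>) < e" if "n0 \<le> j" "j \<le> i" for i j
    proof -
      have "sqn M (\<lambda>\<omega>. P i T \<omega> - P j T \<omega>) \<le> 2 * D * sum a {j..<i}"
        using bound[of j "i - j"] that by simp
      also have "\<dots> \<le> 2 * D * (e / (2 * D + 1))"
        using n0[OF that(1), of i] pos by (intro mult_left_mono) auto
      also have "\<dots> < e" using e pos by (simp add: field_simps)
      finally show ?thesis .
    qed
    have "sqn M (\<lambda>\<omega>. P i T \<omega> - P j T \<omega>) < e" if "n0 \<le> i" "n0 \<le> j" for i j
      using le[of i j] le[of j i] that sqn_minus[of M "P i T" "P j T"] by (cases "i \<le> j") auto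
    then show ?thesis by blast
  qed
  obtain P0 where P0: "cmart P0"
    "\<And>e. e > 0 \<Longrightarrow> \<exists>n0. \<forall>n\<ge>n0. \<forall>t\<in>{0..T}. sqn M (\<lambda>\<omega>. P n t \<omega> - P0 t \<omega>) \<le> e"
    using cmart_limit[OF P Cauchy] by blast
  have conv: "(\<lambda>n. sqn M (\<lambda>\<omega>. P n t \<omega> - P0 t \<omega>)) \<longlonglongrightarrow> 0" if t: "t \<in> {0..T}" for t
  proof (rule LIMSEQ_I)
    fix e :: real assume "e > 0"
    then obtain n0 where "\<forall>n\<ge>n0. \<forall>t\<in>{0..T}. sqn M (\<lambda>\<omega>. P n t \<omega> - P0 t \<omega>) \<le> e / 2"
      using P0(2)[of "e / 2"] by auto
    then show "\<exists>n0. \<forall>n\<ge>n0. norm (sqn M (\<lambda>\<omega>. P n t \<omega> - P0 t \<omega>) - 0) < e"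
      using t \<open>e > 0\<close> by (intro exI[of _ n0]) force
  qed
  show thesis
  proof (rule that[OF P0(1)])
    fix t assume t: "t \<in> {0..T}"
    let ?u = "\<lambda>Q p \<omega>. indicat_real {0<..t} p *\<^sub>R (\<psi> p \<omega> - Q p \<omega> *\<^sub>R b p)"
    have us: "sq_int pm (case_prod (?u Q))" if "cmart Q" for Q
      using integrand_L2[OF \<psi> that] by (intro pm_indicator(1)) (auto simp: L2_processes_iff)
    show "SI (?u P0) (\<lambda>\<omega>. P0 t \<omega> - p0)"
    proof (rule SI_limit[OF PSI[OF t] us[OF P0(1)]])
      show "sq_int M (\<lambda>\<omega>. P0 t \<omega> - p0)" by (intro sq_int_diff cmart_sq_int[OF P0(1) t] sq_int_const)
      show "(\<lambda>n. sqn M (\<lambda>\<omega>. P (Suc n) t \<omega> - p0 - (P0 t \<omega> - p0))) \<longlonglongrightarrow> 0"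
        using LIMSEQ_Suc[OF conv[OF t]] by simp
      \<comment> \<open>Closeness at time T controls the integrands at all times, because the second
        moment of the martingale P0 - P n increases.\<close>
      have le: "sqn pm (\<lambda>(p, \<omega>). ?u (P n) p \<omega> - ?u P0 p \<omega>) \<le> L * T * sqn M (\<lambda>\<omega>. P n T \<omega> - P0 T \<omega>)" for n
      proof -
        have c: "cmart (\<lambda>s \<omega>. P0 s \<omega> - P n s \<omega>)" by (intro cmart_diff P P0)
        have h: "sq_int pm (\<lambda>(s, \<omega>). indicat_real {0<..t} s * (P0 s \<omega> - P n s \<omega>))"
          using pm_indicator(1)[OF cmart_sq_int_pm(1)[OF c], of "{0<..t}"] by simp
        have "sqn pm (\<lambda>(p, \<omega>). ?u (P n) p \<omega> - ?u P0 p \<omega>) = sqn pm (\<lambda>(s, \<omega>). (indicat_real {0<..t} s * (P0 s \<omega> - P n s \<omega>)) *\<^sub>R b s)"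
          by (rule arg_cong[of _ _ "sqn pm"]) (auto simp: fun_eq_iff scaleR_diff_left split: split_indicator)
        also have "\<dots> \<le> Kb\<^sup>2 * sqn pm (\<lambda>(s, \<omega>). indicat_real {0<..t} s * (P0 s \<omega> - P n s \<omega>))"
          by (rule sq_int_pm_vector_mult(2)[OF h b_meas b_bound])
        also have "\<dots> \<le> Kb\<^sup>2 * (sqn M (\<lambda>\<omega>. P0 T \<omega> - P n T \<omega>) * T)"
        proof (rule mult_left_mono)
          have "sqn pm (\<lambda>(s, \<omega>). indicat_real {0<..t} s * (P0 s \<omega> - P n s \<omega>)) \<le> sqn pm (\<lambda>(s, \<omega>). P0 s \<omega> - P n s \<omega>)"
            using pm_indicator(2)[OF cmart_sq_int_pm(1)[OF c], of "{0<..t}"] by simp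
          also have "\<dots> \<le> sqn M (\<lambda>\<omega>. P0 T \<omega> - P n T \<omega>) * T" by (rule cmart_sq_int_pm(2)[OF c])
          finally show "sqn pm (\<lambda>(s, \<omega>). indicat_real {0<..t} s * (P0 s \<omega> - P n s \<omega>)) \<le> sqn M (\<lambda>\<omega>. P0 T \<omega> - P n T \<omega>) * T" .
        qed simp
        finally show ?thesis by (simp add: L_def sqn_minus[of M "P0 T"] mult_ac)
      qed
      have "(\<lambda>n. L * T * sqn M (\<lambda>\<omega>. P n T \<omega> - P0 T \<omega>)) \<longlonglongrightarrow> L * T * 0"
        by (intro tendsto_mult_left conv T)
      then have l0: "(\<lambda>n. L * T * sqn M (\<lambda>\<omega>. P n T \<omega> - P0 T \<omega>)) \<longlonglongrightarrow> 0" by simp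
      show "(\<lambda>n. sqn pm (\<lambda>(p, \<omega>). ?u (P n) p \<omega> - ?u P0 p \<omega>)) \<longlonglongrightarrow> 0"
        by (rule tendsto_sandwich[OF always_eventually always_eventually tendsto_const l0])
           (use le in auto)
    qed
  qed
qed

section \<open>Duality\<close>

text \<open>\<open>solves\<close> speaks of adapted continuous paths and not of moments of X;
  uniqueness transfers the moments of the constructed solution.\<close>

lemma solves_moments:
  assumes X: "solves x v X"
  obtains C where "0 \<le> C" "\<And>t. t \<in> {0..T} \<Longrightarrow> sq_int M (X t) \<and> sqn M (X t) \<le> C"
proof -
  have v: "v \<in> L2_processes M F T" using X by (simp add: solves_def)
  obtain Y C where Y: "solves x v Y" "0 \<le> C" "\<And>t. t \<in> {0..T} \<Longrightarrow> sq_int M (Y t) \<and> sqn M (Y t) \<le> C"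
    by (rule solves_exists[OF v, of x]) auto
  show thesis
  proof (rule that[OF Y(2)])
    fix t assume t: "t \<in> {0..T}"
    have Xm: "X t \<in> borel_measurable M"
      by (rule measurable_F_M[of _ t]) (use X t in \<open>auto simp: solves_def\<close>)
    note ae = solves_unique[OF Y(1) X t]
    have Ys: "sq_int M (Y t)" using Y(3)[OF t] by simp
    show "sq_int M (X t) \<and> sqn M (X t) \<le> C"
      using sq_int_AE_cong[OF Ys Xm ae] sqn_AE_cong[OF sq_int_measurable[OF Ys] Xm ae] Y(3)[OF t] by simp
  qed
qed

lemma solves_progressive: "solves x v X \<Longrightarrow> progressively_measurable F T X"
  by (rule continuous_adapted_progressive) (auto simp: solves_def)

text \<open>After Fubini, P t may be replaced by P s inside the time integral, since
  \<open>\<alpha> s\<close> is known at s and can serve as test variable. Its square integrability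
  is available for almost every s, which suffices under the integral.\<close>

lemma martingale_time_integral:
  assumes P: "cmart P" and \<alpha>: "progressively_measurable F T \<alpha>" "sq_int pm (case_prod \<alpha>)" and t: "t \<in> {0..T}"
  shows "(\<integral>\<omega>. P t \<omega> * (LBINT s:{0..t}. \<alpha> s \<omega>) \<partial>M) = (\<integral>(s, \<omega>). indicat_real {0<..t} s * (P s \<omega> * \<alpha> s \<omega>) \<partial>pm)"
proof -
  have \<alpha>m [measurable]: "case_prod \<alpha> \<in> borel_measurable pm" by (rule sq_int_measurable[OF \<alpha>(2)])
  have Pm: "P t \<in> borel_measurable M" by (rule sq_int_measurable[OF cmart_sq_int[OF P t]])
  have Pt: "sq_int pm (\<lambda>(s, \<omega>). P t \<omega>)"
  proof (rule sq_int_pm_uniform(1)[where C = "sqn M (P t)"])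
    show "(\<lambda>(s, \<omega>). P t \<omega>) \<in> borel_measurable pm" using measurable_compose[OF measurable_snd Pm] by (simp add: split_beta')
  qed (use cmart_sq_int[OF P t] in auto)
  note Ps = cmart_sq_int_pm(1)[OF P]
  have i1: "integrable pm (\<lambda>(s, \<omega>). P t \<omega> * \<alpha> s \<omega>)" using sq_int_mult[OF Pt \<alpha>(2)] by (simp add: split_beta')
  have i2: "integrable pm (\<lambda>(s, \<omega>). P s \<omega> * \<alpha> s \<omega>)" using sq_int_mult[OF Ps \<alpha>(2)] by (simp add: split_beta')
  have ind: "integrable pm (\<lambda>(s, \<omega>). indicat_real {0<..t} s * h s \<omega>)" if "integrable pm (case_prod h)" for h
  proof (rule Bochner_Integration.integrable_bound[OF that])
    have [measurable]: "indicat_real {0<..t} \<in> borel_measurable lam" by (rule borel_measurable_lam) simp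
    have "(\<lambda>x. indicat_real {0<..t} (fst x) * case_prod h x) \<in> borel_measurable pm"
      using that by measurable
    then show "(\<lambda>(s, \<omega>). indicat_real {0<..t} s * h s \<omega>) \<in> borel_measurable pm" by (simp add: split_beta')
  qed (auto split: split_indicator)
  note j1 = ind[OF i1] and j2 = ind[OF i2]
  have "(\<integral>\<omega>. P t \<omega> * (LBINT s:{0..t}. \<alpha> s \<omega>) \<partial>M) = (\<integral>\<omega>. (\<integral>s. indicat_real {0<..t} s * (P t \<omega> * \<alpha> s \<omega>) \<partial>lam) \<partial>M)"
  proof (rule Bochner_Integration.integral_cong[OF refl])
    fix \<omega> assume w: "\<omega> \<in> space M"
    have "(\<lambda>s. (s, \<omega>)) \<in> measurable lam pm" by (rule measurable_Pair2'[OF w])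
    from measurable_compose[OF this \<alpha>m] have m: "(\<lambda>s. \<alpha> s \<omega>) \<in> borel_measurable lam" by simp
    show "P t \<omega> * (LBINT s:{0..t}. \<alpha> s \<omega>) = (\<integral>s. indicat_real {0<..t} s * (P t \<omega> * \<alpha> s \<omega>) \<partial>lam)"
      unfolding lam_set_integral[OF t m, symmetric]
      by (subst integral_mult_right_zero[symmetric]) (simp add: mult.left_commute)
  qed
  also have "\<dots> = (\<integral>(s, \<omega>). indicat_real {0<..t} s * (P t \<omega> * \<alpha> s \<omega>) \<partial>pm)"
    by (rule integral_snd[OF j1])
  also have "\<dots> = (\<integral>(s, \<omega>). indicat_real {0<..t} s * (P s \<omega> * \<alpha> s \<omega>) \<partial>pm)"
  proof -
    have i3: "AE s in lam. integrable M (\<lambda>\<omega>. (norm (\<alpha> s \<omega>))\<^sup>2)"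
      using AE_integrable_fst'[OF sq_int_integrable[OF \<alpha>(2)]] by simp
    have "(\<integral>s. (\<integral>\<omega>. indicat_real {0<..t} s * (P t \<omega> * \<alpha> s \<omega>) \<partial>M) \<partial>lam)
        = (\<integral>s. (\<integral>\<omega>. indicat_real {0<..t} s * (P s \<omega> * \<alpha> s \<omega>) \<partial>M) \<partial>lam)"
    proof (rule integral_cong_AE)
      show "(\<lambda>s. \<integral>\<omega>. indicat_real {0<..t} s * (P t \<omega> * \<alpha> s \<omega>) \<partial>M) \<in> borel_measurable lam"
        using borel_measurable_integrable[OF integrable_fst'[OF j1]] by simp
      show "(\<lambda>s. \<integral>\<omega>. indicat_real {0<..t} s * (P s \<omega> * \<alpha> s \<omega>) \<partial>M) \<in> borel_measurable lam"
        using borel_measurable_integrable[OF integrable_fst'[OF j2]] by simp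
      show "AE s in lam. (\<integral>\<omega>. indicat_real {0<..t} s * (P t \<omega> * \<alpha> s \<omega>) \<partial>M) = (\<integral>\<omega>. indicat_real {0<..t} s * (P s \<omega> * \<alpha> s \<omega>) \<partial>M)"
        using i3 AE_space
      proof eventually_elim
        case (elim s)
        then have s: "s \<in> {0..T}" by simp
        have m: "\<alpha> s \<in> borel_measurable (F s)" by (rule progressive_section[OF \<alpha>(1) s])
        have "sq_int M (\<alpha> s)" using elim(1) measurable_F_M[OF m] s by (simp add: sq_int_def)
        then have "(\<integral>\<omega>. \<alpha> s \<omega> * P t \<omega> \<partial>M) = (\<integral>\<omega>. \<alpha> s \<omega> * P s \<omega> \<partial>M)" if "s \<le> t"
          by (intro cmart_martingale[OF P] m) (use s t that in auto)
        then show ?case by (cases "s \<in> {0<..t}") (auto simp: mult.commute)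
      qed
    qed
    then show ?thesis using integral_fst'[OF j1] integral_fst'[OF j2] by simp
  qed
  finally show ?thesis .
qed

text \<open>A product rule in expectation. Split X t into x, the drift integral and the stochastic
  integral: the first contributes p0 x, the second is \<open>martingale_time_integral\<close>, the
  third is the isometry. The term P b . v from the drift of X cancels against the term - P b in the
  integrand of P, which is the reason for that term in the equation of P.\<close>

lemma duality:
  assumes X: "solves x v X" and \<psi>: "\<psi> \<in> L2_processes M F T" and P: "cmart P"
    and PSI: "\<And>t. t \<in> {0..T} \<Longrightarrow> SI (\<lambda>p \<omega>. indicat_real {0<..t} p *\<^sub>R (\<psi> p \<omega> - P p \<omega> *\<^sub>R b p)) (\<lambda>\<omega>. P t \<omega> - p0)"
    and t: "t \<in> {0..T}"
  shows "(\<integral>\<omega>. P t \<omega> * X t \<omega> \<partial>M)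
    = p0 * x + (LBINT s:{0..t}. r s * (\<integral>\<omega>. P s \<omega> * X s \<omega> \<partial>M)) + (LBINT s:{0..t}. (\<integral>\<omega>. \<psi> s \<omega> \<bullet> v s \<omega> \<partial>M))"
proof -
  have v: "progressively_measurable F T v" "sq_int pm (case_prod v)" using X by (auto simp: solves_def L2_processes_iff)
  have \<psi>s: "sq_int pm (case_prod \<psi>)" using \<psi> by (simp add: L2_processes_iff)
  obtain C where C: "0 \<le> C" "\<And>t. t \<in> {0..T} \<Longrightarrow> sq_int M (X t) \<and> sqn M (X t) \<le> C"
    by (rule solves_moments[OF X]) auto
  note Xp = solves_progressive[OF X]
  note Xs = sq_int_pm_uniform(1)[OF progressive_pm[OF Xp] C(2) C(1)]
  define \<alpha> where "\<alpha> s \<omega> = r s * X s \<omega> + b s \<bullet> v s \<omega>" for s \<omega>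
  have \<alpha>p: "progressively_measurable F T \<alpha>" unfolding \<alpha>_def[abs_def] by (rule drift_progressive[OF Xp v(1)])
  obtain Kr where Kr: "0 < Kr" "\<And>s. s \<in> {0..T} \<Longrightarrow> \<bar>r s\<bar> \<le> Kr" by (rule bdd_meas_bound[OF r_bdd]) auto
  have rl: "r \<in> borel_measurable lam" using r_bdd by (simp add: bdd_meas_def measurable_lam_iff)
  have rX: "sq_int pm (\<lambda>(s, \<omega>). r s * X s \<omega>)"
    using pm_time_mult(1)[OF Xs rl Kr(2)] by simp
  have \<alpha>s: "sq_int pm (case_prod \<alpha>)"
    using pm_add[OF rX sq_int_pm_vector_inner[OF v(2) b_meas b_bound]] by (simp add: \<alpha>_def[abs_def])
  obtain I where I: "SI (\<lambda>p \<omega>. indicat_real {0<..t} p *\<^sub>R v p \<omega>) I"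
    "AE \<omega> in M. X t \<omega> = x + (LBINT s:{0..t}. r s * X s \<omega> + b s \<bullet> v s \<omega>) + I \<omega>"
    using X t unfolding solves_def by blast
  define A where "A \<omega> = (LBINT s:{0..t}. \<alpha> s \<omega>)" for \<omega>
  have Am: "A \<in> borel_measurable M"
    unfolding A_def[abs_def] by (rule measurable_F_M[OF progressive_integral'[OF \<alpha>p t]]) (use t in simp)
  have As: "sq_int M A"
    using sq_int_time_integral(1)[OF \<alpha>s t] Am unfolding A_def[abs_def] by blast
  note Pt = cmart_sq_int[OF P t] and Is = SI_sq_int(2)[OF I(1)]
  have one: "(\<integral>\<omega>. 1 * J \<omega> \<partial>M) = 0" if "SI (\<lambda>p \<omega>. indicat_real {0<..t} p *\<^sub>R u p \<omega>) J" for u J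
    by (rule SI_orthogonal[OF that]) (use t in auto)
  have EP: "(\<integral>\<omega>. P t \<omega> \<partial>M) = p0"
    using one[OF PSI[OF t]] sq_int_imp_integrable[OF Pt] by (simp add: prob_space)
  have EI: "(\<integral>\<omega>. I \<omega> \<partial>M) = 0" using one[OF I(1)] by simp
  have EPI: "(\<integral>\<omega>. P t \<omega> * I \<omega> \<partial>M) = (\<integral>(s, \<omega>). indicat_real {0<..t} s * ((\<psi> s \<omega> - P s \<omega> *\<^sub>R b s) \<bullet> v s \<omega>) \<partial>pm)"
  proof -
    have "(\<integral>\<omega>. P t \<omega> * I \<omega> \<partial>M) = (\<integral>\<omega>. (P t \<omega> - p0) * I \<omega> + p0 * I \<omega> \<partial>M)"
      by (simp add: algebra_simps)
    also have "\<dots> = (\<integral>\<omega>. (P t \<omega> - p0) * I \<omega> \<partial>M) + (\<integral>\<omega>. p0 * I \<omega> \<partial>M)"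
      by (intro Bochner_Integration.integral_add sq_int_mult sq_int_diff Pt Is sq_int_const)
    also have "\<dots> = (\<integral>(s, \<omega>). (indicat_real {0<..t} s *\<^sub>R (\<psi> s \<omega> - P s \<omega> *\<^sub>R b s)) \<bullet> (indicat_real {0<..t} s *\<^sub>R v s \<omega>) \<partial>pm)"
      using SI_isometry[OF PSI[OF t] I(1)] EI by simp
    also have "\<dots> = (\<integral>(s, \<omega>). indicat_real {0<..t} s * ((\<psi> s \<omega> - P s \<omega> *\<^sub>R b s) \<bullet> v s \<omega>) \<partial>pm)"
      by (intro Bochner_Integration.integral_cong) (auto split: split_indicator)
    finally show ?thesis .
  qed
  have EPA: "(\<integral>\<omega>. P t \<omega> * A \<omega> \<partial>M) = (\<integral>(s, \<omega>). indicat_real {0<..t} s * (P s \<omega> * \<alpha> s \<omega>) \<partial>pm)"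
    unfolding A_def by (rule martingale_time_integral[OF P \<alpha>p \<alpha>s t])
  note Ps = cmart_sq_int_pm(1)[OF P]
  have h1: "integrable pm (\<lambda>(s, \<omega>). r s * (P s \<omega> * X s \<omega>))"
    using sq_int_mult[OF Ps rX] by (simp add: split_beta' mult.left_commute)
  have h2: "integrable pm (\<lambda>(s, \<omega>). \<psi> s \<omega> \<bullet> v s \<omega>)"
    using sq_int_inner[OF \<psi>s v(2)] by (simp add: split_beta')
  have ind: "integrable pm (\<lambda>(s, \<omega>). indicat_real {0<..t} s * h s \<omega>)" if "integrable pm (case_prod h)" for h
  proof (rule Bochner_Integration.integrable_bound[OF that])
    have [measurable]: "indicat_real {0<..t} \<in> borel_measurable lam" by (rule borel_measurable_lam) simp
    have "(\<lambda>x. indicat_real {0<..t} (fst x) * case_prod h x) \<in> borel_measurable pm"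
      using that by measurable
    then show "(\<lambda>(s, \<omega>). indicat_real {0<..t} s * h s \<omega>) \<in> borel_measurable pm" by (simp add: split_beta')
  qed (auto split: split_indicator)
  have g1: "integrable pm (\<lambda>(s, \<omega>). P s \<omega> * \<alpha> s \<omega>)" using sq_int_mult[OF Ps \<alpha>s] by (simp add: split_beta')
  have g2: "integrable pm (\<lambda>(s, \<omega>). (\<psi> s \<omega> - P s \<omega> *\<^sub>R b s) \<bullet> v s \<omega>)"
  proof -
    have "sq_int pm (\<lambda>(s, \<omega>). \<psi> s \<omega> - P s \<omega> *\<^sub>R b s)"
      using integrand_L2[OF \<psi> P] by (simp add: L2_processes_iff)
    from sq_int_inner[OF this v(2)] show ?thesis by (simp add: split_beta')
  qed
  have "(\<integral>\<omega>. P t \<omega> * X t \<omega> \<partial>M) = (\<integral>\<omega>. P t \<omega> * x + P t \<omega> * A \<omega> + P t \<omega> * I \<omega> \<partial>M)"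
  proof (rule integral_cong_AE)
    show "AE \<omega> in M. P t \<omega> * X t \<omega> = P t \<omega> * x + P t \<omega> * A \<omega> + P t \<omega> * I \<omega>"
      using I(2) by eventually_elim (simp add: A_def \<alpha>_def algebra_simps)
    have [measurable]: "P t \<in> borel_measurable M" "X t \<in> borel_measurable M" "I \<in> borel_measurable M" "A \<in> borel_measurable M"
      using Pt C(2)[OF t] Is As sq_int_measurable by blast+
    show "(\<lambda>\<omega>. P t \<omega> * X t \<omega>) \<in> borel_measurable M" by measurable
    show "(\<lambda>\<omega>. P t \<omega> * x + P t \<omega> * A \<omega> + P t \<omega> * I \<omega>) \<in> borel_measurable M" by measurable
  qed
  also have "\<dots> = p0 * x + (\<integral>\<omega>. P t \<omega> * A \<omega> \<partial>M) + (\<integral>\<omega>. P t \<omega> * I \<omega> \<partial>M)"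
    using sq_int_mult[OF Pt As] sq_int_mult[OF Pt Is] sq_int_imp_integrable[OF Pt] EP by simp
  also have "\<dots> = p0 * x + ((\<integral>(s, \<omega>). indicat_real {0<..t} s * (P s \<omega> * \<alpha> s \<omega>) \<partial>pm)
      + (\<integral>(s, \<omega>). indicat_real {0<..t} s * ((\<psi> s \<omega> - P s \<omega> *\<^sub>R b s) \<bullet> v s \<omega>) \<partial>pm))"
    by (simp only: EPA EPI add.assoc)
  also have "(\<integral>(s, \<omega>). indicat_real {0<..t} s * (P s \<omega> * \<alpha> s \<omega>) \<partial>pm)
      + (\<integral>(s, \<omega>). indicat_real {0<..t} s * ((\<psi> s \<omega> - P s \<omega> *\<^sub>R b s) \<bullet> v s \<omega>) \<partial>pm)
      = (\<integral>(s, \<omega>). indicat_real {0<..t} s * (r s * (P s \<omega> * X s \<omega>)) \<partial>pm)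
      + (\<integral>(s, \<omega>). indicat_real {0<..t} s * (\<psi> s \<omega> \<bullet> v s \<omega>) \<partial>pm)"
  proof -
    have "(\<lambda>x. (case x of (s, \<omega>) \<Rightarrow> indicat_real {0<..t} s * (P s \<omega> * \<alpha> s \<omega>))
          + (case x of (s, \<omega>) \<Rightarrow> indicat_real {0<..t} s * ((\<psi> s \<omega> - P s \<omega> *\<^sub>R b s) \<bullet> v s \<omega>)))
        = (\<lambda>x. (case x of (s, \<omega>) \<Rightarrow> indicat_real {0<..t} s * (r s * (P s \<omega> * X s \<omega>)))
          + (case x of (s, \<omega>) \<Rightarrow> indicat_real {0<..t} s * (\<psi> s \<omega> \<bullet> v s \<omega>)))"
      by (auto simp: fun_eq_iff \<alpha>_def inner_diff_left algebra_simps)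
    then show ?thesis
      using Bochner_Integration.integral_add[OF ind[OF g1] ind[OF g2]]
        Bochner_Integration.integral_add[OF ind[OF h1] ind[OF h2]] by simp
  qed
  also have "\<dots> = (LBINT s:{0..t}. r s * (\<integral>\<omega>. P s \<omega> * X s \<omega> \<partial>M)) + (LBINT s:{0..t}. (\<integral>\<omega>. \<psi> s \<omega> \<bullet> v s \<omega> \<partial>M))"
    using pm_time_integral[OF h1 t] pm_time_integral[OF h2 t] by simp
  finally show ?thesis by simp
qed

section \<open>Integration by parts with a deterministic factor\<close>

text \<open>Left-point Riemann sums of \<open>\<phi>\<close> against N are evaluated twice. In L2
  they tend to the stochastic integral of \<open>\<phi>\<close> times \<open>\<eta>\<close>, because
  step functions approximate the Lipschitz function \<open>\<phi>\<close> uniformly. Along each path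
  they tend to the expression from summation by parts. The two limits agree almost surely.\<close>

lemma deterministic_integration_by_parts:
  assumes \<phi>: "primitive T \<phi> \<phi>'" and \<eta>: "\<eta> \<in> L2_processes M F T" and N: "cmart N"
    and NSI: "\<And>t. t \<in> {0..T} \<Longrightarrow> SI (\<lambda>p \<omega>. indicat_real {0<..t} p *\<^sub>R \<eta> p \<omega>) (N t)"
    and t: "t \<in> {0..T}"
  shows "SI (\<lambda>p \<omega>. indicat_real {0<..t} p *\<^sub>R (\<phi> p *\<^sub>R \<eta> p \<omega>)) (\<lambda>\<omega>. \<phi> t * N t \<omega> - (LBINT s:{0..t}. \<phi>' s * N s \<omega>))"
proof -
  have \<eta>s: "progressively_measurable F T \<eta>" "sq_int pm (case_prod \<eta>)" using \<eta> by (auto simp: L2_processes_iff)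
  obtain K where K: "0 < K" "\<And>s t. 0 \<le> s \<Longrightarrow> s \<le> t \<Longrightarrow> t \<le> T \<Longrightarrow> \<bar>\<phi> t - \<phi> s\<bar> \<le> K * (t - s)" "\<And>s. s \<in> {0..T} \<Longrightarrow> \<bar>\<phi>' s\<bar> \<le> K"
    by (rule primitive_Lipschitz[OF \<phi>]) auto
  note \<phi>b = primitive_bdd[OF \<phi>] and \<phi>'b = primitive_density[OF \<phi>]
  obtain B where B: "0 < B" "\<And>s. s \<in> {0..T} \<Longrightarrow> \<bar>\<phi> s\<bar> \<le> B" by (rule bdd_meas_bound[OF \<phi>b]) auto
  have \<phi>m: "\<phi> \<in> borel_measurable (restrict_space borel {0..T})" using \<phi>b by (simp add: bdd_meas_def)
  then have \<phi>l: "\<phi> \<in> borel_measurable lam" by (simp add: measurable_lam_iff)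
  have \<phi>\<eta>: "(\<lambda>p \<omega>. \<phi> p *\<^sub>R \<eta> p \<omega>) \<in> L2_processes M F T"
    unfolding L2_processes_iff
    by (intro conjI progressive_scaleR progressive_deterministic \<phi>m \<eta>s pm_time_mult(1)[OF \<eta>s(2) \<phi>l B(2)])
  obtain V where V: "cmart V" "\<And>t. t \<in> {0..T} \<Longrightarrow> SI (\<lambda>p \<omega>. indicat_real {0<..t} p *\<^sub>R (\<phi> p *\<^sub>R \<eta> p \<omega>)) (V t)"
    by (rule ito_integral_exists[OF \<phi>\<eta>]) auto
  define \<tau> where "\<tau> n k = t / real (Suc n) * real k" for n k :: nat
  have d: "\<tau> n (Suc k) - \<tau> n k = t / real (Suc n)" for n k
    unfolding \<tau>_def right_diff_distrib[symmetric] by simp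
  have \<tau>0: "\<tau> n 0 = 0" "\<tau> n (Suc n) = t" for n by (simp_all add: \<tau>_def del: of_nat_Suc)
  have \<tau>: "\<tau> n k \<in> {0..T}" "\<tau> n k \<le> t" if "k \<le> Suc n" for n k
  proof -
    have "t / real (Suc n) * real k \<le> t / real (Suc n) * real (Suc n)"
      using t that by (intro mult_left_mono) auto
    then show "\<tau> n k \<le> t" by (simp add: \<tau>_def)
    moreover have "0 \<le> \<tau> n k" using t by (simp add: \<tau>_def)
    ultimately show "\<tau> n k \<in> {0..T}" using t by simp
  qed
  have \<tau>S: "\<tau> n k \<le> \<tau> n (Suc k)" for n k
  proof -
    have "0 \<le> t / real (Suc n)" using t by simp
    then show ?thesis using d[of n k] by linarith
  qed
  have cell: "{\<tau> n k<..\<tau> n (Suc k)} = cell (t / real (Suc n)) k" for n k by (simp add: \<tau>_def cell_def)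
  define c where "c n s = (\<Sum>k<Suc n. \<phi> (\<tau> n k) * indicat_real {\<tau> n k<..\<tau> n (Suc k)} s)" for n s
  define I where "I n \<omega> = (\<Sum>k<Suc n. \<phi> (\<tau> n k) * (N (\<tau> n (Suc k)) \<omega> - N (\<tau> n k) \<omega>))" for n \<omega>
  have ISI: "SI (\<lambda>p \<omega>. c n p *\<^sub>R \<eta> p \<omega>) (I n)" for n
  proof -
    have "SI (\<lambda>p \<omega>. \<Sum>k<Suc n. \<phi> (\<tau> n k) *\<^sub>R (indicat_real {\<tau> n k<..\<tau> n (Suc k)} p *\<^sub>R \<eta> p \<omega>))
       (\<lambda>\<omega>. \<Sum>k<Suc n. \<phi> (\<tau> n k) * (N (\<tau> n (Suc k)) \<omega> - N (\<tau> n k) \<omega>))"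
    proof (rule SI_sum, rule SI_scaleR)
      fix k assume "k \<in> {..<Suc n}"
      then have k: "k \<le> Suc n" "Suc k \<le> Suc n" by auto
      show "SI (\<lambda>p \<omega>. indicat_real {\<tau> n k<..\<tau> n (Suc k)} p *\<^sub>R \<eta> p \<omega>) (\<lambda>\<omega>. N (\<tau> n (Suc k)) \<omega> - N (\<tau> n k) \<omega>)"
        using \<tau>(1)[OF k(1)] by (intro SI_indicator_diff NSI \<tau> k \<tau>S) auto
    qed
    then show ?thesis by (simp only: c_def I_def[abs_def] scaleR_sum_left scaleR_scaleR)
  qed
  have cd: "\<bar>c n s - indicat_real {0<..t} s * \<phi> s\<bar> \<le> K * t / real (Suc n)" if s: "s \<in> {0..T}" for n s
  proof (cases "s \<in> {0<..t}")
    case True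
    then interpret Iv: interval t by unfold_locales auto
    obtain k where k: "k < Suc n" "s \<in> cell (t / real (Suc n)) k"
      using Iv.cell_exists[OF _ True, of "Suc n"] by (metis zero_less_Suc)
    have h: "0 < t / real (Suc n)" using Iv.t_pos by simp
    have e: "indicat_real {\<tau> n j<..\<tau> n (Suc j)} s = (if j = k then 1 else 0)" for j
      unfolding cell using cell_disjoint[OF h, of j k] cell_disjoint[OF h, of k j] k(2)
      by (cases j k rule: linorder_cases) (auto simp: indicator_def)
    have "c n s = \<phi> (\<tau> n k)" using k(1) by (simp add: c_def e if_distrib[of "(*) _"] sum.delta cong: if_cong del: sum.lessThan_Suc)
    moreover have sk: "\<tau> n k < s" "s \<le> \<tau> n (Suc k)" using k(2) cell[of n k] by auto
    moreover have "\<bar>\<phi> s - \<phi> (\<tau> n k)\<bar> \<le> K * (s - \<tau> n k)"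
      by (rule K(2)) (use sk s \<tau>(1)[of k n] k in auto)
    moreover have "K * (s - \<tau> n k) \<le> K * (t / real (Suc n))"
      using sk d[of n k] K(1) by (intro mult_left_mono) auto
    ultimately show ?thesis using True by (simp add: abs_minus_commute)
  next
    case False
    have "indicat_real {\<tau> n k<..\<tau> n (Suc k)} s = 0" if "k < Suc n" for k
    proof -
      have "{\<tau> n k<..\<tau> n (Suc k)} \<subseteq> {0<..t}" using \<tau>(1)[of k n] \<tau>(2)[of "Suc k" n] that by auto
      then have "s \<notin> {\<tau> n k<..\<tau> n (Suc k)}" using False by blast
      then show ?thesis by simp
    qed
    then have "c n s = 0" unfolding c_def by (intro sum.neutral) auto
    then show ?thesis using False K(1) t by simp
  qed
  have conv: "(\<lambda>n. sqn M (\<lambda>\<omega>. I n \<omega> - V t \<omega>)) \<longlonglongrightarrow> 0"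
  proof (rule tendsto_sandwich[OF always_eventually always_eventually tendsto_const], safe)
    fix n
    have cm: "(\<lambda>s. c n s - indicat_real {0<..t} s * \<phi> s) \<in> borel_measurable lam"
      unfolding c_def by (intro borel_measurable_diff borel_measurable_sum borel_measurable_times \<phi>l borel_measurable_const borel_measurable_lam) auto
    have "sqn M (\<lambda>\<omega>. I n \<omega> - V t \<omega>) = sqn pm (\<lambda>(p, \<omega>). c n p *\<^sub>R \<eta> p \<omega> - indicat_real {0<..t} p *\<^sub>R (\<phi> p *\<^sub>R \<eta> p \<omega>))"
      by (rule SI_distance[OF ISI V(2)[OF t]])
    also have "\<dots> = sqn pm (\<lambda>(p, \<omega>). (c n p - indicat_real {0<..t} p * \<phi> p) *\<^sub>R \<eta> p \<omega>)"
      by (simp add: scaleR_diff_left)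
    also have "\<dots> \<le> (K * t / real (Suc n))\<^sup>2 * sqn pm (case_prod \<eta>)"
      by (rule pm_time_mult(2)[OF \<eta>s(2) cm cd])
    finally show "sqn M (\<lambda>\<omega>. I n \<omega> - V t \<omega>) \<le> (K * t * inverse (real (Suc n)))\<^sup>2 * sqn pm (case_prod \<eta>)"
      by (simp only: divide_inverse)
  next
    have "(\<lambda>n. (K * t * inverse (real (Suc n)))\<^sup>2 * sqn pm (case_prod \<eta>)) \<longlonglongrightarrow> (K * t * 0)\<^sup>2 * sqn pm (case_prod \<eta>)"
      by (intro tendsto_intros LIMSEQ_inverse_real_of_nat)
    then show "(\<lambda>n. (K * t * inverse (real (Suc n)))\<^sup>2 * sqn pm (case_prod \<eta>)) \<longlonglongrightarrow> 0" by simp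
  qed simp
  define R where "R \<omega> = \<phi> t * N t \<omega> - \<phi> 0 * N 0 \<omega> - (LBINT s:{0..t}. \<phi>' s * N s \<omega>)" for \<omega>
  have path: "(\<lambda>n. I n \<omega>) \<longlonglongrightarrow> R \<omega>" if w: "\<omega> \<in> space M" for \<omega>
  proof (rule LIMSEQ_I)
    fix e :: real assume e: "e > 0"
    note Nc = cmart_continuous[OF N w]
    have Nb: "bdd_meas T (\<lambda>s. N s \<omega>)" by (rule bdd_meas_continuous[OF Nc])
    \<comment> \<open>The added 1 keeps the denominator positive for t = 0 and makes the final
      inequality strict.\<close>
    have e': "0 < e / (K * t + 1)" using e K(1) t by (simp add: add_nonneg_pos)
    have "uniformly_continuous_on {0..T} (\<lambda>s. N s \<omega>)" by (rule compact_uniformly_continuous[OF Nc]) simp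
    then obtain \<rho> where \<rho>: "\<rho> > 0" "\<And>s s'. s \<in> {0..T} \<Longrightarrow> s' \<in> {0..T} \<Longrightarrow> dist s' s < \<rho> \<Longrightarrow> dist (N s' \<omega>) (N s \<omega>) < e / (K * t + 1)"
      using e' unfolding uniformly_continuous_on_def by blast
    obtain n0 where n0: "real n0 > t / \<rho>" using reals_Archimedean2 by blast
    have "norm (I n \<omega> - R \<omega>) < e" if n: "n \<ge> n0" for n
    proof -
      have small: "t / real (Suc n) < \<rho>"
      proof -
        have "t / \<rho> < real (Suc n)" using n0 n by linarith
        then show ?thesis using \<rho>(1) by (simp add: field_simps)
      qed
      define J where "J s = (LBINT u:{0..s}. \<phi>' u * N u \<omega>)" for s
      have pN: "bdd_meas T (\<lambda>u. \<phi>' u * N u \<omega>)" by (rule bdd_meas_mult[OF \<phi>'b Nb])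
      have J: "J (\<tau> n (Suc k)) - J (\<tau> n k) = (LBINT u:{\<tau> n k..\<tau> n (Suc k)}. \<phi>' u * N u \<omega>)" if "k < Suc n" for k
        unfolding J_def
        by (rule set_integral_split[OF bdd_meas_set_integrable[OF pN]]) (use \<tau>(1)[of k n] \<tau>(1)[of "Suc k" n] \<tau>S[of n k] that in auto)
      \<comment> \<open>Telescoping writes the limit over the same cells as the Riemann sum. What
        remains on each cell is the integral of \<open>\<phi>'\<close> times the difference between
        N and its value at the right end, which uniform continuity makes small.\<close>
      have "R \<omega> = (\<Sum>k<Suc n. (\<phi> (\<tau> n (Suc k)) * N (\<tau> n (Suc k)) \<omega> - \<phi> (\<tau> n k) * N (\<tau> n k) \<omega>) - (J (\<tau> n (Suc k)) - J (\<tau> n k)))"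
        unfolding sum_subtractf[of _ "\<lambda>k. J (\<tau> n (Suc k)) - J (\<tau> n k)"] sum_lessThan_telescope[of "\<lambda>k. J (\<tau> n k)"]
          sum_lessThan_telescope[of "\<lambda>k. \<phi> (\<tau> n k) * N (\<tau> n k) \<omega>"] \<tau>0
        by (simp add: R_def J_def)
      then have "I n \<omega> - R \<omega> = (\<Sum>k<Suc n. (\<phi> (\<tau> n k) * (N (\<tau> n (Suc k)) \<omega> - N (\<tau> n k) \<omega>))
        - ((\<phi> (\<tau> n (Suc k)) * N (\<tau> n (Suc k)) \<omega> - \<phi> (\<tau> n k) * N (\<tau> n k) \<omega>) - (J (\<tau> n (Suc k)) - J (\<tau> n k))))"
        by (simp only: I_def sum_subtractf)
      then have "norm (I n \<omega> - R \<omega>) = norm (\<Sum>k<Suc n. (\<phi> (\<tau> n k) * (N (\<tau> n (Suc k)) \<omega> - N (\<tau> n k) \<omega>))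
        - ((\<phi> (\<tau> n (Suc k)) * N (\<tau> n (Suc k)) \<omega> - \<phi> (\<tau> n k) * N (\<tau> n k) \<omega>) - (J (\<tau> n (Suc k)) - J (\<tau> n k))))"
        by (rule arg_cong)
      also have "\<dots> \<le> (\<Sum>k<Suc n. K * (e / (K * t + 1)) * (t / real (Suc n)))"
      proof (rule sum_norm_le)
        fix k assume "k \<in> {..<Suc n}"
        then have k: "k < Suc n" by simp
        let ?a = "\<tau> n k" and ?b = "\<tau> n (Suc k)"
        have ab: "0 \<le> ?a" "?a \<le> ?b" "?b \<le> T" using \<tau>(1)[of k n] \<tau>(1)[of "Suc k" n] \<tau>S[of n k] k by auto
        have i: "set_integrable lborel {?a..?b} f" if "bdd_meas T f" for f
          by (rule bdd_meas_set_integrable[OF that ab(1,3)])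
        have "(\<phi> ?a * (N ?b \<omega> - N ?a \<omega>)) - ((\<phi> ?b * N ?b \<omega> - \<phi> ?a * N ?a \<omega>) - (J ?b - J ?a))
            = (J ?b - J ?a) - (\<phi> ?b - \<phi> ?a) * N ?b \<omega>" by (simp add: algebra_simps)
        also have "\<dots> = (LBINT u:{?a..?b}. \<phi>' u * N u \<omega>) - (LBINT u:{?a..?b}. \<phi>' u * N ?b \<omega>)"
          unfolding J[OF k] primitive_diff[OF \<phi> ab] by simp
        also have "\<dots> = (LBINT u:{?a..?b}. \<phi>' u * N u \<omega> - \<phi>' u * N ?b \<omega>)"
          by (rule set_integral_diff(2)[symmetric]) (intro i bdd_meas_mult \<phi>'b Nb bdd_meas_const)+
        finally have eq: "(\<phi> ?a * (N ?b \<omega> - N ?a \<omega>)) - ((\<phi> ?b * N ?b \<omega> - \<phi> ?a * N ?a \<omega>) - (J ?b - J ?a))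
            = (LBINT u:{?a..?b}. \<phi>' u * N u \<omega> - \<phi>' u * N ?b \<omega>)" .
        have "\<bar>LBINT u:{?a..?b}. \<phi>' u * N u \<omega> - \<phi>' u * N ?b \<omega>\<bar> \<le> K * (e / (K * t + 1)) * (?b - ?a)"
        proof (rule bdd_meas_integral_bound[OF _ ab])
          show "bdd_meas T (\<lambda>u. \<phi>' u * N u \<omega> - \<phi>' u * N ?b \<omega>)"
            by (intro bdd_meas_diff bdd_meas_mult \<phi>'b Nb bdd_meas_const)
          fix u assume u: "u \<in> {?a..?b}"
          then have uT: "u \<in> {0..T}" "?b \<in> {0..T}" using ab by auto
          have "dist u ?b < \<rho>" using u d[of n k] small by (simp add: dist_real_def)
          from \<rho>(2)[OF uT(2,1) this] have "\<bar>N u \<omega> - N ?b \<omega>\<bar> \<le> e / (K * t + 1)" by (simp add: dist_real_def)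
          then show "\<bar>\<phi>' u * N u \<omega> - \<phi>' u * N ?b \<omega>\<bar> \<le> K * (e / (K * t + 1))"
            unfolding right_diff_distrib[symmetric] abs_mult using K(1,3) uT by (intro mult_mono) auto
        qed
        then show "norm ((\<phi> ?a * (N ?b \<omega> - N ?a \<omega>)) - ((\<phi> ?b * N ?b \<omega> - \<phi> ?a * N ?a \<omega>) - (J ?b - J ?a)))
            \<le> K * (e / (K * t + 1)) * (t / real (Suc n))"
          unfolding eq d by simp
      qed
      also have "\<dots> = K * t * (e / (K * t + 1))"
      proof -
        have "q * (K * y * (t / q)) = K * t * y" if "q \<noteq> 0" for q y :: real using that by simp
        from this[of "real (Suc n)" "e / (K * t + 1)"] show ?thesis
          by (simp only: sum_constant card_lessThan of_nat_eq_0_iff nat.distinct simp_thms)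
      qed
      also have "\<dots> < e"
      proof -
        have "0 < K * t + 1" using K(1) t by (simp add: add_nonneg_pos)
        moreover have "K * t * e < e * (K * t + 1)" using e by (simp add: algebra_simps)
        ultimately show ?thesis by (simp add: pos_divide_less_eq)
      qed
      finally show ?thesis .
    qed
    then show "\<exists>n0. \<forall>n\<ge>n0. norm (I n \<omega> - R \<omega>) < e" by blast
  qed
  have Nm: "(\<lambda>\<omega>. LBINT s:{0..t}. \<phi>' s * N s \<omega>) \<in> borel_measurable M"
  proof (rule measurable_F_M)
    have "\<phi>' \<in> borel_measurable (restrict_space borel {0..T})" using \<phi>'b by (simp add: bdd_meas_def)
    then show "(\<lambda>\<omega>. LBINT s:{0..t}. \<phi>' s * N s \<omega>) \<in> borel_measurable (F t)"
      by (intro progressive_integral' progressive_mult progressive_deterministic cmart_progressive N t)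
  qed (use t in simp)
  have z: "0 \<in> {0..T}" using T_pos by simp
  have [measurable]: "N t \<in> borel_measurable M" "N 0 \<in> borel_measurable M"
    using cmart_sq_int[OF N t] cmart_sq_int[OF N z] sq_int_measurable by blast+
  have Rm: "R \<in> borel_measurable M" unfolding R_def[abs_def] using Nm by measurable
  have "AE \<omega> in M. V t \<omega> = R \<omega>"
    by (rule L2_AE_limit_unique[OF SI_sq_int(2)[OF ISI] cmart_sq_int[OF V(1) t] Rm conv])
       (use path in \<open>auto intro: AE_I2\<close>)
  \<comment> \<open>The integral over the empty interval (0, 0] vanishes, which removes the boundary
    term at 0.\<close>
  moreover have "AE \<omega> in M. N 0 \<omega> = 0"
    using SI_unique[OF NSI[OF z], of "\<lambda>_. 0"] SI_zero by simp
  ultimately have ae: "AE \<omega> in M. V t \<omega> = \<phi> t * N t \<omega> - (LBINT s:{0..t}. \<phi>' s * N s \<omega>)"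
    by eventually_elim (simp add: R_def)
  show ?thesis
  proof (rule SI_AE_cong[OF V(2)[OF t] _ _ _ ae])
    show "(\<lambda>(p, \<omega>). indicat_real {0<..t} p *\<^sub>R (\<phi> p *\<^sub>R \<eta> p \<omega>)) \<in> borel_measurable pm"
      by (rule sq_int_measurable[OF SI_sq_int(1)[OF V(2)[OF t]]])
    show "(\<lambda>\<omega>. \<phi> t * N t \<omega> - (LBINT s:{0..t}. \<phi>' s * N s \<omega>)) \<in> borel_measurable M" using Nm by measurable
  qed simp
qed

end

section \<open>The optimal control\<close>

context market
begin

lemma zero_L2_process: "(\<lambda>s \<omega>. 0) \<in> L2_processes M F T"
  by (simp add: L2_processes_def progressively_measurable_def case_prod_beta')

lemma AE_eq_of_variance_zero:
  fixes D :: "'w \<Rightarrow> real"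
  assumes "sq_int M D" "variance D = 0" shows "AE \<omega> in M. D \<omega> = expectation D"
proof -
  have "sqn M (\<lambda>\<omega>. D \<omega> - expectation D) = 0" using assms(2) by (simp add: sqn_real)
  then have "AE \<omega> in M. D \<omega> - expectation D = 0"
    by (subst (asm) sqn_zero_iff[OF sq_int_diff[OF assms(1) sq_int_const]])
  then show ?thesis by eventually_elim simp
qed

text \<open>By hypothesis the centred part of X is (1 - Z) / nu, so for D = Y - X with E[Z D] = 0
  its covariance with D is E[D] / nu. The cross term of the variance, weighted by nu / 2, therefore
  equals E[D] and cancels the change of the mean; the variance of D is all that is left.\<close>

lemma mean_variance_expansion:
  fixes X Y Z :: "'w \<Rightarrow> real"
  assumes X: "sq_int M X" and Y: "sq_int M Y" and Z: "sq_int M Z" and \<nu>: "0 < \<nu>"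
    and XZ: "AE \<omega> in M. X \<omega> - expectation X - 1 / \<nu> = - (Z \<omega> / \<nu>)"
    and orth: "(\<integral>\<omega>. Z \<omega> * (Y \<omega> - X \<omega>) \<partial>M) = 0"
  shows "\<nu> / 2 * variance Y - expectation Y
     = (\<nu> / 2 * variance X - expectation X) + \<nu> / 2 * variance (\<lambda>\<omega>. Y \<omega> - X \<omega>)"
proof -
  define D where "D \<omega> = Y \<omega> - X \<omega>" for \<omega>
  have D: "sq_int M D" unfolding D_def[abs_def] by (rule sq_int_diff[OF Y X])
  define X' where "X' \<omega> = X \<omega> - expectation X" for \<omega>
  define D' where "D' \<omega> = D \<omega> - expectation D" for \<omega>
  have X': "sq_int M X'" unfolding X'_def[abs_def] by (intro sq_int_diff X sq_int_const)
  have D': "sq_int M D'" unfolding D'_def[abs_def] by (intro sq_int_diff D sq_int_const)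
  note i = sq_int_imp_integrable[OF X] sq_int_imp_integrable[OF Y] sq_int_imp_integrable[OF D]
  have ED: "expectation D = expectation Y - expectation X" unfolding D_def[abs_def] using i by simp
  have EX': "(\<integral>\<omega>. X' \<omega> \<partial>M) = 0" unfolding X'_def using i by (simp add: prob_space)
  have "(\<integral>\<omega>. X' \<omega> * D \<omega> \<partial>M) = (\<integral>\<omega>. (D \<omega> - Z \<omega> * D \<omega>) / \<nu> \<partial>M)"
  proof (rule integral_cong_AE)
    have [measurable]: "X' \<in> borel_measurable M" "D \<in> borel_measurable M" "Z \<in> borel_measurable M"
      using X' D Z sq_int_measurable by blast+
    show "(\<lambda>\<omega>. X' \<omega> * D \<omega>) \<in> borel_measurable M" by measurable
    show "(\<lambda>\<omega>. (D \<omega> - Z \<omega> * D \<omega>) / \<nu>) \<in> borel_measurable M" by measurable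
    show "AE \<omega> in M. X' \<omega> * D \<omega> = (D \<omega> - Z \<omega> * D \<omega>) / \<nu>"
      using XZ
    proof eventually_elim
      case (elim \<omega>)
      then have "X' \<omega> = (1 - Z \<omega>) / \<nu>" unfolding X'_def by (simp add: diff_divide_distrib)
      then show ?case by (simp add: field_simps)
    qed
  qed
  also have "\<dots> = (expectation D - (\<integral>\<omega>. Z \<omega> * D \<omega> \<partial>M)) / \<nu>"
    using i(3) sq_int_mult[OF Z D] by simp
  also have "(\<integral>\<omega>. Z \<omega> * D \<omega> \<partial>M) = 0" using orth by (simp add: D_def)
  finally have XD: "(\<integral>\<omega>. X' \<omega> * D \<omega> \<partial>M) = expectation D / \<nu>" by simp
  have XD': "(\<integral>\<omega>. X' \<omega> * D' \<omega> \<partial>M) = expectation D / \<nu>"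
    unfolding D'_def using sq_int_mult[OF X' D] sq_int_imp_integrable[OF X'] XD EX'
    by (simp add: right_diff_distrib)
  have "variance Y = (\<integral>\<omega>. X' \<omega> * X' \<omega> + 2 * (X' \<omega> * D' \<omega>) + D' \<omega> * D' \<omega> \<partial>M)"
    unfolding X'_def D'_def ED
    by (intro Bochner_Integration.integral_cong) (auto simp: D_def power2_eq_square algebra_simps)
  also have "\<dots> = (\<integral>\<omega>. X' \<omega> * X' \<omega> \<partial>M) + 2 * (\<integral>\<omega>. X' \<omega> * D' \<omega> \<partial>M) + (\<integral>\<omega>. D' \<omega> * D' \<omega> \<partial>M)"
    using sq_int_mult[OF X' X'] sq_int_mult[OF X' D'] sq_int_mult[OF D' D'] by simp
  also have "\<dots> = variance X + 2 * (expectation D / \<nu>) + variance D"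
    unfolding XD' by (simp add: X'_def D'_def power2_eq_square)
  finally have V: "variance Y = variance X + 2 * (expectation D / \<nu>) + variance D" .
  have VD: "variance (\<lambda>\<omega>. Y \<omega> - X \<omega>) = variance D" by (simp only: D_def[abs_def])
  have "\<nu> / 2 * (2 * (expectation D / \<nu>)) = expectation D" using \<nu> by simp
  then have "\<nu> / 2 * variance Y = \<nu> / 2 * variance X + expectation D + \<nu> / 2 * variance D"
    by (simp only: V distrib_left)
  then show ?thesis unfolding VD using ED by linarith
qed

text \<open>Uniqueness for the Volterra equation is stated for bounded measurable functions.
  Boundedness comes from Cauchy-Schwarz and the moment bounds, measurability from Fubini.\<close>

lemma duality_bdd:
  assumes X: "solves x v X" and P: "cmart P"
  shows "bdd_meas T (\<lambda>t. \<integral>\<omega>. P t \<omega> * X t \<omega> \<partial>M)"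
proof -
  obtain C where C: "0 \<le> C" "\<And>t. t \<in> {0..T} \<Longrightarrow> sq_int M (X t) \<and> sqn M (X t) \<le> C"
    by (rule solves_moments[OF X]) auto
  note Xs = sq_int_pm_uniform(1)[OF progressive_pm[OF solves_progressive[OF X]] C(2) C(1)]
  note Ps = cmart_sq_int_pm(1)[OF P]
  show ?thesis
  proof (rule bdd_measI[where K = "sqrt (sqn M (P T)) * sqrt C"])
    have "integrable pm (\<lambda>(s, \<omega>). P s \<omega> * X s \<omega>)" using sq_int_mult[OF Ps Xs] by (simp add: split_beta')
    from borel_measurable_integrable[OF integrable_fst'[OF this]]
    show "(\<lambda>t. \<integral>\<omega>. P t \<omega> * X t \<omega> \<partial>M) \<in> borel_measurable (restrict_space borel {0..T})"
      by (simp add: measurable_lam_iff)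
    fix t assume t: "t \<in> {0..T}"
    have "\<bar>\<integral>\<omega>. P t \<omega> * X t \<omega> \<partial>M\<bar> \<le> sqrt (sqn M (P t)) * sqrt (sqn M (X t))"
      using L2_Cauchy_Schwarz[OF cmart_sq_int[OF P t], of "X t"] C(2)[OF t] by simp
    also have "\<dots> \<le> sqrt (sqn M (P T)) * sqrt C"
      using cmart_sqn_mono[OF P, of t T] C(2)[OF t] t by (intro mult_mono real_sqrt_le_mono) auto
    finally show "\<bar>\<integral>\<omega>. P t \<omega> * X t \<omega> \<partial>M\<bar> \<le> sqrt (sqn M (P T)) * sqrt C" .
  qed
qed

text \<open>Both pairings satisfy \<open>duality\<close> with the same constant p0 x, so their
  difference solves a Volterra equation with kernel r and forcing Q, and uniqueness makes it
  explicit.\<close>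

lemma duality_difference:
  assumes X: "solves x v X" and Y: "solves x u Y" and \<psi>: "\<psi> \<in> L2_processes M F T" and P: "cmart P"
    and PSI: "\<And>t. t \<in> {0..T} \<Longrightarrow> SI (\<lambda>p \<omega>. indicat_real {0<..t} p *\<^sub>R (\<psi> p \<omega> - P p \<omega> *\<^sub>R b p)) (\<lambda>\<omega>. P t \<omega> - p0)"
  defines "Q \<equiv> \<lambda>t. LBINT s:{0..t}. (\<integral>\<omega>. \<psi> s \<omega> \<bullet> (v s \<omega> - u s \<omega>) \<partial>M)"
  shows "bdd_meas T Q" "(\<integral>\<omega>. P T \<omega> * X T \<omega> \<partial>M) - (\<integral>\<omega>. P T \<omega> * Y T \<omega> \<partial>M) = Q T + volterra r Q T"
proof -
  have T: "T \<in> {0..T}" using T_pos by simp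
  have v: "sq_int pm (case_prod v)" and u: "sq_int pm (case_prod u)" using X Y by (auto simp: solves_def L2_processes_iff)
  have \<psi>s: "sq_int pm (case_prod \<psi>)" using \<psi> by (simp add: L2_processes_iff)
  have i: "integrable pm (\<lambda>(s, \<omega>). \<psi> s \<omega> \<bullet> v s \<omega>)" "integrable pm (\<lambda>(s, \<omega>). \<psi> s \<omega> \<bullet> u s \<omega>)"
    "integrable pm (\<lambda>(s, \<omega>). \<psi> s \<omega> \<bullet> (v s \<omega> - u s \<omega>))"
    using sq_int_inner[OF \<psi>s v] sq_int_inner[OF \<psi>s u] sq_int_inner[OF \<psi>s pm_diff[OF v u]] by (simp_all add: split_beta')
  have ind: "integrable pm (\<lambda>(s, \<omega>). indicat_real {0<..t} s * h s \<omega>)" if "integrable pm (case_prod h)" for h t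
  proof (rule Bochner_Integration.integrable_bound[OF that])
    have [measurable]: "indicat_real {0<..t} \<in> borel_measurable lam" by (rule borel_measurable_lam) simp
    have "(\<lambda>x. indicat_real {0<..t} (fst x) * case_prod h x) \<in> borel_measurable pm"
      using that by measurable
    then show "(\<lambda>(s, \<omega>). indicat_real {0<..t} s * h s \<omega>) \<in> borel_measurable pm" by (simp add: split_beta')
  qed (auto split: split_indicator)
  have Qeq: "(LBINT s:{0..t}. (\<integral>\<omega>. \<psi> s \<omega> \<bullet> v s \<omega> \<partial>M)) - (LBINT s:{0..t}. (\<integral>\<omega>. \<psi> s \<omega> \<bullet> u s \<omega> \<partial>M)) = Q t"
    if t: "t \<in> {0..T}" for t
  proof -
    have eq: "(\<lambda>x. (case x of (s, \<omega>) \<Rightarrow> indicat_real {0<..t} s * (\<psi> s \<omega> \<bullet> v s \<omega>)) - (case x of (s, \<omega>) \<Rightarrow> indicat_real {0<..t} s * (\<psi> s \<omega> \<bullet> u s \<omega>)))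
      = (\<lambda>(s, \<omega>). indicat_real {0<..t} s * (\<psi> s \<omega> \<bullet> (v s \<omega> - u s \<omega>)))"
      by (auto simp: fun_eq_iff inner_diff_right algebra_simps)
    show ?thesis
      unfolding Q_def pm_time_integral[OF i(1) t, symmetric] pm_time_integral[OF i(2) t, symmetric] pm_time_integral[OF i(3) t, symmetric]
      by (simp only: Bochner_Integration.integral_diff[OF ind[OF i(1)] ind[OF i(2)], symmetric] eq)
  qed
  have "integrable lam (\<lambda>s. \<integral>\<omega>. \<psi> s \<omega> \<bullet> (v s \<omega> - u s \<omega>) \<partial>M)" using integrable_fst'[OF i(3)] by simp
  then show Qb: "bdd_meas T Q"
    unfolding Q_def lam_set_integrable by (intro bdd_meas_continuous continuous_on_indefinite_set_integral)
  let ?f = "\<lambda>t. (\<integral>\<omega>. P t \<omega> * X t \<omega> \<partial>M)" and ?g = "\<lambda>t. (\<integral>\<omega>. P t \<omega> * Y t \<omega> \<partial>M)"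
  note f = duality_bdd[OF X P] and g = duality_bdd[OF Y P]
  have "?f T - ?g T = Q T + volterra r Q T"
  proof (rule volterra_unique[OF r_bdd bdd_meas_diff[OF f g] Qb _ T])
    fix t assume t: "t \<in> {0..T}"
    have s: "set_integrable lborel {0..t} h" if "bdd_meas T h" for h
      by (rule bdd_meas_set_integrable[OF that]) (use t in auto)
    have "?f t - ?g t = Q t + ((LBINT s:{0..t}. r s * ?f s) - (LBINT s:{0..t}. r s * ?g s))"
      using duality[OF X \<psi> P PSI t] duality[OF Y \<psi> P PSI t] Qeq[OF t] by simp
    also have "(LBINT s:{0..t}. r s * ?f s) - (LBINT s:{0..t}. r s * ?g s) = (LBINT s:{0..t}. r s * ?f s - r s * ?g s)"
      by (rule set_integral_diff(2)[symmetric]) (intro s bdd_meas_mult r_bdd f g)+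
    finally show "?f t - ?g t = Q t + (LBINT s:{0..t}. r s * (?f s - ?g s))" by (simp add: right_diff_distrib)
  qed
  then show "?f T - ?g T = Q T + volterra r Q T" .
qed

text \<open>The factor phi with phi T = 1 / nu and phi' = (r - |b|^2) phi. With it, m + phi (1 - Z)
  for a suitable deterministic m obeys the wealth equation under the control phi Z b and has the
  terminal value required by \<open>mean_variance_expansion\<close>.\<close>

definition price_scale :: "real \<Rightarrow> real \<Rightarrow> real" where
  "price_scale \<nu> t = 1 / \<nu> * exp (LBINT s:{t..T}. (norm (b s))\<^sup>2 - r s)"

lemma norm_b_bdd: "bdd_meas T (\<lambda>s. (norm (b s))\<^sup>2)"
proof (rule bdd_measI)
  show "(\<lambda>s. (norm (b s))\<^sup>2) \<in> borel_measurable (restrict_space borel {0..T})" using b_meas by measurable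
  show "\<bar>(norm (b s))\<^sup>2\<bar> \<le> Kb\<^sup>2" if "s \<in> {0..T}" for s
    using power_mono[OF b_bound[OF that] norm_ge_zero, of 2] by simp
qed

text \<open>The integral from t to T is a constant minus the integral from 0 to t, which reverses
  the sign of the density.\<close>

lemma price_scale_primitive:
  "primitive T (price_scale \<nu>) (\<lambda>t. (r t - (norm (b t))\<^sup>2) * price_scale \<nu> t)"
proof -
  let ?d = "\<lambda>s. (norm (b s))\<^sup>2 - r s" and ?c = "\<lambda>s. r s - (norm (b s))\<^sup>2"
  have d: "bdd_meas T ?d" and c: "bdd_meas T ?c" by (intro bdd_meas_diff norm_b_bdd r_bdd)+
  let ?A = "LBINT s:{0..T}. ?d s"
  have "primitive T (\<lambda>t. (LBINT s:{t..T}. ?d s)) ?c"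
    unfolding primitive_def
  proof (intro conjI ballI c)
    fix t assume t: "t \<in> {0..T}"
    have "?A - (LBINT s:{0..t}. ?d s) = (LBINT s:{t..T}. ?d s)"
      by (rule set_integral_split[OF bdd_meas_set_integrable[OF d]]) (use t in auto)
    moreover have "(LBINT s:{0..t}. ?c s) = - (LBINT s:{0..t}. ?d s)"
      unfolding set_lebesgue_integral_def
      by (subst integral_minus[symmetric], rule Bochner_Integration.integral_cong) (auto simp: algebra_simps)
    ultimately show "(LBINT s:{t..T}. ?d s) = ?A + (LBINT s:{0..t}. ?c s)" by simp
  qed
  from primitive_exp[OF this]
  have e: "primitive T (\<lambda>t. exp (LBINT s:{t..T}. ?d s)) (\<lambda>t. ?c t * exp (LBINT s:{t..T}. ?d s))" .
  have k: "primitive T (\<lambda>t. 1 / \<nu>) (\<lambda>t. 0)" by (simp add: primitive_def bdd_meas_const set_lebesgue_integral_def)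
  from primitive_mult[OF k e] show ?thesis by (simp add: price_scale_def[abs_def] mult.left_commute)
qed

lemma pricing_martingale:
  obtains Z where "cmart Z"
    "\<And>t. t \<in> {0..T} \<Longrightarrow> SI (\<lambda>p \<omega>. indicat_real {0<..t} p *\<^sub>R (0 - Z p \<omega> *\<^sub>R b p)) (\<lambda>\<omega>. Z t \<omega> - 1)"
    "\<And>t. (\<integral>\<omega>. Z t \<omega> \<partial>M) = 1"
proof -
  note 0 = zero_L2_process
  obtain Z where Z: "cmart Z"
    "\<And>t. t \<in> {0..T} \<Longrightarrow> SI (\<lambda>p \<omega>. indicat_real {0<..t} p *\<^sub>R (0 - Z p \<omega> *\<^sub>R b p)) (\<lambda>\<omega>. Z t \<omega> - 1)"
    by (rule linear_sde_exists[OF 0, of 1]) auto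
  \<comment> \<open>Outside [0, T] the process is set to 1, so that its mean is 1 at every real time
    and the later identities in t carry no range condition.\<close>
  define Y where "Y t = (if t \<in> {0..T} then Z t else (\<lambda>_. 1))" for t
  have YZ: "Y t = Z t" if "t \<in> {0..T}" for t using that by (simp add: Y_def)
  have Yc: "cmart Y"
    unfolding cmart_def
  proof (intro conjI ballI allI impI)
    fix t assume t: "t \<in> {0..T}"
    show "Y t \<in> borel_measurable (F t)" "sq_int M (Y t)"
      using cmart_adapted[OF Z(1) t] cmart_sq_int[OF Z(1) t] YZ[OF t] by simp_all
  next
    fix \<omega> assume "\<omega> \<in> space M"
    from cmart_continuous[OF Z(1) this] show "continuous_on {0..T} (\<lambda>t. Y t \<omega>)"
      by (rule continuous_on_cong[THEN iffD1, rotated 2]) (simp_all add: YZ)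
  next
    fix s t and \<xi> :: "'w \<Rightarrow> real"
    assume a: "0 \<le> s" "s \<le> t" "t \<le> T" "\<xi> \<in> borel_measurable (F s)" "sq_int M \<xi>"
    show "(\<integral>\<omega>. \<xi> \<omega> * Y t \<omega> \<partial>M) = (\<integral>\<omega>. \<xi> \<omega> * Y s \<omega> \<partial>M)"
      using cmart_martingale[OF Z(1) a] YZ[of s] YZ[of t] a by simp
  qed
  have YSI: "SI (\<lambda>p \<omega>. indicat_real {0<..t} p *\<^sub>R (0 - Y p \<omega> *\<^sub>R b p)) (\<lambda>\<omega>. Y t \<omega> - 1)" if t: "t \<in> {0..T}" for t
  proof (rule SI_AE_cong[OF Z(2)[OF t]])
    show "(\<lambda>(p, \<omega>). indicat_real {0<..t} p *\<^sub>R (0 - Y p \<omega> *\<^sub>R b p)) \<in> borel_measurable pm"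
      using integrand_L2[OF 0 Yc] by (intro sq_int_measurable pm_indicator(1)) (auto simp: L2_processes_iff)
    show "(\<lambda>\<omega>. Y t \<omega> - 1) \<in> borel_measurable M"
      using sq_int_measurable[OF cmart_sq_int[OF Yc t]] by measurable
  qed (use t in \<open>auto simp: space_pair_measure YZ intro!: AE_I2\<close>)
  have "(\<integral>\<omega>. Y t \<omega> \<partial>M) = 1" for t
  proof (cases "t \<in> {0..T}")
    case True
    have "(\<integral>\<omega>. 1 * (Y t \<omega> - 1) \<partial>M) = 0"
      by (rule SI_orthogonal[OF YSI[OF True]]) (use True in auto)
    then show ?thesis using sq_int_imp_integrable[OF cmart_sq_int[OF Yc True]] by (simp add: prob_space)
  next
    case False
    then have "Y t = (\<lambda>_. 1)" by (auto simp: Y_def)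
    then show ?thesis by (simp add: prob_space)
  qed
  with Yc YSI show thesis by (rule that)
qed

text \<open>Let m solve m' = r m + |b|^2 phi with m 0 = x, and put X = m + phi - phi Z. As Z has
  mean 1, the mean of X is m and the feedback expression collapses to phi Z b. So the equation that
  contains its own mean is solved explicitly, without a fixed point argument for the mean.\<close>

lemma optimal_pair:
  obtains X Z where "cmart Z"
    "\<And>t. t \<in> {0..T} \<Longrightarrow> SI (\<lambda>p \<omega>. indicat_real {0<..t} p *\<^sub>R (0 - Z p \<omega> *\<^sub>R b p)) (\<lambda>\<omega>. Z t \<omega> - 1)"
    "\<And>t. (\<integral>\<omega>. Z t \<omega> \<partial>M) = 1"
    "\<And>t \<omega>. X t \<omega> - expectation (X t) - price_scale \<nu> t = - (price_scale \<nu> t * Z t \<omega>)"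
    "solves x (\<lambda>t \<omega>. - ((X t \<omega> - expectation (X t) - price_scale \<nu> t) *\<^sub>R b t)) X"
proof -
  obtain Z where Z: "cmart Z"
    and ZSI: "\<And>t. t \<in> {0..T} \<Longrightarrow> SI (\<lambda>p \<omega>. indicat_real {0<..t} p *\<^sub>R (0 - Z p \<omega> *\<^sub>R b p)) (\<lambda>\<omega>. Z t \<omega> - 1)"
    and EZ: "\<And>t. (\<integral>\<omega>. Z t \<omega> \<partial>M) = 1"
    by (rule pricing_martingale) auto
  let ?\<phi> = "price_scale \<nu>" and ?b2 = "\<lambda>s. (norm (b s))\<^sup>2"
  define \<phi>' where "\<phi>' t = (r t - ?b2 t) * ?\<phi> t" for t
  have \<phi>: "primitive T ?\<phi> \<phi>'" unfolding \<phi>'_def by (rule price_scale_primitive)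
  note \<phi>b = primitive_bdd[OF \<phi>] and \<phi>'b = primitive_density[OF \<phi>]
  obtain B where B: "0 < B" "\<And>s. s \<in> {0..T} \<Longrightarrow> \<bar>?\<phi> s\<bar> \<le> B" by (rule bdd_meas_bound[OF \<phi>b]) auto
  have \<phi>m: "?\<phi> \<in> borel_measurable (restrict_space borel {0..T})" using \<phi>b by (simp add: bdd_meas_def)
  have h: "bdd_meas T (\<lambda>s. ?b2 s * ?\<phi> s)" by (intro bdd_meas_mult norm_b_bdd \<phi>b)
  define G where "G t = x + (LBINT s:{0..t}. ?b2 s * ?\<phi> s)" for t
  have Gp: "primitive T G (\<lambda>s. ?b2 s * ?\<phi> s)" unfolding primitive_def G_def using h by simp
  note Gb = primitive_bdd[OF Gp]
  define m where "m t = G t + volterra r G t" for t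
  have mc: "continuous_on {0..T} m"
    unfolding m_def by (intro continuous_on_add primitive_continuous[OF Gp] primitive_continuous[OF primitive_volterra[OF r_bdd Gb]])
  note mb = bdd_meas_continuous[OF mc]
  have m: "m t = x + (LBINT s:{0..t}. r s * m s + ?b2 s * ?\<phi> s)" if t: "t \<in> {0..T}" for t
  proof -
    have s: "set_integrable lborel {0..t} f" if "bdd_meas T f" for f
      by (rule bdd_meas_set_integrable[OF that]) (use t in auto)
    have "m t = x + (LBINT s:{0..t}. ?b2 s * ?\<phi> s) + (LBINT s:{0..t}. r s * m s)"
      unfolding m_def volterra_equation[OF r_bdd Gb t] G_def[of t] by (simp add: m_def[symmetric] add.commute)
    also have "\<dots> = x + (LBINT s:{0..t}. r s * m s + ?b2 s * ?\<phi> s)"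
      using set_integral_add(2)[OF s[OF bdd_meas_mult[OF r_bdd mb]] s[OF h]] by simp
    finally show ?thesis .
  qed
  define X where "X t \<omega> = m t + ?\<phi> t - ?\<phi> t * Z t \<omega>" for t \<omega>
  define u where "u t \<omega> = - ((X t \<omega> - expectation (X t) - ?\<phi> t) *\<^sub>R b t)" for t \<omega>
  \<comment> \<open>A non-integrable function has Bochner integral 0, so the mean 1 already yields
    integrability at every t.\<close>
  have iZ: "integrable M (Z t)" for t
    using EZ[of t] not_integrable_integral_eq[of M "Z t"] by fastforce
  have EX: "expectation (X t) = m t" for t
    unfolding X_def[abs_def] using iZ EZ by (simp add: prob_space)
  have XZ: "X t \<omega> - expectation (X t) - ?\<phi> t = - (?\<phi> t * Z t \<omega>)" for t \<omega>
    unfolding EX by (simp add: X_def)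
  have ueq: "u t \<omega> = ?\<phi> t *\<^sub>R (Z t \<omega> *\<^sub>R b t)" for t \<omega> by (simp add: u_def XZ)
  note Zb = integrand_L2[OF zero_L2_process Z]
  have uL2: "u \<in> L2_processes M F T"
  proof -
    have Z': "progressively_measurable F T (\<lambda>s \<omega>. Z s \<omega> *\<^sub>R b s)" "sq_int pm (\<lambda>(s, \<omega>). Z s \<omega> *\<^sub>R b s)"
      by (intro progressive_scaleR cmart_progressive Z progressive_deterministic b_meas)
         (rule sq_int_pm_vector_mult(1)[OF cmart_sq_int_pm(1)[OF Z] b_meas b_bound])
    have "?\<phi> \<in> borel_measurable lam" using \<phi>m by (simp add: measurable_lam_iff)
    from pm_time_mult(1)[OF Z'(2) this B(2)] progressive_scaleR[OF progressive_deterministic[OF \<phi>m] Z'(1)]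
    show ?thesis unfolding L2_processes_iff ueq[abs_def] by simp
  qed
  have Nc: "cmart (\<lambda>t \<omega>. Z t \<omega> - 1)" by (intro cmart_diff Z cmart_const)
  \<comment> \<open>Integration by parts is applied to Z - 1, whose integrand is - Z b; the factor
    -1 restores the sign of the control phi Z b.\<close>
  have uSI: "SI (\<lambda>p \<omega>. indicat_real {0<..t} p *\<^sub>R u p \<omega>)
      (\<lambda>\<omega>. - (?\<phi> t * (Z t \<omega> - 1) - (LBINT s:{0..t}. \<phi>' s * (Z s \<omega> - 1))))" if t: "t \<in> {0..T}" for t
    using SI_scaleR[OF deterministic_integration_by_parts[OF \<phi> Zb Nc ZSI t], of "-1"]
    by (simp add: ueq)
  have Xm: "X t \<in> borel_measurable (F t)" if t: "t \<in> {0..T}" for t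
    unfolding X_def[abs_def] using cmart_adapted[OF Z t] by measurable
  have Xc: "continuous_on {0..T} (\<lambda>t. X t \<omega>)" if "\<omega> \<in> space M" for \<omega>
    unfolding X_def
    by (intro continuous_on_diff continuous_on_add continuous_on_mult mc primitive_continuous[OF \<phi>] cmart_continuous[OF Z that])
  have bu: "b s \<bullet> u s \<omega> = ?b2 s * ?\<phi> s * Z s \<omega>" for s \<omega>
    by (simp add: ueq power2_norm_eq_inner)
  have db: "bdd_meas T (\<lambda>s. r s * X s \<omega> + b s \<bullet> u s \<omega>)" if w: "\<omega> \<in> space M" for \<omega>
    unfolding bu
    by (intro bdd_meas_add bdd_meas_mult r_bdd norm_b_bdd \<phi>b bdd_meas_continuous[OF Xc[OF w]] bdd_meas_continuous[OF cmart_continuous[OF Z w]])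
  have eq: "X t \<omega> = x + (LBINT s:{0..t}. r s * X s \<omega> + b s \<bullet> u s \<omega>)
      + - (?\<phi> t * (Z t \<omega> - 1) - (LBINT s:{0..t}. \<phi>' s * (Z s \<omega> - 1)))"
    if w: "\<omega> \<in> space M" and t: "t \<in> {0..T}" for t \<omega>
  proof -
    have s: "set_integrable lborel {0..t} f" if "bdd_meas T f" for f
      by (rule bdd_meas_set_integrable[OF that]) (use t in auto)
    have Zb': "bdd_meas T (\<lambda>s. \<phi>' s * (Z s \<omega> - 1))"
      by (intro bdd_meas_mult \<phi>'b bdd_meas_diff bdd_meas_const bdd_meas_continuous[OF cmart_continuous[OF Z w]])
    \<comment> \<open>Because phi' = (r - |b|^2) phi, all terms with Z cancel and the integrand of
      the equation for m remains.\<close>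
    have "(LBINT s:{0..t}. r s * X s \<omega> + b s \<bullet> u s \<omega>) + (LBINT s:{0..t}. \<phi>' s * (Z s \<omega> - 1))
        = (LBINT s:{0..t}. (r s * X s \<omega> + b s \<bullet> u s \<omega>) + \<phi>' s * (Z s \<omega> - 1))"
      by (rule set_integral_add(2)[symmetric]) (intro s db w Zb')+
    also have "\<dots> = (LBINT s:{0..t}. r s * m s + ?b2 s * ?\<phi> s)"
      by (rule arg_cong[of _ _ "set_lebesgue_integral lborel {0..t}"])
         (simp add: fun_eq_iff bu \<phi>'_def X_def algebra_simps)
    also have "\<dots> = m t - x" using m[OF t] by simp
    finally show ?thesis by (simp add: X_def algebra_simps)
  qed
  have "solves x u X"
    unfolding solves_def
  proof (intro conjI ballI uL2 Xm Xc)
    show "AE \<omega> in M. set_integrable lborel {0..T} (\<lambda>s. r s * X s \<omega> + b s \<bullet> u s \<omega>)"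
      by (rule AE_I2) (rule bdd_meas_set_integrable[OF db], auto)
    fix t assume t: "t \<in> {0..T}"
    show "\<exists>I. SI (\<lambda>p \<omega>. indicat_real {0<..t} p *\<^sub>R u p \<omega>) I \<and>
        (AE \<omega> in M. X t \<omega> = x + (LBINT s:{0..t}. r s * X s \<omega> + b s \<bullet> u s \<omega>) + I \<omega>)"
      by (rule exI, rule conjI, rule uSI[OF t], rule AE_I2, rule eq[OF _ t])
  qed auto
  with Z ZSI EZ XZ show thesis unfolding u_def[abs_def] by (rule that)
qed

end

section \<open>Optimality and uniqueness of the control\<close>

locale mv_market = market M F W T r b Kb
  for M :: "'w measure" and F :: "real \<Rightarrow> 'w measure" and W :: "real \<Rightarrow> 'w \<Rightarrow> real ^ 'm"
    and T :: real and r :: "real \<Rightarrow> real" and b :: "real \<Rightarrow> real ^ 'm" and Kb :: real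
begin

text \<open>Existence of a solution is what gives meaning to the choice operator in
  \<open>wealth\<close>.\<close>

lemma wealth_solves:
  assumes "v \<in> L2_processes M F T" shows "solves x v (wealth M F W T r b x v)"
proof -
  obtain X where "solves x v X" by (rule solves_exists[OF assms, of x]) auto
  then have "wealth_equation M F W T r b x v X" by (simp add: wealth_equation_def wealth_equation_iff)
  then have "wealth_equation M F W T r b x v (wealth M F W T r b x v)"
    unfolding wealth_def by (rule someI[where P = "wealth_equation M F W T r b x v"])
  then show ?thesis by (simp add: wealth_equation_def wealth_equation_iff)
qed

lemma mean_variance_optimum:
  assumes \<nu>: "0 < \<nu>"
  obtains u X where
    "mv_optimal_control M F W T r b \<nu> x u"
    "\<And>v. mv_optimal_control M F W T r b \<nu> x v \<Longrightarrow> AE y in pm. case_prod v y = case_prod u y"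
    "wealth_equation M F W T r b x u X"
    "\<And>t \<omega>. u t \<omega> = - ((X t \<omega> - expectation (X t) - price_scale \<nu> t) *\<^sub>R b t)"
proof -
  have T: "T \<in> {0..T}" using T_pos by simp
  obtain X Z where Z: "cmart Z"
    and ZSI: "\<And>t. t \<in> {0..T} \<Longrightarrow> SI (\<lambda>p \<omega>. indicat_real {0<..t} p *\<^sub>R (0 - Z p \<omega> *\<^sub>R b p)) (\<lambda>\<omega>. Z t \<omega> - 1)"
    and EZ: "\<And>t. (\<integral>\<omega>. Z t \<omega> \<partial>M) = 1"
    and XZ: "\<And>t \<omega>. X t \<omega> - expectation (X t) - price_scale \<nu> t = - (price_scale \<nu> t * Z t \<omega>)"
    and sol: "solves x (\<lambda>t \<omega>. - ((X t \<omega> - expectation (X t) - price_scale \<nu> t) *\<^sub>R b t)) X"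
    by (rule optimal_pair[of \<nu> x]) blast
  define u where "u t \<omega> = - ((X t \<omega> - expectation (X t) - price_scale \<nu> t) *\<^sub>R b t)" for t \<omega>
  have uX: "solves x u X" using sol unfolding u_def[abs_def] .
  then have u: "u \<in> L2_processes M F T" by (simp add: solves_def)
  let ?w = "\<lambda>v. wealth M F W T r b x v T" and ?J = "mv_cost M F W T r b \<nu> x"
  have \<phi>T: "price_scale \<nu> T = 1 / \<nu>" by (simp add: price_scale_def)
  have sq: "sq_int M (Y T)" if Y: "solves x v Y" for v Y
  proof -
    obtain C where "\<And>t. t \<in> {0..T} \<Longrightarrow> sq_int M (Y t) \<and> sqn M (Y t) \<le> C" by (rule solves_moments[OF Y]) auto
    then show ?thesis using T by blast
  qed
  note ZT = cmart_sq_int[OF Z T]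
  note 0 = zero_L2_process
  \<comment> \<open>With \<open>\<psi>\<close> = 0 the forcing Q vanishes, and with it the
    resolvent, so the pairing with Z is the same for all controls.\<close>
  have orth: "(\<integral>\<omega>. Z T \<omega> * (Y T \<omega> - X T \<omega>) \<partial>M) = 0" if Y: "solves x v Y" for v Y
  proof -
    have "(\<integral>\<omega>. Z T \<omega> * Y T \<omega> \<partial>M) - (\<integral>\<omega>. Z T \<omega> * X T \<omega> \<partial>M) = 0"
      using duality_difference(2)[OF Y uX 0 Z ZSI] by (simp add: volterra_def set_lebesgue_integral_def)
    then show ?thesis
      using sq_int_mult[OF ZT sq[OF Y]] sq_int_mult[OF ZT sq[OF uX]] by (simp add: right_diff_distrib)
  qed
  have cost: "?J v = (\<nu> / 2 * variance (X T) - expectation (X T)) + \<nu> / 2 * variance (\<lambda>\<omega>. ?w v \<omega> - X T \<omega>)"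
    if v: "v \<in> L2_processes M F T" for v
    unfolding mv_cost_def
  proof (rule mean_variance_expansion[OF sq[OF uX] sq[OF wealth_solves[OF v]] ZT \<nu> _ orth[OF wealth_solves[OF v]]])
    show "AE \<omega> in M. X T \<omega> - expectation (X T) - 1 / \<nu> = - (Z T \<omega> / \<nu>)"
      using XZ[of T] \<phi>T by (intro AE_I2) simp
  qed
  have costu: "?J u = \<nu> / 2 * variance (X T) - expectation (X T)"
  proof -
    have "AE \<omega> in M. ?w u \<omega> - X T \<omega> = 0"
      using solves_unique[OF wealth_solves[OF u] uX T] by eventually_elim simp
    moreover have "(\<lambda>\<omega>. ?w u \<omega> - X T \<omega>) \<in> borel_measurable M"
      by (rule sq_int_measurable[OF sq_int_diff[OF sq[OF wealth_solves[OF u]] sq[OF uX]]])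
    ultimately have e: "expectation (\<lambda>\<omega>. ?w u \<omega> - X T \<omega>) = 0"
      by (intro integral_eq_zero_AE)
    have "variance (\<lambda>\<omega>. ?w u \<omega> - X T \<omega>) = 0"
      unfolding e
      by (rule integral_eq_zero_AE)
         (use \<open>AE \<omega> in M. ?w u \<omega> - X T \<omega> = 0\<close> in \<open>eventually_elim, simp\<close>)
    then show ?thesis using cost[OF u] by simp
  qed
  have le: "?J u \<le> ?J v" if "v \<in> L2_processes M F T" for v
    using cost[OF that] costu \<nu> variance_positive[of "\<lambda>\<omega>. ?w v \<omega> - X T \<omega>"] by simp
  have inf: "(INF v\<in>L2_processes M F T. ereal (?J v)) = ereal (?J u)"
    by (rule antisym) (auto intro!: INF_lower2[OF u] INF_greatest le)
  show thesis
  proof (rule that[of u X])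
    show "mv_optimal_control M F W T r b \<nu> x u"
      unfolding mv_optimal_control_def inf using u by simp
    show "wealth_equation M F W T r b x u X"
      using uX by (simp add: wealth_equation_def wealth_equation_iff)
    show "u t \<omega> = - ((X t \<omega> - expectation (X t) - price_scale \<nu> t) *\<^sub>R b t)" for t \<omega> by (rule u_def)
    fix v assume "mv_optimal_control M F W T r b \<nu> x v"
    then have v: "v \<in> L2_processes M F T" "?J v = ?J u" unfolding mv_optimal_control_def inf by auto
    define D where "D \<omega> = ?w v \<omega> - X T \<omega>" for \<omega>
    note wv = wealth_solves[OF v(1)]
    have Ds: "sq_int M D" unfolding D_def[abs_def] by (rule sq_int_diff[OF sq[OF wv] sq[OF uX]])
    have "variance D = 0" using cost[OF v(1)] costu v(2) \<nu> by (simp add: D_def[abs_def])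
    from AE_eq_of_variance_zero[OF Ds this] have De: "AE \<omega> in M. D \<omega> = expectation D" .
    have D0: "expectation D = 0"
    proof -
      have "0 = (\<integral>\<omega>. Z T \<omega> * D \<omega> \<partial>M)" using orth[OF wv] by (simp add: D_def)
      also have "\<dots> = (\<integral>\<omega>. Z T \<omega> * expectation D \<partial>M)"
      proof (rule integral_cong_AE)
        show "AE \<omega> in M. Z T \<omega> * D \<omega> = Z T \<omega> * expectation D" using De by eventually_elim simp
        show "(\<lambda>\<omega>. Z T \<omega> * D \<omega>) \<in> borel_measurable M"
          using sq_int_measurable[OF ZT] sq_int_measurable[OF Ds] by measurable
        show "(\<lambda>\<omega>. Z T \<omega> * expectation D) \<in> borel_measurable M"
          using sq_int_measurable[OF ZT] by measurable
      qed
      also have "\<dots> = expectation D" by (simp add: EZ)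
      finally show ?thesis by simp
    qed
    define \<psi> where "\<psi> s \<omega> = v s \<omega> - u s \<omega>" for s \<omega>
    have \<psi>: "\<psi> \<in> L2_processes M F T" unfolding \<psi>_def[abs_def] by (rule L2_processes_diff[OF v(1) u])
    have \<psi>s: "sq_int pm (case_prod \<psi>)" using \<psi> by (simp add: L2_processes_iff)
    \<comment> \<open>With \<open>\<psi>\<close> equal to the difference of the controls, the
      forcing Q t becomes the squared norm of that difference up to time t.\<close>
    obtain P where P: "cmart P"
      "\<And>t. t \<in> {0..T} \<Longrightarrow> SI (\<lambda>p \<omega>. indicat_real {0<..t} p *\<^sub>R (\<psi> p \<omega> - P p \<omega> *\<^sub>R b p)) (\<lambda>\<omega>. P t \<omega> - 0)"
      by (rule linear_sde_exists[OF \<psi>, of 0]) auto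
    define Q where "Q t = (LBINT s:{0..t}. (\<integral>\<omega>. \<psi> s \<omega> \<bullet> (v s \<omega> - u s \<omega>) \<partial>M))" for t
    have Q0: "0 \<le> Q t" for t
      unfolding Q_def set_lebesgue_integral_def by (intro integral_nonneg_AE AE_I2) (simp add: \<psi>_def[symmetric])
    note PT = cmart_sq_int[OF P(1) T]
    have "Q T + volterra r Q T = (\<integral>\<omega>. P T \<omega> * ?w v \<omega> \<partial>M) - (\<integral>\<omega>. P T \<omega> * X T \<omega> \<partial>M)"
      unfolding Q_def[abs_def] by (rule duality_difference(2)[OF wv uX \<psi> P, symmetric])
    also have "\<dots> = (\<integral>\<omega>. P T \<omega> * D \<omega> \<partial>M)"
      using sq_int_mult[OF PT sq[OF wv]] sq_int_mult[OF PT sq[OF uX]] by (simp add: D_def right_diff_distrib)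
    also have "\<dots> = 0"
      by (rule integral_eq_zero_AE) (use De in \<open>eventually_elim, simp add: D0\<close>)
    finally have "Q T + volterra r Q T = 0" .
    \<comment> \<open>Both summands are nonnegative, the resolvent because r and Q are, so their
      vanishing sum forces Q T = 0.\<close>
    moreover have "0 \<le> volterra r Q T" by (rule volterra_nonneg) (use r_nonneg Q0 in auto)
    ultimately have QT: "Q T = 0" using Q0[of T] by linarith
    have i: "integrable pm (\<lambda>(s, \<omega>). \<psi> s \<omega> \<bullet> \<psi> s \<omega>)" using sq_int_inner[OF \<psi>s \<psi>s] by (simp add: split_beta')
    have "sqn pm (case_prod \<psi>) = (\<integral>(s, \<omega>). indicat_real {0<..T} s * (\<psi> s \<omega> \<bullet> \<psi> s \<omega>) \<partial>pm)"
      unfolding sqn_def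
    proof (rule integral_cong_AE)
      show "(\<lambda>y. (norm (case_prod \<psi> y))\<^sup>2) \<in> borel_measurable pm" using sq_int_measurable[OF \<psi>s] by measurable
      have [measurable]: "indicat_real {0<..T} \<in> borel_measurable lam" by (rule borel_measurable_lam) simp
      have "(\<lambda>y. indicat_real {0<..T} (fst y) * (case_prod \<psi> y \<bullet> case_prod \<psi> y)) \<in> borel_measurable pm"
        using sq_int_measurable[OF \<psi>s] by measurable
      then show "(\<lambda>(s, \<omega>). indicat_real {0<..T} s * (\<psi> s \<omega> \<bullet> \<psi> s \<omega>)) \<in> borel_measurable pm" by (simp add: split_beta')
      show "AE y in pm. (norm (case_prod \<psi> y))\<^sup>2 = (case y of (s, \<omega>) \<Rightarrow> indicat_real {0<..T} s * (\<psi> s \<omega> \<bullet> \<psi> s \<omega>))"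
        using AE_pm_nonzero AE_space
        by eventually_elim (auto simp: space_pair_measure power2_norm_eq_inner split: split_indicator)
    qed
    also have "\<dots> = Q T" using pm_time_integral[OF i T] by (simp add: Q_def \<psi>_def)
    finally have "sqn pm (case_prod \<psi>) = 0" using QT by simp
    then have "AE y in pm. case_prod \<psi> y = 0" unfolding sqn_zero_iff[OF \<psi>s] .
    then show "AE y in pm. case_prod v y = case_prod u y"
      by eventually_elim (auto simp: \<psi>_def split_beta')
  qed
qed

end

section \<open>Gaussian increments\<close>

text \<open>Lebesgue measure on a Euclidean space is the image of the product measure over the
  basis, where Fubini factorizes the integral.\<close>

lemma lborel_product_integral:
  fixes h :: "'a::euclidean_space \<Rightarrow> real \<Rightarrow> real"
  assumes "\<And>b. b \<in> Basis \<Longrightarrow> integrable lborel (h b)"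
  shows "integrable lborel (\<lambda>x::'a. \<Prod>b\<in>Basis. h b (x \<bullet> b))"
    and "(\<integral>x. (\<Prod>b\<in>Basis. h b (x \<bullet> b)) \<partial>(lborel :: 'a measure)) = (\<Prod>b\<in>Basis. \<integral>y. h b y \<partial>lborel)"
proof -
  interpret product_sigma_finite "\<lambda>_::'a. lborel :: real measure" ..
  have m: "(\<lambda>x::'a. \<Prod>b\<in>Basis. h b (x \<bullet> b)) \<in> borel_measurable borel"
  proof (rule borel_measurable_prod)
    fix b :: 'a assume "b \<in> Basis"
    then have h: "h b \<in> borel_measurable borel" using borel_measurable_integrable[OF assms] by simp
    have "(\<lambda>x. x \<bullet> b) \<in> borel_measurable borel" by simp
    from measurable_compose[OF this h] show "(\<lambda>x. h b (x \<bullet> b)) \<in> borel_measurable borel" .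
  qed
  have f: "(\<lambda>f. \<Sum>b\<in>Basis. f b *\<^sub>R b) \<in> measurable (\<Pi>\<^sub>M b\<in>(Basis::'a set). lborel) borel" by measurable
  have eq: "(\<Prod>b\<in>Basis. h b ((\<Sum>c\<in>Basis. f c *\<^sub>R c) \<bullet> b)) = (\<Prod>b\<in>Basis. h b (f b))" for f :: "'a \<Rightarrow> real"
    by (intro prod.cong) auto
  show "integrable lborel (\<lambda>x::'a. \<Prod>b\<in>Basis. h b (x \<bullet> b))"
    by (subst lborel_eq, subst integrable_distr_eq[OF f m]) (simp add: eq product_integrable_prod assms)
  show "(\<integral>x. (\<Prod>b\<in>Basis. h b (x \<bullet> b)) \<partial>(lborel :: 'a measure)) = (\<Prod>b\<in>Basis. \<integral>y. h b y \<partial>lborel)"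
    by (subst lborel_eq, subst integral_distr[OF f m]) (simp add: eq product_integral_prod assms)
qed

lemma normal_moments:
  assumes "0 < h"
  shows "integrable lborel (\<lambda>y. normal_density 0 (sqrt h) y * y)" "(\<integral>y. normal_density 0 (sqrt h) y * y \<partial>lborel) = 0"
    and "integrable lborel (\<lambda>y. normal_density 0 (sqrt h) y * (y * y))" "(\<integral>y. normal_density 0 (sqrt h) y * (y * y) \<partial>lborel) = h"
proof -
  have s: "0 < sqrt h" using assms by simp
  from normal_moment_nz_1[OF s, of 0]
  show "integrable lborel (\<lambda>y. normal_density 0 (sqrt h) y * y)" "(\<integral>y. normal_density 0 (sqrt h) y * y \<partial>lborel) = 0"
    by (auto simp: has_bochner_integral_iff)
  have "has_bochner_integral lborel (\<lambda>y. normal_density 0 (sqrt h) y * (y * y)) h"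
    using normal_moment_even[OF s, of 0 1] assms by (simp add: power2_eq_square)
  then show "integrable lborel (\<lambda>y. normal_density 0 (sqrt h) y * (y * y))" "(\<integral>y. normal_density 0 (sqrt h) y * (y * y) \<partial>lborel) = h"
    by (auto simp: has_bochner_integral_iff)
qed

lemma gaussian_moments:
  fixes i j :: "'a::euclidean_space"
  assumes h: "0 < h" and ij: "i \<in> Basis" "j \<in> Basis"
  defines "g \<equiv> \<lambda>x::'a. \<Prod>b\<in>Basis. normal_density 0 (sqrt h) (x \<bullet> b)"
  shows "integrable lborel (\<lambda>x. g x * (x \<bullet> i))" "(\<integral>x. g x * (x \<bullet> i) \<partial>lborel) = 0"
    and "integrable lborel (\<lambda>x. g x * ((x \<bullet> i) * (x \<bullet> j)))"
    and "(\<integral>x. g x * ((x \<bullet> i) * (x \<bullet> j)) \<partial>lborel) = (if i = j then h else 0)"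
proof -
  let ?n = "normal_density 0 (sqrt h)"
  note nm = normal_moments[OF h]
  have n: "integrable lborel ?n" "(\<integral>y. ?n y \<partial>lborel) = 1" using h by auto
  \<comment> \<open>The monomial is absorbed into the coordinate densities, so that the integrand is
    again a product over the basis.\<close>
  define p where "p b y = ?n y * (if b = i then y else 1)" for b :: 'a and y
  have p: "integrable lborel (p b)" "(\<integral>y. p b y \<partial>lborel) = (if b = i then 0 else 1)" for b
    using n nm by (cases "b = i"; simp add: p_def[abs_def])+
  have gp: "g x * (x \<bullet> i) = (\<Prod>b\<in>Basis. p b (x \<bullet> b))" for x
    using ij(1) by (simp add: g_def p_def prod.distrib)
  show "integrable lborel (\<lambda>x. g x * (x \<bullet> i))"
    unfolding gp by (rule lborel_product_integral(1)[OF p(1)])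
  show "(\<integral>x. g x * (x \<bullet> i) \<partial>lborel) = 0"
    unfolding gp lborel_product_integral(2)[OF p(1)] p(2) by (rule prod_zero) (use ij in auto)
  \<comment> \<open>Two separate conditionals: for i = j they multiply to y * y, for different
    indices each acts on its own coordinate, and one formula covers both cases.\<close>
  define q where "q b y = ?n y * ((if b = i then y else 1) * (if b = j then y else 1))" for b :: 'a and y
  have q: "integrable lborel (q b)" "(\<integral>y. q b y \<partial>lborel) = (if b = i \<and> b = j then h else if b = i \<or> b = j then 0 else 1)" for b
    using n nm by (cases "b = i"; cases "b = j"; simp add: q_def[abs_def])+
  have gq: "g x * ((x \<bullet> i) * (x \<bullet> j)) = (\<Prod>b\<in>Basis. q b (x \<bullet> b))" for x
    using ij by (simp add: g_def q_def prod.distrib)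
  show "integrable lborel (\<lambda>x. g x * ((x \<bullet> i) * (x \<bullet> j)))"
    unfolding gq by (rule lborel_product_integral(1)[OF q(1)])
  show "(\<integral>x. g x * ((x \<bullet> i) * (x \<bullet> j)) \<partial>lborel) = (if i = j then h else 0)"
  proof (cases "i = j")
    case True
    then have "(\<Prod>b\<in>Basis. \<integral>y. q b y \<partial>lborel) = (\<Prod>b\<in>Basis. if b = j then h else 1)"
      unfolding q(2) by (intro prod.cong) auto
    then show ?thesis unfolding gq lborel_product_integral(2)[OF q(1)] using True ij by simp
  next
    case False
    have "(\<Prod>b\<in>Basis. \<integral>y. q b y \<partial>lborel) = 0"
      unfolding q(2) by (rule prod_zero) (use ij False in auto)
    then show ?thesis unfolding gq lborel_product_integral(2)[OF q(1)] using False by simp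
  qed
qed

lemma prod_UNIV_eq_Basis:
  fixes f :: "real \<Rightarrow> real" and x :: "real ^ 'm"
  shows "(\<Prod>i\<in>UNIV. f (x $ i)) = (\<Prod>b\<in>Basis. f (x \<bullet> b))"
proof -
  have B: "Basis = (\<lambda>i::'m. axis i (1::real)) ` UNIV" by (auto simp: Basis_vec_def)
  have "inj (\<lambda>i::'m. axis i (1::real))" by (auto simp: inj_def axis_eq_axis)
  then show ?thesis unfolding B by (simp add: prod.reindex cart_eq_inner_axis)
qed

section \<open>Independent Gaussian increments and everywhere continuous paths\<close>

context prob_space
begin

text \<open>Brownian motion is defined through independence of set systems. The preimages of Borel
  sets under D already form a \<open>\<sigma>\<close>-algebra, hence contain the one generated by
  \<open>\<phi>\<close> of D, and G contains the one generated by Y; independence passes to these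
  smaller systems.\<close>

lemma indep_var_of_preimages:
  fixes D :: "'a \<Rightarrow> 'b::topological_space" and Y :: "'a \<Rightarrow> real" and \<phi> :: "'b \<Rightarrow> real"
  assumes G: "subalgebra M G" and D: "D \<in> borel_measurable M" and Y: "Y \<in> borel_measurable G"
    and \<phi>: "\<phi> \<in> borel_measurable borel"
    and ind: "indep_set {D -` A \<inter> space M | A. A \<in> sets borel} (sets G)"
  shows "indep_var borel Y borel (\<lambda>\<omega>. \<phi> (D \<omega>))"
proof -
  let ?Y = "sigma_sets (space M) {Y -` A \<inter> space M | A. A \<in> sets borel}"
  let ?D = "sigma_sets (space M) {(\<lambda>\<omega>. \<phi> (D \<omega>)) -` A \<inter> space M | A. A \<in> sets borel}"
  have YM: "Y \<in> borel_measurable M" by (rule measurable_from_subalg[OF G Y])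
  have \<phi>D: "(\<lambda>\<omega>. \<phi> (D \<omega>)) \<in> borel_measurable M" by (rule measurable_compose[OF D \<phi>])
  have sp: "space G = space M" using G by (simp add: subalgebra_def)
  have YS: "?Y \<subseteq> sets G"
    unfolding sp[symmetric] by (rule sets.sigma_sets_subset) (use measurable_sets[OF Y] in auto)
  have DS: "?D \<subseteq> {D -` A \<inter> space M | A. A \<in> sets borel}"
  proof -
    have "sigma_algebra (space M) {D -` A \<inter> space M | A. A \<in> sets borel}"
    proof -
      have "{D -` A \<inter> space M | A. A \<in> sets borel} = sets (vimage_algebra (space M) D borel)"
        by (simp add: sets_vimage_algebra2)
      then show ?thesis using sets.sigma_algebra_axioms[of "vimage_algebra (space M) D borel"] by simp
    qed
    moreover have "{(\<lambda>\<omega>. \<phi> (D \<omega>)) -` A \<inter> space M | A. A \<in> sets borel} \<subseteq> {D -` A \<inter> space M | A. A \<in> sets borel}"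
    proof safe
      fix A :: "real set" assume "A \<in> sets borel"
      then have "\<phi> -` A \<in> sets borel" using measurable_sets[OF \<phi>, of A] by simp
      then show "\<exists>B. (\<lambda>\<omega>. \<phi> (D \<omega>)) -` A \<inter> space M = D -` B \<inter> space M \<and> B \<in> sets borel"
        by (intro exI[of _ "\<phi> -` A"]) auto
    qed
    ultimately show ?thesis by (rule sigma_algebra.sigma_sets_subset)
  qed
  have "indep_set ?Y ?D"
    unfolding indep_sets2_eq
  proof (intro conjI ballI)
    show "?Y \<subseteq> events" using YS G by (auto simp: subalgebra_def)
    show "?D \<subseteq> events" using indep_setD_ev1[OF ind] DS by (rule order_trans[rotated])
    fix a c assume "a \<in> ?Y" "c \<in> ?D"
    then have "c \<in> {D -` A \<inter> space M | A. A \<in> sets borel}" "a \<in> sets G" using subsetD[OF DS, of c] subsetD[OF YS, of a] by simp_all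
    from indep_setD[OF ind this] show "prob (a \<inter> c) = prob a * prob c" by (simp add: Int_commute mult.commute)
  qed
  then show ?thesis using \<phi>D YM by (simp add: indep_var_eq)
qed

text \<open>Independence splits each mean into the mean of Y and a Gaussian moment, which supplies
  the two moment conditions of \<open>brownian_basis\<close>.\<close>

lemma gaussian_increment:
  fixes D :: "'a \<Rightarrow> real ^ 'm" and Y :: "'a \<Rightarrow> real"
  assumes h: "0 < h" and G: "subalgebra M G"
    and dist: "distributed M lborel D (\<lambda>x. ennreal (\<Prod>i\<in>UNIV. normal_density 0 (sqrt h) (x $ i)))"
    and ind: "indep_set {D -` A \<inter> space M | A. A \<in> sets borel} (sets G)"
    and Y: "Y \<in> borel_measurable G" "integrable M Y" and ij: "i \<in> Basis" "j \<in> Basis"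
  shows "integrable M (\<lambda>\<omega>. Y \<omega> * (D \<omega> \<bullet> i))" "(\<integral>\<omega>. Y \<omega> * (D \<omega> \<bullet> i) \<partial>M) = 0"
    and "integrable M (\<lambda>\<omega>. Y \<omega> * ((D \<omega> \<bullet> i) * (D \<omega> \<bullet> j)))"
    and "(\<integral>\<omega>. Y \<omega> * ((D \<omega> \<bullet> i) * (D \<omega> \<bullet> j)) \<partial>M) = (if i = j then h else 0) * (\<integral>\<omega>. Y \<omega> \<partial>M)"
proof -
  let ?g = "\<lambda>x::real ^ 'm. \<Prod>b\<in>Basis. normal_density 0 (sqrt h) (x \<bullet> b)"
  have d: "distributed M lborel D (\<lambda>x. ennreal (?g x))" using dist by (simp add: prod_UNIV_eq_Basis)
  have Dm: "D \<in> borel_measurable M" using distributed_measurable[OF d] by simp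
  have pos: "0 \<le> ?g x" for x by (intro prod_nonneg) auto
  note gm = gaussian_moments[OF h ij]
  have m1: "(\<lambda>x::real ^ 'm. x \<bullet> i) \<in> borel_measurable lborel" and m2: "(\<lambda>x::real ^ 'm. (x \<bullet> i) * (x \<bullet> j)) \<in> borel_measurable lborel"
    by simp_all
  have D1: "integrable M (\<lambda>\<omega>. D \<omega> \<bullet> i)" "(\<integral>\<omega>. D \<omega> \<bullet> i \<partial>M) = 0"
    using distributed_integrable[OF d m1 pos] distributed_integral[OF d m1 pos] gm(1,2) by simp_all
  have D2: "integrable M (\<lambda>\<omega>. (D \<omega> \<bullet> i) * (D \<omega> \<bullet> j))" "(\<integral>\<omega>. (D \<omega> \<bullet> i) * (D \<omega> \<bullet> j) \<partial>M) = (if i = j then h else 0)"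
    using distributed_integrable[OF d m2 pos] distributed_integral[OF d m2 pos] gm(3,4) by simp_all
  note iv = indep_var_of_preimages[OF G Dm Y(1) _ ind]
  have i1: "indep_var borel Y borel (\<lambda>\<omega>. D \<omega> \<bullet> i)"
    by (rule iv) simp
  have i2: "indep_var borel Y borel (\<lambda>\<omega>. (D \<omega> \<bullet> i) * (D \<omega> \<bullet> j))"
    by (rule iv) simp
  show "integrable M (\<lambda>\<omega>. Y \<omega> * (D \<omega> \<bullet> i))" by (rule indep_var_integrable[OF i1 Y(2) D1(1)])
  show "(\<integral>\<omega>. Y \<omega> * (D \<omega> \<bullet> i) \<partial>M) = 0"
    using indep_var_lebesgue_integral[OF i1 Y(2) D1(1)] D1(2) by simp
  show "integrable M (\<lambda>\<omega>. Y \<omega> * ((D \<omega> \<bullet> i) * (D \<omega> \<bullet> j)))" by (rule indep_var_integrable[OF i2 Y(2) D2(1)])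
  show "(\<integral>\<omega>. Y \<omega> * ((D \<omega> \<bullet> i) * (D \<omega> \<bullet> j)) \<partial>M) = (if i = j then h else 0) * (\<integral>\<omega>. Y \<omega> \<partial>M)"
    using indep_var_lebesgue_integral[OF i2 Y(2) D2(1)] D2(2) by simp
qed

text \<open>Paths are required to be continuous for every \<open>\<omega>\<close> in the locale, so the Brownian motion is
  set to zero on a null set.\<close>

lemma brownian_modification:
  fixes W :: "real \<Rightarrow> 'a \<Rightarrow> real ^ 'm"
  assumes F: "F = augmented_natural_filtration M W" and BM: "brownian_motion M F W" and T: "0 < T"
  obtains V where "brownian_basis M F V T" "\<And>t. AE \<omega> in M. V t \<omega> = W t \<omega>"
proof -
  have sub: "subalgebra M (F t)" if "0 \<le> t" for t using BM that by (simp add: brownian_motion_def)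
  have mono: "sets (F s) \<subseteq> sets (F t)" if "0 \<le> s" "s \<le> t" for s t using BM that by (simp add: brownian_motion_def)
  have ad: "W t \<in> borel_measurable (F t)" if "0 \<le> t" for t using BM that by (simp add: brownian_motion_def)
  \<comment> \<open>Null sets are among the generators of the augmented filtration, so a change of W
    on a null set keeps it adapted.\<close>
  have null: "null_sets M \<subseteq> sets (F t)" for t
  proof -
    have "{W s -` A \<inter> space M | s A. s \<in> {0..t} \<and> A \<in> sets borel} \<union> null_sets M \<subseteq> Pow (space M)"
      using sets.sets_into_space by auto
    then show ?thesis unfolding F augmented_natural_filtration_def by (subst sets_measure_of) (auto intro: sigma_sets.Basic)
  qed
  have "AE \<omega> in M. continuous_on {0..} (\<lambda>t. W t \<omega>)" using BM by (simp add: brownian_motion_def)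
  then obtain Z where Z: "{\<omega>\<in>space M. \<not> continuous_on {0..} (\<lambda>t. W t \<omega>)} \<subseteq> Z" "Z \<in> null_sets M"
    unfolding eventually_ae_filter by auto
  define V where "V t \<omega> = (if \<omega> \<in> Z then 0 else W t \<omega>)" for t \<omega>
  have VW: "AE \<omega> in M. V t \<omega> = W t \<omega>" for t
    using AE_not_in[OF Z(2)] by eventually_elim (simp add: V_def)
  have WM: "W t \<in> borel_measurable M" if "0 \<le> t" for t by (rule measurable_from_subalg[OF sub ad]) (use that in auto)
  have Vad: "V t \<in> borel_measurable (F t)" if t: "0 \<le> t" for t
  proof -
    have [measurable]: "Z \<in> sets (F t)" "W t \<in> borel_measurable (F t)" using null Z(2) ad[OF t] by auto
    show ?thesis unfolding V_def[abs_def] by measurable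
  qed
  have VM: "V t \<in> borel_measurable M" if "0 \<le> t" for t by (rule measurable_from_subalg[OF sub Vad]) (use that in auto)
  \<comment> \<open>The law of an increment is given for s < t; for s = t the increment is 0 and so
    is the covariance factor.\<close>
  have incr: "(integrable M (\<lambda>\<omega>. Y \<omega> * ((W t \<omega> - W s \<omega>) \<bullet> i)) \<and> (\<integral>\<omega>. Y \<omega> * ((W t \<omega> - W s \<omega>) \<bullet> i) \<partial>M) = 0) \<and>
      (integrable M (\<lambda>\<omega>. Y \<omega> * (((W t \<omega> - W s \<omega>) \<bullet> i) * ((W t \<omega> - W s \<omega>) \<bullet> j))) \<and>
       (\<integral>\<omega>. Y \<omega> * (((W t \<omega> - W s \<omega>) \<bullet> i) * ((W t \<omega> - W s \<omega>) \<bullet> j)) \<partial>M) = (if i = j then t - s else 0) * (\<integral>\<omega>. Y \<omega> \<partial>M))"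
    if a: "0 \<le> s" "s \<le> t" "Y \<in> borel_measurable (F s)" "integrable M Y" "i \<in> Basis" "j \<in> Basis" for s t Y i j
  proof (cases "s = t")
    case False
    then have st: "s < t" using a by simp
    have d: "distributed M lborel (\<lambda>\<omega>. W t \<omega> - W s \<omega>) (\<lambda>x. ennreal (\<Prod>i\<in>UNIV. normal_density 0 (sqrt (t - s)) (x $ i)))"
      and ind: "indep_set {(\<lambda>\<omega>. W t \<omega> - W s \<omega>) -` A \<inter> space M | A. A \<in> sets borel} (sets (F s))"
      using BM a(1) st unfolding brownian_motion_def by blast+
    have "0 < t - s" using st by simp
    from gaussian_increment[OF this sub[OF a(1)] d ind a(3-6)] show ?thesis by blast
  qed simp
  have "brownian_basis M F V T"
  proof (unfold_locales)
    show "0 < T" by (rule T)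
    show "subalgebra M (F t)" if "0 \<le> t" for t by (rule sub[OF that])
    show "sets (F s) \<subseteq> sets (F t)" if "0 \<le> s" "s \<le> t" for s t by (rule mono[OF that])
    show "null_sets M \<subseteq> sets (F t)" if "0 \<le> t" for t by (rule null)
    show "V t \<in> borel_measurable (F t)" if "0 \<le> t" for t by (rule Vad[OF that])
    show "continuous_on {0..} (\<lambda>t. V t \<omega>)" if "\<omega> \<in> space M" for \<omega>
      using Z(1) that by (cases "\<omega> \<in> Z") (auto simp: V_def)
  next
    fix s t and Y :: "'a \<Rightarrow> real" and i :: "real ^ 'm"
    assume a: "0 \<le> s" "s \<le> t" "Y \<in> borel_measurable (F s)" "integrable M Y" "i \<in> Basis"
    have [measurable]: "Y \<in> borel_measurable M" "V t \<in> borel_measurable M" "V s \<in> borel_measurable M"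
      "W t \<in> borel_measurable M" "W s \<in> borel_measurable M"
      using a VM WM by auto
    have ae: "AE \<omega> in M. Y \<omega> * ((W t \<omega> - W s \<omega>) \<bullet> i) = Y \<omega> * ((V t \<omega> - V s \<omega>) \<bullet> i)"
      using VW[of t] VW[of s] by eventually_elim simp
    note w = incr[OF a a(5)]
    have "integrable M (\<lambda>\<omega>. Y \<omega> * ((V t \<omega> - V s \<omega>) \<bullet> i))"
      by (rule integrable_cong_AE_imp[OF _ _ ae]) (use w in auto)
    moreover have "(\<integral>\<omega>. Y \<omega> * ((W t \<omega> - W s \<omega>) \<bullet> i) \<partial>M) = (\<integral>\<omega>. Y \<omega> * ((V t \<omega> - V s \<omega>) \<bullet> i) \<partial>M)"
      by (rule integral_cong_AE[OF _ _ ae]; measurable)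
    ultimately show "integrable M (\<lambda>\<omega>. Y \<omega> * ((V t \<omega> - V s \<omega>) \<bullet> i)) \<and> (\<integral>\<omega>. Y \<omega> * ((V t \<omega> - V s \<omega>) \<bullet> i) \<partial>M) = 0"
      using w by simp
  next
    fix s t and Y :: "'a \<Rightarrow> real" and i j :: "real ^ 'm"
    assume a: "0 \<le> s" "s \<le> t" "Y \<in> borel_measurable (F s)" "integrable M Y" "i \<in> Basis" "j \<in> Basis"
    have [measurable]: "Y \<in> borel_measurable M" "V t \<in> borel_measurable M" "V s \<in> borel_measurable M"
      "W t \<in> borel_measurable M" "W s \<in> borel_measurable M"
      using a VM WM by auto
    have ae: "AE \<omega> in M. Y \<omega> * (((W t \<omega> - W s \<omega>) \<bullet> i) * ((W t \<omega> - W s \<omega>) \<bullet> j)) = Y \<omega> * (((V t \<omega> - V s \<omega>) \<bullet> i) * ((V t \<omega> - V s \<omega>) \<bullet> j))"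
      using VW[of t] VW[of s] by eventually_elim simp
    note w = incr[OF a]
    have "integrable M (\<lambda>\<omega>. Y \<omega> * (((V t \<omega> - V s \<omega>) \<bullet> i) * ((V t \<omega> - V s \<omega>) \<bullet> j)))"
      by (rule integrable_cong_AE_imp[OF _ _ ae]) (use w in auto)
    moreover have "(\<integral>\<omega>. Y \<omega> * (((W t \<omega> - W s \<omega>) \<bullet> i) * ((W t \<omega> - W s \<omega>) \<bullet> j)) \<partial>M)
        = (\<integral>\<omega>. Y \<omega> * (((V t \<omega> - V s \<omega>) \<bullet> i) * ((V t \<omega> - V s \<omega>) \<bullet> j)) \<partial>M)"
      by (rule integral_cong_AE[OF _ _ ae]; measurable)
    ultimately show "integrable M (\<lambda>\<omega>. Y \<omega> * (((V t \<omega> - V s \<omega>) \<bullet> i) * ((V t \<omega> - V s \<omega>) \<bullet> j))) \<and>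
        (\<integral>\<omega>. Y \<omega> * (((V t \<omega> - V s \<omega>) \<bullet> i) * ((V t \<omega> - V s \<omega>) \<bullet> j)) \<partial>M) = (if i = j then t - s else 0) * (\<integral>\<omega>. Y \<omega> \<partial>M)"
      using w by simp
  qed
  with VW show thesis by (rule that[rotated])
qed

end

text \<open>An elementary integral reads the path at finitely many deterministic times, so almost
  sure equality at each fixed time is enough.\<close>

lemma has_ito_integral_modification:
  assumes "\<And>t. AE \<omega> in M. V t \<omega> = W t \<omega>"
  shows "has_ito_integral M F V t u I = has_ito_integral M F W t u I"
proof -
  have "(\<integral>\<^sup>+\<omega>. ennreal ((I \<omega> - elementary_integral V n \<tau> \<xi> \<omega>)\<^sup>2) \<partial>M)
      = (\<integral>\<^sup>+\<omega>. ennreal ((I \<omega> - elementary_integral W n \<tau> \<xi> \<omega>)\<^sup>2) \<partial>M)" for n \<tau> \<xi>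
  proof (rule nn_integral_cong_AE)
    have "AE \<omega> in M. \<forall>k\<le>n. V (\<tau> k) \<omega> = W (\<tau> k) \<omega>"
      using assms by (simp add: AE_all_countable)
    then show "AE \<omega> in M. ennreal ((I \<omega> - elementary_integral V n \<tau> \<xi> \<omega>)\<^sup>2) = ennreal ((I \<omega> - elementary_integral W n \<tau> \<xi> \<omega>)\<^sup>2)"
      by eventually_elim (simp add: elementary_integral_def)
  qed
  then show ?thesis by (simp add: has_ito_integral_def)
qed

lemma ito_process_modification:
  assumes "\<And>t. AE \<omega> in M. V t \<omega> = W t \<omega>"
  shows "ito_process M F V = ito_process M F W"
  by (intro ext) (simp add: ito_process_def has_ito_integral_modification[OF assms])

section \<open>The risk premium\<close>

text \<open>The quadratic form of A times its transpose is the squared length of the transpose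
  applied to v, and \<open>mat \<delta>\<close> is \<open>\<delta>\<close> times the
  identity.\<close>

lemma elliptic_transpose_bound:
  fixes A :: "real ^ 'm ^ 'm"
  assumes "0 \<le> v \<bullet> ((A ** transpose A - mat \<delta>) *v v)"
  shows "\<delta> * (norm v)\<^sup>2 \<le> (norm (transpose A *v v))\<^sup>2"
proof -
  have "(A ** transpose A - mat \<delta>) *v v = A *v (transpose A *v v) - \<delta> *\<^sub>R v"
  proof -
    have "mat \<delta> *v v = \<delta> *\<^sub>R v"
      by (simp add: vec_eq_iff matrix_vector_mult_def mat_def if_distrib[of "\<lambda>x. x * _"] cong: if_cong)
    then show ?thesis by (simp add: matrix_vector_mult_diff_rdistrib matrix_vector_mul_assoc del: transpose_matrix_vector)
  qed
  then have "0 \<le> v \<bullet> (A *v (transpose A *v v)) - \<delta> * (v \<bullet> v)" using assms by (simp add: inner_diff_right)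
  also have "v \<bullet> (A *v (transpose A *v v)) = (transpose A *v v) \<bullet> (transpose A *v v)"
    by (metis dot_lmul_matrix transpose_matrix_vector)
  finally show ?thesis by (simp add: power2_norm_eq_inner)
qed

text \<open>The lower bound makes the transpose injective, hence A invertible. Write w, the inverse
  applied to y, as the transpose applied to some v. Then |w|^2 = v . y, and |v| is at most |w| /
  sqrt \<open>\<delta>\<close> by ellipticity.\<close>

lemma elliptic_inverse:
  fixes A :: "real ^ 'm ^ 'm"
  assumes \<delta>: "0 < \<delta>" and ell: "\<And>v. 0 \<le> v \<bullet> ((A ** transpose A - mat \<delta>) *v v)"
  shows "A ** matrix_inv A = mat 1" "det A \<noteq> 0" "norm (matrix_inv A *v y) \<le> norm y / sqrt \<delta>"
proof -
  note b = elliptic_transpose_bound[OF ell]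
  have "v = 0" if "transpose A *v v = 0" for v
    using b[of v] that \<delta> by (simp add: mult_le_0_iff)
  then obtain B where "B ** transpose A = mat 1" using matrix_left_invertible_ker[of "transpose A"] by blast
  then have "transpose (B ** transpose A) = mat 1" by (simp add: transpose_mat)
  then have AB: "A ** transpose B = mat 1" by (simp add: matrix_transpose_mul)
  then have inv: "invertible A" by (auto simp: invertible_right_inverse)
  then show "det A \<noteq> 0" by (simp add: invertible_det_nz)
  have "A ** matrix_inv A = mat 1 \<and> matrix_inv A ** A = mat 1"
    unfolding matrix_inv_def by (rule someI_ex) (use inv in \<open>simp add: invertible_def\<close>)
  then show A1: "A ** matrix_inv A = mat 1" by simp
  let ?w = "matrix_inv A *v y"
  define v where "v = B *v ?w"
  have "transpose A ** B = mat 1" using \<open>B ** transpose A = mat 1\<close> by (simp add: matrix_left_right_inverse)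
  then have tv: "transpose A *v v = ?w" by (simp add: v_def matrix_vector_mul_assoc[of "transpose A" B] del: transpose_matrix_vector)
  have Aw: "A *v ?w = y" by (simp add: matrix_vector_mul_assoc A1)
  have "(norm ?w)\<^sup>2 = (transpose A *v v) \<bullet> ?w" by (simp add: tv power2_norm_eq_inner del: transpose_matrix_vector)
  also have "\<dots> = v \<bullet> (A *v ?w)" by (metis dot_lmul_matrix transpose_matrix_vector)
  also have "\<dots> \<le> norm v * norm y" unfolding Aw by (rule norm_cauchy_schwarz)
  also have "\<dots> \<le> (norm ?w / sqrt \<delta>) * norm y"
  proof (rule mult_right_mono)
    have "(sqrt \<delta> * norm v)\<^sup>2 \<le> (norm ?w)\<^sup>2" using b[of v] \<delta> unfolding tv by (simp add: power_mult_distrib)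
    then have "sqrt \<delta> * norm v \<le> norm ?w" by (rule power2_le_imp_le) simp
    then show "norm v \<le> norm ?w / sqrt \<delta>" using \<delta> by (simp add: field_simps)
  qed simp
  finally have "norm ?w * norm ?w \<le> norm ?w * (norm y / sqrt \<delta>)" by (simp add: power2_eq_square)
  then show "norm ?w \<le> norm y / sqrt \<delta>"
    using \<delta> by (cases "norm ?w = 0") (auto intro: mult_left_le_imp_le[of "norm ?w"] simp del: times_divide_eq_right)
qed

text \<open>Cramer's rule writes the components of the risk premium as quotients of determinants,
  which are polynomials in measurable entries; so measurability in time is obtained without studying
  matrix inversion as a map. The bound comes from ellipticity.\<close>

lemma risk_premium_measurable_bounded:
  fixes \<mu> :: "real \<Rightarrow> real ^ 'm" and \<sigma> :: "real \<Rightarrow> real ^ 'm ^ 'm"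
  assumes r: "r \<in> borel_measurable (restrict_space borel {0..T})" "bounded (r ` {0..T})"
    and \<mu>: "\<mu> \<in> borel_measurable (restrict_space borel {0..T})" "bounded (\<mu> ` {0..T})"
    and \<sigma>: "\<sigma> \<in> borel_measurable (restrict_space borel {0..T})"
    and \<delta>: "0 < \<delta>" and ell: "\<And>t v. t \<in> {0..T} \<Longrightarrow> 0 \<le> v \<bullet> ((\<sigma> t ** transpose (\<sigma> t) - mat \<delta>) *v v)"
  shows "risk_premium r \<mu> \<sigma> \<in> borel_measurable (restrict_space borel {0..T})"
    and "\<exists>K. \<forall>t\<in>{0..T}. norm (risk_premium r \<mu> \<sigma> t) \<le> K"
proof -
  let ?R = "restrict_space borel {0..T} :: real measure"
  define y where "y t = \<mu> t - r t *\<^sub>R (\<chi> i. 1)" for t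
  have y: "y \<in> borel_measurable ?R" unfolding y_def[abs_def] using r(1) \<mu>(1) by measurable
  obtain Kr K\<mu> where K: "\<forall>t\<in>{0..T}. norm (r t) \<le> Kr" "\<forall>t\<in>{0..T}. norm (\<mu> t) \<le> K\<mu>"
    using r(2) \<mu>(2) by (auto simp: bounded_iff)
  have "norm (risk_premium r \<mu> \<sigma> t) \<le> (K\<mu> + Kr * norm ((\<chi> i. 1) :: real ^ 'm)) / sqrt \<delta>" if t: "t \<in> {0..T}" for t
  proof -
    have "norm (risk_premium r \<mu> \<sigma> t) \<le> norm (y t) / sqrt \<delta>"
      unfolding risk_premium_def y_def by (rule elliptic_inverse(3)[OF \<delta> ell[OF t]])
    also have "\<dots> \<le> (K\<mu> + Kr * norm ((\<chi> i. 1) :: real ^ 'm)) / sqrt \<delta>"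
    proof (rule divide_right_mono)
      have "norm (y t) \<le> norm (\<mu> t) + norm (r t *\<^sub>R ((\<chi> i. 1) :: real ^ 'm))"
        unfolding y_def by (rule norm_triangle_ineq4)
      also have "\<dots> \<le> K\<mu> + Kr * norm ((\<chi> i. 1) :: real ^ 'm)"
        unfolding norm_scaleR using K t by (intro add_mono mult_right_mono) auto
      finally show "norm (y t) \<le> K\<mu> + Kr * norm ((\<chi> i. 1) :: real ^ 'm)" .
    qed (use \<delta> in simp)
    finally show ?thesis .
  qed
  then show "\<exists>K. \<forall>t\<in>{0..T}. norm (risk_premium r \<mu> \<sigma> t) \<le> K" by blast
  have nth: "(\<lambda>t. \<sigma> t $ i $ j) \<in> borel_measurable ?R" for i j
  proof -
    have "(\<lambda>A::real ^ 'm ^ 'm. A $ i $ j) \<in> borel_measurable borel"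
      by (intro borel_measurable_continuous_onI continuous_intros)
    from measurable_compose[OF \<sigma> this] show ?thesis .
  qed
  have ynth: "(\<lambda>t. y t $ i) \<in> borel_measurable ?R" for i
  proof -
    have "(\<lambda>v::real ^ 'm. v $ i) \<in> borel_measurable borel"
      by (intro borel_measurable_continuous_onI continuous_intros)
    from measurable_compose[OF y this] show ?thesis .
  qed
  have det: "(\<lambda>t. det (\<chi> i j. A t i j)) \<in> borel_measurable ?R"
    if "\<And>i j. (\<lambda>t. A t i j) \<in> borel_measurable ?R" for A :: "real \<Rightarrow> 'm \<Rightarrow> 'm \<Rightarrow> real"
    unfolding det_def using that by (auto intro!: borel_measurable_sum borel_measurable_times borel_measurable_prod)
  define c where "c t = (\<chi> k. det (\<chi> i j. if j = k then y t $ i else \<sigma> t $ i $ j) / det (\<chi> i j. \<sigma> t $ i $ j))" for t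
  have "c \<in> borel_measurable ?R"
    unfolding borel_measurable_euclidean_space[of c]
  proof
    fix e :: "real ^ 'm" assume "e \<in> Basis"
    then obtain k where e: "e = axis k 1" by (auto simp: Basis_vec_def)
    have "(\<lambda>t. det (\<chi> i j. if j = k then y t $ i else \<sigma> t $ i $ j) / det (\<chi> i j. \<sigma> t $ i $ j)) \<in> borel_measurable ?R"
    proof (intro borel_measurable_divide det nth)
      fix i j show "(\<lambda>t. if j = k then y t $ i else \<sigma> t $ i $ j) \<in> borel_measurable ?R"
        using nth ynth by (cases "j = k") auto
    qed
    then show "(\<lambda>t. c t \<bullet> e) \<in> borel_measurable ?R"
      by (simp add: e c_def flip: cart_eq_inner_axis)
  qed
  moreover have "risk_premium r \<mu> \<sigma> t = c t" if t: "t \<in> {0..T}" for t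
  proof -
    note inv = elliptic_inverse[OF \<delta> ell[OF t]]
    have "\<sigma> t *v risk_premium r \<mu> \<sigma> t = y t"
      by (simp add: risk_premium_def y_def matrix_vector_mul_assoc inv(1))
    then show ?thesis using cramer[OF inv(2)] by (simp add: c_def)
  qed
  ultimately show "risk_premium r \<mu> \<sigma> \<in> borel_measurable ?R"
    by (subst measurable_cong[where g = c]) (auto simp: space_restrict_space)
qed

theorem proposition5p1:
  fixes M :: "'w measure"
    and F :: "real \<Rightarrow> 'w measure"
    and W :: "real \<Rightarrow> 'w \<Rightarrow> real ^ 'm"
    and r :: "real \<Rightarrow> real"
    and \<mu> :: "real \<Rightarrow> real ^ 'm"
    and \<sigma> :: "real \<Rightarrow> real ^ 'm ^ 'm"
    and b :: "real \<Rightarrow> real ^ 'm"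
    and T \<delta> \<nu> x :: real
  assumes "prob_space M" and "complete_measure M"
    and "F = augmented_natural_filtration M W"
    and "brownian_motion M F W"
    and "T > 0"
    and "r \<in> borel_measurable (restrict_space borel {0..T})" and "bounded (r ` {0..T})"
    and "\<And>t. t \<in> {0..T} \<Longrightarrow> r t \<ge> 0"
    and "\<mu> \<in> borel_measurable (restrict_space borel {0..T})" and "bounded (\<mu> ` {0..T})"
    and "\<And>t i. t \<in> {0..T} \<Longrightarrow> \<mu> t $ i > 0"
    and "\<sigma> \<in> borel_measurable (restrict_space borel {0..T})" and "bounded (\<sigma> ` {0..T})"
    and "\<delta> > 0"
    and "\<And>t v. t \<in> {0..T} \<Longrightarrow> v \<bullet> ((\<sigma> t ** transpose (\<sigma> t) - mat \<delta>) *v v) \<ge> 0"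
    and "b = risk_premium r \<mu> \<sigma>"
    and "x > 0" and "\<nu> > 0"
  shows "\<exists>u X.
    mv_optimal_control M F W T r b \<nu> x u \<and>
    (\<forall>v. mv_optimal_control M F W T r b \<nu> x v \<longrightarrow>
       (AE (t, \<omega>) in restrict_space lborel {0..T} \<Otimes>\<^sub>M M. v t \<omega> = u t \<omega>)) \<and>
    wealth_equation M F W T r b x u X \<and>
    (\<forall>t\<in>{0..T}. \<forall>\<omega>\<in>space M.
       u t \<omega> = - ((X t \<omega> - prob_space.expectation M (X t)
                    - 1 / \<nu> * exp (LBINT s:{t..T}. (norm (b s))\<^sup>2 - r s)) *\<^sub>R b t)) \<and>
    ito_process M F W T x
      (\<lambda>t \<omega>. (r t - (norm (b t))\<^sup>2) * X t \<omega>
              + (norm (b t))\<^sup>2 * prob_space.expectation M (X t)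
              + (norm (b t))\<^sup>2 / \<nu> * exp (LBINT s:{t..T}. (norm (b s))\<^sup>2 - r s))
      (\<lambda>t \<omega>. - ((X t \<omega> - prob_space.expectation M (X t)
                  - 1 / \<nu> * exp (LBINT s:{t..T}. (norm (b s))\<^sup>2 - r s)) *\<^sub>R b t))
      X"
proof -
  interpret prob_space M by fact
  obtain V where V: "brownian_basis M F V T" and VW: "\<And>t. AE \<omega> in M. V t \<omega> = W t \<omega>"
    by (rule brownian_modification[OF assms(3-5)]) auto
  note rp = risk_premium_measurable_bounded[OF assms(6,7,9,10,12,14,15)]
  have b_meas: "b \<in> borel_measurable (restrict_space borel {0..T})"
    unfolding assms(16) by (rule rp(1))
  have "\<exists>K. \<forall>t\<in>{0..T}. norm (b t) \<le> K"
    unfolding assms(16) by (rule rp(2))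
  then obtain K where K: "\<And>t. t \<in> {0..T} \<Longrightarrow> norm (b t) \<le> K" by blast
  interpret mv_market M F V T r b K
  proof -
    interpret brownian_basis M F V T by (rule V)
    show "mv_market M F V T r b K"
      by unfold_locales (use assms(6-8) b_meas K in \<open>auto simp: bdd_meas_def\<close>)
  qed
  \<comment> \<open>The optimum is constructed for the modification V. Wealth, cost and optimality
    see the driving process through \<open>ito_process\<close> alone, so they are the same for
    W.\<close>
  note eq = ito_process_modification[OF VW, of F]
  have weq: "wealth_equation M F V T r b x = wealth_equation M F W T r b x"
    by (intro ext) (simp add: wealth_equation_def eq)
  have "wealth M F V T r b x = wealth M F W T r b x"
    by (intro ext) (simp add: wealth_def weq)
  then have "mv_cost M F V T r b \<nu> x = mv_cost M F W T r b \<nu> x"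
    by (intro ext) (simp add: mv_cost_def)
  then have oeq: "mv_optimal_control M F V T r b \<nu> x = mv_optimal_control M F W T r b \<nu> x"
    by (intro ext) (simp add: mv_optimal_control_def)
  obtain u X where opt: "mv_optimal_control M F V T r b \<nu> x u"
    and uniq: "\<And>v. mv_optimal_control M F V T r b \<nu> x v \<Longrightarrow> AE y in pm. case_prod v y = case_prod u y"
    and wealth: "wealth_equation M F V T r b x u X"
    and u: "\<And>t \<omega>. u t \<omega> = - ((X t \<omega> - expectation (X t) - price_scale \<nu> t) *\<^sub>R b t)"
    by (rule mean_variance_optimum[OF assms(18), of x]) (rule that, assumption+)
  have u': "u = (\<lambda>t \<omega>. - ((X t \<omega> - expectation (X t)
      - 1 / \<nu> * exp (LBINT s:{t..T}. (norm (b s))\<^sup>2 - r s)) *\<^sub>R b t))"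
    by (intro ext) (simp add: u price_scale_def)
  \<comment> \<open>The control is a multiple of b, so b . u equals - |b|^2 times the feedback
    factor; expanding that factor gives the closed-loop drift.\<close>
  have drift: "(\<lambda>t \<omega>. r t * X t \<omega> + b t \<bullet> u t \<omega>) = (\<lambda>t \<omega>. (r t - (norm (b t))\<^sup>2) * X t \<omega>
      + (norm (b t))\<^sup>2 * expectation (X t)
      + (norm (b t))\<^sup>2 / \<nu> * exp (LBINT s:{t..T}. (norm (b s))\<^sup>2 - r s))"
    by (intro ext) (simp add: u price_scale_def power2_norm_eq_inner algebra_simps)
  have "ito_process M F W T x (\<lambda>t \<omega>. r t * X t \<omega> + b t \<bullet> u t \<omega>) u X"
    using wealth unfolding wealth_equation_def eq .
  note ito = this[unfolded drift, unfolded u']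
  have uniq': "AE (t, \<omega>) in restrict_space lborel {0..T} \<Otimes>\<^sub>M M. v t \<omega> = u t \<omega>"
    if "mv_optimal_control M F W T r b \<nu> x v" for v
    using uniq[of v] that unfolding oeq lam_def by (simp add: case_prod_beta')
  show ?thesis
  proof (intro exI conjI allI impI ballI)
    show "mv_optimal_control M F W T r b \<nu> x u" using opt unfolding oeq .
    show "wealth_equation M F W T r b x u X" using wealth unfolding weq .
  qed (use uniq' ito u' in \<open>auto simp: u price_scale_def\<close>)
qed

end
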